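(* Let $\varepsilon\le\frac13$ and $\delta\in(0,1)$. Suppose that $g(x,A)\le g(x,A')$ for all $x\in\mathcal{P}$ and all $A\subseteq A'$. In the setting $\mathcal{A}=2^U$ with the $L_\infty$ metric, we can compute a solution $\bar x\in\mathcal{P}$ satisfying $h_{p^*}(\bar x)\le(2+O(\varepsilon))\min_{x\in\mathcal{P}}h_{p^*}(x)$ with probability at least $1-\delta$, in time polynomial in $\mathcal{I}$, $\frac{\lambda}{\varepsilon r}$ and $\log(\frac1\delta)$.
   Context: $U$ is a finite ground set and the scenarios are all subsets $A\subseteq U$. $\mathcal{P}\subseteq\mathbb{R}^m_{\ge0}$ is a polytope of fractional first-stage decisions, $X=\mathcal{P}\cap\mathbb{Z}^m$, $c\in\mathbb{R}^m$ the first-stage cost vector, and $g(x,A)\ge0$ the optimal fractional second-stage cost of scenario $A$ given $x\in\mathcal{P}$. For a radius $0<r\le1$ and a central distribution $p^*$ on $2^U$ accessible only via independent samples, $h_{p^*}(x)=c^\top x+\max\{\mathbb{E}_{A\sim q}[g(x,A)]: q\text{ a distribution on }2^U,\ \max_A|p^*_A-q_A|\le r\}$. $\mathcal{I}$ is the input size. Standing assumptions: (P1) $0\in X$, $c\ge0$, $\log|X|$ polynomial in $\mathcal{I}$, $0\le g(x,A)\le g(0,A)$; (P2) $g(0,A)\le g(x,A)+\lambda c^\top x$ for a known $\lambda\ge1$; (P3) known $R$, $V\le1$ with $\mathcal{P}\subseteq\{\|x\|_2\le R\}$, $\mathcal{P}$ contains a ball of radius $V$, $\ln(R/V)$ polynomial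 in $\mathcal{I}$; (P4) $g(\cdot,A)$ is convex on $\mathcal{P}$ and efficiently computable; (P5') for every $x\in\mathcal{P},A$, a subgradient $d^{x,A}$ of $g(\cdot,A)$ at $x$ with $-\lambda c\le d^{x,A}\le0$ can be efficiently computed. *)

theory Defs
  imports
    "HOL-Probability.SPMF"
    "HOL-Computational_Algebra.Polynomial"
    "HOL-Library.Log_Nat"
    "Jordan_Normal_Form.Matrix"
begin

unbundle no inner_syntax
unbundle no vec_syntax

section \<open>Vectors, polytopes and encoding lengths\<close>

abbreviation real_vec :: "rat Matrix.vec \<Rightarrow> real Matrix.vec" where
  "real_vec \<equiv> map_vec real_of_rat"

definition norm2 :: "real Matrix.vec \<Rightarrow> real" where
  "norm2 x = sqrt (x \<bullet> x)"

definition polytope_vec :: "nat \<Rightarrow> real Matrix.vec set \<Rightarrow> bool" where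
  "polytope_vec m P \<longleftrightarrow>
     (\<exists>F. finite F \<and> F \<subseteq> carrier_vec m \<times> UNIV \<and>
          P = {x \<in> carrier_vec m. \<forall>(a, b) \<in> F. a \<bullet> x \<le> b}) \<and>
     (\<exists>B. \<forall>x\<in>P. norm2 x \<le> B)"

definition convex_fun_on :: "real Matrix.vec set \<Rightarrow> (real Matrix.vec \<Rightarrow> real) \<Rightarrow> bool" where
  "convex_fun_on P f \<longleftrightarrow>
     (\<forall>x\<in>P. \<forall>y\<in>P. \<forall>t. 0 \<le> t \<and> t \<le> 1 \<longrightarrow>
        f ((1 - t) \<cdot>\<^sub>v x + t \<cdot>\<^sub>v y) \<le> (1 - t) * f x + t * f y)"

definition subgradient_on ::
    "real Matrix.vec set \<Rightarrow> (real Matrix.vec \<Rightarrow> real) \<Rightarrow> real Matrix.vec \<Rightarrow> real Matrix.vec \<Rightarrow> bool" where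
  "subgradient_on P f x d \<longleftrightarrow> (\<forall>y\<in>P. f y \<ge> f x + d \<bullet> (y - x))"

text \<open>Binary encoding length: sign, numerator and denominator in lowest terms.\<close>

definition rat_size :: "rat \<Rightarrow> nat" where
  "rat_size q = (case quotient_of q of (a, b) \<Rightarrow> 1 + floorlog 2 (nat \<bar>a\<bar>) + floorlog 2 (nat b))"

definition vec_size :: "rat Matrix.vec \<Rightarrow> nat" where
  "vec_size v = (\<Sum>i<dim_vec v. rat_size (v $ i))"


section \<open>Instances\<close>

text \<open>
  The ground set is \<open>{..<usize}\<close>. The numerical data are rational, as they are part of the
  finite input of an algorithm; the polytope, the recourse function and the central distribution
  are arbitrary real objects, which an algorithm reaches only through oracles. \<open>orc_time b\<close> is the
  time needed to answer a query of encoding length \<open>b\<close>. \<open>isize\<close> is the input size; besides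
  the explicit numbers it may account for whatever describes the polytope and the recourse function.
\<close>

record drso =
  mdim :: nat
  usize :: nat
  cost1 :: "rat Matrix.vec"
  lam :: rat
  radius :: rat
  outer_rad :: rat
  inner_rad :: rat
  isize :: nat
  feas :: "real Matrix.vec set"
  recourse :: "real Matrix.vec \<Rightarrow> nat set \<Rightarrow> real"
  center :: "nat set pmf"
  value_orc :: "rat Matrix.vec \<Rightarrow> nat set \<Rightarrow> rat"
  subgrad_orc :: "rat Matrix.vec \<Rightarrow> nat set \<Rightarrow> rat Matrix.vec"
  sep_orc :: "rat Matrix.vec \<Rightarrow> rat Matrix.vec option"
  orc_time :: "nat \<Rightarrow> nat"

definition ground :: "drso \<Rightarrow> nat set" where
  "ground I = {..<usize I}"

definition scenarios :: "drso \<Rightarrow> nat set set" where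
  "scenarios I = Pow (ground I)"

definition int_feas :: "drso \<Rightarrow> real Matrix.vec set" where
  "int_feas I = {x \<in> feas I. \<forall>i<mdim I. x $ i \<in> \<int>}"

definition linf_dist :: "drso \<Rightarrow> nat set pmf \<Rightarrow> nat set pmf \<Rightarrow> real" where
  "linf_dist I p q = (MAX A\<in>scenarios I. \<bar>pmf p A - pmf q A\<bar>)"

definition ambiguity :: "drso \<Rightarrow> nat set pmf set" where
  "ambiguity I = {q. set_pmf q \<subseteq> scenarios I \<and> linf_dist I (center I) q \<le> real_of_rat (radius I)}"

text \<open>
  The supremum is a maximum: the distributions in the ball form a compact set and the expectation
  is linear in the distribution.
\<close>

definition robust_cost :: "drso \<Rightarrow> real Matrix.vec \<Rightarrow> real" where
  "robust_cost I x =
     real_vec (cost1 I) \<bullet> x +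
     (SUP q\<in>ambiguity I. measure_pmf.expectation q (\<lambda>A. recourse I x A))"


section \<open>Standing assumptions\<close>

text \<open>
  \<open>\<pi>\<close> is the polynomial behind all the phrases ``polynomial in the input size'' and
  ``efficiently computable''.
\<close>

definition basic_data :: "drso \<Rightarrow> bool" where
  "basic_data I \<longleftrightarrow>
     cost1 I \<in> carrier_vec (mdim I) \<and>
     0 < radius I \<and> radius I \<le> 1 \<and>
     polytope_vec (mdim I) (feas I) \<and> (\<forall>x\<in>feas I. 0\<^sub>v (mdim I) \<le> x) \<and>
     set_pmf (center I) \<subseteq> scenarios I \<and>
     mdim I + usize I + vec_size (cost1 I) + rat_size (lam I) + rat_size (radius I)
       + rat_size (outer_rad I) + rat_size (inner_rad I) \<le> isize I"

definition nonneg_costs :: "real poly \<Rightarrow> drso \<Rightarrow> bool" where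
  "nonneg_costs \<pi> I \<longleftrightarrow>
     0\<^sub>v (mdim I) \<in> int_feas I \<and> 0\<^sub>v (mdim I) \<le> cost1 I \<and>
     finite (int_feas I) \<and> ln (real (card (int_feas I))) \<le> poly \<pi> (real (isize I)) \<and>
     (\<forall>x\<in>feas I. \<forall>A\<in>scenarios I.
        0 \<le> recourse I x A \<and> recourse I x A \<le> recourse I (0\<^sub>v (mdim I)) A)"

definition bounded_inflation :: "drso \<Rightarrow> bool" where
  "bounded_inflation I \<longleftrightarrow>
     lam I \<ge> 1 \<and>
     (\<forall>x\<in>feas I. \<forall>A\<in>scenarios I.
        recourse I (0\<^sub>v (mdim I)) A
          \<le> recourse I x A + real_of_rat (lam I) * (real_vec (cost1 I) \<bullet> x))"

definition well_rounded :: "real poly \<Rightarrow> drso \<Rightarrow> bool" where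
  "well_rounded \<pi> I \<longleftrightarrow>
     0 < outer_rad I \<and> 0 < inner_rad I \<and> inner_rad I \<le> 1 \<and>
     (\<forall>x\<in>feas I. norm2 x \<le> real_of_rat (outer_rad I)) \<and>
     (\<exists>z\<in>carrier_vec (mdim I).
        {y \<in> carrier_vec (mdim I). norm2 (y - z) \<le> real_of_rat (inner_rad I)} \<subseteq> feas I) \<and>
     ln (real_of_rat (outer_rad I) / real_of_rat (inner_rad I)) \<le> poly \<pi> (real (isize I))"

text \<open>
  Efficient access to the polytope: a strong separation oracle, returning \<open>None\<close> on members
  and the normal of a strictly separating hyperplane on non-members.
\<close>

definition efficient_feas :: "real poly \<Rightarrow> drso \<Rightarrow> bool" where
  "efficient_feas \<pi> I \<longleftrightarrow>
     (\<forall>b. real (orc_time I b) \<le> poly \<pi> (real (isize I + b))) \<and>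
     (\<forall>x\<in>carrier_vec (mdim I).
        (case sep_orc I x of
           None \<Rightarrow> real_vec x \<in> feas I
         | Some a \<Rightarrow> a \<in> carrier_vec (mdim I) \<and>
             (\<forall>y\<in>feas I. real_vec a \<bullet> y < real_vec a \<bullet> real_vec x) \<and>
             vec_size a \<le> orc_time I (vec_size x)))"

definition efficient_convex_recourse :: "drso \<Rightarrow> bool" where
  "efficient_convex_recourse I \<longleftrightarrow>
     (\<forall>A\<in>scenarios I. convex_fun_on (feas I) (\<lambda>x. recourse I x A)) \<and>
     (\<forall>x\<in>carrier_vec (mdim I). \<forall>A\<in>scenarios I. real_vec x \<in> feas I \<longrightarrow>
        real_of_rat (value_orc I x A) = recourse I (real_vec x) A \<and>
        rat_size (value_orc I x A) \<le> orc_time I (vec_size x + usize I))"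

definition good_subgradient :: "drso \<Rightarrow> real Matrix.vec \<Rightarrow> nat set \<Rightarrow> real Matrix.vec \<Rightarrow> bool" where
  "good_subgradient I x A d \<longleftrightarrow>
     d \<in> carrier_vec (mdim I) \<and>
     subgradient_on (feas I) (\<lambda>y. recourse I y A) x d \<and>
     - (real_of_rat (lam I) \<cdot>\<^sub>v real_vec (cost1 I)) \<le> d \<and> d \<le> 0\<^sub>v (mdim I)"

definition efficient_subgradients :: "drso \<Rightarrow> bool" where
  "efficient_subgradients I \<longleftrightarrow>
     (\<forall>x\<in>feas I. \<forall>A\<in>scenarios I. \<exists>d. good_subgradient I x A d) \<and>
     (\<forall>x\<in>carrier_vec (mdim I). \<forall>A\<in>scenarios I. real_vec x \<in> feas I \<longrightarrow>
        good_subgradient I (real_vec x) A (real_vec (subgrad_orc I x A)) \<and>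
        vec_size (subgrad_orc I x A) \<le> orc_time I (vec_size x + usize I))"

definition standing_assumptions :: "real poly \<Rightarrow> drso \<Rightarrow> bool" where
  "standing_assumptions \<pi> I \<longleftrightarrow>
     basic_data I \<and> nonneg_costs \<pi> I \<and> bounded_inflation I \<and> well_rounded \<pi> I \<and>
     efficient_feas \<pi> I \<and> efficient_convex_recourse I \<and> efficient_subgradients I"

definition monotone_recourse :: "drso \<Rightarrow> bool" where
  "monotone_recourse I \<longleftrightarrow>
     (\<forall>x\<in>feas I. \<forall>A\<in>scenarios I. \<forall>A'\<in>scenarios I. A \<subseteq> A' \<longrightarrow> recourse I x A \<le> recourse I x A')"


section \<open>Model of computation\<close>

text \<open>
  A random access machine over the rationals with logarithmic cost: an instruction is charged the
  encoding lengths of the numbers it reads, so that time agrees with Turing machine time up to a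
  polynomial. The memory consists of arrays \<open>M a\<close> of rationals; \<open>M a 0\<close> serves as the scalar
  register \<open>a\<close>. The central distribution is accessible only through \<open>Sample\<close>, each execution
  of which draws a fresh independent scenario.
\<close>

datatype arith = Plus | Minus | Times | Divide

datatype com =
    Const nat rat
  | Arith arith nat nat nat
  | Floor nat nat
  | Load nat nat nat
  | Store nat nat nat
  | Sample nat
  | Value nat nat nat
  | Subgrad nat nat nat
  | Separate nat nat nat
  | Seq com com
  | Cond nat com com
  | While nat com

type_synonym memory = "nat \<Rightarrow> nat \<Rightarrow> rat"
type_synonym config = "memory \<times> nat"

fun arith_op :: "arith \<Rightarrow> rat \<Rightarrow> rat \<Rightarrow> rat" where
  "arith_op Plus p q = p + q"
| "arith_op Minus p q = p - q"
| "arith_op Times p q = p * q"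
| "arith_op Divide p q = p / q"

definition set_cell :: "nat \<Rightarrow> nat \<Rightarrow> rat \<Rightarrow> memory \<Rightarrow> memory" where
  "set_cell a i q M = M(a := (M a)(i := q))"

definition set_vec :: "nat \<Rightarrow> rat Matrix.vec \<Rightarrow> memory \<Rightarrow> memory" where
  "set_vec a v M = M(a := (\<lambda>i. if i < dim_vec v then v $ i else M a i))"

definition get_vec :: "nat \<Rightarrow> nat \<Rightarrow> memory \<Rightarrow> rat Matrix.vec" where
  "get_vec a k M = Matrix.vec k (M a)"

definition get_scenario :: "nat \<Rightarrow> nat \<Rightarrow> memory \<Rightarrow> nat set" where
  "get_scenario a k M = {i. i < k \<and> M a i \<noteq> 0}"

definition index_of :: "rat \<Rightarrow> nat" where
  "index_of q = nat \<lfloor>q\<rfloor>"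

definition oracle_cost :: "drso \<Rightarrow> nat \<Rightarrow> nat" where
  "oracle_cost I b = 1 + b + orc_time I b"

text \<open>
  \<open>exec I k c (M, t)\<close> is the subprobability distribution of the final configuration when \<open>c\<close> is
  started in memory \<open>M\<close> after time \<open>t\<close>; \<open>k\<close> bounds the recursion depth, and the missing
  mass is the probability that this bound is exceeded.
\<close>

fun exec :: "drso \<Rightarrow> nat \<Rightarrow> com \<Rightarrow> config \<Rightarrow> config spmf" where
  "exec I 0 c s = return_pmf None"
| "exec I (Suc k) (Const a q) (M, t) = return_spmf (set_cell a 0 q M, t + 1 + rat_size q)"
| "exec I (Suc k) (Arith f a b c) (M, t) =
     return_spmf (set_cell a 0 (arith_op f (M b 0) (M c 0)) M,
                  t + 1 + rat_size (M b 0) + rat_size (M c 0))"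
| "exec I (Suc k) (Floor a b) (M, t) =
     return_spmf (set_cell a 0 (of_int \<lfloor>M b 0\<rfloor>) M, t + 1 + rat_size (M b 0))"
| "exec I (Suc k) (Load a b c) (M, t) =
     (let q = M b (index_of (M c 0))
      in return_spmf (set_cell a 0 q M, t + 1 + rat_size (M c 0) + rat_size q))"
| "exec I (Suc k) (Store a b c) (M, t) =
     return_spmf (set_cell a (index_of (M b 0)) (M c 0) M,
                  t + 1 + rat_size (M b 0) + rat_size (M c 0))"
| "exec I (Suc k) (Sample a) (M, t) =
     map_spmf (\<lambda>A. (set_vec a (Matrix.vec (usize I) (\<lambda>i. if i \<in> A then 1 else 0)) M,
                    t + 1 + usize I))
       (spmf_of_pmf (center I))"
| "exec I (Suc k) (Value a b c) (M, t) =
     (let x = get_vec b (mdim I) M; A = get_scenario c (usize I) M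
      in return_spmf (set_cell a 0 (value_orc I x A) M,
                      t + oracle_cost I (vec_size x + usize I)))"
| "exec I (Suc k) (Subgrad a b c) (M, t) =
     (let x = get_vec b (mdim I) M; A = get_scenario c (usize I) M
      in return_spmf (set_vec a (subgrad_orc I x A) M,
                      t + oracle_cost I (vec_size x + usize I)))"
| "exec I (Suc k) (Separate a b c) (M, t) =
     (let x = get_vec c (mdim I) M
      in return_spmf
           (case sep_orc I x of
              None \<Rightarrow> set_cell a 0 0 M
            | Some d \<Rightarrow> set_cell a 0 1 (set_vec b d M),
            t + oracle_cost I (vec_size x)))"
| "exec I (Suc k) (Seq c1 c2) s = bind_spmf (exec I k c1 s) (exec I k c2)"
| "exec I (Suc k) (Cond a c1 c2) (M, t) =
     exec I k (if M a 0 > 0 then c1 else c2) (M, t + 1 + rat_size (M a 0))"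
| "exec I (Suc k) (While a c) (M, t) =
     (let t' = t + 1 + rat_size (M a 0)
      in if M a 0 > 0 then bind_spmf (exec I k c (M, t')) (exec I k (While a c))
         else return_spmf (M, t'))"

text \<open>
  Input: array 0 holds the first-stage costs, array 1 the parameters. The accuracy and
  the confidence may be arbitrary reals; the machine is told \<open>\<lceil>1/\<epsilon>\<rceil>\<close> and
  \<open>\<lceil>log 2 (1/\<delta>)\<rceil>\<close>, so that reading them takes no longer than the claimed time bound.
  Output: array 2.
\<close>

definition input_params :: "drso \<Rightarrow> real \<Rightarrow> real \<Rightarrow> rat list" where
  "input_params I \<epsilon> \<delta> =
     [of_nat (mdim I), of_nat (usize I), lam I, radius I, outer_rad I, inner_rad I,
      of_int \<lceil>1 / \<epsilon>\<rceil>, of_int \<lceil>log 2 (1 / \<delta>)\<rceil>]"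

definition initial_config :: "drso \<Rightarrow> real \<Rightarrow> real \<Rightarrow> config" where
  "initial_config I \<epsilon> \<delta> =
     (set_vec 0 (cost1 I) (set_vec 1 (vec_of_list (input_params I \<epsilon> \<delta>)) (\<lambda>a i. 0)), 0)"

definition answer :: "drso \<Rightarrow> config \<Rightarrow> real Matrix.vec" where
  "answer I s = real_vec (get_vec 2 (mdim I) (fst s))"

definition run_time :: "config \<Rightarrow> nat" where
  "run_time s = snd s"

end

theory Submission
  imports Defs "HOL-Probability.Hoeffding" "Jordan_Normal_Form.Determinant" "HOL-Library.Nat_Bijection"
begin

unbundle no vec_syntax
unbundle no inner_syntax

text \<open>
  Write \<open>M\<close> for the mass that the central distribution puts on scenarios after truncating all
  probabilities at \<open>r\<close>. Moving to a distribution in the ball adds at most \<open>r\<close> to every scenario and at most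
  \<open>M\<close> in total, and conversely any such addition is dominated by a distribution in the ball; hence the sum
  of the expected cost under the centre and of the best gain of a shift of mass \<open>M\<close> lies between
  \<open>h\<close> and \<open>2 h\<close>. This sum is estimated from samples. By monotonicity the gain is computed greedily: the
  best scenarios not yet used are found among those obtained from used ones by deleting one element,
  starting from the full scenario. The resulting convex function is minimised by a
  cutting plane method that keeps a simplex with rational vertices: cutting through the centroid and
  rescaling the simplex about one vertex shrinks its volume by a factor that depends only on the dimension, and rounding the
  scaling factors to a fixed grid keeps the numbers short. Only finitely many grid points can occur as
  queries, so a union bound over them makes the estimate uniform.
\<close>

text \<open>Errors must be relative to an optimum that may be tiny, while sampling yields additive
  ones. The rescue is that a shift may always put \<open>r\<close> on the full scenario
  \<open>U\<close>: the gain at \<open>y\<close> is at least \<open>r * g(y, U)\<close>, so an error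
  \<open>r^2 / (4 E) * g(y, U)\<close> is at most a share \<open>1 / (4 E)\<close> of it.
  \<open>M\<close> can be estimated although there are \<open>2 ^ |U|\<close> scenarios, because
  truncation matters only at those heavier than \<open>r\<close>, at most \<open>1 / r\<close> in
  number. For the minimisation, bounded inflation gives
  \<open>r * g(0, U) \<le> \<lambda> * h\<close>, a lower bound that enters the number of cuts only
  logarithmically. The cutting plane method is that of Yamnitsky and Levin; unlike the ellipsoid
  method it takes no square roots and so stays within rational arithmetic. Lengths are the other
  obstacle, since instructions are charged for the numbers they read. On the grid, the length of a
  query point depends on the number of cuts, not on later oracle answers, so long answers cannot
  lead to longer queries. Time is bounded by three numbers fixed in advance: cell length
  \<open>B\<close>, rounds per loop \<open>Z\<close>, cost per instruction \<open>W\<close>.\<close>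

section \<open>Rationals of bounded encoding length\<close>

text \<open>The fraction need not be in lowest terms. That is what makes the bound compose: under
  arithmetic the exponents just add up, whereas \<open>rat_size\<close> refers to the reduced form.
  \<open>rb_rat_size\<close> and \<open>rat_size_rb\<close> translate between the two at the loss of
  a constant factor.\<close>

definition rb :: "nat => rat => bool" where
 "rb b q \<longleftrightarrow> (\<exists>n d::int. 0 < d \<and> \<bar>n\<bar> \<le> 2 ^ b \<and> d \<le> 2 ^ b \<and> q = of_int n / of_int d)"

lemma rbI: "0 < d ==> \<bar>n\<bar> \<le> 2 ^ b ==> d \<le> 2 ^ b ==> q = of_int n / of_int d ==> rb b q"
 unfolding rb_def by blast

lemma rb_mono: "rb b q ==> b \<le> c ==> rb c q"
proof -
 assume "rb b q" and bc: "b \<le> c"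
 then obtain n d where *: "0 < d" "\<bar>n\<bar> \<le> 2 ^ b" "d \<le> 2 ^ b" "q = of_int n / of_int d"
  unfolding rb_def by blast
 have "(2::int) ^ b \<le> 2 ^ c" using bc by (intro power_increasing) auto
 with * have "\<bar>n\<bar> \<le> 2 ^ c" "d \<le> 2 ^ c" by linarith+
 with * show "rb c q" by (intro rbI[of d n])
qed

lemma rb_int: "\<bar>n\<bar> \<le> 2 ^ b ==> rb b (of_int n)"
 by (rule rbI[of 1 n]) auto

lemma rb_nat: "n \<le> 2 ^ b ==> rb b (of_nat n)"
 using rb_int[of "int n" b] by (metis abs_of_nat of_int_of_nat_eq of_nat_le_iff of_nat_numeral of_nat_power)

lemma rb_0 [simp]: "rb b 0" and rb_1 [simp]: "rb b 1"
 using rb_int[of 0 b] rb_int[of 1 b] by auto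

lemma rb_mult:
 assumes "rb b x" "rb c y" shows "rb (b + c) (x * y)"
proof -
 from assms obtain n d n' d' where *: "0 < d" "\<bar>n\<bar> \<le> 2 ^ b" "d \<le> 2 ^ b" "x = of_int n / of_int d"
  "0 < d'" "\<bar>n'\<bar> \<le> 2 ^ c" "d' \<le> 2 ^ c" "y = of_int n' / of_int d'"
  unfolding rb_def by blast
 show ?thesis
  by (rule rbI[of "d * d'" "n * n'"]) (use * in \<open>auto simp: power_add abs_mult intro!: mult_mono\<close>)
qed

lemma rb_minus: "rb b x ==> rb b (- x)"
 unfolding rb_def by (metis abs_minus_cancel minus_divide_left of_int_minus)

text \<open>Numerator and denominator swap roles, so the sign has to move. For 0 the convention
  \<open>inverse 0 = 0\<close> keeps the bound, hence division needs no side condition.\<close>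

lemma rb_inverse:
 assumes "rb b x" shows "rb b (inverse x)"
proof -
 from assms obtain n d where *: "0 < d" "\<bar>n\<bar> \<le> 2 ^ b" "d \<le> 2 ^ b" "x = of_int n / of_int d"
  unfolding rb_def by blast
 show ?thesis
 proof (cases "n = 0")
  case True then show ?thesis using * by simp
 next
  case False
  have "inverse x = of_int (sgn n * d) / of_int \<bar>n\<bar>"
   using False * by (cases "n > 0") (auto simp: sgn_if)
  then show ?thesis
   by (intro rbI[of "\<bar>n\<bar>" "sgn n * d"]) (use False * in \<open>auto simp: sgn_if\<close>)
 qed
qed

lemma rb_div: "rb b x ==> rb c y ==> rb (b + c) (x / y)"
 unfolding divide_inverse by (intro rb_mult rb_inverse)

lemma rb_add:
 assumes "rb b x" "rb c y" shows "rb (b + c + 1) (x + y)"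
proof -
 from assms obtain n d n' d' where *: "0 < d" "\<bar>n\<bar> \<le> 2 ^ b" "d \<le> 2 ^ b" "x = of_int n / of_int d"
  "0 < d'" "\<bar>n'\<bar> \<le> 2 ^ c" "d' \<le> 2 ^ c" "y = of_int n' / of_int d'"
  unfolding rb_def by blast
 have "\<bar>n * d'\<bar> \<le> 2 ^ b * 2 ^ c" "\<bar>n' * d\<bar> \<le> 2 ^ c * 2 ^ b" "d * d' \<le> 2 ^ b * 2 ^ c"
  using * by (auto simp: abs_mult intro!: mult_mono)
 moreover have "\<bar>n * d' + n' * d\<bar> \<le> \<bar>n * d'\<bar> + \<bar>n' * d\<bar>" by (rule abs_triangle_ineq)
 moreover have "(2::int) ^ b * 2 ^ c > 0" by simp
 ultimately have "\<bar>n * d' + n' * d\<bar> \<le> 2 ^ (b + c + 1)" "d * d' \<le> 2 ^ (b + c + 1)"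
  by (simp_all add: power_add mult.commute del: zero_less_power)
 moreover have "x + y = of_int (n * d' + n' * d) / of_int (d * d')"
  using * by (simp add: add_frac_eq)
 ultimately show ?thesis
  using *(1,5) by (intro rbI[of "d * d'" "n * d' + n' * d"]) auto
qed

lemma rb_diff: "rb b x ==> rb c y ==> rb (b + c + 1) (x - y)"
 using rb_add[of b x c "- y"] by (simp add: rb_minus)

text \<open>Dividing by a denominator of at least 1 and rounding down never leads further from 0
  than the numerator: for negative \<open>n\<close> the quotient lies between \<open>n\<close> and
  -1.\<close>

lemma rb_floor:
 assumes "rb b x" shows "rb b (of_int \<lfloor>x\<rfloor>)"
proof -
 from assms obtain n d where *: "0 < d" "\<bar>n\<bar> \<le> 2 ^ b" "d \<le> 2 ^ b" "x = of_int n / of_int d"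
  unfolding rb_def by blast
 have "\<lfloor>x\<rfloor> = n div d" using * by (simp add: floor_divide_of_int_eq)
 moreover have "\<bar>n div d\<bar> \<le> \<bar>n\<bar>"
 proof (cases "n \<ge> 0")
  case True then show ?thesis using *(1) zdiv_mono2[of n 1 d] by (simp add: pos_imp_zdiv_nonneg_iff)
 next
  case False
  then have "n \<le> n div d"
   using *(1) zdiv_mono2_neg[of n 1 d] by simp
  moreover have "n div d < 0" using False *(1) by (simp add: pos_imp_zdiv_neg_iff)
  ultimately show ?thesis using False by linarith
 qed
 ultimately show ?thesis using * by (intro rb_int) linarith
qed

lemma rb_sum: "(\<And>i. i < n ==> rb b (f i)) ==> rb (n * (b + 1)) (\<Sum>i<n. f i)"
proof (induction n)
 case (Suc n)
 then have "rb (n * (b + 1) + b + 1) ((\<Sum>i<n. f i) + f n)" by (intro rb_add) auto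
 then show ?case by (simp add: algebra_simps)
qed simp

lemma rb_arith_op: "rb b x ==> rb c y ==> rb (b + c + 1) (arith_op f x y)"
 using rb_add[of b x c y] rb_diff[of b x c y] rb_mono[OF rb_mult[of b x c y]] rb_mono[OF rb_div[of b x c y]]
 by (cases f) auto

lemma rb_rat_size: "rb (rat_size q) q"
proof -
 obtain a b where ab: "quotient_of q = (a, b)" by (cases "quotient_of q")
 have b: "b > 0" and q: "q = of_int a / of_int b"
  using quotient_of_denom_pos[OF ab] quotient_of_div[OF ab] by auto
 have less: "n < 2 ^ floorlog 2 n" for n
  using floorlog_bounds[of n 2] by (cases "n = 0") (auto simp: floorlog_def)
 have le: "n \<le> 2 ^ k" if "floorlog 2 (nat n) \<le> k" for n :: int and k
 proof -
  have "nat n < 2 ^ k" using less[of "nat n"] power_increasing[OF that, of "2::nat"] by linarith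
  then have "int (nat n) < int (2 ^ k)" by (simp only: of_nat_less_iff)
  moreover have "n \<le> int (nat n)" "int (2 ^ k) = 2 ^ k" by simp_all
  ultimately show ?thesis by linarith
 qed
 have "rat_size q = 1 + floorlog 2 (nat \<bar>a\<bar>) + floorlog 2 (nat b)" by (simp add: rat_size_def ab)
 then have "floorlog 2 (nat \<bar>a\<bar>) \<le> rat_size q" "floorlog 2 (nat b) \<le> rat_size q" by simp_all
 then have "\<bar>a\<bar> \<le> 2 ^ rat_size q" "b \<le> 2 ^ rat_size q" using le by blast+
 then show ?thesis using b q by (intro rbI[of b a])
qed

text \<open>\<open>quotient_of\<close> divides both parts by their gcd, which can only shrink them;
  each part then has at most \<open>b + 1\<close> digits, and one more bit is the sign.\<close>

lemma rat_size_rb: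
 assumes "rb b q" shows "rat_size q \<le> 2 * b + 3"
proof -
 from assms obtain n d where *: "0 < d" "\<bar>n\<bar> \<le> 2 ^ b" "d \<le> 2 ^ b" "q = of_int n / of_int d"
  unfolding rb_def by blast
 have q: "quotient_of q = (n div gcd n d, d div gcd n d)"
  using * by (simp add: Fract_of_int_quotient[symmetric] quotient_of_Fract normalize_def Let_def)
 have gp: "gcd n d > 0" using *(1) by (simp add: gcd_pos_int)
 have fl: "floorlog 2 k \<le> b + 1" if "k \<le> 2 ^ b" for k
 proof (cases "k = 0")
  case False
  then have "2 ^ (floorlog 2 k - 1) \<le> k" using floorlog_bounds[of k 2] by auto
  then have "2 ^ (floorlog 2 k - 1) \<le> (2::nat) ^ b" using that by linarith
  then show ?thesis by (simp add: power_increasing_iff)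
 qed (simp add: floorlog_def)
 have 1: "\<bar>n div gcd n d\<bar> \<le> 2 ^ b"
 proof -
  have "n = (n div gcd n d) * gcd n d" by simp
  then have "\<bar>n\<bar> = \<bar>n div gcd n d\<bar> * gcd n d" using gp by (metis abs_mult abs_of_pos)
  moreover have "\<bar>n div gcd n d\<bar> * 1 \<le> \<bar>n div gcd n d\<bar> * gcd n d"
   using gp by (intro mult_left_mono) linarith+
  ultimately show ?thesis using *(2) by linarith
 qed
 have "1 \<le> gcd n d" using gp by linarith
 then have 2: "d div gcd n d \<le> 2 ^ b" using *(1,3) zdiv_mono2[of d 1 "gcd n d"] by simp
 have "floorlog 2 (nat \<bar>n div gcd n d\<bar>) \<le> b + 1" "floorlog 2 (nat (d div gcd n d)) \<le> b + 1"
  using 1 2 fl[of "nat \<bar>n div gcd n d\<bar>"] fl[of "nat (d div gcd n d)"] by (simp_all add: nat_le_iff)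
 then show ?thesis by (simp add: rat_size_def q)
qed

section \<open>Deterministic execution\<close>

text \<open>Determinism is expressed on the level of distributions: with enough fuel, the result is
  a point mass. Quantifying over the start time \<open>t0\<close> makes costs additive under
  composition.\<close>

definition runs :: "drso => com => memory => memory => nat => bool" where
 "runs I c M M' t \<longleftrightarrow>
   (\<exists>k0. \<forall>k\<ge>k0. \<forall>t0. exec I k c (M, t0) = return_spmf (M', t0 + t))"

lemma runs_prim:
 assumes "\<And>k t0. exec I (Suc k) c (M, t0) = return_spmf (M', t0 + t)"
 shows "runs I c M M' t"
 unfolding runs_def
proof (intro exI[of _ 1] allI impI)
 fix k t0 assume "(1::nat) \<le> k"
 then obtain k' where "k = Suc k'" by (cases k) auto
 then show "exec I k c (M, t0) = return_spmf (M', t0 + t)" using assms by simp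
qed

lemma runs_Seq:
 assumes "runs I c1 M M1 t1" "runs I c2 M1 M2 t2"
 shows "runs I (Seq c1 c2) M M2 (t1 + t2)"
proof -
 from assms obtain k1 k2 where
  k1: "\<And>k t0. k1 \<le> k ==> exec I k c1 (M, t0) = return_spmf (M1, t0 + t1)" and
  k2: "\<And>k t0. k2 \<le> k ==> exec I k c2 (M1, t0) = return_spmf (M2, t0 + t2)"
  unfolding runs_def by blast
 show ?thesis unfolding runs_def
 proof (intro exI[of _ "Suc (max k1 k2)"] allI impI)
  fix k t0 assume "Suc (max k1 k2) \<le> k"
  then obtain k' where "k = Suc k'" "k1 \<le> k'" "k2 \<le> k'" by (cases k) auto
  then show "exec I k (Seq c1 c2) (M, t0) = return_spmf (M2, t0 + (t1 + t2))"
   by (simp add: k1 k2 add.assoc)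
 qed
qed

lemma runs_Cond:
 assumes "runs I (if M a 0 > 0 then c1 else c2) M M' t"
 shows "runs I (Cond a c1 c2) M M' (1 + rat_size (M a 0) + t)"
proof -
 from assms obtain k1 where
  k1: "\<And>k t0. k1 \<le> k ==> exec I k (if M a 0 > 0 then c1 else c2) (M, t0) = return_spmf (M', t0 + t)"
  unfolding runs_def by blast
 show ?thesis unfolding runs_def
 proof (intro exI[of _ "Suc k1"] allI impI)
  fix k t0 assume "Suc k1 \<le> k"
  then obtain k' where "k = Suc k'" "k1 \<le> k'" by (cases k) auto
  then show "exec I k (Cond a c1 c2) (M, t0) = return_spmf (M', t0 + (1 + rat_size (M a 0) + t))"
   by (simp only: exec.simps k1) (simp add: add.assoc)
 qed
qed

lemma runs_While_False: "\<not> M a 0 > 0 ==> runs I (While a c) M M (1 + rat_size (M a 0))"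
 by (rule runs_prim) simp

lemma runs_While_True:
 assumes "M a 0 > 0" "runs I c M M1 t1" "runs I (While a c) M1 M2 t2"
 shows "runs I (While a c) M M2 (1 + rat_size (M a 0) + t1 + t2)"
proof -
 from assms obtain k1 k2 where
  k1: "\<And>k t0. k1 \<le> k ==> exec I k c (M, t0) = return_spmf (M1, t0 + t1)" and
  k2: "\<And>k t0. k2 \<le> k ==> exec I k (While a c) (M1, t0) = return_spmf (M2, t0 + t2)"
  unfolding runs_def by blast
 show ?thesis unfolding runs_def
 proof (intro exI[of _ "Suc (max k1 k2)"] allI impI)
  fix k t0 assume "Suc (max k1 k2) \<le> k"
  then obtain k' where "k = Suc k'" "k1 \<le> k'" "k2 \<le> k'" by (cases k) auto
  then show "exec I k (While a c) (M, t0) = return_spmf (M2, t0 + (1 + rat_size (M a 0) + t1 + t2))"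
   using assms(1) by (simp add: k1 k2 Let_def add.assoc)
 qed
qed

primrec wr :: "com => nat set" where
 "wr (Const a q) = {a}"
| "wr (Arith f a b c) = {a}"
| "wr (Floor a b) = {a}"
| "wr (Load a b c) = {a}"
| "wr (Store a b c) = {a}"
| "wr (Sample a) = {a}"
| "wr (Value a b c) = {a}"
| "wr (Subgrad a b c) = {a}"
| "wr (Separate a b c) = {a, b}"
| "wr (Seq c1 c2) = wr c1 \<union> wr c2"
| "wr (Cond a c1 c2) = wr c1 \<union> wr c2"
| "wr (While a c) = wr c"

text \<open>A syntactic frame rule. It holds for every possible outcome of a run and relieves later
  invariants of mentioning registers that a program part does not write.\<close>

lemma exec_frame:
 "s' \<in> set_spmf (exec I k c s) ==> a \<notin> wr c ==> fst s' a = fst s a"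
proof (induction I k c s arbitrary: s' rule: exec.induct)
 case (11 I k c1 c2 s)
 from "11.prems" obtain s1 where s1: "s1 \<in> set_spmf (exec I k c1 s)" "s' \<in> set_spmf (exec I k c2 s1)"
  by (auto simp: set_bind_spmf)
 then show ?case using "11.IH"(1)[OF s1(1)] "11.IH"(2)[OF s1(2)] "11.prems"(2) by simp
next
 case (12 I k a b c1 M t)
 then show ?case by (auto split: if_splits)
next
 case (13 I k b c M t)
 show ?case
 proof (cases "M b 0 > 0")
  case True
  with "13.prems" obtain s1 where s1: "s1 \<in> set_spmf (exec I k c (M, t + 1 + rat_size (M b 0)))"
   "s' \<in> set_spmf (exec I k (While b c) s1)"
   by (auto simp: set_bind_spmf Let_def)
  show ?thesis using "13.IH"(1)[OF refl True s1(1)] "13.IH"(2)[OF refl True s1(2)] "13.prems"(2) by simp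
 qed (use "13.prems" in \<open>auto simp: Let_def\<close>)
qed (auto simp: Let_def set_cell_def set_vec_def split: option.splits)

lemma runs_frame: "runs I c M M' t ==> a \<notin> wr c ==> M' a = M a"
 unfolding runs_def using exec_frame[of "(M', _)" I _ c "(M, _)" a]
 by (metis fst_conv insertI1 order_refl set_return_spmf)

section \<open>Expressions\<close>

text \<open>Machine instructions work on registers only. Expressions with a compiler hide the
  intermediate registers, so that a program part can be specified by \<open>ev\<close>
  alone.\<close>

datatype ex = Vr nat | Kn nat | Bi arith ex ex | Fl ex | Ix nat ex

primrec ev :: "ex => memory => rat" where
 "ev (Vr a) M = M a 0"
| "ev (Kn n) M = of_nat n"
| "ev (Bi f e1 e2) M = arith_op f (ev e1 M) (ev e2 M)"
| "ev (Fl e) M = of_int \<lfloor>ev e M\<rfloor>"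
| "ev (Ix a e) M = M a (index_of (ev e M))"

primrec esz :: "ex => nat" where
 "esz (Vr a) = 1"
| "esz (Kn n) = 1"
| "esz (Bi f e1 e2) = esz e1 + esz e2 + 1"
| "esz (Fl e) = esz e + 1"
| "esz (Ix a e) = esz e + 1"

primrec evs :: "ex => nat set" where
 "evs (Vr a) = {a}"
| "evs (Kn n) = {}"
| "evs (Bi f e1 e2) = evs e1 \<union> evs e2"
| "evs (Fl e) = evs e"
| "evs (Ix a e) = insert a (evs e)"

text \<open>The cap \<open>1024 = 2 ^ 10\<close> lets a constant pass as a cell of at least 10 bits,
  the lower bound that \<open>mach\<close> puts on \<open>B\<close>.\<close>

primrec kok :: "ex => bool" where
 "kok (Vr a) = True"
| "kok (Kn n) = (n \<le> 1024)"
| "kok (Bi f e1 e2) = (kok e1 \<and> kok e2)"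
| "kok (Fl e) = kok e"
| "kok (Ix a e) = kok e"

text \<open>Registers from 60 on hold intermediate values of expressions.\<close>

primrec ecomp :: "ex => nat => com" where
 "ecomp (Vr a) r = Seq (Const r 0) (Arith Plus r a r)"
| "ecomp (Kn n) r = Const r (of_nat n)"
| "ecomp (Bi f e1 e2) r = Seq (ecomp e1 r) (Seq (ecomp e2 (Suc r)) (Arith f r r (Suc r)))"
| "ecomp (Fl e) r = Seq (ecomp e r) (Floor r r)"
| "ecomp (Ix a e) r = Seq (ecomp e r) (Load r a r)"

text \<open>Forgets the scratch registers. Assertions speak of \<open>low M\<close> only, so that
  two memories differing in leftovers of expression evaluation count as equal.\<close>

definition low :: "memory => memory" where
 "low M = (\<lambda>a. if a < 60 then M a else (\<lambda>_. 0))"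

text \<open>The limit 40 is a convenient constant that accommodates every expression of the program;
  the assumption \<open>W_arith\<close> of \<open>mach\<close> uses the same 40.\<close>

definition eok :: "ex => bool" where
 "eok e \<longleftrightarrow> evs e \<subseteq> {..<60} \<and> esz e \<le> 40 \<and> kok e"

definition bd :: "nat => memory => bool" where
 "bd B M \<longleftrightarrow> (\<forall>a<60. \<forall>i. rb B (M a i))"

lemma bdD: "bd B M ==> a < 60 ==> rb B (M a i)"
 by (simp add: bd_def)

lemma bd_low [simp]: "bd B (low M) = bd B M"
 by (simp add: bd_def low_def)

lemma low_apply [simp]: "a < 60 ==> low M a = M a"
 by (simp add: low_def)

lemma ev_cong: "(\<And>a. a \<in> evs e ==> M a = M' a) ==> ev e M = ev e M'"
 by (induction e) auto

lemma ev_low: "eok e ==> ev e (low M) = ev e M"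
 by (rule ev_cong) (auto simp: eok_def)

text \<open>Each node of the syntax tree costs at most one addition of exponents and one carry bit,
  so a tree of \<open>esz e\<close> nodes is charged \<open>B + 1\<close> bits per node. A loaded
  cell is bounded by \<open>B\<close> whatever its index.\<close>

lemma rb_ev:
 assumes "bd B M" "10 \<le> B" "evs e \<subseteq> {..<60}" "kok e"
 shows "rb (esz e * (B + 1)) (ev e M)"
 using assms(3,4)
proof (induction e)
 case (Vr a) then show ?case using rb_mono[OF bdD[OF assms(1)], of a "B + 1"] by simp
next
 case (Kn n)
 have "n \<le> 2 ^ 10" using Kn by simp
 also have "(2::nat) ^ 10 \<le> 2 ^ (B + 1)" using assms(2) by (intro power_increasing) auto
 finally show ?case using rb_nat by simp
next
 case (Bi f e1 e2)
 then show ?case by (auto intro!: rb_mono[OF rb_arith_op] simp: algebra_simps)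
next
 case (Fl e) then show ?case by (auto intro!: rb_mono[OF rb_floor])
next
 case (Ix a e)
 have "rb B (M a (index_of (ev e M)))" using bdD[OF assms(1)] Ix.prems by auto
 then show ?case by (auto intro: rb_mono)
qed

lemma wr_ecomp: "a \<in> wr (ecomp e r) ==> r \<le> a"
 by (induction e arbitrary: r) (auto dest: Suc_leD)

lemma wr_ecomp60 [simp]: "a < 60 ==> a \<notin> wr (ecomp e 60)" "a < 60 ==> a \<notin> wr (ecomp e 61)"
 using wr_ecomp[of a e 60] wr_ecomp[of a e 61] by auto

text \<open>There is no move instruction: the value is copied by adding a 0 kept in register
  61.\<close>

definition asg :: "nat => ex => com" where
 "asg a e = Seq (ecomp e 60) (Seq (Const 61 0) (Arith Plus a 60 61))"

definition put :: "nat => ex => ex => com" where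
 "put a i e = Seq (ecomp i 60) (Seq (ecomp e 61) (Store a 60 61))"

definition ifp :: "ex => com => com => com" where
 "ifp e c1 c2 = Seq (ecomp e 60) (Cond 60 c1 c2)"

definition skip :: com where
 "skip = Const 60 0"

text \<open>\<open>While\<close> tests a register, so the guard is evaluated into register 60 before
  the loop and again at the end of each round.\<close>

definition whl :: "ex => com => com" where
 "whl e c = Seq (ecomp e 60) (While 60 (Seq c (ecomp e 60)))"

text \<open>The guard \<open>n - i > 0\<close> re-evaluates the bound in each round;
  \<open>cor_floop\<close> therefore requires the body not to write what \<open>n\<close>
  reads.\<close>

definition floop :: "nat => ex => com => com" where
 "floop i n c = Seq (asg i (Kn 0)) (whl (Bi Minus n (Vr i)) (Seq c (asg i (Bi Plus (Vr i) (Kn 1)))))"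

lemma wr_asg [simp]: "b < 60 ==> b \<in> wr (asg a e) \<longleftrightarrow> b = a"
 and wr_put [simp]: "b < 60 ==> b \<in> wr (put a i e) \<longleftrightarrow> b = a"
 and wr_ifp [simp]: "b < 60 ==> b \<in> wr (ifp e c1 c2) \<longleftrightarrow> b \<in> wr c1 \<or> b \<in> wr c2"
 and wr_skip [simp]: "b < 60 ==> b \<notin> wr skip"
 and wr_whl [simp]: "b < 60 ==> b \<in> wr (whl e c) \<longleftrightarrow> b \<in> wr c"
 by (auto simp: asg_def put_def ifp_def skip_def whl_def)

lemma wr_floop [simp]: "b < 60 ==> b \<in> wr (floop i n c) \<longleftrightarrow> b = i \<or> b \<in> wr c"
 by (auto simp: floop_def)

text \<open>Bounds the number of executed instructions when no loop exceeds \<open>Z\<close> rounds;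
  both branches of a conditional are charged. For a fixed program this is a polynomial in
  \<open>Z\<close>, which is all that the time bound needs.\<close>

primrec ticks :: "nat => com => nat" where
 "ticks Z (Const a q) = 1"
| "ticks Z (Arith f a b c) = 1"
| "ticks Z (Floor a b) = 1"
| "ticks Z (Load a b c) = 1"
| "ticks Z (Store a b c) = 1"
| "ticks Z (Sample a) = 1"
| "ticks Z (Value a b c) = 1"
| "ticks Z (Subgrad a b c) = 1"
| "ticks Z (Separate a b c) = 1"
| "ticks Z (Seq c1 c2) = ticks Z c1 + ticks Z c2"
| "ticks Z (Cond a c1 c2) = 1 + ticks Z c1 + ticks Z c2"
| "ticks Z (While a c) = Z * (1 + ticks Z c) + 1"

lemma set_cell_apply: "set_cell a i q M b j = (if b = a \<and> j = i then q else M b j)"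
 by (simp add: set_cell_def)

lemma set_cell_other [simp]: "b \<noteq> a ==> set_cell a i q M b = M b"
 by (simp add: set_cell_def)

lemma set_cell_same [simp]: "set_cell a i q M a = (M a)(i := q)"
 by (simp add: set_cell_def)

lemma bd_set_cell: "bd B M ==> rb B q ==> bd B (set_cell a i q M)"
 by (auto simp: bd_def set_cell_apply)

section \<open>A program logic with resource bounds\<close>

text \<open>Every cell of the memory always has a length bounded by \<open>B\<close>, no loop makes more than
 \<open>Z\<close> iterations, and \<open>W\<close> bounds the cost of a single instruction.\<close>

locale mach =
 fixes I :: drso and B Z W :: nat
 assumes B10: "10 \<le> B"
  and W_arith: "2 * (2 * (40 * (B + 1)) + 3) + 1 \<le> W"
  and W_oracle: "\<And>b. b \<le> mdim I * (2 * B + 3) + usize I ==> oracle_cost I b \<le> W"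
  and W_sample: "1 + usize I \<le> W"
begin

text \<open>Encoding length of a computed value: an expression of size at most 40 over cells bounded
  by \<open>B\<close> satisfies \<open>rb (40 * (B + 1))\<close>, and \<open>rat_size_rb\<close>
  turns \<open>b\<close> into \<open>2 * b + 3\<close>.\<close>

definition "SB = 2 * (40 * (B + 1)) + 3"

lemma W_SB: "2 * SB + 1 \<le> W" using W_arith by (simp add: SB_def)

lemma size_ev:
 assumes "bd B M" "evs e \<subseteq> {..<60}" "kok e" "esz e \<le> 40"
 shows "rat_size (ev e M) \<le> SB"
proof -
 have "esz e * (B + 1) \<le> 40 * (B + 1)" using assms(4) by (rule mult_right_mono) simp
 from rat_size_rb[OF rb_mono[OF rb_ev[OF assms(1) B10 assms(2,3)] this]] show ?thesis by (simp add: SB_def)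
qed

lemma size_bd: "bd B M ==> a < 60 ==> rat_size (M a i) \<le> SB"
 using rat_size_rb[OF bdD, of B M a i] by (auto simp: SB_def)

lemma size_small: "q \<le> 1024 ==> rat_size (of_nat q) \<le> SB"
 using size_ev[of "\<lambda>_ _. 0" "Kn q"] by (auto simp: bd_def)

text \<open>Evaluation uses registers from \<open>r\<close> upwards and leaves everything below
  intact, which allows the second operand of a binary node to be evaluated in \<open>Suc r\<close>
  without losing the first.\<close>

lemma runs_ecomp:
 assumes "bd B M" "evs e \<subseteq> {..<60}" "kok e" "esz e \<le> 40" "60 \<le> r"
 shows "\<exists>M' t. runs I (ecomp e r) M M' t \<and> (\<forall>a<r. M' a = M a) \<and> M' r 0 = ev e M \<and>
      t \<le> ticks Z (ecomp e r) * W"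
 using assms
proof (induction e arbitrary: r M)
 case (Vr a)
 have 1: "runs I (Const r 0) M (set_cell r 0 0 M) (1 + rat_size 0)" by (rule runs_prim) simp
 have 2: "runs I (Arith Plus r a r) (set_cell r 0 0 M) (set_cell r 0 (M a 0) (set_cell r 0 0 M))
  (1 + rat_size (M a 0) + rat_size 0)"
  by (rule runs_prim) (use Vr in auto)
 show ?case unfolding ecomp.simps ticks.simps
  using size_small[of 0] size_bd[of M a 0] Vr W_SB
  by (intro exI conjI) (rule runs_Seq[OF 1 2], auto)
next
 case (Kn n)
 have 1: "runs I (Const r (of_nat n)) M (set_cell r 0 (of_nat n) M) (1 + rat_size (of_nat n))" by (rule runs_prim) simp
 show ?case unfolding ecomp.simps ticks.simps using size_small[of n] Kn W_SB
  by (intro exI conjI) (rule 1, auto)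
next
 case (Bi f e1 e2)
 obtain M1 t1 where 1: "runs I (ecomp e1 r) M M1 t1" "\<forall>a<r. M1 a = M a" "M1 r 0 = ev e1 M"
  "t1 \<le> ticks Z (ecomp e1 r) * W" using Bi.IH(1)[of M r] Bi.prems by auto
 have bd1: "bd B M1" using Bi.prems(1,5) 1(2) by (auto simp: bd_def)
 obtain M2 t2 where 2: "runs I (ecomp e2 (Suc r)) M1 M2 t2" "\<forall>a<Suc r. M2 a = M1 a" "M2 (Suc r) 0 = ev e2 M1"
  "t2 \<le> ticks Z (ecomp e2 (Suc r)) * W" using Bi.IH(2)[of M1 "Suc r"] Bi.prems bd1 by auto
 have e2: "ev e2 M1 = ev e2 M" using 1(2) Bi.prems by (intro ev_cong) auto
 have 3: "runs I (Arith f r r (Suc r)) M2 (set_cell r 0 (arith_op f (ev e1 M) (ev e2 M)) M2)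
  (1 + rat_size (ev e1 M) + rat_size (ev e2 M))"
  by (rule runs_prim) (use 1 2 e2 in auto)
 have "1 + rat_size (ev e1 M) + rat_size (ev e2 M) \<le> W"
  using size_ev[of M e1] size_ev[of M e2] Bi.prems W_SB by auto
 then show ?case unfolding ecomp.simps ticks.simps using 1 2
  by (intro exI conjI) (rule runs_Seq[OF 1(1) runs_Seq[OF 2(1) 3]], auto simp: algebra_simps)
next
 case (Fl e)
 obtain M1 t1 where 1: "runs I (ecomp e r) M M1 t1" "\<forall>a<r. M1 a = M a" "M1 r 0 = ev e M"
  "t1 \<le> ticks Z (ecomp e r) * W" using Fl.IH[of M r] Fl.prems by auto
 have 3: "runs I (Floor r r) M1 (set_cell r 0 (of_int \<lfloor>ev e M\<rfloor>) M1) (1 + rat_size (ev e M))"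
  by (rule runs_prim) (use 1 in auto)
 have "1 + rat_size (ev e M) \<le> W"
  using size_ev[of M e] Fl.prems W_SB by auto
 then show ?case unfolding ecomp.simps ticks.simps using 1
  by (intro exI conjI) (rule runs_Seq[OF 1(1) 3], auto simp: algebra_simps)
next
 case (Ix b e)
 obtain M1 t1 where 1: "runs I (ecomp e r) M M1 t1" "\<forall>a<r. M1 a = M a" "M1 r 0 = ev e M"
  "t1 \<le> ticks Z (ecomp e r) * W" using Ix.IH[of M r] Ix.prems by auto
 have b: "b < 60" "M1 b = M b" using Ix.prems 1 by auto
 have 3: "runs I (Load r b r) M1 (set_cell r 0 (M b (index_of (ev e M))) M1)
   (1 + rat_size (ev e M) + rat_size (M b (index_of (ev e M))))"
  by (rule runs_prim) (use 1 b in \<open>auto simp: Let_def\<close>)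
 have "1 + rat_size (ev e M) + rat_size (M b (index_of (ev e M))) \<le> W"
  using size_ev[of M e] size_bd[of M b "index_of (ev e M)"] b(1) Ix.prems W_SB by auto
 then show ?case unfolding ecomp.simps ticks.simps using 1
  by (intro exI conjI) (rule runs_Seq[OF 1(1) 3], auto simp: algebra_simps)
qed

text \<open>A judgement in the style of weakest preconditions: the start state \<open>L\<close> is
  one fixed memory, and termination, the time bound and preservation of the cell bound are part of
  the meaning. Programs proved this way run deterministically; sampling is treated by
  \<open>rexec\<close>.\<close>

definition cor :: "com => memory => (memory => bool) => bool" where
 "cor c L Q \<longleftrightarrow> (\<forall>M. low M = L -->
   (\<exists>M' t. runs I c M M' t \<and> t \<le> ticks Z c * W \<and> bd B M' \<and> Q (low M')))"

lemma low_frame: "runs I c M M' t ==> a \<notin> wr c ==> low M' a = low M a"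
 by (simp add: low_def runs_frame)

lemma cor_conseq:
 assumes "cor c L Q"
  and "\<And>L'. bd B L' ==> (\<And>a. a < 60 ==> a \<notin> wr c ==> L' a = L a) ==> Q L' ==> Q' L'"
 shows "cor c L Q'"
 using assms low_frame unfolding cor_def by (metis bd_low)

text \<open>The frame condition for \<open>c1\<close> is handed to the proof of \<open>c2\<close>,
  so the intermediate assertion \<open>Q1\<close> has to describe only what \<open>c1\<close>
  changes.\<close>

lemma cor_seq:
 assumes "cor c1 L Q1"
  and "\<And>L'. bd B L' ==> (\<And>a. a < 60 ==> a \<notin> wr c1 ==> L' a = L a) ==> Q1 L' ==> cor c2 L' Q"
 shows "cor (Seq c1 c2) L Q"
 unfolding cor_def
proof (intro allI impI)
 fix M assume M: "low M = L"
 obtain M1 t1 where 1: "runs I c1 M M1 t1" "t1 \<le> ticks Z c1 * W" "bd B M1" "Q1 (low M1)"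
  using assms(1) M unfolding cor_def by blast
 have "cor c2 (low M1) Q" by (rule assms(2)) (use 1 M low_frame[OF 1(1)] in \<open>simp_all del: low_apply\<close>)
 then obtain M2 t2 where 2: "runs I c2 M1 M2 t2" "t2 \<le> ticks Z c2 * W" "bd B M2" "Q (low M2)"
  unfolding cor_def by blast
 show "\<exists>M' t. runs I (Seq c1 c2) M M' t \<and> t \<le> ticks Z (Seq c1 c2) * W \<and> bd B M' \<and> Q (low M')"
  using 1 2 by (intro exI conjI) (rule runs_Seq[OF 1(1) 2(1)], auto simp: algebra_simps)
qed

lemma low_set_cell: "a < 60 ==> low (set_cell a i q M) = set_cell a i q (low M)"
 by (auto simp: low_def set_cell_def fun_eq_iff)

lemma low_eqI: "(\<And>a. a < 60 ==> M a = M' a) ==> low M = low M'"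
 by (auto simp: low_def)

lemma cor_asg:
 assumes "bd B L" "a < 60" "eok e" "rb B (ev e L)" "Q (set_cell a 0 (ev e L) L)"
 shows "cor (asg a e) L Q"
 unfolding cor_def
proof (intro allI impI)
 fix M assume M: "low M = L"
 have bd: "bd B M" using assms(1) M by auto
 have ev: "ev e M = ev e L" using ev_low[OF assms(3)] M by metis
 obtain M1 t1 where 1: "runs I (ecomp e 60) M M1 t1" "\<forall>a<60. M1 a = M a" "M1 60 0 = ev e M"
  "t1 \<le> ticks Z (ecomp e 60) * W" using runs_ecomp[of M e 60] bd assms(3) by (auto simp: eok_def)
 have 2: "runs I (Const 61 0) M1 (set_cell 61 0 0 M1) (1 + rat_size 0)" by (rule runs_prim) simp
 have 3: "runs I (Arith Plus a 60 61) (set_cell 61 0 0 M1) (set_cell a 0 (ev e L) (set_cell 61 0 0 M1))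
   (1 + rat_size (ev e L) + rat_size 0)"
  by (rule runs_prim) (use 1 ev in auto)
 have 4: "1 + rat_size (ev e L) + rat_size 0 \<le> W" "1 + rat_size 0 \<le> W"
  using size_ev[of L e] size_small[of 0] assms(1,3) W_SB by (auto simp: eok_def)
 have "low (set_cell a 0 (ev e L) (set_cell 61 0 0 M1)) = low (set_cell a 0 (ev e L) M)"
  using 1(2) assms(2) by (intro low_eqI) (auto simp: set_cell_def)
 also have "\<dots> = set_cell a 0 (ev e L) L" using assms(2) M by (simp add: low_set_cell)
 finally have 5: "low (set_cell a 0 (ev e L) (set_cell 61 0 0 M1)) = set_cell a 0 (ev e L) L" .
 then have "bd B (set_cell a 0 (ev e L) (set_cell 61 0 0 M1))"
  using bd_set_cell[OF assms(1,4)] by (metis bd_low)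
 then show "\<exists>M' t. runs I (asg a e) M M' t \<and> t \<le> ticks Z (asg a e) * W \<and> bd B M' \<and> Q (low M')"
  unfolding asg_def
  using 1 4 5 assms(5)
  by (intro exI conjI) (rule runs_Seq[OF 1(1) runs_Seq[OF 2 3]], auto simp: algebra_simps)
qed

lemma cor_put:
 assumes "bd B L" "a < 60" "eok i" "eok e" "rb B (ev e L)"
  and "Q (set_cell a (index_of (ev i L)) (ev e L) L)"
 shows "cor (put a i e) L Q"
 unfolding cor_def
proof (intro allI impI)
 fix M assume M: "low M = L"
 have bd: "bd B M" using assms(1) M by auto
 have ev: "ev e M = ev e L" "ev i M = ev i L" using ev_low[OF assms(3)] ev_low[OF assms(4)] M by metis+
 obtain M1 t1 where 1: "runs I (ecomp i 60) M M1 t1" "\<forall>a<60. M1 a = M a" "M1 60 0 = ev i M"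
  "t1 \<le> ticks Z (ecomp i 60) * W" using runs_ecomp[of M i 60] bd assms(3) by (auto simp: eok_def)
 have bd1: "bd B M1" using bd 1(2) by (auto simp: bd_def)
 obtain M2 t2 where 2: "runs I (ecomp e 61) M1 M2 t2" "\<forall>a<61. M2 a = M1 a" "M2 61 0 = ev e M1"
  "t2 \<le> ticks Z (ecomp e 61) * W" using runs_ecomp[of M1 e 61] bd1 assms(4) by (auto simp: eok_def)
 have ev1: "ev e M1 = ev e M" using 1(2) assms(4) by (intro ev_cong) (auto simp: eok_def)
 have 3: "runs I (Store a 60 61) M2 (set_cell a (index_of (ev i L)) (ev e L) M2)
   (1 + rat_size (ev i L) + rat_size (ev e L))"
  by (rule runs_prim) (use 1 2 ev ev1 in auto)
 have 4: "1 + rat_size (ev i L) + rat_size (ev e L) \<le> W"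
  using size_ev[of L e] size_ev[of L i] assms(1,3,4) W_SB by (auto simp: eok_def)
 have "low (set_cell a (index_of (ev i L)) (ev e L) M2) = low (set_cell a (index_of (ev i L)) (ev e L) M)"
  using 1(2) 2(2) assms(2) by (intro low_eqI) (auto simp: set_cell_def)
 also have "\<dots> = set_cell a (index_of (ev i L)) (ev e L) L" using assms(2) M by (simp add: low_set_cell)
 finally have 5: "low (set_cell a (index_of (ev i L)) (ev e L) M2) = set_cell a (index_of (ev i L)) (ev e L) L" .
 then have "bd B (set_cell a (index_of (ev i L)) (ev e L) M2)"
  using bd_set_cell[OF assms(1,5)] by (metis bd_low)
 then show "\<exists>M' t. runs I (put a i e) M M' t \<and> t \<le> ticks Z (put a i e) * W \<and> bd B M' \<and> Q (low M')"
  unfolding put_def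
  using 1 2 4 5 assms(6)
  by (intro exI conjI) (rule runs_Seq[OF 1(1) runs_Seq[OF 2(1) 3]], auto simp: algebra_simps)
qed

lemma cor_skip: "bd B L ==> Q L ==> cor skip L Q"
 unfolding cor_def
proof (intro allI impI)
 fix M assume *: "bd B L" "Q L" "low M = L"
 have 1: "runs I skip M (set_cell 60 0 0 M) (1 + rat_size 0)" unfolding skip_def by (rule runs_prim) simp
 have 2: "low (set_cell 60 0 0 M) = L" using *(3) by (auto simp: low_def set_cell_def)
 then have "bd B (set_cell 60 0 0 M)" using *(1) by (metis bd_low)
 then show "\<exists>M' t. runs I skip M M' t \<and> t \<le> ticks Z skip * W \<and> bd B M' \<and> Q (low M')"
  using 2 * size_small[of 0] W_SB
  by (intro exI conjI) (rule 1, auto simp: skip_def)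
qed

lemma cor_ifp:
 assumes "bd B L" "eok e"
  and "ev e L > 0 ==> cor c1 L Q" "\<not> ev e L > 0 ==> cor c2 L Q"
 shows "cor (ifp e c1 c2) L Q"
 unfolding cor_def
proof (intro allI impI)
 fix M assume M: "low M = L"
 have bd: "bd B M" using assms(1) M by auto
 have ev: "ev e M = ev e L" using ev_low[OF assms(2)] M by metis
 obtain M1 t1 where 1: "runs I (ecomp e 60) M M1 t1" "\<forall>a<60. M1 a = M a" "M1 60 0 = ev e M"
  "t1 \<le> ticks Z (ecomp e 60) * W" using runs_ecomp[of M e 60] bd assms(2) by (auto simp: eok_def)
 have l1: "low M1 = L" using 1(2) M low_eqI[of M1 M] by simp
 have 4: "1 + rat_size (ev e L) \<le> W"
  using size_ev[of L e] assms(1,2) W_SB by (auto simp: eok_def)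
 let ?c = "if M1 60 0 > 0 then c1 else c2"
 have "cor ?c L Q" using assms(3,4) 1(3) ev by auto
 then obtain M2 t2 where 2: "runs I ?c M1 M2 t2" "t2 \<le> ticks Z ?c * W" "bd B M2" "Q (low M2)"
  unfolding cor_def using l1 by blast
 have "ticks Z ?c * W \<le> (ticks Z c1 + ticks Z c2) * W" by (rule mult_right_mono) auto
 then show "\<exists>M' t. runs I (ifp e c1 c2) M M' t \<and> t \<le> ticks Z (ifp e c1 c2) * W \<and> bd B M' \<and> Q (low M')"
  unfolding ifp_def
  using 1 2 4 ev
  by (intro exI conjI) (rule runs_Seq[OF 1(1) runs_Cond[OF 2(1)]], auto simp: algebra_simps)
qed

text \<open>The number \<open>N\<close> of rounds is known beforehand and indexes the invariant, so
  termination needs no separate measure.\<close>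

lemma cor_whl:
 assumes "bd B L" "eok e" "N \<le> Z" "Inv 0 L"
  and step: "\<And>j L'. j < N ==> bd B L' ==> (\<And>a. a < 60 ==> a \<notin> wr c ==> L' a = L a) ==> Inv j L' ==>
    ev e L' > 0 \<and> cor c L' (Inv (Suc j))"
  and stop: "\<And>L'. bd B L' ==> (\<And>a. a < 60 ==> a \<notin> wr c ==> L' a = L a) ==> Inv N L' ==> \<not> ev e L' > 0 \<and> Q L'"
 shows "cor (whl e c) L Q"
 unfolding cor_def
proof (intro allI impI)
 fix M assume M: "low M = L"
 let ?b = "Seq c (ecomp e 60)"
 let ?loop = "While 60 ?b"
 have comp: "\<exists>M' t. runs I (ecomp e 60) M M' t \<and> low M' = low M \<and> M' 60 0 = ev e (low M) \<and>
   t \<le> ticks Z (ecomp e 60) * W" if bdM: "bd B M" for M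
 proof -
  obtain M' t where *: "runs I (ecomp e 60) M M' t" "\<forall>a<60. M' a = M a" "M' 60 0 = ev e M"
   "t \<le> ticks Z (ecomp e 60) * W"
   using runs_ecomp[of M e 60] bdM assms(2) by (auto simp: eok_def)
  then have "low M' = low M" by (intro low_eqI) auto
  with * ev_low[OF assms(2), of M] show ?thesis by (intro exI[of _ M'] exI[of _ t]) simp
 qed
 \<comment> \<open>Induction on the rounds that remain. The memory is taken just after an evaluation
   of the guard, when register 60 agrees with \<open>ev e\<close>.\<close>
 have main: "\<exists>M' t. runs I ?loop M1 M' t \<and> t \<le> (N - j) * ((1 + ticks Z ?b) * W) + W \<and> bd B M' \<and> Q (low M')"
  if "j \<le> N" "bd B M1" "\<And>a. a < 60 ==> a \<notin> wr c ==> low M1 a = L a" "Inv j (low M1)" "M1 60 0 = ev e (low M1)" for j M1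
  using that
 proof (induction "N - j" arbitrary: j M1)
  case 0
  then have j: "j = N" by simp
  have "\<not> ev e (low M1) > 0" and Q: "Q (low M1)" using stop[of "low M1"] 0 j by auto
  then have "runs I ?loop M1 M1 (1 + rat_size (ev e (low M1)))"
   using runs_While_False[of M1 60 I ?b] 0 by simp
  moreover have "1 + rat_size (ev e (low M1)) \<le> W"
   using size_ev[of "low M1" e] assms(2) 0 W_SB by (auto simp: eok_def)
  ultimately show ?case using Q 0 by (intro exI conjI) (assumption, auto)
 next
  case (Suc n)
  then have j: "j < N" by simp
  have pos: "ev e (low M1) > 0" and cb: "cor c (low M1) (Inv (Suc j))"
   using step[of j "low M1"] Suc.prems j by auto
  obtain M2 t2 where 2: "runs I c M1 M2 t2" "t2 \<le> ticks Z c * W" "bd B M2" "Inv (Suc j) (low M2)"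
   using cb unfolding cor_def by blast
  obtain M3 t3 where 3: "runs I (ecomp e 60) M2 M3 t3" "low M3 = low M2" "M3 60 0 = ev e (low M2)"
   "t3 \<le> ticks Z (ecomp e 60) * W" using comp[OF 2(3)] by blast
  have nn: "n = N - Suc j" using Suc.hyps(2) by simp
  have bd3: "bd B M3" using 2(3) 3(2) by (metis bd_low)
  have "low M2 a = L a" if "a < 60" "a \<notin> wr c" for a
   using low_frame[OF 2(1) that(2)] Suc.prems(3) that by auto
  then obtain M4 t4 where 4: "runs I ?loop M3 M4 t4" "t4 \<le> (N - Suc j) * ((1 + ticks Z ?b) * W) + W" "bd B M4" "Q (low M4)"
   using Suc.hyps(1)[of "Suc j" M3, OF nn] 2 3 bd3 j by (metis Suc_leI)
  have r: "runs I ?loop M1 M4 (1 + rat_size (M1 60 0) + (t2 + t3) + t4)"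
   by (rule runs_While_True[OF _ runs_Seq[OF 2(1) 3(1)] 4(1)]) (use pos Suc.prems in simp)
  have sz: "1 + rat_size (M1 60 0) \<le> W"
   using size_ev[of "low M1" e] assms(2) Suc.prems W_SB by (auto simp: eok_def)
  have "N - j = Suc (N - Suc j)" using j by simp
  then have "(N - j) * ((1 + ticks Z ?b) * W) = (N - Suc j) * ((1 + ticks Z ?b) * W) + (W + ticks Z c * W + ticks Z (ecomp e 60) * W)"
   by (simp add: algebra_simps)
  then show ?case using sz 2(2) 3(4) 4
  by (intro exI conjI) (rule r, auto)
 qed
 have bd: "bd B M" using assms(1) M by auto
 obtain M1 t1 where 1: "runs I (ecomp e 60) M M1 t1" "low M1 = low M" "M1 60 0 = ev e (low M)"
   "t1 \<le> ticks Z (ecomp e 60) * W" using comp[OF bd] by blast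
 have "bd B M1" using bd 1(2) by (metis bd_low)
 then obtain M2 t2 where 2: "runs I ?loop M1 M2 t2" "t2 \<le> N * ((1 + ticks Z ?b) * W) + W" "bd B M2" "Q (low M2)"
  using main[of 0 M1] 1 M assms(4) by auto
 have "N * ((1 + ticks Z ?b) * W) \<le> Z * ((1 + ticks Z ?b) * W)" using assms(3) by (rule mult_right_mono) simp
 then have "t1 + t2 \<le> ticks Z (whl e c) * W" using 1(4) 2(2) by (simp add: whl_def algebra_simps)
 then show "\<exists>M' t. runs I (whl e c) M M' t \<and> t \<le> ticks Z (whl e c) * W \<and> bd B M' \<and> Q (low M')"
  using runs_Seq[OF 1(1) 2(1)] 2 unfolding whl_def by blast
qed

text \<open>The step delivers the invariant for the memory in which the counter is already advanced,
  since the increment is the last statement of a round; the invariant may thus mention the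
  counter.\<close>

lemma cor_floop:
 assumes "bd B L" "i < 60" "evs n \<subseteq> {..<60}" "esz n \<le> 30" "kok n"
  and N: "ev n L = of_nat N" "N \<le> Z" "N \<le> 2 ^ B"
  and nw: "i \<notin> wr c" "i \<notin> evs n" "evs n \<inter> wr c = {}"
  and Inv0: "Inv 0 (set_cell i 0 0 L)"
  and step: "\<And>j L'. j < N ==> bd B L' ==> (\<And>a. a < 60 ==> a \<noteq> i ==> a \<notin> wr c ==> L' a = L a) ==>
    L' i 0 = of_nat j ==> Inv j L' ==> cor c L' (\<lambda>L''. Inv (Suc j) (set_cell i 0 (of_nat (Suc j)) L''))"
  and post: "\<And>L'. bd B L' ==> (\<And>a. a < 60 ==> a \<noteq> i ==> a \<notin> wr c ==> L' a = L a) ==> Inv N L' ==> Q L'"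
 shows "cor (floop i n c) L Q"
 unfolding floop_def
proof (rule cor_seq[OF cor_asg])
 let ?L = "set_cell i 0 0 L"
 have frame: "ev n L' = of_nat N" if "\<And>a. a < 60 ==> a \<notin> wr (Seq c (asg i (Bi Plus (Vr i) (Kn 1)))) ==> L' a = ?L a" for L'
 proof -
  have "ev n L' = ev n L"
  proof (rule ev_cong)
   fix a assume "a \<in> evs n"
   then show "L' a = L a" using that[of a] assms(3) nw by auto
  qed
  then show ?thesis using N by simp
 qed
 fix L' assume "bd B L'" and L': "L' = set_cell i 0 (ev (Kn 0) L) L"
 then have L': "L' = ?L" "bd B ?L" by auto
 show "cor (whl (Bi Minus n (Vr i)) (Seq c (asg i (Bi Plus (Vr i) (Kn 1))))) L' Q" unfolding L'(1)
 proof (rule cor_whl[where N = N and Inv = "\<lambda>j L'. Inv j L' \<and> L' i 0 = of_nat j"])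
  show "eok (Bi Minus n (Vr i))" using assms by (auto simp: eok_def)
  show "Inv 0 ?L \<and> ?L i 0 = of_nat 0" using Inv0 by simp
 next
  fix j L1 assume j: "j < N" and bd1: "bd B L1"
   and fr: "\<And>a. a < 60 ==> a \<notin> wr (Seq c (asg i (Bi Plus (Vr i) (Kn 1)))) ==> L1 a = ?L a"
   and inv: "Inv j L1 \<and> L1 i 0 = of_nat j"
  have "cor (Seq c (asg i (Bi Plus (Vr i) (Kn 1)))) L1 (\<lambda>L'. Inv (Suc j) L' \<and> L' i 0 = of_nat (Suc j))"
  proof (rule cor_seq[OF step[OF j bd1 fr[THEN trans]]])
   fix L2 assume 2: "bd B L2" "\<And>a. a < 60 ==> a \<notin> wr c ==> L2 a = L1 a" "Inv (Suc j) (set_cell i 0 (of_nat (Suc j)) L2)"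
   have i2: "L2 i 0 = of_nat j" using 2(2)[OF assms(2) nw(1)] inv by simp
   show "cor (asg i (Bi Plus (Vr i) (Kn 1))) L2 (\<lambda>L'. Inv (Suc j) L' \<and> L' i 0 = of_nat (Suc j))"
   proof (rule cor_asg[OF 2(1) assms(2)])
    show "rb B (ev (Bi Plus (Vr i) (Kn 1)) L2)"
     using rb_nat[of "Suc j" B] j N by (simp add: i2 add.commute)
   qed (use 2 assms(2) i2 in \<open>auto simp: eok_def add.commute\<close>)
  qed (use inv in auto)
  then show "0 < ev (Bi Minus n (Vr i)) L1 \<and>
    cor (Seq c (asg i (Bi Plus (Vr i) (Kn 1)))) L1 (\<lambda>L'. Inv (Suc j) L' \<and> L' i 0 = of_nat (Suc j))"
   using frame[OF fr] inv j by simp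
 next
  fix L1 assume bd1: "bd B L1"
   and fr: "\<And>a. a < 60 ==> a \<notin> wr (Seq c (asg i (Bi Plus (Vr i) (Kn 1)))) ==> L1 a = ?L a"
   and inv: "Inv N L1 \<and> L1 i 0 = of_nat N"
  show "\<not> 0 < ev (Bi Minus n (Vr i)) L1 \<and> Q L1"
   using frame[OF fr] inv post[OF bd1 fr[THEN trans]] by simp
 qed (use assms(1) L' N in auto)
qed (use assms(1,2) in \<open>auto simp: eok_def\<close>)

lemma get_vec_size: "bd B M ==> b < 60 ==> vec_size (get_vec b (mdim I) M) \<le> mdim I * (2 * B + 3)"
proof -
 assume "bd B M" "b < 60"
 then have "rat_size (M b i) \<le> 2 * B + 3" for i using rat_size_rb bdD by blast
 then have "(\<Sum>i<mdim I. rat_size (M b i)) \<le> of_nat (card {..<mdim I}) * (2 * B + 3)"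
  by (intro sum_bounded_above)
 then show ?thesis by (simp add: vec_size_def get_vec_def)
qed

lemma cor_prim:
 assumes "\<And>M k t0. low M = L ==> exec I (Suc k) c (M, t0) = return_spmf (F M, t0 + t M)"
  and "\<And>M. low M = L ==> t M \<le> W" "\<And>M. low M = L ==> low (F M) = L'" "bd B L'" "Q L'" "ticks Z c = 1"
 shows "cor c L Q"
 unfolding cor_def
proof (intro allI impI)
 fix M assume M: "low M = L"
 have "runs I c M (F M) (t M)" by (rule runs_prim) (use assms M in auto)
 moreover have "bd B (F M)" using assms(3,4) M by (metis bd_low)
 ultimately show "\<exists>M' t. runs I c M M' t \<and> t \<le> ticks Z c * W \<and> bd B M' \<and> Q (low M')"
  using assms M by (intro exI conjI) (assumption, auto)
qed

lemma get_vec_low: "b < 60 ==> get_vec b k (low M) = get_vec b k M"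
 and get_scenario_low: "b < 60 ==> get_scenario b k (low M) = get_scenario b k M"
 by (auto simp: get_vec_def get_scenario_def)

lemma low_set_vec: "a < 60 ==> low (set_vec a v M) = set_vec a v (low M)"
 by (auto simp: low_def set_vec_def fun_eq_iff)

lemma cor_Value:
 assumes "bd B L" "a < 60" "b < 60" "c < 60"
  and "rb B (value_orc I (get_vec b (mdim I) L) (get_scenario c (usize I) L))"
  and "Q (set_cell a 0 (value_orc I (get_vec b (mdim I) L) (get_scenario c (usize I) L)) L)"
 shows "cor (Value a b c) L Q"
proof -
 let ?r = "set_cell a 0 (value_orc I (get_vec b (mdim I) L) (get_scenario c (usize I) L))"
 have t: "oracle_cost I (vec_size (get_vec b (mdim I) L) + usize I) \<le> W"
  using get_vec_size[OF assms(1,3)] by (intro W_oracle) auto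
 show ?thesis
 proof (rule cor_prim[where F = ?r and L' = "?r L" and t = "\<lambda>M. oracle_cost I (vec_size (get_vec b (mdim I) L) + usize I)"])
  fix M k t0 assume "low M = L"
  then show "exec I (Suc k) (Value a b c) (M, t0) =
   return_spmf (?r M, t0 + oracle_cost I (vec_size (get_vec b (mdim I) L) + usize I))"
   using get_vec_low[OF assms(3), of "mdim I" M] get_scenario_low[OF assms(4), of "usize I" M]
   by (simp add: Let_def)
 qed (use assms t in \<open>auto simp: low_set_cell intro: bd_set_cell\<close>)
qed

lemma bd_set_vec: "bd B L ==> (\<And>i. i < dim_vec v ==> rb B (v $ i)) ==> bd B (set_vec a v L)"
 by (simp add: bd_def set_vec_def)

lemma cor_Subgrad:
 assumes "bd B L" "a < 60" "b < 60" "c < 60"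
  and "\<And>i. i < dim_vec (subgrad_orc I (get_vec b (mdim I) L) (get_scenario c (usize I) L)) ==>
    rb B (subgrad_orc I (get_vec b (mdim I) L) (get_scenario c (usize I) L) $ i)"
  and "Q (set_vec a (subgrad_orc I (get_vec b (mdim I) L) (get_scenario c (usize I) L)) L)"
 shows "cor (Subgrad a b c) L Q"
proof -
 let ?r = "set_vec a (subgrad_orc I (get_vec b (mdim I) L) (get_scenario c (usize I) L))"
 have t: "oracle_cost I (vec_size (get_vec b (mdim I) L) + usize I) \<le> W"
  using get_vec_size[OF assms(1,3)] by (intro W_oracle) auto
 show ?thesis
 proof (rule cor_prim[where F = ?r and L' = "?r L" and t = "\<lambda>M. oracle_cost I (vec_size (get_vec b (mdim I) L) + usize I)"])
  fix M k t0 assume "low M = L"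
  then show "exec I (Suc k) (Subgrad a b c) (M, t0) =
   return_spmf (?r M, t0 + oracle_cost I (vec_size (get_vec b (mdim I) L) + usize I))"
   using get_vec_low[OF assms(3), of "mdim I" M] get_scenario_low[OF assms(4), of "usize I" M]
   by (simp add: Let_def)
 qed (use assms t in \<open>auto simp: low_set_vec intro: bd_set_vec\<close>)
qed

lemma cor_Separate:
 assumes "bd B L" "a < 60" "b < 60" "c < 60"
  and "sep_orc I (get_vec c (mdim I) L) = None ==> Q (set_cell a 0 0 L)"
  and "\<And>d. sep_orc I (get_vec c (mdim I) L) = Some d ==>
   (\<forall>i<dim_vec d. rb B (d $ i)) \<and> Q (set_cell a 0 1 (set_vec b d L))"
 shows "cor (Separate a b c) L Q"
proof -
 let ?r = "\<lambda>M. case sep_orc I (get_vec c (mdim I) L) of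
       None => set_cell a 0 0 M
      | Some d => set_cell a 0 1 (set_vec b d M)"
 have t: "oracle_cost I (vec_size (get_vec c (mdim I) L)) \<le> W"
  using get_vec_size[OF assms(1,4)] by (intro W_oracle) auto
 show ?thesis
 proof (rule cor_prim[where F = ?r and L' = "?r L" and t = "\<lambda>M. oracle_cost I (vec_size (get_vec c (mdim I) L))"])
  fix M k t0 assume "low M = L"
  then show "exec I (Suc k) (Separate a b c) (M, t0) =
   return_spmf (?r M, t0 + oracle_cost I (vec_size (get_vec c (mdim I) L)))"
   using get_vec_low[OF assms(4), of "mdim I" M]
   by (simp add: Let_def)
  show "low (?r M) = ?r L" using assms \<open>low M = L\<close>
   by (auto simp: low_set_cell low_set_vec split: option.split)
 qed (use assms t in \<open>auto intro!: bd_set_vec bd_set_cell split: option.split\<close>)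
qed

end

section \<open>Uniform deviation bounds for independent samples\<close>

text \<open>Independence in the form of a recursion: \<open>replicate_pmf (Suc n) p\<close> draws
  one sample and then \<open>n\<close> others, so the moment generating function of the sum
  factorises.\<close>

lemma nn_integral_replicate_pmf_exp:
 fixes f :: "'a => real"
 shows "(\<integral>\<^sup>+xs. ennreal (exp (l * (\<Sum>x\<leftarrow>xs. f x))) \<partial>replicate_pmf n p) =
  (\<integral>\<^sup>+x. ennreal (exp (l * f x)) \<partial>p) ^ n"
proof (induction n)
 case (Suc n)
 have "(\<integral>\<^sup>+xs. ennreal (exp (l * (\<Sum>x\<leftarrow>xs. f x))) \<partial>replicate_pmf (Suc n) p) =
   (\<integral>\<^sup>+x. \<integral>\<^sup>+xs. ennreal (exp (l * f x)) * ennreal (exp (l * (\<Sum>x\<leftarrow>xs. f x))) \<partial>replicate_pmf n p \<partial>p)"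
  by (simp add: algebra_simps exp_add ennreal_mult)
 also have "\<dots> = (\<integral>\<^sup>+x. ennreal (exp (l * f x)) * (\<integral>\<^sup>+x. ennreal (exp (l * f x)) \<partial>p) ^ n \<partial>p)"
  by (simp add: nn_integral_cmult Suc)
 also have "\<dots> = (\<integral>\<^sup>+x. ennreal (exp (l * f x)) \<partial>p) ^ Suc n"
  by (simp add: nn_integral_multc)
 finally show ?case .
qed simp

text \<open>Chernoff's method. With parameter \<open>l\<close>, Hoeffding's lemma bounds the
  exponent by \<open>- l * n * \<eta> + n * l^2 / 8\<close>, which is least at
  \<open>l = 4 * \<eta>\<close>.\<close>

lemma replicate_pmf_Hoeffding_ge:
 fixes \<phi> :: "'a => real"
 assumes rng: "\<And>x. x \<in> set_pmf p ==> 0 \<le> \<phi> x \<and> \<phi> x \<le> 1" and \<eta>: "\<eta> > 0"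
 defines "\<mu> \<equiv> measure_pmf.expectation p \<phi>"
 shows "measure_pmf.prob (replicate_pmf n p) {xs. (\<Sum>x\<leftarrow>xs. \<phi> x) \<ge> real n * (\<mu> + \<eta>)} \<le> exp (- 2 * real n * \<eta>\<^sup>2)"
proof -
 interpret X: interval_bounded_random_variable "measure_pmf p" \<phi> 0 1
  by unfold_locales (auto simp: AE_measure_pmf_iff rng)
 let ?l = "4 * \<eta>" and ?R = "replicate_pmf n p"
 let ?A = "{xs. (\<Sum>x\<leftarrow>xs. \<phi> x) \<ge> real n * (\<mu> + \<eta>)}"
 have "emeasure (measure_pmf ?R) ?A = (\<integral>\<^sup>+xs. indicator ?A xs \<partial>?R)" by simp
 also have "\<dots> \<le> (\<integral>\<^sup>+xs. ennreal (exp (- ?l * (real n * \<eta>))) * ennreal (exp (?l * (\<Sum>x\<leftarrow>xs. \<phi> x - \<mu>))) \<partial>?R)"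
 proof (rule nn_integral_mono_AE, unfold AE_measure_pmf_iff, intro ballI)
  fix xs assume "xs \<in> set_pmf ?R"
  then have "length xs = n" by (simp add: set_replicate_pmf)
  then have s: "(\<Sum>x\<leftarrow>xs. \<phi> x - \<mu>) = (\<Sum>x\<leftarrow>xs. \<phi> x) - real n * \<mu>"
   by (simp add: sum_list_subtractf sum_list_triv)
  have "indicator ?A xs \<le> ennreal (exp (?l * ((\<Sum>x\<leftarrow>xs. \<phi> x) - real n * \<mu> - real n * \<eta>)))"
  proof (cases "xs \<in> ?A")
   case True
   then have "0 \<le> ?l * ((\<Sum>x\<leftarrow>xs. \<phi> x) - real n * \<mu> - real n * \<eta>)"
    using \<eta> by (intro mult_nonneg_nonneg) (auto simp: algebra_simps)
   then show ?thesis using True by simp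
  qed simp
  also have "\<dots> = ennreal (exp (- ?l * (real n * \<eta>))) * ennreal (exp (?l * (\<Sum>x\<leftarrow>xs. \<phi> x - \<mu>)))"
   unfolding s by (simp add: ennreal_mult[symmetric] exp_add[symmetric] algebra_simps)
  finally show "indicator ?A xs \<le> ennreal (exp (- ?l * (real n * \<eta>))) * ennreal (exp (?l * (\<Sum>x\<leftarrow>xs. \<phi> x - \<mu>)))" .
 qed
 also have "\<dots> = ennreal (exp (- ?l * (real n * \<eta>))) * (\<integral>\<^sup>+x. ennreal (exp (?l * (\<phi> x - \<mu>))) \<partial>p) ^ n"
  by (simp add: nn_integral_cmult nn_integral_replicate_pmf_exp)
 also have "\<dots> \<le> ennreal (exp (- ?l * (real n * \<eta>))) * ennreal (exp (?l\<^sup>2 * (1 - 0)\<^sup>2 / 8)) ^ n"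
  using X.Hoeffdings_lemma_nn_integral[of ?l] \<eta> unfolding \<mu>_def
  by (intro mult_left_mono power_mono) auto
 also have "\<dots> = ennreal (exp (- ?l * (real n * \<eta>) + real n * (?l\<^sup>2 / 8)))"
  by (simp add: ennreal_power ennreal_mult[symmetric] exp_diff exp_minus exp_of_nat_mult field_simps)
 also have "- ?l * (real n * \<eta>) + real n * (?l\<^sup>2 / 8) = - 2 * real n * \<eta>\<^sup>2"
  by (simp add: power2_eq_square)
 finally show ?thesis
  by (simp add: measure_pmf.emeasure_eq_measure)
qed

text \<open>The lower tail is the upper tail of \<open>1 - \<phi>\<close>, which has the same
  range.\<close>

lemma replicate_pmf_Hoeffding_abs:
 fixes \<phi> :: "'a => real"
 assumes rng: "\<And>x. x \<in> set_pmf p ==> 0 \<le> \<phi> x \<and> \<phi> x \<le> 1" and \<eta>: "\<eta> > 0"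
 defines "\<mu> \<equiv> measure_pmf.expectation p \<phi>"
 shows "measure_pmf.prob (replicate_pmf n p) {xs. \<bar>(\<Sum>x\<leftarrow>xs. \<phi> x) - real n * \<mu>\<bar> \<ge> real n * \<eta>}
  \<le> 2 * exp (- 2 * real n * \<eta>\<^sup>2)"
proof -
 let ?R = "replicate_pmf n p"
 let ?A = "{xs. (\<Sum>x\<leftarrow>xs. \<phi> x) \<ge> real n * (\<mu> + \<eta>)}"
 let ?B = "{xs. (\<Sum>x\<leftarrow>xs. 1 - \<phi> x) \<ge> real n * ((1 - \<mu>) + \<eta>)}"
 have int: "integrable (measure_pmf p) \<phi>"
  by (rule measure_pmf.integrable_const_bound[where B = 1]) (auto simp: AE_measure_pmf_iff rng)
 have mu': "measure_pmf.expectation p (\<lambda>x. 1 - \<phi> x) = 1 - \<mu>"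
  using int by (simp add: \<mu>_def)
 have A: "measure_pmf.prob ?R ?A \<le> exp (- 2 * real n * \<eta>\<^sup>2)"
  unfolding \<mu>_def by (rule replicate_pmf_Hoeffding_ge[OF rng \<eta>])
 have B: "measure_pmf.prob ?R ?B \<le> exp (- 2 * real n * \<eta>\<^sup>2)"
  using replicate_pmf_Hoeffding_ge[of p "\<lambda>x. 1 - \<phi> x" \<eta> n] rng \<eta> by (simp add: mu')
 have "measure_pmf.prob ?R {xs. \<bar>(\<Sum>x\<leftarrow>xs. \<phi> x) - real n * \<mu>\<bar> \<ge> real n * \<eta>}
   \<le> measure_pmf.prob ?R (?A \<union> ?B)"
 proof (rule measure_pmf.finite_measure_mono_AE, unfold AE_measure_pmf_iff, intro ballI impI)
  fix xs assume "xs \<in> set_pmf ?R" and xs: "xs \<in> {xs. \<bar>(\<Sum>x\<leftarrow>xs. \<phi> x) - real n * \<mu>\<bar> \<ge> real n * \<eta>}"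
  then have "length xs = n" by (simp add: set_replicate_pmf)
  then have s: "(\<Sum>x\<leftarrow>xs. 1 - \<phi> x) = real n - (\<Sum>x\<leftarrow>xs. \<phi> x)"
   by (simp add: sum_list_subtractf sum_list_triv)
  show "xs \<in> ?A \<union> ?B" using xs unfolding s mem_Collect_eq Un_iff by (simp add: algebra_simps) linarith
 qed simp
 also have "\<dots> \<le> measure_pmf.prob ?R ?A + measure_pmf.prob ?R ?B"
  by (rule measure_Un_le) auto
 finally show ?thesis using A B by linarith
qed

lemma replicate_pmf_uniform_deviation:
 fixes F :: "('a => real) set"
 assumes "finite F" and rng: "\<And>\<phi> x. \<phi> \<in> F ==> x \<in> set_pmf p ==> 0 \<le> \<phi> x \<and> \<phi> x \<le> 1" and \<eta>: "\<eta> > 0"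
 shows "measure_pmf.prob (replicate_pmf n p)
   {xs. \<exists>\<phi>\<in>F. \<bar>(\<Sum>x\<leftarrow>xs. \<phi> x) - real n * measure_pmf.expectation p \<phi>\<bar> \<ge> real n * \<eta>}
  \<le> real (card F) * (2 * exp (- 2 * real n * \<eta>\<^sup>2))"
proof -
 let ?S = "\<lambda>\<phi>. {xs. \<bar>(\<Sum>x\<leftarrow>xs. \<phi> x) - real n * measure_pmf.expectation p \<phi>\<bar> \<ge> real n * \<eta>}"
 have "{xs. \<exists>\<phi>\<in>F. \<bar>(\<Sum>x\<leftarrow>xs. \<phi> x) - real n * measure_pmf.expectation p \<phi>\<bar> \<ge> real n * \<eta>} = (\<Union>\<phi>\<in>F. ?S \<phi>)"
  by auto
 then have "measure_pmf.prob (replicate_pmf n p)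
   {xs. \<exists>\<phi>\<in>F. \<bar>(\<Sum>x\<leftarrow>xs. \<phi> x) - real n * measure_pmf.expectation p \<phi>\<bar> \<ge> real n * \<eta>}
   \<le> (\<Sum>\<phi>\<in>F. measure_pmf.prob (replicate_pmf n p) (?S \<phi>))"
  using measure_pmf.finite_measure_subadditive_finite[OF assms(1), of ?S] by simp
 also have "\<dots> \<le> (\<Sum>\<phi>\<in>F. 2 * exp (- 2 * real n * \<eta>\<^sup>2))"
  by (intro sum_mono replicate_pmf_Hoeffding_abs rng \<eta>)
 finally show ?thesis by simp
qed

section \<open>Cutting simplices through the centroid\<close>

definition in_simplex :: "nat => (nat => nat => real) => (nat => real) => bool" where
 "in_simplex m v y \<longleftrightarrow> (\<exists>l. (\<forall>i\<le>m. 0 \<le> l i) \<and> (\<Sum>i\<le>m. l i) = 1 \<and>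
   (\<forall>k<m. y k = (\<Sum>i\<le>m. l i * v i k)))"

definition simplex_mat :: "nat => (nat => nat => real) => real Matrix.mat" where
 "simplex_mat m v = Matrix.mat (Suc m) (Suc m) (\<lambda>(i, k). if k = 0 then 1 else v i (k - 1))"

text \<open>This is \<open>m!\<close> times the Euclidean volume of the simplex with vertices
  \<open>v 0, ..., v m\<close>. The factor is harmless, as only such determinants are compared with
  each other.\<close>

definition simplex_vol :: "nat => (nat => nat => real) => real" where
 "simplex_vol m v = \<bar>Determinant.det (simplex_mat m v)\<bar>"

lemma simplex_mat_carrier [simp]: "simplex_mat m v \<in> carrier_mat (Suc m) (Suc m)"
 by (simp add: simplex_mat_def)

text \<open>Row \<open>i\<close> of the new matrix is \<open>s i\<close> times the old row plus
  \<open>1 - s i\<close> times row \<open>p\<close>; the entry 1 in column 0 agrees with this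
  because the coefficients add up to 1. Replacing the rows one by one multiplies the determinant by
  one factor at a time.\<close>

lemma simplex_vol_contract:
 assumes p: "p \<le> m" and v': "\<And>i k. i \<le> m ==> k < m ==> v' i k = v p k + s i * (v i k - v p k)"
 shows "simplex_vol m v' = (\<Prod>i\<in>{..m} - {p}. \<bar>s i\<bar>) * simplex_vol m v"
proof -
 define w where "w t i k = (if i < t then v' i k else v i k)" for t i k :: nat
 have vp: "v' p k = v p k" if "k < m" for k using v'[OF p that] by simp
 have "simplex_vol m (w t) = (\<Prod>i\<in>{..<t} - {p}. \<bar>s i\<bar>) * simplex_vol m v" if "t \<le> Suc m" for t
  using that
 proof (induction t)
  case 0 then show ?case by (simp add: w_def)
 next
  case (Suc t)
  show ?case
  proof (cases "t = p")
   case True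
   have "w (Suc t) i k = w t i k" if "k < m" for i k
    using vp[OF that] True by (auto simp: w_def less_Suc_eq)
   then have "simplex_mat m (w (Suc t)) = simplex_mat m (w t)"
    by (intro eq_matI) (auto simp: simplex_mat_def)
   moreover have "{..<Suc t} - {p} = {..<t} - {p}" using True by auto
   ultimately show ?thesis using Suc by (simp add: simplex_vol_def)
  next
   case False
   have e: "simplex_mat m (w (Suc t)) = addrow (1 - s t) t p (multrow t (s t) (simplex_mat m (w t)))"
    (is "_ = ?R")
   proof (rule eq_matI)
    fix i j assume "i < dim_row ?R" "j < dim_col ?R"
    then have ij: "i \<le> m" "j \<le> m" by (auto simp: simplex_mat_def)
    have wp: "w t p k = v p k" if "k < m" for k using vp that by (simp add: w_def)
    show "simplex_mat m (w (Suc t)) $$ (i, j) = ?R $$ (i, j)"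
    proof (cases "i = t")
     case True
     have "w (Suc t) t k = s t * w t t k + (1 - s t) * w t p k" if "k < m" for k
      using v'[of t k] ij True that wp by (simp add: w_def algebra_simps)
     then show ?thesis using ij p True False by (auto simp: simplex_mat_def)
    next
     case False
     then have "w (Suc t) i = w t i" by (auto simp: w_def fun_eq_iff)
     then show ?thesis using ij p False by (auto simp: simplex_mat_def)
    qed
   qed (auto simp: simplex_mat_def)
   have "Determinant.det (simplex_mat m (w (Suc t))) = s t * Determinant.det (simplex_mat m (w t))"
    unfolding e using False p Suc.prems by (subst det_addrow[of _ "Suc m"]) (auto simp: det_multrow[of _ "Suc m"])
   moreover have "{..<Suc t} - {p} = insert t ({..<t} - {p})" using False by auto
   ultimately show ?thesis using Suc by (simp add: simplex_vol_def abs_mult)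
  qed
 qed
 from this[of "Suc m"] have "simplex_vol m (w (Suc m)) = (\<Prod>i\<in>{..m} - {p}. \<bar>s i\<bar>) * simplex_vol m v"
  by (simp add: lessThan_Suc_atMost)
 moreover have "simplex_mat m (w (Suc m)) = simplex_mat m v'"
  by (rule eq_matI) (auto simp: simplex_mat_def w_def)
 ultimately show ?thesis by (simp add: simplex_vol_def)
qed

text \<open>With barycentric coordinates \<open>l\<close> of \<open>y\<close>, the new ones are
  \<open>l i / s i\<close> for \<open>i\<close> other than \<open>p\<close>, and vertex
  \<open>p\<close> takes the rest. The rest is nonnegative because \<open>1 / s i\<close> is at most
  \<open>1 + \<kappa> * \<alpha> i / (- \<alpha> p)\<close>, an affine function of the height: its
  average with weights \<open>l\<close> is at most 1 on the side of the cut that is kept, and its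
  value \<open>1 - \<kappa>\<close> at \<open>p\<close> is not negative.\<close>

lemma simplex_cut:
 assumes p: "p \<le> m" and v': "\<And>i k. i \<le> m ==> k < m ==> v' i k = v p k + s i * (v i k - v p k)"
  and y: "in_simplex m v y"
  and cut: "(\<Sum>k<m. a k * y k) < (\<Sum>k<m. a k * x k)"
  and \<alpha>: "\<And>i. i \<le> m ==> \<alpha> i = (\<Sum>k<m. a k * (v i k - x k))"
  and neg: "\<alpha> p < 0" and \<kappa>: "0 < \<kappa>" "\<kappa> \<le> 1"
  and s: "\<And>i. i \<le> m ==> i \<noteq> p ==> 0 < s i \<and> 1 / s i \<le> 1 + \<kappa> * (\<alpha> i / (- \<alpha> p))"
 shows "in_simplex m v' y"
proof -
 obtain l where l: "\<And>i. i \<le> m ==> 0 \<le> l i" "(\<Sum>i\<le>m. l i) = 1" "\<And>k. k < m ==> y k = (\<Sum>i\<le>m. l i * v i k)"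
  using y by (auto simp: in_simplex_def)
 have "(\<Sum>i\<le>m. l i * \<alpha> i) = (\<Sum>i\<le>m. \<Sum>k<m. a k * (l i * v i k) - l i * (a k * x k))"
  using \<alpha> by (intro sum.cong refl) (simp add: sum_distrib_left algebra_simps)
 also have "\<dots> = (\<Sum>k<m. \<Sum>i\<le>m. a k * (l i * v i k) - l i * (a k * x k))" by (rule sum.swap)
 also have "\<dots> = (\<Sum>k<m. a k * y k - a k * x k)"
  using l(2,3) by (intro sum.cong refl) (simp add: sum_subtractf sum_distrib_left[symmetric] sum_distrib_right[symmetric])
 also have "\<dots> < 0" using cut by (simp add: sum_subtractf)
 finally have neg': "(\<Sum>i\<le>m. l i * \<alpha> i) < 0" .
 have fin: "finite {..m}" "p \<in> {..m}" using p by auto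
 let ?c = "\<lambda>i. 1 + \<kappa> * (\<alpha> i / (- \<alpha> p))"
 have "(\<Sum>i\<le>m. l i * ?c i) = (\<Sum>i\<le>m. l i) + \<kappa> / (- \<alpha> p) * (\<Sum>i\<le>m. l i * \<alpha> i)"
 proof -
  have "l i * ?c i = l i + \<kappa> / (- \<alpha> p) * (l i * \<alpha> i)" for i by (simp add: algebra_simps)
  then show ?thesis by (simp only: sum.distrib sum_distrib_left)
 qed
 also have "\<dots> \<le> 1"
 proof -
  have "0 \<le> \<kappa> / (- \<alpha> p)" using neg \<kappa> by (intro divide_nonneg_pos) auto
  then have "\<kappa> / (- \<alpha> p) * (\<Sum>i\<le>m. l i * \<alpha> i) \<le> 0" using neg' by (intro mult_nonneg_nonpos) auto
  then show ?thesis using l(2) by linarith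
 qed
 finally have c1: "(\<Sum>i\<le>m. l i * ?c i) \<le> 1" .
 have "(\<Sum>i\<in>{..m} - {p}. l i / s i) \<le> (\<Sum>i\<in>{..m} - {p}. l i * ?c i)"
 proof (rule sum_mono)
  fix i assume "i \<in> {..m} - {p}"
  then show "l i / s i \<le> l i * ?c i"
   using mult_left_mono[of "1 / s i" "?c i" "l i"] s[of i] l(1)[of i] by auto
 qed
 also have "\<dots> = (\<Sum>i\<le>m. l i * ?c i) - l p * ?c p"
  using fin by (simp add: sum.remove)
 also have "\<dots> \<le> 1"
 proof -
  have "?c p = 1 - \<kappa>" using neg by simp
  then have "0 \<le> l p * ?c p" using l(1)[OF p] \<kappa> by simp
  then show ?thesis using c1 by linarith
 qed
 finally have le1: "(\<Sum>i\<in>{..m} - {p}. l i / s i) \<le> 1" .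
 define l' where "l' i = (if i = p then 1 - (\<Sum>i\<in>{..m} - {p}. l i / s i) else l i / s i)" for i
 have rest: "(\<Sum>i\<in>{..m} - {p}. l' i * f i) = (\<Sum>i\<in>{..m} - {p}. l i / s i * f i)" for f
  by (intro sum.cong) (auto simp: l'_def)
 have sum1: "(\<Sum>i\<le>m. l' i) = 1"
  using sum.remove[OF fin, of l'] rest[of "\<lambda>_. 1"] by (simp add: l'_def)
 show ?thesis unfolding in_simplex_def
 proof (intro exI[of _ l'] conjI allI impI)
  fix i assume "i \<le> m"
  then show "0 \<le> l' i" using le1 s[of i] l(1)[of i] by (auto simp: l'_def)
 next
  fix k assume k: "k < m"
  have "(\<Sum>i\<le>m. l' i * v' i k) = (\<Sum>i\<le>m. l' i * v p k + l' i * (s i * (v i k - v p k)))"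
  proof (intro sum.cong refl)
   fix i assume "i \<in> {..m}"
   then have "v' i k = v p k + s i * (v i k - v p k)" using v' k by auto
   then show "l' i * v' i k = l' i * v p k + l' i * (s i * (v i k - v p k))" by (simp only: distrib_left)
  qed
  also have "\<dots> = v p k + (\<Sum>i\<le>m. l' i * (s i * (v i k - v p k)))"
   by (simp add: sum.distrib sum1 flip: sum_distrib_right)
  also have "(\<Sum>i\<le>m. l' i * (s i * (v i k - v p k))) = (\<Sum>i\<in>{..m} - {p}. l i / s i * (s i * (v i k - v p k)))"
   using sum.remove[OF fin, of "\<lambda>i. l' i * (s i * (v i k - v p k))"] rest[of "\<lambda>i. s i * (v i k - v p k)"] by simp
  also have "\<dots> = (\<Sum>i\<in>{..m} - {p}. l i * (v i k - v p k))"
   using s by (intro sum.cong refl) force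
  also have "\<dots> = (\<Sum>i\<le>m. l i * (v i k - v p k))"
   using sum.remove[OF fin, of "\<lambda>i. l i * (v i k - v p k)"] by simp
  also have "\<dots> = y k - v p k"
   using l(2,3) k by (simp add: algebra_simps sum_subtractf flip: sum_distrib_right)
  finally show "y k = (\<Sum>i\<le>m. l' i * v' i k)" by simp
 qed (rule sum1)
qed

text \<open>To first order the product is \<open>exp (- \<kappa>)\<close>, as the \<beta> add up to
  1. The second-order loss \<open>2 * \<kappa>^2 * \<Sum> \<beta>^2\<close> and the rounding loss
  \<open>m / (32 m^3)\<close> are dominated for \<open>\<kappa> = 1 / (8 m^2)\<close>: in units of
  \<open>1 / (32 m^2)\<close> the balance is \<open>-4 + 2 + 1 = -1\<close>.\<close>

lemma contraction_factor:
 fixes \<beta> s :: "nat => real"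
 assumes m: "m > 0" and p: "p \<le> m"
  and \<beta>: "\<And>i. i \<le> m ==> i \<noteq> p ==> -1 \<le> \<beta> i" "(\<Sum>i\<in>{..m} - {p}. \<beta> i) = 1"
  and s: "\<And>i. i \<le> m ==> i \<noteq> p ==> 0 < s i \<and>
    s i \<le> 1 / (1 + \<beta> i / (8 * real m ^ 2)) + 1 / (32 * real m ^ 3)"
 shows "(\<Prod>i\<in>{..m} - {p}. \<bar>s i\<bar>) \<le> exp (- 1 / (32 * real m ^ 2))"
proof -
 let ?S = "{..m} - {p}" and ?M = "real m"
 have M: "?M \<ge> 1" using m by simp
 have card: "card ?S = m" using p by simp
 define \<kappa> where "\<kappa> = 1 / (8 * ?M ^ 2)"
 have \<kappa>: "0 < \<kappa>" "\<kappa> \<le> 1/8" using M by (auto simp: \<kappa>_def field_simps)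
 have one: "\<bar>s i\<bar> \<le> exp (- \<kappa> * \<beta> i + 2 * \<kappa>\<^sup>2 * (\<beta> i)\<^sup>2 + 1 / (32 * ?M ^ 3))" if "i \<in> ?S" for i
 proof -
  define x where "x = \<kappa> * \<beta> i"
  have "\<kappa> * \<beta> i \<ge> \<kappa> * (-1)" using \<beta>(1)[of i] that \<kappa> by (intro mult_left_mono) auto
  then have x: "x \<ge> -1/8" using \<kappa> by (simp add: x_def)
  have "1 \<le> (1 - x + 2 * x\<^sup>2) * (1 + x)"
  proof -
   have "(1 - x + 2 * x\<^sup>2) * (1 + x) = 1 + x\<^sup>2 * (1 + 2 * x)" by (simp add: algebra_simps power2_eq_square power3_eq_cube)
   moreover have "0 \<le> x\<^sup>2 * (1 + 2 * x)" using x by simp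
   ultimately show ?thesis by linarith
  qed
  then have "1 / (1 + x) \<le> 1 - x + 2 * x\<^sup>2" using x by (simp add: field_simps)
  then have "s i \<le> 1 + (- x + 2 * x\<^sup>2 + 1 / (32 * ?M ^ 3))"
   using s[of i] that by (simp add: x_def \<kappa>_def)
  also have "\<dots> \<le> exp (- x + 2 * x\<^sup>2 + 1 / (32 * ?M ^ 3))" by (rule exp_ge_add_one_self)
  finally show ?thesis using s[of i] that by (simp add: x_def power_mult_distrib mult.assoc)
 qed
 \<comment> \<open>Shifting by 1 makes the terms nonnegative with sum \<open>m + 1\<close>, so the
   sum of the shifted squares is at most \<open>(m + 1)^2\<close>.\<close>
 have sq: "(\<Sum>i\<in>?S. (\<beta> i)\<^sup>2) \<le> 2 * ?M ^ 2"
 proof -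
  have b1: "(\<Sum>i\<in>?S. \<beta> i + 1) = ?M + 1" using \<beta>(2) card by (simp add: sum.distrib)
  have "(\<Sum>i\<in>?S. (\<beta> i + 1)\<^sup>2) \<le> (\<Sum>i\<in>?S. (\<beta> i + 1) * (?M + 1))"
  proof (rule sum_mono)
   fix i assume i: "i \<in> ?S"
   have "\<beta> i + 1 \<le> ?M + 1" unfolding b1[symmetric]
    by (rule member_le_sum[OF i]) (use \<beta>(1) in force)+
   then show "(\<beta> i + 1)\<^sup>2 \<le> (\<beta> i + 1) * (?M + 1)"
    unfolding power2_eq_square using \<beta>(1)[of i] i by (intro mult_left_mono) auto
  qed
  also have "\<dots> = (?M + 1) * (?M + 1)" by (simp add: b1 flip: sum_distrib_right)
  finally have "(\<Sum>i\<in>?S. (\<beta> i)\<^sup>2 + 2 * \<beta> i + 1) \<le> (?M + 1) * (?M + 1)"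
   by (simp add: power2_eq_square algebra_simps)
  then have "(\<Sum>i\<in>?S. (\<beta> i)\<^sup>2) + 2 + ?M \<le> (?M + 1) * (?M + 1)"
   using \<beta>(2) card by (simp add: sum.distrib flip: sum_distrib_left)
  moreover have "?M \<le> ?M * ?M" using M by (simp add: mult_le_cancel_left1)
  ultimately show ?thesis by (simp add: power2_eq_square algebra_simps)
 qed
 have "(\<Prod>i\<in>?S. \<bar>s i\<bar>) \<le> (\<Prod>i\<in>?S. exp (- \<kappa> * \<beta> i + 2 * \<kappa>\<^sup>2 * (\<beta> i)\<^sup>2 + 1 / (32 * ?M ^ 3)))"
  using one by (intro prod_mono) auto
 also have "\<dots> = exp (\<Sum>i\<in>?S. - \<kappa> * \<beta> i + 2 * \<kappa>\<^sup>2 * (\<beta> i)\<^sup>2 + 1 / (32 * ?M ^ 3))"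
  by (simp add: exp_sum)
 also have "(\<Sum>i\<in>?S. - \<kappa> * \<beta> i + 2 * \<kappa>\<^sup>2 * (\<beta> i)\<^sup>2 + 1 / (32 * ?M ^ 3)) =
   - \<kappa> * (\<Sum>i\<in>?S. \<beta> i) + 2 * \<kappa>\<^sup>2 * (\<Sum>i\<in>?S. (\<beta> i)\<^sup>2) + ?M * (1 / (32 * ?M ^ 3))"
  unfolding sum.distrib sum_distrib_left by (simp add: card)
 also have "exp \<dots> \<le> exp (- \<kappa> + 2 * \<kappa>\<^sup>2 * (2 * ?M ^ 2) + ?M * (1 / (32 * ?M ^ 3)))"
  using mult_left_mono[OF sq, of "2 * \<kappa>\<^sup>2"] by (simp add: \<beta>(2))
 also have "- \<kappa> + 2 * \<kappa>\<^sup>2 * (2 * ?M ^ 2) + ?M * (1 / (32 * ?M ^ 3)) = - 1 / (32 * ?M ^ 2)"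
  using M by (simp add: \<kappa>_def field_simps power2_eq_square power3_eq_cube)
 finally show ?thesis .
qed

text \<open>The Leibniz formula has \<open>n!\<close> terms, each at most 1 in absolute value. For a
  stochastic matrix even 1 would be a bound, but the factor costs only a logarithm in the number of
  cuts.\<close>

lemma det_stochastic_bound:
 fixes A :: "real Matrix.mat"
 assumes A: "A \<in> carrier_mat n n" and le: "\<And>i j. i < n ==> j < n ==> \<bar>A $$ (i, j)\<bar> \<le> 1"
 shows "\<bar>Determinant.det A\<bar> \<le> fact n"
proof -
 let ?P = "{p. p permutes {0..<n}}"
 have "\<bar>Determinant.det A\<bar> \<le> (\<Sum>p\<in>?P. \<bar>signof p * (\<Prod>i = 0..<n. A $$ (i, p i))\<bar>)"
  unfolding det_def'[OF A] by (rule sum_abs)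
 also have "\<dots> \<le> (\<Sum>p\<in>?P. 1)"
 proof (rule sum_mono)
  fix p assume p: "p \<in> ?P"
  have "\<bar>signof p :: real\<bar> = 1" by (cases p rule: sign_cases) simp_all
  moreover have "(\<Prod>i = 0..<n. \<bar>A $$ (i, p i)\<bar>) \<le> 1"
   using p le permutes_in_image[of p "{0..<n}"] by (intro prod_le_1) auto
  ultimately show "\<bar>signof p * (\<Prod>i = 0..<n. A $$ (i, p i))\<bar> \<le> 1"
   by (simp add: abs_mult abs_prod)
 qed
 also have "\<dots> = fact n" by (simp add: card_permutations[of _ n])
 finally show ?thesis .
qed

text \<open>A simplex that contains a small corner cannot have small volume: writing the vertices of
  the corner in barycentric coordinates gives a matrix product whose left factor has determinant at
  most \<open>(m + 1)!\<close>, while the corner itself has \<open>\<rho> ^ m\<close>.\<close>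

lemma simplex_vol_ge:
 assumes y0: "in_simplex m v y" and y: "\<And>j. j < m ==> in_simplex m v (\<lambda>k. y k + (if k = j then \<rho> else 0))"
  and \<rho>: "\<rho> \<ge> 0"
 shows "\<rho> ^ m \<le> fact (Suc m) * simplex_vol m v"
proof -
 define z where "z j k = (if j = 0 then y k else y k + (if k = j - 1 then \<rho> else 0))" for j k :: nat
 have "in_simplex m v (z j)" if "j \<le> m" for j
  using y0 y[of "j - 1"] that by (cases j) (auto simp: z_def[abs_def])
 then have "\<exists>l. \<forall>j\<le>m. (\<forall>i\<le>m. 0 \<le> l j i) \<and> (\<Sum>i\<le>m. l j i) = 1 \<and> (\<forall>k<m. z j k = (\<Sum>i\<le>m. l j i * v i k))"
  unfolding in_simplex_def by metis
 then obtain l where l: "\<And>j i. j \<le> m ==> i \<le> m ==> 0 \<le> l j i" "\<And>j. j \<le> m ==> (\<Sum>i\<le>m. l j i) = 1"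
  "\<And>j k. j \<le> m ==> k < m ==> z j k = (\<Sum>i\<le>m. l j i * v i k)" by blast
 define A where "A = Matrix.mat (Suc m) (Suc m) (\<lambda>(j, i). l j i)"
 have A: "A \<in> carrier_mat (Suc m) (Suc m)" by (simp add: A_def)
 have sp: "(\<Sum>i = 0..<Suc m. f i) = (\<Sum>i\<le>m. f i)" for f :: "nat => real"
  by (simp add: atLeast0LessThan lessThan_Suc_atMost)
 have 1: "simplex_mat m z = A * simplex_mat m v"
 proof (rule eq_matI)
  fix i j assume "i < dim_row (A * simplex_mat m v)" "j < dim_col (A * simplex_mat m v)"
  then have ij: "i \<le> m" "j \<le> m" by (auto simp: A_def simplex_mat_def)
  then have "(A * simplex_mat m v) $$ (i, j) = (\<Sum>t\<le>m. l i t * (if j = 0 then 1 else v t (j - 1)))"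
   by (simp add: A_def simplex_mat_def scalar_prod_def sp del: sum.op_ivl_Suc)
  also have "\<dots> = (if j = 0 then 1 else z i (j - 1))" using l ij by auto
  finally show "simplex_mat m z $$ (i, j) = (A * simplex_mat m v) $$ (i, j)"
   using ij by (simp add: simplex_mat_def)
 qed (auto simp: A_def simplex_mat_def)
 have "l j i \<le> 1" if "j \<le> m" "i \<le> m" for i j
  using member_le_sum[of i "{..m}" "l j"] l that by auto
 then have dA: "\<bar>Determinant.det A\<bar> \<le> fact (Suc m)"
  using l(1) by (intro det_stochastic_bound[OF A]) (auto simp: A_def)
 \<comment> \<open>Subtraction of the first row from all others, written as a factorisation:
   \<open>Lo\<close> undoes the subtraction and \<open>Up\<close> is what remains.\<close>
 define Lo :: "real Matrix.mat" where "Lo = Matrix.mat (Suc m) (Suc m) (\<lambda>(i, j). if j = 0 \<or> i = j then 1 else 0)"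
 define Up :: "real Matrix.mat" where "Up = Matrix.mat (Suc m) (Suc m)
   (\<lambda>(i, j). if i = 0 then (if j = 0 then 1 else y (j - 1)) else if i = j then \<rho> else 0)"
 have LU: "Lo \<in> carrier_mat (Suc m) (Suc m)" "Up \<in> carrier_mat (Suc m) (Suc m)" by (auto simp: Lo_def Up_def)
 have 2: "simplex_mat m z = Lo * Up"
 proof (rule eq_matI)
  fix i j assume "i < dim_row (Lo * Up)" "j < dim_col (Lo * Up)"
  then have ij: "i \<le> m" "j \<le> m" by (auto simp: Lo_def Up_def)
  then have "(Lo * Up) $$ (i, j) = (\<Sum>t\<le>m. (if t = 0 \<or> i = t then 1 else 0) * Up $$ (t, j))"
   by (simp add: Lo_def scalar_prod_def sp Up_def del: sum.op_ivl_Suc)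
  also have "\<dots> = (\<Sum>t\<in>{0, i}. Up $$ (t, j))"
   using ij by (intro sum.mono_neutral_cong_right) auto
  also have "\<dots> = (if j = 0 then 1 else z i (j - 1))" using ij by (auto simp: Up_def z_def)
  finally show "simplex_mat m z $$ (i, j) = (Lo * Up) $$ (i, j)" using ij by (simp add: simplex_mat_def)
 qed (auto simp: Lo_def Up_def simplex_mat_def)
 have "Determinant.det Lo = 1"
  by (subst det_lower_triangular[OF _ LU(1)]) (auto simp: Lo_def prod_list_diag_prod)
 moreover have "Determinant.det Up = \<rho> ^ m"
 proof (subst det_upper_triangular[OF _ LU(2)])
  show "upper_triangular Up" by (auto simp: Up_def upper_triangular_def)
  have "prod_list (diag_mat Up) = (\<Prod>i = 0..<Suc m. if i = 0 then 1 else \<rho>)"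
   unfolding prod_list_diag_prod by (intro prod.cong) (auto simp: Up_def)
  also have "\<dots> = \<rho> ^ m" by (subst prod.atLeast0_lessThan_Suc_shift) simp
  finally show "prod_list (diag_mat Up) = \<rho> ^ m" .
 qed
 ultimately have "Determinant.det (simplex_mat m z) = \<rho> ^ m" unfolding 2 by (simp add: det_mult[OF LU])
 then have "\<rho> ^ m = \<bar>Determinant.det A\<bar> * simplex_vol m v"
  unfolding 1 using \<rho> by (simp add: det_mult[OF A simplex_mat_carrier] simplex_vol_def abs_mult[symmetric])
 also have "\<dots> \<le> fact (Suc m) * simplex_vol m v"
  using dA by (intro mult_right_mono) (auto simp: simplex_vol_def)
 finally show ?thesis .
qed

lemma simplex_vol_corner:
 assumes "\<And>k. k < m ==> v 0 k = 0" "\<And>i k. i < m ==> k < m ==> v (Suc i) k = (if i = k then c else 0)"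
 shows "simplex_vol m v = \<bar>c\<bar> ^ m"
proof -
 have "Determinant.det (simplex_mat m v) = prod_list (diag_mat (simplex_mat m v))"
 proof (rule det_lower_triangular[OF _ simplex_mat_carrier])
  fix i j assume "i < j" "j < Suc m"
  then show "simplex_mat m v $$ (i, j) = 0"
   using assms(1)[of "j - 1"] assms(2)[of "i - 1" "j - 1"] by (cases i) (auto simp: simplex_mat_def)
 qed
 also have "\<dots> = (\<Prod>i = 0..<Suc m. if i = 0 then 1 else c)"
  unfolding prod_list_diag_prod
 proof (intro prod.cong)
  fix i assume "i \<in> {0..<Suc m}"
  then show "simplex_mat m v $$ (i, i) = (if i = 0 then 1 else c)"
   using assms(2)[of "i - 1" "i - 1"] by (cases i) (auto simp: simplex_mat_def)
 qed (simp add: simplex_mat_def)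
 also have "\<dots> = c ^ m" by (subst prod.atLeast0_lessThan_Suc_shift) simp
 finally show ?thesis by (simp add: simplex_vol_def power_abs)
qed

lemma in_simplex_corner:
 assumes "\<And>k. k < m ==> v 0 k = 0" "\<And>i k. i < m ==> k < m ==> v (Suc i) k = (if i = k then c else 0)"
  and "c > 0" "\<And>k. k < m ==> 0 \<le> y k" "(\<Sum>k<m. y k) \<le> c"
 shows "in_simplex m v y"
proof -
 define l where "l i = (case i of 0 => 1 - (\<Sum>k<m. y k) / c | Suc k => y k / c)" for i
 have sp: "(\<Sum>i\<le>m. f i) = f 0 + (\<Sum>i<m. f (Suc i))" for f :: "nat => real"
  by (rule sum.atMost_shift)
 show ?thesis unfolding in_simplex_def
 proof (intro exI[of _ l] conjI allI impI)
  fix i assume "i \<le> m" then show "0 \<le> l i" using assms(3-5) by (auto simp: l_def split: nat.split)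
 next
  show "(\<Sum>i\<le>m. l i) = 1" by (simp add: sp l_def sum_divide_distrib)
 next
  fix k assume k: "k < m"
  have "(\<Sum>i<m. l (Suc i) * v (Suc i) k) = (\<Sum>i<m. if i = k then y k else 0)"
   using assms(2,3) k by (intro sum.cong) (auto simp: l_def)
  then show "y k = (\<Sum>i\<le>m. l i * v i k)" using k assms(1) by (simp add: sp)
 qed
qed

section \<open>Redistributing probability mass\<close>

definition light_mass :: "'a set => real => ('a => real) => real" where
 "light_mass S r q = (\<Sum>A\<in>S. min (q A) r)"

text \<open>A shift records the mass added to each scenario and forgets the mass removed elsewhere.
  Counting the mean under the centre in full besides it is what costs the factor 2.\<close>

definition shifts :: "'a set => real => real => ('a => real) set" where
 "shifts S r M = {s. (\<forall>A\<in>S. 0 \<le> s A \<and> s A \<le> r) \<and> (\<Sum>A\<in>S. s A) \<le> M}"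

definition shift_gain :: "'a set => real => real => ('a => real) => real" where
 "shift_gain S r M g = (SUP s\<in>shifts S r M. \<Sum>A\<in>S. s A * g A)"

text \<open>Either some scenario alone contributes \<open>r\<close>, or nothing is truncated and the
  whole mass 1 remains.\<close>

lemma light_mass_ge:
 assumes "finite S" "\<And>A. A \<in> S ==> 0 \<le> q A" "(\<Sum>A\<in>S. q A) = 1" "0 \<le> r" "r \<le> 1"
 shows "r \<le> light_mass S r q"
proof (cases "\<exists>A\<in>S. q A \<ge> r")
 case True
 then obtain A where A: "A \<in> S" "q A \<ge> r" by blast
 have "min (q A) r \<le> light_mass S r q" unfolding light_mass_def
  using assms A by (intro member_le_sum) auto
 then show ?thesis using A by simp
next
 case False
 then have "light_mass S r q = (\<Sum>A\<in>S. q A)" unfolding light_mass_def by (intro sum.cong) auto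
 then show ?thesis using assms by simp
qed

lemma light_mass_le_card: "light_mass S r q \<le> r * real (card S)"
 using sum_bounded_above[of S "\<lambda>A. min (q A) r" r] by (simp add: light_mass_def mult.commute)

lemma light_mass_le_1: "(\<Sum>A\<in>S. q A) = 1 ==> light_mass S r q \<le> 1"
 using sum_mono[of S "\<lambda>A. min (q A) r" q] by (simp add: light_mass_def)

text \<open>The bound is independent of the number of scenarios: the light mass is 1 minus the
  excess over \<open>r\<close>, and an excess occurs at no more than \<open>1 / r\<close> scenarios
  for each of the two distributions.\<close>

lemma light_mass_diff:
 assumes "finite S" "0 < r"
  and "\<And>A. A \<in> S ==> 0 \<le> q A" "(\<Sum>A\<in>S. q A) = 1"
  and "\<And>A. A \<in> S ==> 0 \<le> q' A" "(\<Sum>A\<in>S. q' A) = 1"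
  and d: "\<And>A. A \<in> S ==> \<bar>q A - q' A\<bar> \<le> \<eta>"
 shows "\<bar>light_mass S r q - light_mass S r q'\<bar> \<le> 2 * \<eta> / r"
proof -
 let ?H = "\<lambda>q. {A\<in>S. q A > r}"
 have heavy: "real (card (?H q)) \<le> 1 / r" if "\<And>A. A \<in> S ==> 0 \<le> q A" "(\<Sum>A\<in>S. q A) = 1" for q
 proof -
  have "real (card (?H q)) * r \<le> (\<Sum>A\<in>?H q. q A)"
   using sum_bounded_below[of "?H q" r q] by (simp add: less_imp_le)
  also have "\<dots> \<le> (\<Sum>A\<in>S. q A)" using assms(1) that by (intro sum_mono2) auto
  finally show ?thesis using that assms(2) by (simp add: field_simps)
 qed
 have eq: "light_mass S r q = 1 - (\<Sum>A\<in>S. max 0 (q A - r))" if "(\<Sum>A\<in>S. q A) = 1" for q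
 proof -
  have "light_mass S r q = (\<Sum>A\<in>S. q A - max 0 (q A - r))"
   unfolding light_mass_def by (intro sum.cong) auto
  then show ?thesis using that by (simp add: sum_subtractf)
 qed
 let ?D = "?H q \<union> ?H q'"
 have fin: "finite ?D" using assms(1) by auto
 have "\<bar>light_mass S r q - light_mass S r q'\<bar> = \<bar>\<Sum>A\<in>S. max 0 (q A - r) - max 0 (q' A - r)\<bar>"
  using eq[OF assms(4)] eq[OF assms(6)] by (simp add: sum_subtractf)
 also have "(\<Sum>A\<in>S. max 0 (q A - r) - max 0 (q' A - r)) = (\<Sum>A\<in>?D. max 0 (q A - r) - max 0 (q' A - r))"
  using assms(1) by (intro sum.mono_neutral_right) auto
 also have "\<bar>\<dots>\<bar> \<le> (\<Sum>A\<in>?D. \<bar>max 0 (q A - r) - max 0 (q' A - r)\<bar>)" by (rule sum_abs)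
 also have "\<dots> \<le> (\<Sum>A\<in>?D. \<eta>)"
 proof (rule sum_mono)
  fix A assume "A \<in> ?D"
  then have "\<bar>q A - q' A\<bar> \<le> \<eta>" using d by auto
  then show "\<bar>max 0 (q A - r) - max 0 (q' A - r)\<bar> \<le> \<eta>" by linarith
 qed
 also have "\<dots> = real (card ?D) * \<eta>" by simp
 also have "\<dots> \<le> (2 / r) * \<eta>"
 proof -
  have "S \<noteq> {}" using assms(4) by auto
  then obtain A where "A \<in> S" by blast
  then have "0 \<le> \<eta>" using d[of A] by linarith
  moreover have "real (card ?D) \<le> 2 / r"
   using card_Un_le[of "?H q" "?H q'"] heavy[OF assms(3,4)] heavy[OF assms(5,6)] by simp
  ultimately show ?thesis by (rule mult_right_mono[rotated])
 qed
 finally show ?thesis by simp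
qed

context
 fixes S :: "'a set" and r :: real and g :: "'a => real" and U :: 'a
 assumes fin: "finite S" and r: "0 < r" and U: "U \<in> S"
  and g0: "\<And>A. A \<in> S ==> 0 \<le> g A" and gU: "\<And>A. A \<in> S ==> g A \<le> g U"
begin

lemma shift_value_le:
 assumes "s \<in> shifts S r M" shows "(\<Sum>A\<in>S. s A * g A) \<le> M * g U"
proof -
 have "(\<Sum>A\<in>S. s A * g A) \<le> (\<Sum>A\<in>S. s A * g U)"
  using assms gU by (intro sum_mono mult_left_mono) (auto simp: shifts_def)
 also have "\<dots> = (\<Sum>A\<in>S. s A) * g U" by (simp add: sum_distrib_right)
 also have "\<dots> \<le> M * g U" using assms g0[OF U] by (intro mult_right_mono) (auto simp: shifts_def)
 finally show ?thesis .
qed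

lemma shift_bdd: "bdd_above ((\<lambda>s. \<Sum>A\<in>S. s A * g A) ` shifts S r M)"
 using shift_value_le by (intro bdd_aboveI2)

lemma shift_gain_ge: "s \<in> shifts S r M ==> (\<Sum>A\<in>S. s A * g A) \<le> shift_gain S r M g"
 unfolding shift_gain_def by (rule cSUP_upper[OF _ shift_bdd])

lemma shifts_nonempty: "0 \<le> M ==> (\<lambda>_. 0) \<in> shifts S r M"
 using r by (auto simp: shifts_def)

lemma shift_gain_least:
 assumes "0 \<le> M" "\<And>s. s \<in> shifts S r M ==> (\<Sum>A\<in>S. s A * g A) \<le> b"
 shows "shift_gain S r M g \<le> b"
 unfolding shift_gain_def using shifts_nonempty[OF assms(1)] assms(2) by (intro cSUP_least) auto

lemma shift_gain_le: "0 \<le> M ==> shift_gain S r M g \<le> M * g U"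
 by (rule shift_gain_least) (auto intro: shift_value_le)

lemma shift_gain_top: "r \<le> M ==> r * g U \<le> shift_gain S r M g"
 using shift_gain_ge[of "\<lambda>A. if A = U then r else 0" M] r fin U
 by (auto simp: shifts_def if_distrib[of "\<lambda>x. x * _"] cong: if_cong)

text \<open>Dividing a shift by \<open>c\<close> keeps it within the limit \<open>r\<close> and
  brings its total down to \<open>M\<close>. A relative error in \<open>M\<close> thus causes no
  larger relative error in the gain.\<close>

lemma shift_gain_scale:
 assumes "0 \<le> M'" "M' \<le> c * M" "1 \<le> c"
 shows "shift_gain S r M' g \<le> c * shift_gain S r M g"
proof (rule shift_gain_least[OF assms(1)])
 fix s assume s: "s \<in> shifts S r M'"
 have "s A / c \<le> r" if "A \<in> S" for A
 proof -
  have "s A \<le> r * 1" "r * 1 \<le> r * c" using s that assms(3) r by (auto simp: shifts_def)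
  then have "s A \<le> r * c" by linarith
  then show ?thesis using assms(3) by (simp add: field_simps)
 qed
 then have "(\<lambda>A. s A / c) \<in> shifts S r M"
  using s assms by (auto simp: shifts_def field_simps simp flip: sum_divide_distrib)
 from shift_gain_ge[OF this] have "(\<Sum>A\<in>S. s A * g A) / c \<le> shift_gain S r M g"
  by (simp add: sum_divide_distrib)
 then show "(\<Sum>A\<in>S. s A * g A) \<le> c * shift_gain S r M g" using assms(3) by (simp add: field_simps)
qed

text \<open>The positive part of \<open>q - p\<close> is a shift. Its total equals that of the
  negative part, which at each scenario is at most both \<open>p\<close> and
  \<open>r\<close>.\<close>

lemma redistribute_upper:
 fixes p q :: "'a pmf"
 assumes p: "set_pmf p \<subseteq> S" and q: "set_pmf q \<subseteq> S" and d: "\<And>A. A \<in> S ==> \<bar>pmf p A - pmf q A\<bar> \<le> r"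
 shows "measure_pmf.expectation q g \<le> measure_pmf.expectation p g + shift_gain S r (light_mass S r (pmf p)) g"
proof -
 have e: "measure_pmf.expectation p g = (\<Sum>A\<in>S. pmf p A * g A)" if "set_pmf p \<subseteq> S" for p
  using that by (subst integral_measure_pmf_real[OF fin]) (auto simp: mult.commute)
 have one: "(\<Sum>A\<in>S. pmf p A) = 1" if "set_pmf p \<subseteq> S" for p using that fin by (rule sum_pmf_eq_1[rotated])
 let ?s = "\<lambda>A. max 0 (pmf q A - pmf p A)"
 have "(\<Sum>A\<in>S. ?s A) = (\<Sum>A\<in>S. max 0 (pmf p A - pmf q A) + (pmf q A - pmf p A))"
  by (intro sum.cong) auto
 also have "\<dots> = (\<Sum>A\<in>S. max 0 (pmf p A - pmf q A))"
  using one[OF p] one[OF q] by (simp add: sum.distrib sum_subtractf)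
 also have "\<dots> \<le> light_mass S r (pmf p)" unfolding light_mass_def
 proof (rule sum_mono)
  fix A assume "A \<in> S"
  then have "\<bar>pmf p A - pmf q A\<bar> \<le> r" "0 \<le> pmf q A" "0 \<le> pmf p A" using d by auto
  then show "max 0 (pmf p A - pmf q A) \<le> min (pmf p A) r" by linarith
 qed
 finally have sum: "(\<Sum>A\<in>S. ?s A) \<le> light_mass S r (pmf p)" .
 have "?s A \<le> r" if "A \<in> S" for A using d[OF that] r by linarith
 with sum have "?s \<in> shifts S r (light_mass S r (pmf p))" by (simp add: shifts_def)
 from shift_gain_ge[OF this]
 have "(\<Sum>A\<in>S. ?s A * g A) \<le> shift_gain S r (light_mass S r (pmf p)) g" .
 moreover have "(\<Sum>A\<in>S. pmf q A * g A) \<le> (\<Sum>A\<in>S. pmf p A * g A + ?s A * g A)"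
  unfolding distrib_right[symmetric] using g0 by (intro sum_mono mult_right_mono) auto
 ultimately show ?thesis using e[OF p] e[OF q] by (simp add: sum.distrib)
qed

text \<open>The total \<sigma> of the shift is taken away in proportion to
  \<open>min (pmf p A) r\<close>, the largest amount removable at each scenario. Amounts removed and
  added both lie between 0 and \<open>r\<close>, so their difference respects the radius; what is
  left of \<open>p\<close> is nonnegative, so \<open>q\<close> dominates \<open>s\<close>.\<close>

lemma redistribute_lower:
 fixes p :: "'a pmf"
 assumes p: "set_pmf p \<subseteq> S" and s: "s \<in> shifts S r (light_mass S r (pmf p))" and r1: "r \<le> 1"
 shows "\<exists>q. set_pmf q \<subseteq> S \<and> (\<forall>A\<in>S. \<bar>pmf p A - pmf q A\<bar> \<le> r) \<and>
  (\<Sum>A\<in>S. s A * g A) \<le> measure_pmf.expectation q g"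
proof -
 define M where "M = light_mass S r (pmf p)"
 have one: "(\<Sum>A\<in>S. pmf p A) = 1" using p fin by (rule sum_pmf_eq_1[rotated])
 have M: "r \<le> M" unfolding M_def using light_mass_ge[OF fin _ one] r r1 by simp
 define \<sigma> where "\<sigma> = (\<Sum>A\<in>S. s A)"
 have s': "0 \<le> s A" "s A \<le> r" if "A \<in> S" for A using s that by (auto simp: shifts_def)
 have \<sigma>: "0 \<le> \<sigma>" "\<sigma> \<le> M" using s s' by (auto simp: shifts_def \<sigma>_def M_def intro: sum_nonneg)
 have q1: "0 \<le> \<sigma> / M" "\<sigma> / M \<le> 1" using \<sigma> M r by auto
 define f where "f A = (if A \<in> S then pmf p A - min (pmf p A) r * (\<sigma> / M) + s A else 0)" for A
 have t: "0 \<le> min (pmf p A) r * (\<sigma> / M)" "min (pmf p A) r * (\<sigma> / M) \<le> min (pmf p A) r" for A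
  using mult_left_mono[OF q1(2), of "min (pmf p A) r"] mult_nonneg_nonneg[OF _ q1(1), of "min (pmf p A) r"] r
  by (auto simp del: times_divide_eq_right)
 have t': "min (pmf p A) r * (\<sigma> / M) \<le> pmf p A" "min (pmf p A) r * (\<sigma> / M) \<le> r" for A
  using t(2)[of A] by linarith+
 have f0: "0 \<le> f A" for A using t'(1)[of A] s' by (auto simp: f_def)
 have "(\<Sum>A\<in>S. f A) = (\<Sum>A\<in>S. pmf p A) - (\<Sum>A\<in>S. min (pmf p A) r) * (\<sigma> / M) + (\<Sum>A\<in>S. s A)"
  by (simp add: f_def sum.distrib sum_subtractf sum_distrib_right sum_divide_distrib)
 also have "\<dots> = 1" using one M r by (simp add: \<sigma>_def M_def light_mass_def)
 finally have f1: "(\<Sum>A\<in>S. f A) = 1" .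
 have "(\<integral>\<^sup>+A. ennreal (f A) \<partial>count_space UNIV) = (\<Sum>A\<in>S. ennreal (f A))"
  using fin by (intro nn_integral_count_space') (auto simp: f_def)
 also have "\<dots> = 1" using f0 f1 by (simp add: sum_ennreal)
 finally have nn: "(\<integral>\<^sup>+A. ennreal (f A) \<partial>count_space UNIV) = 1" .
 define q where "q = embed_pmf f"
 have q: "pmf q A = f A" for A unfolding q_def by (rule pmf_embed_pmf[OF f0 nn])
 have qS: "set_pmf q \<subseteq> S" by (auto simp: set_pmf_iff q f_def split: if_splits)
 have "(\<Sum>A\<in>S. s A * g A) \<le> (\<Sum>A\<in>S. g A * pmf q A)"
 proof (rule sum_mono)
  fix A assume A: "A \<in> S"
  then have "s A \<le> pmf q A" using t'(1)[of A] by (simp add: q f_def)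
  then show "s A * g A \<le> g A * pmf q A" using g0[OF A] by (simp add: mult.commute mult_left_mono)
 qed
 also have "\<dots> = measure_pmf.expectation q g"
  using qS by (subst integral_measure_pmf_real[OF fin]) auto
 finally have "(\<Sum>A\<in>S. s A * g A) \<le> measure_pmf.expectation q g" .
 moreover have "\<bar>pmf p A - pmf q A\<bar> \<le> r" if A: "A \<in> S" for A
 proof -
  have "pmf q A = pmf p A - min (pmf p A) r * (\<sigma> / M) + s A" using A by (simp add: q f_def)
  then show ?thesis using s'[OF A] t(1)[of A] t'(2)[of A] by linarith
 qed
 ultimately show ?thesis using qS by blast
qed

end

text \<open>The scenarios that receive additional mass are the most expensive ones, filled one after
 the other up to the limit \<open>r\<close>.\<close>

definition top_seq :: "'a set => ('a => 'b::linorder) => nat => (nat => 'a) => bool" where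
 "top_seq S g K cs \<longleftrightarrow> (\<forall>k<K. cs k \<in> S \<and> (\<not> S \<subseteq> cs ` {..<k} -->
   cs k \<notin> cs ` {..<k} \<and> (\<forall>A\<in>S. A \<notin> cs ` {..<k} --> g A \<le> g (cs k))))"

text \<open>Polymorphic because the machine fills with rationals and the analysis with
  reals.\<close>

definition fill :: "'b::linordered_field => 'b => nat => 'b" where
 "fill r M k = max 0 (min r (M - of_nat k * r))"

lemma sum_fill: "0 \<le> M ==> 0 \<le> r ==> (\<Sum>j<n. fill r M j) = min M (real n * r)"
proof (induction n)
 case (Suc n)
 then have "(\<Sum>j<Suc n. fill r M j) = min M (real n * r) + fill r M n" by simp
 also have "\<dots> = min M (real n * r + r)" using Suc.prems by (auto simp: fill_def min_def max_def)
 finally show ?case by (simp add: algebra_simps)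
qed simp

text \<open>While fewer than \<open>card S\<close> scenarios are chosen, some scenario is still
  free, and \<open>top_seq\<close> then demands a new one.\<close>

lemma top_seq_inj:
 assumes "top_seq S g K cs" "finite S" "n \<le> K" "n \<le> card S"
 shows "inj_on cs {..<n}"
proof -
 have ne: "cs j \<noteq> cs k" if "j < k" "k < n" for j k
 proof -
  have "card (cs ` {..<k}) < card S" using card_image_le[of "{..<k}" cs] that assms(4) by simp
  then have "\<not> S \<subseteq> cs ` {..<k}" using card_mono[of "cs ` {..<k}" S] by force
  then have "cs k \<notin> cs ` {..<k}" using assms(1,3) that by (auto simp: top_seq_def)
  then show ?thesis using that(1) by (metis imageI lessThan_iff)
 qed
 then show ?thesis unfolding inj_on_def by (metis lessThan_iff nat_neq_iff)
qed

lemma fill_zero: "0 \<le> r ==> M \<le> of_nat k * r ==> fill r M k = 0"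
 by (simp add: fill_def)

context
 fixes S :: "'a set" and r M :: real and cs :: "nat => 'a" and K :: nat
 assumes fin: "finite S" and r: "0 < r" and M: "0 < M" "M \<le> r * real (card S)" "M \<le> r * real K"
begin

text \<open>The position at which the mass runs out: it receives what is left over, all earlier ones
  receive \<open>r\<close>, all later ones nothing.\<close>

definition "last_fill = (LEAST k. M \<le> real (Suc k) * r)"

lemma last_fill:
 "M \<le> real (Suc last_fill) * r" "\<And>j. j < last_fill ==> real (Suc j) * r < M"
 "last_fill < K" "last_fill < card S"
proof -
 have K: "K > 0" "card S > 0" using M r by (auto intro!: Nat.gr0I)
 have ex: "M \<le> real (Suc (K - 1)) * r" "M \<le> real (Suc (card S - 1)) * r"
  using K M by (auto simp: mult.commute)
 show "M \<le> real (Suc last_fill) * r" unfolding last_fill_def by (rule LeastI[of "\<lambda>k. M \<le> real (Suc k) * r", OF ex(1)])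
 show "real (Suc j) * r < M" if "j < last_fill" for j
  using not_less_Least[OF that[unfolded last_fill_def]] by auto
 show "last_fill < K" "last_fill < card S"
  using Least_le[of "\<lambda>k. M \<le> real (Suc k) * r", OF ex(1)] Least_le[of "\<lambda>k. M \<le> real (Suc k) * r", OF ex(2)] K
  unfolding last_fill_def by linarith+
qed

lemma sum_last_fill: "(\<Sum>k<K. fill r M k * f k) = (\<Sum>k\<le>last_fill. fill r M k * f k)"
proof -
 have "(\<Sum>k\<le>last_fill. fill r M k * f k) = (\<Sum>k<K. fill r M k * f k)"
 proof (rule sum.mono_neutral_left)
  show "\<forall>i\<in>{..<K} - {..last_fill}. fill r M i * f i = 0"
  proof
   fix i assume "i \<in> {..<K} - {..last_fill}"
   then have "real (Suc last_fill) * r \<le> real i * r" using r by (intro mult_right_mono) auto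
   then have "M \<le> real i * r" using last_fill(1) by linarith
   then show "fill r M i * f i = 0" using r fill_zero[of r M i] by simp
  qed
 qed (use last_fill(3) in auto)
 then show ?thesis by simp
qed

text \<open>One shift reproduces the greedy sum for every cost function, not only for the
  \<open>g\<close> that determined the order. That makes the weights chosen at one point a lower
  bound for the gain at all other points, and hence yields subgradients.\<close>

lemma greedy_in_shifts:
 assumes cs: "top_seq S g K cs"
 shows "\<exists>s\<in>shifts S r M. \<forall>g'. (\<Sum>A\<in>S. s A * g' A) = (\<Sum>k<K. fill r M k * g' (cs k))"
proof -
 let ?n = "last_fill"
 have inj: "inj_on cs {..?n}" using top_seq_inj[OF cs fin, of "Suc ?n"] last_fill by (simp add: lessThan_Suc_atMost)
 have sub: "cs ` {..?n} \<subseteq> S" using cs last_fill(3) by (auto simp: top_seq_def)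
 define s where "s A = (if A \<in> cs ` {..?n} then fill r M (the_inv_into {..?n} cs A) else 0)" for A
 have eq: "(\<Sum>A\<in>S. s A * g' A) = (\<Sum>k<K. fill r M k * g' (cs k))" for g'
 proof -
  have "(\<Sum>A\<in>S. s A * g' A) = (\<Sum>A\<in>cs ` {..?n}. s A * g' A)"
   using fin sub by (intro sum.mono_neutral_right) (auto simp: s_def)
  also have "\<dots> = (\<Sum>k\<le>?n. fill r M k * g' (cs k))"
   by (subst sum.reindex[OF inj]) (auto intro!: sum.cong simp: s_def the_inv_into_f_f[OF inj])
  finally show ?thesis by (simp add: sum_last_fill)
 qed
 have "(\<Sum>A\<in>S. s A) = (\<Sum>k<K. fill r M k)" using eq[of "\<lambda>_. 1"] by simp
 also have "\<dots> \<le> M" using sum_fill[of M r K] r M by simp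
 finally have "s \<in> shifts S r M" using r by (auto simp: shifts_def s_def fill_def)
 then show ?thesis using eq by blast
qed

text \<open>An exchange argument with the threshold \<gamma>, the cost of the last scenario filled.
  Chosen scenarios cost at least \<gamma> and, except for the last, are filled to \<open>r\<close>;
  all others cost at most \<gamma>. After subtracting \<gamma> throughout, the terms compare one by
  one.\<close>

lemma greedy_optimal:
 assumes cs: "top_seq S g K cs" and g0: "\<And>A. A \<in> S ==> 0 \<le> g A" and s: "s \<in> shifts S r M"
 shows "(\<Sum>A\<in>S. s A * g A) \<le> (\<Sum>k<K. fill r M k * g (cs k))"
proof -
 let ?n = "last_fill"
 have inj: "inj_on cs {..?n}" using top_seq_inj[OF cs fin, of "Suc ?n"] last_fill by (simp add: lessThan_Suc_atMost)
 have sub: "cs ` {..?n} \<subseteq> S" using cs last_fill(3) by (auto simp: top_seq_def)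
 have fresh: "\<not> S \<subseteq> cs ` {..<k}" if "k \<le> ?n" for k
 proof -
  have "card (cs ` {..<k}) < card S" using card_image_le[of "{..<k}" cs] that last_fill(4) by simp
  then show ?thesis using card_mono[of "cs ` {..<k}" S] by force
 qed
 define \<gamma> where "\<gamma> = g (cs ?n)"
 have ge: "g (cs k) \<ge> \<gamma>" if "k \<le> ?n" for k
 proof -
  have "cs ?n \<in> S" "cs ?n \<notin> cs ` {..<k}" using sub inj_onD[OF inj, of ?n] that by fastforce+
  then show ?thesis using cs fresh[OF that] last_fill(3) that unfolding top_seq_def \<gamma>_def by auto
 qed
 have le: "g A \<le> \<gamma>" if "A \<in> S" "A \<notin> cs ` {..?n}" for A
 proof -
  have "A \<notin> cs ` {..<?n}" using that by auto
  then show ?thesis using cs fresh[of ?n] last_fill(3) that unfolding top_seq_def \<gamma>_def by auto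
 qed
 have \<gamma>0: "0 \<le> \<gamma>" using g0 sub by (auto simp: \<gamma>_def)
 have s': "0 \<le> s A" "s A \<le> r" if "A \<in> S" for A using s that by (auto simp: shifts_def)
 have sM: "(\<Sum>A\<in>S. s A) \<le> M" using s by (simp add: shifts_def)
 have "(\<Sum>A\<in>S. s A * g A) = (\<Sum>A\<in>S. s A * (g A - \<gamma>)) + (\<Sum>A\<in>S. s A) * \<gamma>"
  by (simp add: algebra_simps sum.distrib sum_subtractf sum_distrib_left)
 also have "\<dots> \<le> (\<Sum>A\<in>cs ` {..?n}. s A * (g A - \<gamma>)) + M * \<gamma>"
 proof (rule add_mono)
  have "(\<Sum>A\<in>S. s A * (g A - \<gamma>)) \<le> (\<Sum>A\<in>S. if A \<in> cs ` {..?n} then s A * (g A - \<gamma>) else 0)"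
   using le s' by (intro sum_mono) (auto intro!: mult_nonneg_nonpos)
  also have "\<dots> = (\<Sum>A\<in>cs ` {..?n}. s A * (g A - \<gamma>))"
   using fin sub by (subst sum.inter_restrict[symmetric]) (auto intro!: sum.cong)
  finally show "(\<Sum>A\<in>S. s A * (g A - \<gamma>)) \<le> (\<Sum>A\<in>cs ` {..?n}. s A * (g A - \<gamma>))" .
  show "(\<Sum>A\<in>S. s A) * \<gamma> \<le> M * \<gamma>" using sM \<gamma>0 by (rule mult_right_mono)
 qed
 also have "(\<Sum>A\<in>cs ` {..?n}. s A * (g A - \<gamma>)) = (\<Sum>k\<le>?n. s (cs k) * (g (cs k) - \<gamma>))"
  by (subst sum.reindex[OF inj]) simp
 also have "\<dots> \<le> (\<Sum>k\<le>?n. fill r M k * (g (cs k) - \<gamma>))"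
 proof (rule sum_mono)
  fix k assume k: "k \<in> {..?n}"
  show "s (cs k) * (g (cs k) - \<gamma>) \<le> fill r M k * (g (cs k) - \<gamma>)"
  proof (cases "k = ?n")
   case False
   then have "real (Suc k) * r < M" using k last_fill(2)[of k] by auto
   then have "fill r M k = r" using r by (simp add: fill_def algebra_simps)
   then show ?thesis using s'(2)[of "cs k"] ge[of k] sub k by (intro mult_right_mono) auto
  qed (simp add: \<gamma>_def)
 qed
 also have "\<dots> = (\<Sum>k\<le>?n. fill r M k * g (cs k)) - (\<Sum>k\<le>?n. fill r M k) * \<gamma>"
  by (simp add: algebra_simps sum_subtractf sum_distrib_left)
 also have "(\<Sum>k\<le>?n. fill r M k) = M"
  using sum_fill[of M r "Suc ?n"] r M last_fill(1) by (simp add: lessThan_Suc_atMost algebra_simps)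
 finally show ?thesis using sum_last_fill[of "\<lambda>k. g (cs k)"] by simp
qed

end

section \<open>The program\<close>

abbreviation (input) "pl \<equiv> Bi Plus"
abbreviation (input) "mi \<equiv> Bi Minus"
abbreviation (input) "ti \<equiv> Bi Times"
abbreviation (input) "di \<equiv> Bi Divide"
abbreviation (input) "eM \<equiv> Ix (Suc 0) (Kn 0)"
abbreviation (input) "eU \<equiv> Ix (Suc 0) (Kn 1)"
abbreviation (input) "eLam \<equiv> Ix (Suc 0) (Kn 2)"
abbreviation (input) "eR \<equiv> Ix (Suc 0) (Kn 3)"
abbreviation (input) "eOut \<equiv> Ix (Suc 0) (Kn 4)"
abbreviation (input) "eIn \<equiv> Ix (Suc 0) (Kn 5)"
abbreviation (input) "eE \<equiv> Ix (Suc 0) (Kn 6)"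
abbreviation (input) "eDel \<equiv> Ix (Suc 0) (Kn 7)"
abbreviation (input) "dbl a \<equiv> asg a (pl (Vr a) (Vr a))"
text \<open>\<open>Cond\<close> tests for positivity only; for integers
  \<open>1 - (e1 - e2)^2\<close> is positive exactly on equality.\<close>

abbreviation (input) "eqtest e1 e2 \<equiv> mi (Kn 1) (ti (mi e1 e2) (mi e1 e2))"

text \<open>A scenario is stored as the number with these binary digits; oracle calls read it from
 array 10, where \<open>decode_prog\<close> unpacks the digits.\<close>

definition decode_prog :: "nat => com" where
 "decode_prog a = Seq (asg 11 (Vr a))
   (floop 12 eU (Seq (put 10 (Vr 12) (mi (Vr 11) (ti (Kn 2) (Fl (di (Vr 11) (Kn 2))))))
            (asg 11 (Fl (di (Vr 11) (Kn 2))))))"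

definition encode_prog :: com where
 "encode_prog = Seq (asg 13 (Kn 0)) (Seq (asg 14 (Kn 1))
   (floop 12 eU (Seq (asg 13 (pl (Vr 13) (ti (Vr 14) (Ix 10 (Vr 12))))) (dbl 14))))"

text \<open>Register 15: code of the full ground set; 16: \<open>g(0, U)\<close>; 17: sum of the costs; 18: size of
 the initial simplex; 20: binary logarithm of the volume ratio; 21: rounding precision;
 22: number of cuts; 24: number of samples; 25: number of scenarios receiving extra mass.\<close>

definition setup_prog :: com where
 "setup_prog =
   Seq (asg 14 (Kn 1)) (Seq (floop 12 eU (dbl 14)) (Seq (asg 15 (mi (Vr 14) (Kn 1)))
  (Seq (decode_prog 15) (Seq (Value 16 2 10)
  (Seq (asg 17 (Kn 0)) (Seq (floop 12 eM (asg 17 (pl (Vr 17) (Ix 0 (Vr 12)))))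
  (Seq (asg 18 (ti eM (pl (Fl eOut) (Kn 1))))
  (Seq (asg 19 (di (ti (ti eE eLam) (pl (ti eOut (Vr 17)) (ti (Kn 2) (Vr 16)))) (ti eR (Vr 16))))
  (Seq (asg 19 (di (ti (ti (pl eM (Kn 1)) (Vr 18)) (Vr 19)) eIn))
  (Seq (asg 20 (Kn 0)) (Seq (asg 14 (Kn 1))
  (Seq (whl (mi (Vr 19) (Vr 14)) (Seq (dbl 14) (asg 20 (pl (Vr 20) (Kn 1)))))
  (Seq (asg 21 (ti (Kn 32) (ti eM (ti eM eM))))
  (Seq (asg 22 (pl (ti (Vr 21) (Vr 20)) (Kn 1)))
  (Seq (asg 23 (ti eM (pl (pl (ti (Vr 22) (pl (Kn 2) (Vr 21))) (Vr 20)) (pl eM (Kn 5)))))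
  (Seq (asg 24 (pl (Fl (ti (di (ti (Kn 16) (ti eE eE)) (ti (ti eR eR) (ti eR eR)))
               (pl (pl eU (Vr 23)) (pl (Kn 2) eDel)))) (Kn 1)))
     (asg 25 (pl (Fl (di (Kn 1) eR)) (Kn 1)))))))))))))))))))"

text \<open>The codes of the samples occupy the first cells of array 27; \<open>top_prog\<close>
  puts the greedily chosen scenarios behind them, so that a single loop in
  \<open>objective_prog\<close> treats both.\<close>

definition sample_prog :: com where
 "sample_prog = floop 26 (Vr 24) (Seq (Sample 10) (Seq encode_prog (put 27 (Vr 26) (Vr 13))))"

text \<open>A scenario that occurs \<open>n\<close> times in \<open>N\<close> samples should
  contribute \<open>min (n / N) r\<close>. Letting each occurrence contribute
  \<open>min (1 / N) (r / n)\<close> gives the same sum without a table of distinct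
  scenarios.\<close>

definition mass_prog :: com where
 "mass_prog = Seq (asg 28 (Kn 0)) (floop 29 (Vr 24)
   (Seq (asg 30 (Kn 0))
   (Seq (floop 31 (Vr 24) (ifp (eqtest (Ix 27 (Vr 31)) (Ix 27 (Vr 29))) (asg 30 (pl (Vr 30) (Kn 1))) skip))
     (ifp (mi (di (Kn 1) (Vr 24)) (di eR (Vr 30)))
       (asg 28 (pl (Vr 28) (di eR (Vr 30))))
       (asg 28 (pl (Vr 28) (di (Kn 1) (Vr 24))))))))"

text \<open>Vertices are stored row by row in array 33: the origin, then multiples of the unit
  vectors. Register 34 is the best value so far; \<open>2 * g(0, U)\<close> is valid for the point 0
  that array 2 contains initially.\<close>

definition init_prog :: com where
 "init_prog = Seq (floop 12 eM (put 33 (pl (ti (pl (Vr 12) (Kn 1)) eM) (Vr 12)) (Vr 18)))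
   (asg 34 (ti (Kn 2) (Vr 16)))"

definition centroid_prog :: com where
 "centroid_prog = floop 36 eM (Seq (asg 37 (Kn 0))
   (Seq (floop 38 (pl eM (Kn 1)) (asg 37 (pl (Vr 37) (Ix 33 (pl (ti (Vr 38) eM) (Vr 36))))))
     (put 39 (Vr 36) (di (Vr 37) (pl eM (Kn 1))))))"

definition fresh_prog :: com where
 "fresh_prog = Seq (asg 52 (Kn 1)) (floop 53 (pl (Vr 45) (Kn 1))
   (ifp (eqtest (Ix 27 (pl (Vr 24) (Vr 53))) (Vr 51)) (asg 52 (Kn 0)) skip))"

definition candidate_prog :: com where
 "candidate_prog = Seq (asg 51 (mi (Ix 27 (pl (Vr 24) (Vr 48))) (Vr 14)))
   (Seq fresh_prog (ifp (Vr 52)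
    (Seq (decode_prog 51) (Seq (Value 54 39 10)
      (ifp (mi (Vr 54) (Vr 47)) (Seq (asg 47 (Vr 54)) (asg 46 (Vr 51))) skip)))
    skip))"

text \<open>Dividing a code by the power of two in register 14 exposes the digit that tells whether
  there is an element to delete; the same power is what \<open>candidate_prog\<close> subtracts from
  the code.\<close>

definition next_prog :: com where
 "next_prog = floop 48 (pl (Vr 45) (Kn 1)) (Seq (asg 14 (Kn 1))
   (floop 49 eU
    (Seq (asg 50 (Fl (di (Ix 27 (pl (Vr 24) (Vr 48))) (Vr 14))))
    (Seq (ifp (mi (Vr 50) (ti (Kn 2) (Fl (di (Vr 50) (Kn 2))))) candidate_prog skip)
      (dbl 14)))))"

text \<open>The start value -1 is below every cost, so the first fresh candidate always wins; code 0
  is the default when there is none.\<close>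

definition top_prog :: com where
 "top_prog = Seq (put 27 (Vr 24) (Vr 15)) (floop 45 (mi (Vr 25) (Kn 1))
   (Seq (asg 46 (Kn 0)) (Seq (asg 47 (mi (Kn 0) (Kn 1)))
   (Seq next_prog (put 27 (pl (pl (Vr 24) (Vr 45)) (Kn 1)) (Vr 46))))))"

definition weight_prog :: com where
 "weight_prog = ifp (mi (Vr 24) (Vr 57)) (asg 46 (di (Kn 1) (Vr 24)))
   (Seq (ifp (mi eR (Vr 55)) (asg 46 (Vr 55)) (asg 46 eR)) (asg 55 (mi (Vr 55) (Vr 46))))"

definition objective_prog :: com where
 "objective_prog = Seq (asg 55 (Vr 28)) (Seq (asg 56 (Kn 0))
   (Seq (floop 36 eM (Seq (asg 56 (pl (Vr 56) (ti (Ix 0 (Vr 36)) (Ix 39 (Vr 36))))) (put 41 (Vr 36) (Ix 0 (Vr 36)))))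
   (floop 57 (pl (Vr 24) (Vr 25))
    (Seq (asg 58 (Ix 27 (Vr 57))) (Seq (decode_prog 58) (Seq (Value 54 39 10) (Seq (Subgrad 59 39 10)
    (Seq weight_prog
    (Seq (asg 56 (pl (Vr 56) (ti (Vr 46) (Vr 54))))
      (floop 36 eM (put 41 (Vr 36) (pl (Ix 41 (Vr 36)) (ti (Vr 46) (Ix 59 (Vr 36)))))))))))))))"

definition record_prog :: com where
 "record_prog = ifp (mi (Vr 34) (Vr 56))
   (Seq (asg 34 (Vr 56)) (floop 36 eM (put 2 (Vr 36) (Ix 39 (Vr 36))))) skip"

definition heights_prog :: com where
 "heights_prog = floop 36 (pl eM (Kn 1)) (Seq (asg 37 (Kn 0))
   (Seq (floop 38 eM (asg 37 (pl (Vr 37) (ti (Ix 41 (Vr 38))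
       (mi (Ix 33 (pl (ti (Vr 36) eM) (Vr 38))) (Ix 39 (Vr 38)))))))
     (put 42 (Vr 36) (Vr 37))))"

definition argmin_prog :: com where
 "argmin_prog = Seq (asg 43 (Kn 0)) (floop 36 (pl eM (Kn 1))
   (ifp (mi (Ix 42 (Vr 43)) (Ix 42 (Vr 36))) (asg 43 (Vr 36)) skip))"

text \<open>The exact factor \<open>1 / (1 + \<beta> / (8 m^2))\<close> is replaced by a larger
  multiple of \<open>1 / D\<close>. Rounding up, never down, keeps the remaining part inside the new
  simplex.\<close>

definition shrink_prog :: com where
 "shrink_prog = floop 36 (pl eM (Kn 1))
   (Seq (asg 44 (di (pl (Fl (di (Vr 21) (pl (Kn 1)
       (di (di (Ix 42 (Vr 36)) (mi (Kn 0) (Ix 42 (Vr 43)))) (ti (Kn 8) (ti eM eM)))))) (Kn 1)) (Vr 21)))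
     (floop 38 eM (put 33 (pl (ti (Vr 36) eM) (Vr 38))
       (pl (Ix 33 (pl (ti (Vr 43) eM) (Vr 38)))
         (ti (Vr 44) (mi (Ix 33 (pl (ti (Vr 36) eM) (Vr 38))) (Ix 33 (pl (ti (Vr 43) eM) (Vr 38)))))))))"

text \<open>Both kinds of cut leave their normal in array 41: a hyperplane from the separation
  oracle if the centroid is infeasible, a subgradient of the objective otherwise. The remaining
  steps do not distinguish them.\<close>

definition cut_prog :: com where
 "cut_prog = Seq centroid_prog (Seq (Separate 40 41 39)
   (Seq (ifp (Vr 40) skip (Seq top_prog (Seq objective_prog record_prog)))
   (Seq heights_prog (Seq argmin_prog shrink_prog))))"

definition optimize_prog :: com where
 "optimize_prog = Seq mass_prog (Seq init_prog (floop 35 (Vr 22) cut_prog))"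

definition main_prog :: com where
 "main_prog = Seq setup_prog (Seq sample_prog optimize_prog)"

lemma wr_decode [simp]: "b < 60 ==> b \<in> wr (decode_prog a) \<longleftrightarrow> b \<in> {10, 11, 12}"
 by (auto simp: decode_prog_def)

lemma wr_encode [simp]: "b < 60 ==> b \<in> wr encode_prog \<longleftrightarrow> b \<in> {12, 13, 14}"
 by (auto simp: encode_prog_def)

lemma wr_sample [simp]: "b < 60 ==> b \<in> wr sample_prog \<longleftrightarrow> b \<in> {10, 12, 13, 14, 26, 27}"
 by (auto simp: sample_prog_def)

lemma wr_mass [simp]: "b < 60 ==> b \<in> wr mass_prog \<longleftrightarrow> b \<in> {28, 29, 30, 31}"
 by (auto simp: mass_prog_def)

lemma wr_init [simp]: "b < 60 ==> b \<in> wr init_prog \<longleftrightarrow> b \<in> {12, 33, 34}"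
 by (auto simp: init_prog_def)

lemma wr_centroid [simp]: "b < 60 ==> b \<in> wr centroid_prog \<longleftrightarrow> b \<in> {36, 37, 38, 39}"
 by (auto simp: centroid_prog_def)

lemma wr_fresh [simp]: "b < 60 ==> b \<in> wr fresh_prog \<longleftrightarrow> b \<in> {52, 53}"
 by (auto simp: fresh_prog_def)

lemma wr_candidate [simp]: "b < 60 ==> b \<in> wr candidate_prog \<longleftrightarrow> b \<in> {10, 11, 12, 46, 47, 51, 52, 53, 54}"
 by (auto simp: candidate_prog_def)

lemma wr_next [simp]: "b < 60 ==> b \<in> wr next_prog \<longleftrightarrow> b \<in> {10, 11, 12, 14, 46, 47, 48, 49, 50, 51, 52, 53, 54}"
 by (auto simp: next_prog_def)

lemma wr_top [simp]: "b < 60 ==> b \<in> wr top_prog \<longleftrightarrow> b \<in> {10, 11, 12, 14, 27, 45, 46, 47, 48, 49, 50, 51, 52, 53, 54}"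
 by (auto simp: top_prog_def)

lemma wr_weight [simp]: "b < 60 ==> b \<in> wr weight_prog \<longleftrightarrow> b \<in> {46, 55}"
 by (auto simp: weight_prog_def)

lemma wr_objective [simp]: "b < 60 ==> b \<in> wr objective_prog \<longleftrightarrow> b \<in> {10, 11, 12, 36, 41, 46, 54, 55, 56, 57, 58, 59}"
 by (auto simp: objective_prog_def)

lemma wr_record [simp]: "b < 60 ==> b \<in> wr record_prog \<longleftrightarrow> b \<in> {2, 34, 36}"
 by (auto simp: record_prog_def)

lemma wr_heights [simp]: "b < 60 ==> b \<in> wr heights_prog \<longleftrightarrow> b \<in> {36, 37, 38, 42}"
 by (auto simp: heights_prog_def)

lemma wr_argmin [simp]: "b < 60 ==> b \<in> wr argmin_prog \<longleftrightarrow> b \<in> {36, 43}"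
 by (auto simp: argmin_prog_def)

lemma wr_shrink [simp]: "b < 60 ==> b \<in> wr shrink_prog \<longleftrightarrow> b \<in> {33, 36, 38, 44}"
 by (auto simp: shrink_prog_def)

lemma wr_cut [simp]: "b < 60 ==> b \<in> wr cut_prog \<longleftrightarrow>
  b \<in> {2, 10, 11, 12, 14, 27, 33, 34, 36, 37, 38, 39, 40, 41, 42, 43, 44, 45, 46, 47, 48, 49, 50, 51, 52, 53, 54,
   55, 56, 57, 58, 59}"
 by (auto simp: cut_prog_def)

lemma index_of_nat [simp]: "index_of (of_nat n) = n" "index_of 0 = 0" "index_of 1 = 1" "index_of (numeral w) = numeral w"
 by (simp_all add: index_of_def)

lemma index_of_nat_arith [simp]:
 "index_of (of_nat a + of_nat b) = a + b"
 "index_of (of_nat a * of_nat b + of_nat c) = a * b + c"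
 "index_of ((of_nat a + 1) * of_nat b + of_nat c) = Suc a * b + c"
 "index_of (of_nat a + of_nat b + 1) = Suc (a + b)"
proof -
 show "index_of (of_nat a + of_nat b) = a + b"
  using index_of_nat(1)[of "a + b"] by (simp only: of_nat_add)
 show "index_of (of_nat a * of_nat b + of_nat c) = a * b + c"
  using index_of_nat(1)[of "a * b + c"] by (simp only: of_nat_add of_nat_mult)
 have "(of_nat a + 1) * of_nat b + of_nat c = (of_nat (Suc a * b + c) :: rat)" by (simp add: algebra_simps)
 then show "index_of ((of_nat a + 1) * of_nat b + of_nat c) = Suc a * b + c" by (simp only: index_of_nat)
 have "of_nat a + of_nat b + 1 = (of_nat (Suc (a + b)) :: rat)" by simp
 then show "index_of (of_nat a + of_nat b + 1) = Suc (a + b)" by (simp only: index_of_nat)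
qed

lemma floor_half [simp]: "\<lfloor>(of_nat n :: rat) / 2\<rfloor> = int (n div 2)"
 using floor_divide_of_nat_eq[of n 2, where ?'a = rat] by simp

lemma rat_mod_2: "(of_nat n :: rat) - 2 * of_nat (n div 2) = of_nat (n mod 2)"
proof -
 have "(of_nat n :: rat) = of_nat (2 * (n div 2) + n mod 2)" by simp
 then show ?thesis by (simp only: of_nat_add of_nat_mult)
qed

lemma eq_test_nat: "(0::rat) < 1 - (of_nat a - of_nat b) * (of_nat a - of_nat b) \<longleftrightarrow> a = b"
proof
 assume *: "(0::rat) < 1 - (of_nat a - of_nat b) * (of_nat a - of_nat b)"
 show "a = b"
 proof (rule ccontr)
  assume "a \<noteq> b"
  then have "1 \<le> \<bar>int a - int b\<bar> * \<bar>int a - int b\<bar>" using mult_mono[of 1 "\<bar>int a - int b\<bar>" 1 "\<bar>int a - int b\<bar>"] by auto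
  then have "(1::int) \<le> (int a - int b) * (int a - int b)" by (simp add: abs_mult_self_eq)
  then have "(1::rat) \<le> of_int ((int a - int b) * (int a - int b))" by (simp only: of_int_1_le_iff)
  then show False using * by simp
 qed
qed simp

lemma eq_test_nat': "(of_nat a - of_nat b) * (of_nat a - of_nat b) < (1::rat) \<longleftrightarrow> a = b"
 using eq_test_nat[of a b] by simp

lemma rb_of_nat_le: assumes "rb b (of_nat n)" shows "n \<le> 2 ^ b"
proof -
 from assms obtain p q where *: "0 < q" "\<bar>p\<bar> \<le> 2 ^ b" "of_nat n = (of_int p / of_int q :: rat)"
  unfolding rb_def by blast
 then have "of_int (int n * q) = (of_int p :: rat)" by (simp add: field_simps)
 then have "int n * q = p" by (simp only: of_int_eq_iff)
 moreover have "int n * 1 \<le> int n * q" using *(1) by (intro mult_left_mono) auto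
 ultimately have "int n \<le> 2 ^ b" using *(2) by linarith
 then show ?thesis by (metis of_nat_le_iff of_nat_numeral of_nat_power)
qed

lemma set_encode_less: "X \<subseteq> {..<n} ==> set_encode X < 2 ^ n"
proof -
 assume "X \<subseteq> {..<n}"
 then have "(\<Sum>i\<in>X. 2 ^ i) \<le> (\<Sum>i<n. (2::nat) ^ i)" by (intro sum_mono2) auto
 also have "\<dots> < 2 ^ n" by (induction n) auto
 finally show ?thesis by (simp add: set_encode_def)
qed

lemma set_encode_lessThan: "set_encode {..<n} = 2 ^ n - 1"
 by (induction n) (auto simp: lessThan_Suc)

lemma set_encode_remove: "finite A ==> e \<in> A ==> set_encode (A - {e}) = set_encode A - 2 ^ e \<and> 2 ^ e \<le> set_encode A"
 using set_encode_insert[of "A - {e}" e] by (simp add: insert_absorb)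

lemma scenarios_finite: "A \<in> scenarios I ==> finite A"
 by (auto simp: scenarios_def ground_def intro: finite_subset)

lemma finite_scenarios: "finite (scenarios I)"
 by (simp add: scenarios_def ground_def)

lemma full_scenario: "{..<usize I} \<in> scenarios I"
 by (simp add: scenarios_def ground_def)

text \<open>\<open>E\<close> and \<Delta> stand for the accuracy and the confidence as rounded in
  the input; \<open>uB\<close> leaves a spare bit for the last doubling in loops over powers of
  two.\<close>

locale drso_machine = mach +
 fixes E \<Delta> :: nat
 assumes mZ: "mdim I + 1 \<le> Z" and mB: "mdim I + 1 \<le> 2 ^ B" and uZ: "usize I \<le> Z" and uB: "usize I + 1 \<le> B"
begin

definition params :: "memory => bool" where
 "params L \<longleftrightarrow> L 1 0 = of_nat (mdim I) \<and> L 1 1 = of_nat (usize I) \<and> L 1 2 = lam I \<and> L 1 3 = radius I \<and>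
   L 1 4 = outer_rad I \<and> L 1 5 = inner_rad I \<and> L 1 6 = of_nat E \<and> L 1 7 = of_nat \<Delta> \<and>
   (\<forall>k<mdim I. L 0 k = cost1 I $ k)"

lemma paramsD:
 assumes "params L"
 shows "L (Suc 0) 0 = of_nat (mdim I)" "L (Suc 0) (Suc 0) = of_nat (usize I)" "L (Suc 0) 2 = lam I" "L (Suc 0) 3 = radius I"
  "L (Suc 0) 4 = outer_rad I" "L (Suc 0) 5 = inner_rad I" "L (Suc 0) 6 = of_nat E" "L (Suc 0) 7 = of_nat \<Delta>"
  "k < mdim I ==> L 0 k = cost1 I $ k"
 using assms by (auto simp: params_def)

lemma params_cong: "params L ==> L' 0 = L 0 ==> L' (Suc 0) = L (Suc 0) ==> params L'"
 by (simp add: params_def)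

lemma params_set_cell [simp]: "a \<noteq> 0 ==> a \<noteq> Suc 0 ==> params (set_cell a i q L) = params L"
 by (simp add: params_def)

lemma cor_seq_asg:
 assumes "bd B L" "a < 60" "eok e" "rb B (ev e L)"
  "bd B (set_cell a 0 (ev e L) L) ==> cor c2 (set_cell a 0 (ev e L) L) Q"
 shows "cor (Seq (asg a e) c2) L Q"
 by (rule cor_seq[OF cor_asg[where Q = "\<lambda>L'. L' = set_cell a 0 (ev e L) L"]])
   (use assms in auto)

lemma cor_seq_put:
 assumes "bd B L" "a < 60" "eok i" "eok e" "rb B (ev e L)"
  "bd B (set_cell a (index_of (ev i L)) (ev e L) L) ==> cor c2 (set_cell a (index_of (ev i L)) (ev e L) L) Q"
 shows "cor (Seq (put a i e) c2) L Q"
 by (rule cor_seq[OF cor_put[where Q = "\<lambda>L'. L' = set_cell a (index_of (ev i L)) (ev e L) L"]])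
   (use assms in auto)

lemma u_le: "usize I \<le> 2 ^ B"
proof -
 have "usize I < 2 ^ usize I" by (rule less_exp)
 also have "\<dots> \<le> 2 ^ B" using uB by (intro power_increasing) auto
 finally show ?thesis by simp
qed

lemma pow_u: "j \<le> usize I ==> (2::nat) ^ j \<le> 2 ^ B" "j \<le> usize I ==> (2::nat) ^ Suc j \<le> 2 ^ B"
 using uB by (auto intro!: power_increasing simp del: power_Suc)

lemma cor_decode:
 assumes bd: "bd B L" and par: "params L" and a: "a < 60" and n: "L a 0 = of_nat n"
  and Q: "\<And>L'. bd B L' ==> (\<And>b. b < 60 ==> b \<noteq> 10 ==> b \<noteq> 11 ==> b \<noteq> 12 ==> L' b = L b) ==>
   get_scenario 10 (usize I) L' = set_decode n \<inter> {..<usize I} ==> Q L'"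
 shows "cor (decode_prog a) L Q"
 unfolding decode_prog_def
proof (rule cor_seq_asg[OF bd])
 let ?L = "set_cell 11 0 (ev (Vr a) L) L"
 have nB: "n \<le> 2 ^ B" using rb_of_nat_le bdD[OF bd a, of 0] n by simp
 show "rb B (ev (Vr a) L)" using bdD[OF bd a] by simp
 assume bd1: "bd B ?L"
 show "cor (floop 12 eU (Seq (put 10 (Vr 12) (mi (Vr 11) (ti (Kn 2) (Fl (di (Vr 11) (Kn 2))))))
            (asg 11 (Fl (di (Vr 11) (Kn 2)))))) ?L Q"
 proof (rule cor_floop[where N = "usize I" and Inv = "\<lambda>j L'. L' 11 0 = of_nat (n div 2 ^ j) \<and>
   (\<forall>i<j. L' 10 i = of_nat ((n div 2 ^ i) mod 2))", OF bd1])
  show "ev eU ?L = of_nat (usize I)" using paramsD[OF par] by simp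
  fix j L' assume j: "j < usize I" and bd': "bd B L'"
   and fr: "\<And>b. b < 60 ==> b \<noteq> 12 ==> b \<notin> wr (Seq (put 10 (Vr 12) (mi (Vr 11) (ti (Kn 2) (Fl (di (Vr 11) (Kn 2))))))
            (asg 11 (Fl (di (Vr 11) (Kn 2))))) ==> L' b = ?L b"
   and i: "L' 12 0 = of_nat j"
   and inv: "L' 11 0 = of_nat (n div 2 ^ j) \<and> (\<forall>i<j. L' 10 i = of_nat ((n div 2 ^ i) mod 2))"
  have half: "n div 2 ^ j div 2 = n div 2 ^ Suc j" by (metis div_mult2_eq power_Suc2)
  have le: "n div 2 ^ Suc j \<le> 2 ^ B" using nB div_le_dividend order_trans by blast
  have "n div 2 ^ j mod 2 \<le> 1" by simp
  then have "n div 2 ^ j mod 2 \<le> 2 ^ B" using one_le_power[of "2::nat" B] by linarith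
  note rb_mod = rb_nat[OF this]
  show "cor (Seq (put 10 (Vr 12) (mi (Vr 11) (ti (Kn 2) (Fl (di (Vr 11) (Kn 2))))))
            (asg 11 (Fl (di (Vr 11) (Kn 2))))) L'
      (\<lambda>L''. set_cell 12 0 (of_nat (Suc j)) L'' 11 0 = of_nat (n div 2 ^ Suc j) \<and>
   (\<forall>i<Suc j. set_cell 12 0 (of_nat (Suc j)) L'' 10 i = of_nat ((n div 2 ^ i) mod 2)))"
   by (rule cor_seq_put[OF bd' _ _ _ _ cor_asg])
     (use inv i rb_nat[OF le] rb_mod half rat_mod_2[of "n div 2 ^ j"]
      in \<open>auto simp: eok_def less_Suc_eq simp del: power_Suc\<close>)
 next
  fix L' assume bd': "bd B L'"
   and fr: "\<And>b. b < 60 ==> b \<noteq> 12 ==> b \<notin> wr (Seq (put 10 (Vr 12) (mi (Vr 11) (ti (Kn 2) (Fl (di (Vr 11) (Kn 2))))))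
            (asg 11 (Fl (di (Vr 11) (Kn 2))))) ==> L' b = ?L b"
   and inv: "L' 11 0 = of_nat (n div 2 ^ usize I) \<and> (\<forall>i<usize I. L' 10 i = of_nat ((n div 2 ^ i) mod 2))"
  show "Q L'"
  proof (rule Q[OF bd'])
   show "get_scenario 10 (usize I) L' = set_decode n \<inter> {..<usize I}"
    using inv by (auto simp: get_scenario_def set_decode_def odd_iff_mod_2_eq_one)
  qed (use fr in auto)
 qed (use n u_le uZ in \<open>auto simp: eok_def\<close>)
qed (use a in \<open>auto simp: eok_def\<close>)

lemma cor_encode:
 assumes bd: "bd B L" and par: "params L" and A: "\<And>i. i < usize I ==> L 10 i = (if i \<in> A then 1 else 0)"
  and Q: "\<And>L'. bd B L' ==> (\<And>b. b < 60 ==> b \<noteq> 12 ==> b \<noteq> 13 ==> b \<noteq> 14 ==> L' b = L b) ==>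
   L' 13 0 = of_nat (set_encode (A \<inter> {..<usize I})) ==> Q L'"
 shows "cor encode_prog L Q"
 unfolding encode_prog_def
proof (rule cor_seq_asg[OF bd _ _ _ cor_seq_asg], goal_cases)
 case 8
 let ?L = "set_cell 14 0 (ev (Kn 1) (set_cell 13 0 (ev (Kn 0) L) L)) (set_cell 13 0 (ev (Kn 0) L) L)"
 let ?b = "Seq (asg 13 (pl (Vr 13) (ti (Vr 14) (Ix 10 (Vr 12))))) (dbl 14)"
 show "cor (floop 12 eU ?b) ?L Q"
 proof (rule cor_floop[where N = "usize I" and Inv = "\<lambda>j L'. L' 13 0 = of_nat (set_encode (A \<inter> {..<j})) \<and> L' 14 0 = of_nat (2 ^ j)", OF 8(2)])
  show "ev eU ?L = of_nat (usize I)" using paramsD[OF par] by simp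
  fix j L' assume j: "j < usize I" and bd': "bd B L'"
   and fr: "\<And>b. b < 60 ==> b \<noteq> 12 ==> b \<notin> wr ?b ==> L' b = ?L b"
   and i: "L' 12 0 = of_nat j"
   and inv: "L' 13 0 = of_nat (set_encode (A \<inter> {..<j})) \<and> L' 14 0 = of_nat (2 ^ j)"
  have 10: "L' 10 j = (if j \<in> A then 1 else 0)" using fr[of 10] A[OF j] by simp
  have enc: "set_encode (A \<inter> {..<Suc j}) = set_encode (A \<inter> {..<j}) + 2 ^ j * (if j \<in> A then 1 else 0)"
  proof (cases "j \<in> A")
   case True
   then have "A \<inter> {..<Suc j} = insert j (A \<inter> {..<j})" by auto
   then show ?thesis using True by simp
  next
   case False
   then have "A \<inter> {..<Suc j} = A \<inter> {..<j}" by (auto simp: less_Suc_eq)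
   then show ?thesis using False by simp
  qed
  have "set_encode (A \<inter> {..<Suc j}) < 2 ^ Suc j" by (rule set_encode_less) auto
  then have le: "set_encode (A \<inter> {..<Suc j}) \<le> 2 ^ B" using pow_u(2)[of j] j by linarith
  have rb1: "rb B (of_nat (set_encode (A \<inter> {..<j})) + of_nat (2 ^ j) * (if j \<in> A then 1 else 0))"
   using rb_nat[OF le] unfolding enc by (simp split: if_splits)
  have rb2: "rb B (2 ^ j + 2 ^ j)" using rb_nat[OF pow_u(2), of j] j by simp
  show "cor ?b L' (\<lambda>L''. set_cell 12 0 (of_nat (Suc j)) L'' 13 0 = of_nat (set_encode (A \<inter> {..<Suc j})) \<and>
    set_cell 12 0 (of_nat (Suc j)) L'' 14 0 = of_nat (2 ^ Suc j))"
   by (rule cor_seq_asg[OF bd' _ _ _ cor_asg])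
     (use inv i 10 rb1 rb2 enc in \<open>auto simp: eok_def\<close>)
 next
  fix L' assume bd': "bd B L'" and fr: "\<And>b. b < 60 ==> b \<noteq> 12 ==> b \<notin> wr ?b ==> L' b = ?L b"
   and inv: "L' 13 0 = of_nat (set_encode (A \<inter> {..<usize I})) \<and> L' 14 0 = of_nat (2 ^ usize I)"
  show "Q L'" by (rule Q[OF bd']) (use inv fr in auto)
 qed (use u_le uZ in auto)
qed (auto simp: eok_def)

end

section \<open>Correctness of the program parts\<close>

context drso_machine
begin

text \<open>A forward view of \<open>cor\<close> for long straight-line programs: naming each
  intermediate memory keeps the proof flat where repeated use of \<open>cor_seq\<close> would nest
  it.\<close>

definition fwd :: "com => memory => memory => bool" where
 "fwd c M M' \<longleftrightarrow> (\<exists>t. runs I c M M' t \<and> t \<le> ticks Z c * W)"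

lemma fwd_Seq: "fwd c1 M M1 ==> fwd c2 M1 M2 ==> fwd (Seq c1 c2) M M2"
proof -
 assume "fwd c1 M M1" "fwd c2 M1 M2"
 then obtain t1 t2 where *: "runs I c1 M M1 t1" "t1 \<le> ticks Z c1 * W" "runs I c2 M1 M2 t2" "t2 \<le> ticks Z c2 * W"
  unfolding fwd_def by blast
 then have "t1 + t2 \<le> ticks Z (Seq c1 c2) * W" by (simp add: distrib_right add_mono)
 then show ?thesis using runs_Seq[OF *(1,3)] unfolding fwd_def by blast
qed

lemma fwd_frame: "fwd c M M' ==> a \<notin> wr c ==> M' a = M a"
 unfolding fwd_def using runs_frame by blast

lemma cor_fwd:
 assumes "bd B L" "\<And>M. bd B M ==> low M = L ==> \<exists>M'. fwd c M M' \<and> bd B M' \<and> Q (low M')"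
 shows "cor c L Q"
 unfolding cor_def
proof (intro allI impI)
 fix M assume "low M = L"
 moreover from this have "bd B M" using assms(1) by auto
 ultimately obtain M' where "fwd c M M'" "bd B M'" "Q (low M')" using assms(2) by blast
 then show "\<exists>M' t. runs I c M M' t \<and> t \<le> ticks Z c * W \<and> bd B M' \<and> Q (low M')" unfolding fwd_def by blast
qed

lemma fwd_cor:
 assumes "cor c (low M) Q"
 obtains M' where "fwd c M M'" "bd B M'" "Q (low M')"
 using assms unfolding cor_def fwd_def by blast

lemma fwd_asg:
 assumes "bd B M" "a < 60" "eok e" "ev e M = v" "rb B v"
 obtains M' where "fwd (asg a e) M M'" "bd B M'" "M' a 0 = v" "\<And>b. b < 60 ==> b \<noteq> a ==> M' b = M b"
proof -
 have "cor (asg a e) (low M) (\<lambda>L. L = set_cell a 0 v (low M))"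
  by (rule cor_asg) (use assms ev_low[OF assms(3), of M] in auto)
 then obtain M' where M': "fwd (asg a e) M M'" "bd B M'" "low M' = set_cell a 0 v (low M)" by (rule fwd_cor)
 show ?thesis
 proof (rule that[OF M'(1,2)])
  show "M' a 0 = v" using M'(3) assms(2) by (metis fun_upd_same low_apply set_cell_same)
  show "\<And>b. b < 60 ==> b \<noteq> a ==> M' b = M b" using fwd_frame[OF M'(1)] by simp
 qed
qed

lemma params_low: "params (low M) = params M"
 by (simp add: params_def)

lemma idx_eq: "k < n ==> k' < n ==> i * n + k = i' * n + k' \<longleftrightarrow> i = i' \<and> k = (k'::nat)"
proof
 assume *: "k < n" "k' < n" "i * n + k = i' * n + k'"
 from arg_cong[OF *(3), of "\<lambda>x. x div n"] arg_cong[OF *(3), of "\<lambda>x. x mod n"]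
 show "i = i' \<and> k = k'" using *(1,2) by simp
qed auto

lemma cor_mass:
 assumes bd: "bd B L" and par: "params L" and N: "L 24 0 = of_nat N" "N \<le> Z" "N \<le> 2 ^ B"
  and cd: "\<And>j. j < N ==> L 27 j = of_nat (cd j)"
  and cnt: "\<And>j. cnt j = card {i. i < N \<and> cd i = cd j}"
  and rb: "\<And>j. j \<le> N ==> rb B (\<Sum>i<j. min (1 / of_nat N) (radius I / of_nat (cnt i)))"
  and Q: "\<And>L'. bd B L' ==> (\<And>b. b < 60 ==> b \<notin> {28, 29, 30, 31} ==> L' b = L b) ==>
   L' 28 0 = (\<Sum>i<N. min (1 / of_nat N) (radius I / of_nat (cnt i))) ==> Q L'"
 shows "cor mass_prog L Q"
proof -
 let ?S = "\<lambda>j. \<Sum>i<j. min (1 / of_nat N) (radius I / of_nat (cnt i))"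
 let ?in = "ifp (eqtest (Ix 27 (Vr 31)) (Ix 27 (Vr 29))) (asg 30 (pl (Vr 30) (Kn 1))) skip"
 let ?fin = "ifp (mi (di (Kn 1) (Vr 24)) (di eR (Vr 30)))
       (asg 28 (pl (Vr 28) (di eR (Vr 30))))
       (asg 28 (pl (Vr 28) (di (Kn 1) (Vr 24))))"
 let ?body = "Seq (asg 30 (Kn 0)) (Seq (floop 31 (Vr 24) ?in) ?fin)"
 have inner: "cor (floop 31 (Vr 24) ?in) L1 (\<lambda>L2. L2 30 0 = of_nat (cnt j))"
  if bd1: "bd B L1" and fr1: "L1 24 0 = of_nat N" "L1 27 = L 27" and j1: "L1 29 0 = of_nat j" "j < N" and z: "L1 30 0 = 0" for L1 j
 proof (rule cor_floop[where N = N and Inv = "\<lambda>i L2. L2 30 0 = of_nat (card {i'. i' < i \<and> cd i' = cd j})", OF bd1])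
  fix i L2 assume i: "i < N" and bd2: "bd B L2"
   and fr: "\<And>b. b < 60 ==> b \<noteq> 31 ==> b \<notin> wr ?in ==> L2 b = L1 b"
   and i2: "L2 31 0 = of_nat i" and inv: "L2 30 0 = of_nat (card {i'. i' < i \<and> cd i' = cd j})"
  have test: "ev (eqtest (Ix 27 (Vr 31)) (Ix 27 (Vr 29))) L2 > 0 \<longleftrightarrow> cd i = cd j"
   using fr[of 27] fr[of 29] fr1 j1 i2 cd[OF i] cd[OF j1(2)] by (simp add: eq_test_nat')
  have fin: "finite {i'. i' < i \<and> cd i' = cd j}" by (rule finite_subset[of _ "{..<i}"]) auto
  have c: "card {i'. i' < Suc i \<and> cd i' = cd j} = card {i'. i' < i \<and> cd i' = cd j} + (if cd i = cd j then 1 else 0)"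
  proof (cases "cd i = cd j")
   case True
   then have "{i'. i' < Suc i \<and> cd i' = cd j} = insert i {i'. i' < i \<and> cd i' = cd j}" by (auto simp: less_Suc_eq)
   then show ?thesis using True fin by simp
  next
   case False
   then have "{i'. i' < Suc i \<and> cd i' = cd j} = {i'. i' < i \<and> cd i' = cd j}" by (auto simp: less_Suc_eq)
   then show ?thesis using False by simp
  qed
  have "card {i'. i' < Suc i \<and> cd i' = cd j} \<le> card {..<Suc i}" by (rule card_mono) auto
  then have "card {i'. i' < Suc i \<and> cd i' = cd j} \<le> 2 ^ B" using i N by simp
  note rb1 = rb_nat[OF this]
  show "cor ?in L2 (\<lambda>L3. set_cell 31 0 (of_nat (Suc i)) L3 30 0 = of_nat (card {i'. i' < Suc i \<and> cd i' = cd j}))"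
  proof (rule cor_ifp[OF bd2])
   assume "ev (eqtest (Ix 27 (Vr 31)) (Ix 27 (Vr 29))) L2 > 0"
   then have "cd i = cd j" using test by simp
   then show "cor (asg 30 (pl (Vr 30) (Kn 1))) L2
    (\<lambda>L3. set_cell 31 0 (of_nat (Suc i)) L3 30 0 = of_nat (card {i'. i' < Suc i \<and> cd i' = cd j}))"
    by (intro cor_asg[OF bd2]) (use c inv rb1 in \<open>auto simp: eok_def add.commute\<close>)
  next
   assume "\<not> ev (eqtest (Ix 27 (Vr 31)) (Ix 27 (Vr 29))) L2 > 0"
   then have "cd i \<noteq> cd j" using test by simp
   then show "cor skip L2
    (\<lambda>L3. set_cell 31 0 (of_nat (Suc i)) L3 30 0 = of_nat (card {i'. i' < Suc i \<and> cd i' = cd j}))"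
    by (intro cor_skip[OF bd2]) (use c inv in auto)
  qed (simp add: eok_def)
 qed (use z fr1 N in \<open>auto simp: cnt\<close>)
 show ?thesis unfolding mass_prog_def
 proof (rule cor_seq_asg[OF bd])
  let ?L = "set_cell 28 0 (ev (Kn 0) L) L"
  assume bd0: "bd B ?L"
  show "cor (floop 29 (Vr 24) ?body) ?L Q"
  proof (rule cor_floop[where N = N and Inv = "\<lambda>j L1. L1 28 0 = ?S j", OF bd0])
   fix j L1 assume j: "j < N" and bd1: "bd B L1"
    and fr: "\<And>b. b < 60 ==> b \<noteq> 29 ==> b \<notin> wr ?body ==> L1 b = ?L b"
    and j1: "L1 29 0 = of_nat j" and inv: "L1 28 0 = ?S j"
   show "cor ?body L1 (\<lambda>L2. set_cell 29 0 (of_nat (Suc j)) L2 28 0 = ?S (Suc j))"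
   proof (rule cor_seq_asg[OF bd1])
    let ?L1 = "set_cell 30 0 (ev (Kn 0) L1) L1"
    assume bd1': "bd B ?L1"
    show "cor (Seq (floop 31 (Vr 24) ?in) ?fin) ?L1 (\<lambda>L2. set_cell 29 0 (of_nat (Suc j)) L2 28 0 = ?S (Suc j))"
    proof (rule cor_seq[OF inner[OF bd1' _ _ _ j]])
     fix L2 assume bd2: "bd B L2" and fr2: "\<And>b. b < 60 ==> b \<notin> wr (floop 31 (Vr 24) ?in) ==> L2 b = ?L1 b"
      and c: "L2 30 0 = of_nat (cnt j)"
     have v: "L2 24 0 = of_nat N" "L2 (Suc 0) 3 = radius I" "L2 28 0 = ?S j"
      using fr2[of 24] fr2[of "Suc 0"] fr2[of 28] fr[of 24] fr[of "Suc 0"] inv N paramsD[OF par] by auto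
     show "cor ?fin L2 (\<lambda>L2. set_cell 29 0 (of_nat (Suc j)) L2 28 0 = ?S (Suc j))"
      by (rule cor_ifp[OF bd2 _ cor_asg[OF bd2] cor_asg[OF bd2]])
        (use rb[of "Suc j"] j v c in \<open>auto simp: eok_def min_def add.commute\<close>)
    qed (use fr[of 24] fr[of 27] N j1 in auto)
   qed (auto simp: eok_def)
  next
   fix L1 assume "bd B L1" and fr: "\<And>b. b < 60 ==> b \<noteq> 29 ==> b \<notin> wr ?body ==> L1 b = ?L b" and "L1 28 0 = ?S N"
   then show "Q L1" by (intro Q) auto
  qed (use N in auto)
 qed (auto simp: eok_def)
qed

lemma cor_init:
 assumes bd: "bd B L" and par: "params L" and z: "\<And>n. L 33 n = 0" and R: "L 18 0 = R"
  and g: "L 16 0 = g" "rb B (2 * g)"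
  and Q: "\<And>L'. bd B L' ==> (\<And>b. b < 60 ==> b \<notin> {12, 33, 34} ==> L' b = L b) ==>
   L' 34 0 = 2 * g ==> (\<And>k. k < mdim I ==> L' 33 k = 0) ==>
   (\<And>i k. i < mdim I ==> k < mdim I ==> L' 33 (Suc i * mdim I + k) = (if i = k then R else 0)) ==> Q L'"
 shows "cor init_prog L Q"
 unfolding init_prog_def
proof (rule cor_seq)
 let ?m = "mdim I" and ?b = "put 33 (pl (ti (pl (Vr 12) (Kn 1)) eM) (Vr 12)) (Vr 18)"
 let ?Inv = "\<lambda>j L'. \<forall>n. L' 33 n = (if \<exists>i<j. n = Suc i * ?m + i then R else 0)"
 show "cor (floop 12 eM ?b) L (?Inv ?m)"
 proof (rule cor_floop[where N = "?m" and Inv = ?Inv, OF bd])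
  fix j L' assume j: "j < ?m" and bd': "bd B L'"
   and fr: "\<And>b. b < 60 ==> b \<noteq> 12 ==> b \<notin> wr ?b ==> L' b = L b" and i: "L' 12 0 = of_nat j" and inv: "?Inv j L'"
  have v: "L' 18 0 = R" "L' (Suc 0) 0 = of_nat ?m" using fr[of 18] fr[of "Suc 0"] R paramsD[OF par] by auto
  have ix: "ev (pl (ti (pl (Vr 12) (Kn 1)) eM) (Vr 12)) L' = (of_nat j + 1) * of_nat ?m + of_nat j"
   using i v by simp
  show "cor ?b L' (\<lambda>L''. ?Inv (Suc j) (set_cell 12 0 (of_nat (Suc j)) L''))"
  proof (rule cor_put[OF bd'])
   show "?Inv (Suc j) (set_cell 12 0 (of_nat (Suc j)) (set_cell 33 (index_of (ev (pl (ti (pl (Vr 12) (Kn 1)) eM) (Vr 12)) L')) (ev (Vr 18) L') L'))"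
    unfolding ix index_of_nat_arith using inv v by (auto simp: less_Suc_eq)
  qed (use v bdD[OF bd', of 18 0] in \<open>auto simp: eok_def\<close>)
 qed (use paramsD[OF par] mB mZ z in auto)
 fix L' assume bd': "bd B L'" and fr: "\<And>b. b < 60 ==> b \<notin> wr (floop 12 eM ?b) ==> L' b = L b" and inv: "?Inv ?m L'"
 have 16: "L' 16 0 = g" using fr[of 16] g by simp
 show "cor (asg 34 (ti (Kn 2) (Vr 16))) L' Q"
 proof (rule cor_asg[OF bd'])
  show "Q (set_cell 34 0 (ev (ti (Kn 2) (Vr 16)) L') L')"
  proof (rule Q)
   fix i k assume ik: "i < ?m" "k < ?m"
   have iff: "(\<exists>i'<?m. Suc i * ?m + k = Suc i' * ?m + i') \<longleftrightarrow> i = k"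
   proof
    assume "\<exists>i'<?m. Suc i * ?m + k = Suc i' * ?m + i'"
    then obtain i' where "i' < ?m" "Suc i * ?m + k = Suc i' * ?m + i'" by blast
    then show "i = k" using idx_eq[OF ik(2), of i' "Suc i" "Suc i'"] by simp
   qed (use ik in blast)
   have "L' 33 (Suc i * ?m + k) = (if i = k then R else 0)"
    using inv[rule_format, of "Suc i * ?m + k"] unfolding iff .
   then show "set_cell 34 0 (ev (ti (Kn 2) (Vr 16)) L') L' 33 (Suc i * ?m + k) = (if i = k then R else 0)"
    by (simp add: set_cell_apply del: mult_Suc)
  next
   fix k assume k: "k < ?m"
   have nex: "\<not> (\<exists>i'<?m. k = Suc i' * ?m + i')"
   proof
    assume "\<exists>i'<?m. k = Suc i' * ?m + i'"
    then obtain i' where "k = Suc i' * ?m + i'" by blast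
    moreover have "?m \<le> Suc i' * ?m" by simp
    ultimately show False using k by linarith
   qed
   have "L' 33 k = 0" using inv[rule_format, of k] unfolding if_not_P[OF nex] .
   then show "set_cell 34 0 (ev (ti (Kn 2) (Vr 16)) L') L' 33 k = 0" by (simp add: set_cell_apply)
  qed (use bd' 16 g fr in \<open>auto intro: bd_set_cell\<close>)
 qed (use 16 g in \<open>auto simp: eok_def\<close>)
qed

lemma cor_centroid:
 assumes bd: "bd B L" and par: "params L"
  and rb: "\<And>j k. j \<le> Suc (mdim I) ==> k < mdim I ==> rb B (\<Sum>i<j. L 33 (i * mdim I + k))"
  and rb': "\<And>k. k < mdim I ==> rb B ((\<Sum>i\<le>mdim I. L 33 (i * mdim I + k)) / (of_nat (mdim I) + 1))"
  and Q: "\<And>L'. bd B L' ==> (\<And>b. b < 60 ==> b \<notin> {36, 37, 38, 39} ==> L' b = L b) ==>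
   (\<And>k. k < mdim I ==> L' 39 k = (\<Sum>i\<le>mdim I. L 33 (i * mdim I + k)) / (of_nat (mdim I) + 1)) ==> Q L'"
 shows "cor centroid_prog L Q"
proof -
 let ?m = "mdim I"
 let ?in = "asg 37 (pl (Vr 37) (Ix 33 (pl (ti (Vr 38) eM) (Vr 36))))"
 let ?loop = "floop 38 (pl eM (Kn 1)) ?in"
 let ?fin = "put 39 (Vr 36) (di (Vr 37) (pl eM (Kn 1)))"
 let ?body = "Seq (asg 37 (Kn 0)) (Seq ?loop ?fin)"
 let ?c = "\<lambda>k. (\<Sum>i\<le>?m. L 33 (i * ?m + k)) / (of_nat ?m + 1)"
 have inner: "cor ?loop L1 (\<lambda>L2. L2 37 0 = (\<Sum>i\<le>?m. L 33 (i * ?m + k)))"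
  if bd1: "bd B L1" and par1: "params L1" and fr1: "L1 33 = L 33" and k1: "L1 36 0 = of_nat k" "k < ?m" and z: "L1 37 0 = 0" for L1 k
 proof (rule cor_floop[where N = "Suc ?m" and Inv = "\<lambda>j L2. L2 37 0 = (\<Sum>i<j. L 33 (i * ?m + k))", OF bd1])
  fix j L2 assume j: "j < Suc ?m" and bd2: "bd B L2"
   and fr: "\<And>b. b < 60 ==> b \<noteq> 38 ==> b \<notin> wr ?in ==> L2 b = L1 b"
   and j2: "L2 38 0 = of_nat j" and inv: "L2 37 0 = (\<Sum>i<j. L 33 (i * ?m + k))"
  have v: "L2 33 = L 33" "L2 36 0 = of_nat k" "L2 (Suc 0) 0 = of_nat ?m"
   using fr[of 33] fr[of 36] fr[of "Suc 0"] fr1 k1 paramsD[OF par1] by auto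
  show "cor ?in L2 (\<lambda>L3. set_cell 38 0 (of_nat (Suc j)) L3 37 0 = (\<Sum>i<Suc j. L 33 (i * ?m + k)))"
   by (rule cor_asg[OF bd2]) (use v j2 inv rb[of "Suc j" k] j k1 in \<open>auto simp: eok_def\<close>)
 next
  fix L2 assume "L2 37 0 = (\<Sum>i<Suc ?m. L 33 (i * ?m + k))"
  then show "L2 37 0 = (\<Sum>i\<le>?m. L 33 (i * ?m + k))" by (simp only: lessThan_Suc_atMost)
 qed (use z paramsD[OF par1] mB mZ in auto)
 show ?thesis unfolding centroid_prog_def
 proof (rule cor_floop[where N = ?m and Inv = "\<lambda>j L1. \<forall>k<j. L1 39 k = ?c k", OF bd])
  fix k L1 assume k: "k < ?m" and bd1: "bd B L1"
   and fr: "\<And>b. b < 60 ==> b \<noteq> 36 ==> b \<notin> wr ?body ==> L1 b = L b"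
   and k1: "L1 36 0 = of_nat k" and inv: "\<forall>k'<k. L1 39 k' = ?c k'"
  have par1: "params L1" using fr[of 0] fr[of "Suc 0"] by (intro params_cong[OF par]) auto
  show "cor ?body L1 (\<lambda>L2. \<forall>k'<Suc k. set_cell 36 0 (of_nat (Suc k)) L2 39 k' = ?c k')"
  proof (rule cor_seq_asg[OF bd1])
   let ?L1 = "set_cell 37 0 (ev (Kn 0) L1) L1"
   assume bd1': "bd B ?L1"
   show "cor (Seq ?loop ?fin) ?L1 (\<lambda>L2. \<forall>k'<Suc k. set_cell 36 0 (of_nat (Suc k)) L2 39 k' = ?c k')"
   proof (rule cor_seq[OF inner[OF bd1' _ _ _ k]])
    fix L2 assume bd2: "bd B L2" and fr2: "\<And>b. b < 60 ==> b \<notin> wr ?loop ==> L2 b = ?L1 b"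
     and s: "L2 37 0 = (\<Sum>i\<le>?m. L 33 (i * ?m + k))"
    have v: "L2 36 0 = of_nat k" "L2 39 = L1 39" "L2 (Suc 0) 0 = of_nat ?m"
     using fr2[of 36] fr2[of 39] fr2[of "Suc 0"] k1 paramsD[OF par1] by auto
    show "cor ?fin L2 (\<lambda>L2. \<forall>k'<Suc k. set_cell 36 0 (of_nat (Suc k)) L2 39 k' = ?c k')"
     by (rule cor_put[OF bd2]) (use v s inv rb'[OF k] in \<open>auto simp: eok_def less_Suc_eq\<close>)
   qed (use par1 fr[of 33] k1 in auto)
  qed (auto simp: eok_def)
 next
  fix L1 assume "bd B L1" and fr: "\<And>b. b < 60 ==> b \<noteq> 36 ==> b \<notin> wr ?body ==> L1 b = L b" and "\<forall>k<?m. L1 39 k = ?c k"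
  then show "Q L1" by (intro Q) auto
 qed (use paramsD[OF par] mB mZ in auto)
qed

lemma cor_heights:
 assumes bd: "bd B L" and par: "params L"
  and rb: "\<And>i j. i \<le> mdim I ==> j \<le> mdim I ==> rb B (\<Sum>k<j. L 41 k * (L 33 (i * mdim I + k) - L 39 k))"
  and Q: "\<And>L'. bd B L' ==> (\<And>b. b < 60 ==> b \<notin> {36, 37, 38, 42} ==> L' b = L b) ==>
   (\<And>i. i \<le> mdim I ==> L' 42 i = (\<Sum>k<mdim I. L 41 k * (L 33 (i * mdim I + k) - L 39 k))) ==> Q L'"
 shows "cor heights_prog L Q"
proof -
 let ?m = "mdim I"
 let ?h = "\<lambda>i j. \<Sum>k<j. L 41 k * (L 33 (i * ?m + k) - L 39 k)"
 let ?in = "asg 37 (pl (Vr 37) (ti (Ix 41 (Vr 38)) (mi (Ix 33 (pl (ti (Vr 36) eM) (Vr 38))) (Ix 39 (Vr 38)))))"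
 let ?loop = "floop 38 eM ?in"
 let ?fin = "put 42 (Vr 36) (Vr 37)"
 let ?body = "Seq (asg 37 (Kn 0)) (Seq ?loop ?fin)"
 have inner: "cor ?loop L1 (\<lambda>L2. L2 37 0 = ?h i ?m)"
  if bd1: "bd B L1" and par1: "params L1" and fr1: "L1 33 = L 33" "L1 39 = L 39" "L1 41 = L 41"
   and i1: "L1 36 0 = of_nat i" "i \<le> ?m" and z: "L1 37 0 = 0" for L1 i
 proof (rule cor_floop[where N = ?m and Inv = "\<lambda>j L2. L2 37 0 = ?h i j", OF bd1])
  fix j L2 assume j: "j < ?m" and bd2: "bd B L2"
   and fr: "\<And>b. b < 60 ==> b \<noteq> 38 ==> b \<notin> wr ?in ==> L2 b = L1 b"
   and j2: "L2 38 0 = of_nat j" and inv: "L2 37 0 = ?h i j"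
  have v: "L2 33 = L 33" "L2 39 = L 39" "L2 41 = L 41" "L2 36 0 = of_nat i" "L2 (Suc 0) 0 = of_nat ?m"
   using fr[of 33] fr[of 39] fr[of 41] fr[of 36] fr[of "Suc 0"] fr1 i1 paramsD[OF par1] by auto
  show "cor ?in L2 (\<lambda>L3. set_cell 38 0 (of_nat (Suc j)) L3 37 0 = ?h i (Suc j))"
   by (rule cor_asg[OF bd2]) (use v j2 inv rb[of i "Suc j"] j i1 in \<open>auto simp: eok_def\<close>)
 qed (use z paramsD[OF par1] mB mZ in auto)
 show ?thesis unfolding heights_prog_def
 proof (rule cor_floop[where N = "Suc ?m" and Inv = "\<lambda>j L1. \<forall>i<j. L1 42 i = ?h i ?m", OF bd])
  fix i L1 assume i: "i < Suc ?m" and bd1: "bd B L1"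
   and fr: "\<And>b. b < 60 ==> b \<noteq> 36 ==> b \<notin> wr ?body ==> L1 b = L b"
   and i1: "L1 36 0 = of_nat i" and inv: "\<forall>i'<i. L1 42 i' = ?h i' ?m"
  have par1: "params L1" using fr[of 0] fr[of "Suc 0"] by (intro params_cong[OF par]) auto
  show "cor ?body L1 (\<lambda>L2. \<forall>i'<Suc i. set_cell 36 0 (of_nat (Suc i)) L2 42 i' = ?h i' ?m)"
  proof (rule cor_seq_asg[OF bd1])
   let ?L1 = "set_cell 37 0 (ev (Kn 0) L1) L1"
   assume bd1': "bd B ?L1"
   show "cor (Seq ?loop ?fin) ?L1 (\<lambda>L2. \<forall>i'<Suc i. set_cell 36 0 (of_nat (Suc i)) L2 42 i' = ?h i' ?m)"
   proof (rule cor_seq[OF inner[OF bd1', of i]])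
    fix L2 assume bd2: "bd B L2" and fr2: "\<And>b. b < 60 ==> b \<notin> wr ?loop ==> L2 b = ?L1 b"
     and s: "L2 37 0 = ?h i ?m"
    have v: "L2 36 0 = of_nat i" "L2 42 = L1 42" using fr2[of 36] fr2[of 42] i1 by auto
    show "cor ?fin L2 (\<lambda>L2. \<forall>i'<Suc i. set_cell 36 0 (of_nat (Suc i)) L2 42 i' = ?h i' ?m)"
     by (rule cor_put[OF bd2]) (use v s inv rb[of i ?m] i in \<open>auto simp: eok_def less_Suc_eq\<close>)
   qed (use par1 fr[of 33] fr[of 39] fr[of 41] i1 i in auto)
  qed (auto simp: eok_def)
 next
  fix L1 assume "bd B L1" and fr: "\<And>b. b < 60 ==> b \<noteq> 36 ==> b \<notin> wr ?body ==> L1 b = L b"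
   and "\<forall>i<Suc ?m. L1 42 i = ?h i ?m"
  then show "Q L1" by (intro Q) auto
 qed (use paramsD[OF par] mB mZ in auto)
qed

lemma cor_argmin:
 assumes bd: "bd B L" and par: "params L"
  and Q: "\<And>L' p. bd B L' ==> (\<And>b. b < 60 ==> b \<notin> {36, 43} ==> L' b = L b) ==> p \<le> mdim I ==>
   L' 43 0 = of_nat p ==> (\<And>i. i \<le> mdim I ==> L 42 p \<le> L 42 i) ==> Q L'"
 shows "cor argmin_prog L Q"
 unfolding argmin_prog_def
proof (rule cor_seq_asg[OF bd])
 let ?m = "mdim I" and ?L = "set_cell 43 0 (ev (Kn 0) L) L"
 let ?b = "ifp (mi (Ix 42 (Vr 43)) (Ix 42 (Vr 36))) (asg 43 (Vr 36)) skip"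
 assume bd0: "bd B ?L"
 let ?Inv = "\<lambda>j L1. \<exists>p\<le>?m. L1 43 0 = of_nat p \<and> (\<forall>i<j. L 42 p \<le> L 42 i)"
 show "cor (floop 36 (pl eM (Kn 1)) ?b) ?L Q"
 proof (rule cor_floop[where N = "Suc ?m" and Inv = ?Inv, OF bd0])
  fix i L1 assume i: "i < Suc ?m" and bd1: "bd B L1"
   and fr: "\<And>b. b < 60 ==> b \<noteq> 36 ==> b \<notin> wr ?b ==> L1 b = ?L b"
   and i1: "L1 36 0 = of_nat i" and inv: "?Inv i L1"
  from inv obtain p where p: "p \<le> ?m" "L1 43 0 = of_nat p" "\<forall>i'<i. L 42 p \<le> L 42 i'" by blast
  have 42: "L1 42 = L 42" using fr[of 42] by simp
  have rbi: "rb B (of_nat i)" using i mB by (intro rb_nat) auto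
  show "cor ?b L1 (\<lambda>L2. ?Inv (Suc i) (set_cell 36 0 (of_nat (Suc i)) L2))"
  proof (rule cor_ifp[OF bd1])
   assume "0 < ev (mi (Ix 42 (Vr 43)) (Ix 42 (Vr 36))) L1"
   then have lt: "L 42 i < L 42 p" using p(2) i1 42 by simp
   show "cor (asg 43 (Vr 36)) L1 (\<lambda>L2. ?Inv (Suc i) (set_cell 36 0 (of_nat (Suc i)) L2))"
    by (rule cor_asg[OF bd1])
      (use i i1 rbi lt p(3) in \<open>auto simp: eok_def less_Suc_eq intro!: exI[of _ i] intro: less_imp_le less_le_trans\<close>)
  next
   assume "\<not> 0 < ev (mi (Ix 42 (Vr 43)) (Ix 42 (Vr 36))) L1"
   then have "L 42 p \<le> L 42 i" using p(2) i1 42 by simp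
   then show "cor skip L1 (\<lambda>L2. ?Inv (Suc i) (set_cell 36 0 (of_nat (Suc i)) L2))"
    by (intro cor_skip[OF bd1]) (use p in \<open>auto simp: less_Suc_eq\<close>)
  qed (simp add: eok_def)
 next
  fix L1 assume bd1: "bd B L1" and fr: "\<And>b. b < 60 ==> b \<noteq> 36 ==> b \<notin> wr ?b ==> L1 b = ?L b" and inv: "?Inv (Suc ?m) L1"
  from inv obtain p where p: "p \<le> ?m" "L1 43 0 = of_nat p" "\<forall>i'<Suc ?m. L 42 p \<le> L 42 i'" by blast
  show "Q L1" by (rule Q[OF bd1 _ p(1,2)]) (use p(3) fr in auto)
 qed (use paramsD[OF par] mB mZ in auto)
qed (auto simp: eok_def)

lemma cor_shrink:
 assumes bd: "bd B L" and par: "params L" and p: "L 43 0 = of_nat p" "p \<le> mdim I" and D: "L 21 0 = D"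
  and s: "\<And>i. i \<le> mdim I ==>
   s i = (of_int \<lfloor>D / (1 + L 42 i / (0 - L 42 p) / (8 * (of_nat (mdim I) * of_nat (mdim I))))\<rfloor> + 1) / D"
  and rbs: "\<And>i. i \<le> mdim I ==> rb B (s i)"
  and v': "\<And>i k. v' i k = L 33 (p * mdim I + k) + s i * (L 33 (i * mdim I + k) - L 33 (p * mdim I + k))"
  and rbv: "\<And>i k. i \<le> mdim I ==> k < mdim I ==> rb B (v' i k)"
  and Q: "\<And>L'. bd B L' ==> (\<And>b. b < 60 ==> b \<notin> {33, 36, 38, 44} ==> L' b = L b) ==>
   (\<And>i k. i \<le> mdim I ==> k < mdim I ==> L' 33 (i * mdim I + k) = v' i k) ==> Q L'"
 shows "cor shrink_prog L Q"
proof -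
 let ?m = "mdim I"
 let ?v = "\<lambda>i k. L 33 (i * ?m + k)"
 let ?in = "put 33 (pl (ti (Vr 36) eM) (Vr 38))
       (pl (Ix 33 (pl (ti (Vr 43) eM) (Vr 38)))
         (ti (Vr 44) (mi (Ix 33 (pl (ti (Vr 36) eM) (Vr 38))) (Ix 33 (pl (ti (Vr 43) eM) (Vr 38))))))"
 let ?se = "di (pl (Fl (di (Vr 21) (pl (Kn 1)
       (di (di (Ix 42 (Vr 36)) (mi (Kn 0) (Ix 42 (Vr 43)))) (ti (Kn 8) (ti eM eM)))))) (Kn 1)) (Vr 21)"
 let ?body = "Seq (asg 44 ?se) (floop 38 eM ?in)"
 \<comment> \<open>Vertices are overwritten in place: entries before position \<open>(a, b)\<close>
   in row order are new, the others old. Row \<open>p\<close> is fixed by the contraction, so it may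
   be read whether or not it has been passed already.\<close>
 let ?st = "\<lambda>a b L1. \<forall>i\<le>?m. \<forall>k<?m. L1 33 (i * ?m + k) = (if i < a \<or> (i = a \<and> k < b) then v' i k else ?v i k)"
 have vp: "v' p k = ?v p k" for k by (simp add: v')
 have inner: "cor (floop 38 eM ?in) L1 (?st i ?m)"
  if bd1: "bd B L1" and par1: "params L1" and i1: "L1 36 0 = of_nat i" "i \<le> ?m"
   and p1: "L1 43 0 = of_nat p" and s1: "L1 44 0 = s i" and st: "?st i 0 L1" for L1 i
 proof (rule cor_floop[where N = ?m and Inv = "?st i", OF bd1])
  fix j L2 assume j: "j < ?m" and bd2: "bd B L2"
   and fr: "\<And>b. b < 60 ==> b \<noteq> 38 ==> b \<notin> wr ?in ==> L2 b = L1 b"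
   and j2: "L2 38 0 = of_nat j" and inv: "?st i j L2"
  have v: "L2 36 0 = of_nat i" "L2 43 0 = of_nat p" "L2 44 0 = s i" "L2 (Suc 0) 0 = of_nat ?m"
   using fr[of 36] fr[of 43] fr[of 44] fr[of "Suc 0"] i1 p1 s1 paramsD[OF par1] by auto
  have vals: "L2 33 (p * ?m + j) = ?v p j" "L2 33 (i * ?m + j) = ?v i j" using inv p(2) i1(2) j vp by auto
  have eve: "ev (pl (Ix 33 (pl (ti (Vr 43) eM) (Vr 38)))
         (ti (Vr 44) (mi (Ix 33 (pl (ti (Vr 36) eM) (Vr 38))) (Ix 33 (pl (ti (Vr 43) eM) (Vr 38)))))) L2 = v' i j"
   using v j2 vals by (simp add: v')
  have ix: "index_of (ev (pl (ti (Vr 36) eM) (Vr 38)) L2) = i * ?m + j" using v j2 by simp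
  show "cor ?in L2 (\<lambda>L3. ?st i (Suc j) (set_cell 38 0 (of_nat (Suc j)) L3))"
  proof (rule cor_put[OF bd2])
   show "?st i (Suc j) (set_cell 38 0 (of_nat (Suc j)) (set_cell 33 (index_of (ev (pl (ti (Vr 36) eM) (Vr 38)) L2))
     (ev (pl (Ix 33 (pl (ti (Vr 43) eM) (Vr 38)))
         (ti (Vr 44) (mi (Ix 33 (pl (ti (Vr 36) eM) (Vr 38))) (Ix 33 (pl (ti (Vr 43) eM) (Vr 38)))))) L2) L2))"
    unfolding eve ix
   proof (intro allI impI)
    fix i' k assume ik: "i' \<le> ?m" "k < ?m"
    show "set_cell 38 0 (of_nat (Suc j)) (set_cell 33 (i * ?m + j) (v' i j) L2) 33 (i' * ?m + k) =
     (if i' < i \<or> i' = i \<and> k < Suc j then v' i' k else ?v i' k)"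
    proof (cases "i' = i \<and> k = j")
     case False
     then have "i' * ?m + k \<noteq> i * ?m + j" using idx_eq[OF ik(2) j, of i' i] by simp
     moreover have "(i' < i \<or> i' = i \<and> k < Suc j) = (i' < i \<or> i' = i \<and> k < j)" using False by auto
     ultimately show ?thesis using inv ik by (simp add: set_cell_apply)
    qed (simp add: set_cell_apply)
   qed
  qed (use rbv[of i j] i1(2) j in \<open>auto simp: eok_def eve simp del: ev.simps\<close>)
 qed (use st paramsD[OF par1] mB mZ in auto)
 show ?thesis unfolding shrink_prog_def
 proof (rule cor_floop[where N = "Suc ?m" and Inv = "\<lambda>i. ?st i 0", OF bd])
  fix i L1 assume i: "i < Suc ?m" and bd1: "bd B L1"
   and fr: "\<And>b. b < 60 ==> b \<noteq> 36 ==> b \<notin> wr ?body ==> L1 b = L b"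
   and i1: "L1 36 0 = of_nat i" and inv: "?st i 0 L1"
  have par1: "params L1" using fr[of 0] fr[of "Suc 0"] by (intro params_cong[OF par]) auto
  have se: "ev ?se L1 = s i"
   using fr[of 42] fr[of 43] fr[of 21] p D i1 s[of i] i paramsD[OF par1] by simp
  show "cor ?body L1 (\<lambda>L2. ?st (Suc i) 0 (set_cell 36 0 (of_nat (Suc i)) L2))"
  proof (rule cor_seq_asg[OF bd1])
   assume bd1': "bd B (set_cell 44 0 (ev ?se L1) L1)"
   show "cor (floop 38 eM ?in) (set_cell 44 0 (ev ?se L1) L1) (\<lambda>L2. ?st (Suc i) 0 (set_cell 36 0 (of_nat (Suc i)) L2))"
   proof (rule cor_conseq[OF inner[OF bd1', of i]])
    fix L2 :: memory assume "?st i ?m L2"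
    then show "?st (Suc i) 0 (set_cell 36 0 (of_nat (Suc i)) L2)" by (auto simp: less_Suc_eq)
   qed (use par1 i1 i fr[of 43] p se inv in \<open>auto simp del: ev.simps\<close>)
  qed (use rbs[of i] i se in \<open>auto simp: eok_def simp del: ev.simps\<close>)
 next
  fix L1 assume bd1: "bd B L1" and fr: "\<And>b. b < 60 ==> b \<noteq> 36 ==> b \<notin> wr ?body ==> L1 b = L b"
   and inv: "?st (Suc ?m) 0 L1"
  show "Q L1" by (rule Q[OF bd1]) (use fr inv in auto)
 qed (use paramsD[OF par] mB mZ in auto)
qed

end

text \<open>The pair \<open>(0, -1)\<close> marks an empty set of candidates. As code 0 also denotes
  the empty scenario, a search without result still yields a scenario, which \<open>top_seq\<close>
  accepts once all scenarios are used.\<close>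

definition best_of :: "nat set set => (nat set => rat) => rat => rat => bool" where
 "best_of C g bc bv \<longleftrightarrow> (C = {} \<and> bc = 0 \<and> bv = -1) \<or>
   (\<exists>A\<in>C. bc = of_nat (set_encode A) \<and> bv = g A \<and> (\<forall>A'\<in>C. g A' \<le> g A))"

lemma best_of_insert:
 assumes "best_of C g bc bv" "0 \<le> g A"
 shows "best_of (insert A C) g (if bv < g A then of_nat (set_encode A) else bc) (if bv < g A then g A else bv)"
proof (cases "C = {}")
 case True
 then have "bv = -1" using assms by (auto simp: best_of_def)
 then show ?thesis using True assms(2) by (auto simp: best_of_def)
next
 case False
 then obtain A0 where A0: "A0 \<in> C" "bc = of_nat (set_encode A0)" "bv = g A0" "\<forall>A'\<in>C. g A' \<le> g A0"
  using assms by (auto simp: best_of_def)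
 show ?thesis
 proof (cases "bv < g A")
  case True
  then have "\<forall>A'\<in>insert A C. g A' \<le> g A" using A0 by force
  then show ?thesis using True unfolding best_of_def by auto
 next
  case False
  then have "\<forall>A'\<in>insert A C. g A' \<le> g A0" using A0 by auto
  then show ?thesis using False A0 unfolding best_of_def by auto
 qed
qed

text \<open>Monotonicity: a minimal chosen superset of an unchosen scenario has an unchosen child above it.\<close>

lemma unchosen_below_candidate:
 assumes "\<And>A. A \<in> \<C> ==> finite A" "U \<in> \<C>" "A \<subseteq> U" "A \<notin> \<C>"
 shows "\<exists>A'\<in>\<C>. \<exists>e\<in>A'. A' - {e} \<notin> \<C> \<and> A \<subseteq> A' - {e}"
proof -
 let ?S = "{A'\<in>\<C>. A \<subseteq> A'}"
 have "U \<in> ?S" using assms by simp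
 then obtain A' where A': "A' \<in> ?S" "\<forall>A''. A'' \<in> ?S --> card A' \<le> card A''"
  using ex_has_least_nat[of "\<lambda>A'. A' \<in> ?S" U card] by blast
 then have "A \<subset> A'" using assms(4) by auto
 then obtain e where e: "e \<in> A'" "e \<notin> A" by auto
 have "A' - {e} \<notin> \<C>"
 proof
  assume "A' - {e} \<in> \<C>"
  then have "A' - {e} \<in> ?S" using A' e by auto
  then have "card A' \<le> card (A' - {e})" using A'(2) by blast
  moreover have "card (A' - {e}) < card A'" using e A'(1) assms(1) by (intro card_Diff1_less) auto
  ultimately show False by simp
 qed
 then show ?thesis using A' e by (intro bexI[of _ A'] bexI[of _ e]) auto
qed

context drso_machine
begin

lemma cor_fresh:
 assumes bd: "bd B L" and kk: "L 45 0 = of_nat kk" "Suc kk \<le> Z" "Suc kk \<le> 2 ^ B" and N: "L 24 0 = of_nat N"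
  and cd: "\<And>i. i \<le> kk ==> L 27 (N + i) = of_nat (cd i)" and c: "L 51 0 = of_nat c"
  and Q: "\<And>L'. bd B L' ==> (\<And>b. b < 60 ==> b \<notin> {52, 53} ==> L' b = L b) ==>
   L' 52 0 = (if \<exists>i\<le>kk. cd i = c then 0 else 1) ==> Q L'"
 shows "cor fresh_prog L Q"
 unfolding fresh_prog_def
proof (rule cor_seq_asg[OF bd])
 let ?L = "set_cell 52 0 (ev (Kn 1) L) L"
 let ?b = "ifp (eqtest (Ix 27 (pl (Vr 24) (Vr 53))) (Vr 51)) (asg 52 (Kn 0)) skip"
 let ?Inv = "\<lambda>j L2. L2 52 0 = (if \<exists>i<j. cd i = c then 0 else (1::rat))"
 assume bd0: "bd B ?L"
 show "cor (floop 53 (pl (Vr 45) (Kn 1)) ?b) ?L Q"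
 proof (rule cor_floop[where N = "Suc kk" and Inv = ?Inv, OF bd0])
  fix j L2 assume j: "j < Suc kk" and bd2: "bd B L2"
   and fr: "\<And>b. b < 60 ==> b \<noteq> 53 ==> b \<notin> wr ?b ==> L2 b = ?L b"
   and j2: "L2 53 0 = of_nat j" and inv: "?Inv j L2"
  have test: "ev (eqtest (Ix 27 (pl (Vr 24) (Vr 53))) (Vr 51)) L2 > 0 \<longleftrightarrow> cd j = c"
   using fr[of 24] fr[of 27] fr[of 51] N c j2 cd[of j] j by (simp add: eq_test_nat')
  show "cor ?b L2 (\<lambda>L3. ?Inv (Suc j) (set_cell 53 0 (of_nat (Suc j)) L3))"
  proof (rule cor_ifp[OF bd2])
   assume "ev (eqtest (Ix 27 (pl (Vr 24) (Vr 53))) (Vr 51)) L2 > 0"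
   then have "\<exists>i<Suc j. cd i = c" using test by auto
   then show "cor (asg 52 (Kn 0)) L2 (\<lambda>L3. ?Inv (Suc j) (set_cell 53 0 (of_nat (Suc j)) L3))"
    by (intro cor_asg[OF bd2]) (simp_all add: eok_def)
  next
   assume "\<not> ev (eqtest (Ix 27 (pl (Vr 24) (Vr 53))) (Vr 51)) L2 > 0"
   then have "(\<exists>i<Suc j. cd i = c) = (\<exists>i<j. cd i = c)" using test by (auto simp: less_Suc_eq)
   then show "cor skip L2 (\<lambda>L3. ?Inv (Suc j) (set_cell 53 0 (of_nat (Suc j)) L3))"
    using inv by (intro cor_skip[OF bd2]) simp
  qed (simp add: eok_def)
 next
  fix L2 assume bd2: "bd B L2" and fr: "\<And>b. b < 60 ==> b \<noteq> 53 ==> b \<notin> wr ?b ==> L2 b = ?L b"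
   and inv: "?Inv (Suc kk) L2"
  show "Q L2" by (rule Q[OF bd2]) (use inv fr in \<open>auto simp: less_Suc_eq_le\<close>)
 qed (use kk in auto)
qed (auto simp: eok_def)

lemma code_less: "A \<in> scenarios I ==> set_encode A < 2 ^ usize I"
 by (rule set_encode_less) (auto simp: scenarios_def ground_def)

lemma code_le: "A \<in> scenarios I ==> set_encode A \<le> 2 ^ B"
 using code_less[of A] pow_u(1)[of "usize I"] by linarith

lemma decode_scenario: "A \<in> scenarios I ==> set_decode (set_encode A) \<inter> {..<usize I} = A"
 using scenarios_finite[of A I] by (auto simp: scenarios_def ground_def)

lemma cor_candidate:
 assumes bd: "bd B L" and par: "params L"
  and kk: "L 45 0 = of_nat kk" "Suc kk \<le> Z" "Suc kk \<le> 2 ^ B" and N: "L 24 0 = of_nat N"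
  and cs: "\<And>i. i \<le> kk ==> cs i \<in> scenarios I" "\<And>i. i \<le> kk ==> L 27 (N + i) = of_nat (set_encode (cs i))"
  and j: "L 48 0 = of_nat j" "j \<le> kk" and e: "L 14 0 = of_nat (2 ^ e)" "e \<in> cs j"
  and x: "get_vec 39 (mdim I) L = x" and rbg: "\<And>A. A \<in> scenarios I ==> rb B (value_orc I x A)"
  and Q: "\<And>L'. bd B L' ==> (\<And>b. b < 60 ==> b \<notin> {10, 11, 12, 46, 47, 51, 52, 53, 54} ==> L' b = L b) ==>
   L' 46 0 = (if cs j - {e} \<notin> cs ` {..kk} \<and> L 47 0 < value_orc I x (cs j - {e})
         then of_nat (set_encode (cs j - {e})) else L 46 0) ==>
   L' 47 0 = (if cs j - {e} \<notin> cs ` {..kk} \<and> L 47 0 < value_orc I x (cs j - {e})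
         then value_orc I x (cs j - {e}) else L 47 0) ==> Q L'"
 shows "cor candidate_prog L Q"
proof -
 let ?A = "cs j - {e}"
 let ?c = "set_encode ?A"
 have A: "?A \<in> scenarios I" using cs(1)[OF j(2)] by (auto simp: scenarios_def)
 have fin: "finite (cs i)" if "i \<le> kk" for i using scenarios_finite[OF cs(1)[OF that]] .
 have c: "of_nat (set_encode (cs j)) - of_nat (2 ^ e) = (of_nat ?c :: rat)"
  using set_encode_remove[OF fin[OF j(2)] e(2)] by (simp add: of_nat_diff)
 have fresh_iff: "(\<exists>i\<le>kk. set_encode (cs i) = ?c) \<longleftrightarrow> ?A \<in> cs ` {..kk}"
 proof
  assume "\<exists>i\<le>kk. set_encode (cs i) = ?c"
  then obtain i where i: "i \<le> kk" "set_encode (cs i) = ?c" by blast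
  then have "cs i = ?A" using set_encode_eq[OF fin[OF i(1)] scenarios_finite[OF A]] by simp
  then show "?A \<in> cs ` {..kk}" using i(1) by (metis atMost_iff imageI)
 next
  assume "?A \<in> cs ` {..kk}"
  then obtain i where i: "i \<le> kk" "?A = cs i" by auto
  then show "\<exists>i\<le>kk. set_encode (cs i) = ?c" by (intro exI[of _ i]) (simp only: simp_thms)
 qed
 have ev51: "ev (mi (Ix 27 (pl (Vr 24) (Vr 48))) (Vr 14)) L = of_nat ?c"
  using N j e cs(2)[OF j(2)] c by simp
 let ?rec = "ifp (mi (Vr 54) (Vr 47)) (Seq (asg 47 (Vr 54)) (asg 46 (Vr 51))) skip"
 show ?thesis unfolding candidate_prog_def
 proof (rule cor_seq_asg[OF bd])
  let ?L = "set_cell 51 0 (ev (mi (Ix 27 (pl (Vr 24) (Vr 48))) (Vr 14)) L) L"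
  assume bd1: "bd B ?L"
  show "cor (Seq fresh_prog (ifp (Vr 52) (Seq (decode_prog 51) (Seq (Value 54 39 10) ?rec)) skip)) ?L Q"
  proof (rule cor_seq)
   show "cor fresh_prog ?L (\<lambda>L'. L' 52 0 = (if ?A \<in> cs ` {..kk} then 0 else 1))"
    by (rule cor_fresh[OF bd1, where kk = kk and N = N and cd = "\<lambda>i. set_encode (cs i)" and c = ?c])
      (use kk N cs(2) ev51 fresh_iff in \<open>auto simp del: ev.simps\<close>)
   fix L1 assume bd2: "bd B L1" and fr1: "\<And>b. b < 60 ==> b \<notin> wr fresh_prog ==> L1 b = ?L b"
    and fresh: "L1 52 0 = (if ?A \<in> cs ` {..kk} then 0 else (1::rat))"
   show "cor (ifp (Vr 52) (Seq (decode_prog 51) (Seq (Value 54 39 10) ?rec)) skip) L1 Q"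
   proof (rule cor_ifp[OF bd2])
    assume "\<not> ev (Vr 52) L1 > 0"
    then have inA: "?A \<in> cs ` {..kk}" using fresh by (simp split: if_splits)
    have fr: "L1 b = L b" if "b < 60" "b \<notin> {51, 52, 53}" for b using fr1[of b] that by simp
    show "cor skip L1 Q" by (rule cor_skip[OF bd2], rule Q[OF bd2]) (simp_all add: inA fr)
   next
    assume "ev (Vr 52) L1 > 0"
    then have nA: "?A \<notin> cs ` {..kk}" using fresh by (simp split: if_splits)
    show "cor (Seq (decode_prog 51) (Seq (Value 54 39 10) ?rec)) L1 Q"
    proof (rule cor_seq[where ?Q1.0 = "\<lambda>L'. get_scenario 10 (usize I) L' = ?A"])
     show "cor (decode_prog 51) L1 (\<lambda>L'. get_scenario 10 (usize I) L' = ?A)"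
     proof (rule cor_decode[OF bd2, where n = ?c])
      show "params L1" using fr1[of 0] fr1[of "Suc 0"] by (intro params_cong[OF par]) auto
      show "L1 51 0 = of_nat ?c" using fr1[of 51] ev51 by (simp del: ev.simps)
     qed (use decode_scenario[OF A] in auto)
     fix L2 assume bd3: "bd B L2" and fr2: "\<And>b. b < 60 ==> b \<notin> wr (decode_prog 51) ==> L2 b = L1 b"
      and sc: "get_scenario 10 (usize I) L2 = ?A"
     have x2: "get_vec 39 (mdim I) L2 = x" using x fr2[of 39] fr1[of 39] by (simp add: get_vec_def)
     have v: "L2 47 = L 47" "L2 46 = L 46" "L2 51 0 = of_nat ?c"
      using fr2[of 47] fr1[of 47] fr2[of 46] fr1[of 46] fr2[of 51] fr1[of 51] ev51 by (auto simp del: ev.simps)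
     have fr: "L2 b = L b" if "b < 60" "b \<notin> {10, 11, 12, 46, 47, 51, 52, 53, 54}" for b
      using fr2[of b] fr1[of b] that by auto
     let ?L3 = "set_cell 54 0 (value_orc I x ?A) L2"
     show "cor (Seq (Value 54 39 10) ?rec) L2 Q"
     proof (rule cor_seq[OF cor_Value[OF bd3, where Q = "\<lambda>L'. L' = ?L3"]])
      fix L3 assume bd4: "bd B L3" and L3: "L3 = ?L3"
      show "cor ?rec L3 Q"
      proof (rule cor_ifp[OF bd4])
       assume "ev (mi (Vr 54) (Vr 47)) L3 > 0"
       then have gt: "L 47 0 < value_orc I x ?A" using L3 v by simp
       show "cor (Seq (asg 47 (Vr 54)) (asg 46 (Vr 51))) L3 Q"
       proof (rule cor_seq_asg[OF bd4 _ _ _ cor_asg])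
        show "Q (set_cell 46 0 (ev (Vr 51) (set_cell 47 0 (ev (Vr 54) L3) L3)) (set_cell 47 0 (ev (Vr 54) L3) L3))"
        proof (rule Q)
         show "bd B (set_cell 46 0 (ev (Vr 51) (set_cell 47 0 (ev (Vr 54) L3) L3)) (set_cell 47 0 (ev (Vr 54) L3) L3))"
          using L3 v rbg[OF A] rb_nat[OF code_le[OF A]] by (intro bd_set_cell bd4) simp_all
        qed (simp_all add: gt nA L3 v fr)
       qed (simp_all add: eok_def L3 v rbg[OF A] rb_nat[OF code_le[OF A]])
      next
       assume "\<not> ev (mi (Vr 54) (Vr 47)) L3 > 0"
       then have ngt: "\<not> L 47 0 < value_orc I x ?A" using L3 v by simp
       show "cor skip L3 Q" by (rule cor_skip[OF bd4], rule Q[OF bd4]) (simp_all add: ngt L3 v fr)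
      qed (simp add: eok_def)
     qed (use x2 sc rbg[OF A] in auto)
    qed
   qed (simp add: eok_def)
  qed
 qed (use ev51 rb_nat[OF code_le[OF A]] in \<open>auto simp: eok_def simp del: ev.simps\<close>)
qed

lemma cor_next:
 assumes bd: "bd B L" and par: "params L"
  and kk: "L 45 0 = of_nat kk" "Suc kk \<le> Z" "Suc kk \<le> 2 ^ B" and N: "L 24 0 = of_nat N"
  and cs: "\<And>i. i \<le> kk ==> cs i \<in> scenarios I" "\<And>i. i \<le> kk ==> L 27 (N + i) = of_nat (set_encode (cs i))"
  and x: "get_vec 39 (mdim I) L = x" and rbg: "\<And>A. A \<in> scenarios I ==> rb B (value_orc I x A)"
  and g0: "\<And>A. A \<in> scenarios I ==> 0 \<le> value_orc I x A"
  and ini: "L 46 0 = 0" "L 47 0 = -1"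
  and Q: "\<And>L'. bd B L' ==>
   (\<And>b. b < 60 ==> b \<notin> {10, 11, 12, 14, 46, 47, 48, 49, 50, 51, 52, 53, 54} ==> L' b = L b) ==>
   best_of ({cs j - {e} |j e. j \<le> kk \<and> e \<in> cs j} - cs ` {..kk}) (value_orc I x) (L' 46 0) (L' 47 0) ==> Q L'"
 shows "cor next_prog L Q"
proof -
 let ?g = "value_orc I x" and ?ch = "cs ` {..kk}"
 define C where "C j = {cs j' - {e} |j' e. j' < j \<and> e \<in> cs j'} - ?ch" for j
 define D where "D j e = {cs j - {e'} |e'. e' < e \<and> e' \<in> cs j} - ?ch" for j e
 let ?b50 = "asg 50 (Fl (di (Ix 27 (pl (Vr 24) (Vr 48))) (Vr 14)))"
 let ?if = "ifp (mi (Vr 50) (ti (Kn 2) (Fl (di (Vr 50) (Kn 2))))) candidate_prog skip"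
 let ?in = "Seq ?b50 (Seq ?if (dbl 14))"
 let ?loop = "floop 49 eU ?in"
 let ?fr = "\<lambda>L'. \<forall>b<60. b \<notin> {10, 11, 12, 14, 46, 47, 48, 49, 50, 51, 52, 53, 54} --> L' b = L b"
 let ?Inv = "\<lambda>j e L2. best_of (C j \<union> D j e) ?g (L2 46 0) (L2 47 0) \<and> L2 14 0 = of_nat (2 ^ e)"
 have facts: "params L'" "L' 45 0 = of_nat kk" "L' 24 0 = of_nat N" "L' 27 = L 27" "get_vec 39 (mdim I) L' = x"
  "L' (Suc 0) (Suc 0) = of_nat (usize I)"
  if "?fr L'" for L'
  using that kk N x par paramsD[OF par] params_cong[OF par, of L'] by (auto simp: get_vec_def)
 have inner: "cor ?loop L1 (\<lambda>L2. best_of (C (Suc j)) ?g (L2 46 0) (L2 47 0))"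
  if bd1: "bd B L1" and fr1: "?fr L1" and j1: "L1 48 0 = of_nat j" "j \<le> kk"
   and inv1: "best_of (C j) ?g (L1 46 0) (L1 47 0)" "L1 14 0 = 1" for L1 j
 proof (rule cor_floop[where N = "usize I" and Inv = "?Inv j", OF bd1])
  have fin: "finite (cs j)" using scenarios_finite[OF cs(1)[OF j1(2)]] .
  fix e L2 assume e: "e < usize I" and bd2: "bd B L2"
   and fr: "\<And>b. b < 60 ==> b \<noteq> 49 ==> b \<notin> wr ?in ==> L2 b = L1 b"
   and e2: "L2 49 0 = of_nat e" and inv: "?Inv j e L2"
  have fr2: "?fr L2" using fr fr1 by auto
  have j2: "L2 48 0 = of_nat j" using fr[of 48] j1 by simp
  let ?q = "set_encode (cs j) div 2 ^ e"
  have ev50: "ev (Fl (di (Ix 27 (pl (Vr 24) (Vr 48))) (Vr 14))) L2 = of_nat ?q"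
   using facts[OF fr2] j2 inv cs(2)[OF j1(2)] floor_divide_of_nat_eq[of "set_encode (cs j)" "2 ^ e", where ?'a = rat]
   by simp
  have "?q \<le> 2 ^ B" using code_le[OF cs(1)[OF j1(2)]] div_le_dividend order_trans by blast
  note rb50 = rb_nat[OF this]
  have rbp: "rb B (2 ^ e + 2 ^ e)" using rb_nat[OF pow_u(2), of e] e by simp
  have mem: "odd ?q \<longleftrightarrow> e \<in> cs j" using set_encode_inverse[OF fin] unfolding set_decode_def by auto
  show "cor ?in L2 (\<lambda>L3. ?Inv j (Suc e) (set_cell 49 0 (of_nat (Suc e)) L3))"
  proof (rule cor_seq_asg[OF bd2])
   let ?L2 = "set_cell 50 0 (ev (Fl (di (Ix 27 (pl (Vr 24) (Vr 48))) (Vr 14))) L2) L2"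
   assume bd2': "bd B ?L2"
   have fr2': "?fr ?L2" using fr2 by simp
   show "cor (Seq ?if (dbl 14)) ?L2 (\<lambda>L3. ?Inv j (Suc e) (set_cell 49 0 (of_nat (Suc e)) L3))"
   proof (rule cor_seq[where ?Q1.0 = "\<lambda>L3. best_of (C j \<union> D j (Suc e)) ?g (L3 46 0) (L3 47 0)"])
    have test: "ev (mi (Vr 50) (ti (Kn 2) (Fl (di (Vr 50) (Kn 2))))) ?L2 = of_nat (?q mod 2)"
     unfolding ev50 by (simp add: rat_mod_2)
    show "cor ?if ?L2 (\<lambda>L3. best_of (C j \<union> D j (Suc e)) ?g (L3 46 0) (L3 47 0))"
    proof (rule cor_ifp[OF bd2'])
     assume "ev (mi (Vr 50) (ti (Kn 2) (Fl (di (Vr 50) (Kn 2))))) ?L2 > 0"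
     then have "?q mod 2 > 0" unfolding test by simp
     then have ej: "e \<in> cs j" using mem by (simp add: odd_iff_mod_2_eq_one)
     let ?A = "cs j - {e}"
     have A: "?A \<in> scenarios I" using cs(1)[OF j1(2)] by (auto simp: scenarios_def)
     have D: "D j (Suc e) = (if ?A \<in> ?ch then D j e else insert ?A (D j e))"
      using ej by (auto simp: D_def less_Suc_eq)
     show "cor candidate_prog ?L2 (\<lambda>L3. best_of (C j \<union> D j (Suc e)) ?g (L3 46 0) (L3 47 0))"
     proof (rule cor_candidate[OF bd2' facts(1)[OF fr2'], where kk = kk and N = N and cs = cs and j = j and e = e and x = x])
      fix L3 assume 46: "L3 46 0 = (if ?A \<notin> ?ch \<and> ?L2 47 0 < ?g ?A then of_nat (set_encode ?A) else ?L2 46 0)"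
       and 47: "L3 47 0 = (if ?A \<notin> ?ch \<and> ?L2 47 0 < ?g ?A then ?g ?A else ?L2 47 0)"
      show "best_of (C j \<union> D j (Suc e)) ?g (L3 46 0) (L3 47 0)"
      proof (cases "?A \<in> ?ch")
       case True
       then show ?thesis using inv by (simp add: D 46 47 del: ev.simps)
      next
       case False
       then have eqs: "L3 46 0 = (if L2 47 0 < ?g ?A then of_nat (set_encode ?A) else L2 46 0)"
        "L3 47 0 = (if L2 47 0 < ?g ?A then ?g ?A else L2 47 0)" using 46 47 by simp_all
       have un: "C j \<union> D j (Suc e) = insert ?A (C j \<union> D j e)" using False by (simp add: D)
       show ?thesis unfolding eqs un using inv g0[OF A] by (intro best_of_insert) simp_all
      qed
     qed (use facts[OF fr2'] cs kk j1 j2 inv ej rbg in \<open>auto simp del: ev.simps\<close>)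
    next
     assume "\<not> ev (mi (Vr 50) (ti (Kn 2) (Fl (di (Vr 50) (Kn 2))))) ?L2 > 0"
     then have "\<not> ?q mod 2 > 0" unfolding test by simp
     then have "e \<notin> cs j" using mem by (simp add: odd_iff_mod_2_eq_one)
     then have "D j (Suc e) = D j e" by (auto simp: D_def less_Suc_eq)
     then show "cor skip ?L2 (\<lambda>L3. best_of (C j \<union> D j (Suc e)) ?g (L3 46 0) (L3 47 0))"
      using inv by (intro cor_skip[OF bd2']) (simp del: ev.simps)
    qed (simp add: eok_def)
    fix L3 assume bd3: "bd B L3" and fr3: "\<And>b. b < 60 ==> b \<notin> wr ?if ==> L3 b = ?L2 b"
     and best: "best_of (C j \<union> D j (Suc e)) ?g (L3 46 0) (L3 47 0)"
    have 14: "L3 14 0 = 2 ^ e" using fr3[of 14] inv by simp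
    show "cor (dbl 14) L3 (\<lambda>L3. ?Inv j (Suc e) (set_cell 49 0 (of_nat (Suc e)) L3))"
     by (rule cor_asg[OF bd3]) (use best 14 rbp in \<open>auto simp: eok_def\<close>)
   qed
  qed (use ev50 rb50 in \<open>auto simp: eok_def simp del: ev.simps\<close>)
 next
  fix L2 assume "?Inv j (usize I) L2"
  moreover have "C j \<union> D j (usize I) = C (Suc j)"
   using cs(1)[OF j1(2)] by (auto simp: C_def D_def less_Suc_eq scenarios_def ground_def)
  ultimately show "best_of (C (Suc j)) ?g (L2 46 0) (L2 47 0)" by simp
 next
  have "D j 0 = {}" by (simp add: D_def)
  then show "?Inv j 0 (set_cell 49 0 0 L1)" using inv1 by simp
 qed (use facts[OF fr1] u_le uZ in auto)
 show ?thesis unfolding next_prog_def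
 proof (rule cor_floop[where N = "Suc kk" and Inv = "\<lambda>j L1. best_of (C j) ?g (L1 46 0) (L1 47 0)", OF bd])
  fix j L1 assume j: "j < Suc kk" and bd1: "bd B L1"
   and fr: "\<And>b. b < 60 ==> b \<noteq> 48 ==> b \<notin> wr (Seq (asg 14 (Kn 1)) ?loop) ==> L1 b = L b"
   and j1: "L1 48 0 = of_nat j" and inv: "best_of (C j) ?g (L1 46 0) (L1 47 0)"
  show "cor (Seq (asg 14 (Kn 1)) ?loop) L1
   (\<lambda>L2. best_of (C (Suc j)) ?g (set_cell 48 0 (of_nat (Suc j)) L2 46 0) (set_cell 48 0 (of_nat (Suc j)) L2 47 0))"
  proof (rule cor_seq_asg[OF bd1])
   assume "bd B (set_cell 14 0 (ev (Kn 1) L1) L1)"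
   from inner[OF this, of j]
   show "cor ?loop (set_cell 14 0 (ev (Kn 1) L1) L1)
    (\<lambda>L2. best_of (C (Suc j)) ?g (set_cell 48 0 (of_nat (Suc j)) L2 46 0) (set_cell 48 0 (of_nat (Suc j)) L2 47 0))"
    using fr j1 j inv by simp
  qed (auto simp: eok_def)
 next
  fix L1 assume bd1: "bd B L1"
   and fr: "\<And>b. b < 60 ==> b \<noteq> 48 ==> b \<notin> wr (Seq (asg 14 (Kn 1)) ?loop) ==> L1 b = L b"
   and inv: "best_of (C (Suc kk)) ?g (L1 46 0) (L1 47 0)"
  have "C (Suc kk) = {cs j - {e} |j e. j \<le> kk \<and> e \<in> cs j} - ?ch" by (auto simp: C_def less_Suc_eq_le)
  then show "Q L1" using inv by (intro Q[OF bd1]) (use fr in auto)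
 next
  have "C 0 = {}" by (simp add: C_def)
  then show "best_of (C 0) ?g (set_cell 48 0 0 L 46 0) (set_cell 48 0 0 L 47 0)" using ini by (simp add: best_of_def)
 qed (use kk in auto)
qed

end

lemma top_seq_extend:
 assumes top: "top_seq (scenarios I) g (Suc kk) cs" and U: "cs 0 = {..<usize I}"
  and mono: "\<And>A A'. A \<in> scenarios I ==> A' \<in> scenarios I ==> A \<subseteq> A' ==> g A \<le> g A'"
  and best: "best_of ({cs j - {e} |j e. j \<le> kk \<and> e \<in> cs j} - cs ` {..kk}) g bc bv"
 shows "\<exists>A\<in>scenarios I. bc = of_nat (set_encode A) \<and> top_seq (scenarios I) g (Suc (Suc kk)) (cs(Suc kk := A))"
proof -
 let ?S = "scenarios I" and ?ch = "cs ` {..kk}"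
 let ?C = "{cs j - {e} |j e. j \<le> kk \<and> e \<in> cs j} - ?ch"
 have csS: "cs j \<in> ?S" if "j \<le> kk" for j using top that by (simp add: top_seq_def)
 have below: "\<exists>A'\<in>?C. A \<subseteq> A'" if "A \<in> ?S" "A \<notin> ?ch" for A
 proof -
  have "\<exists>A'\<in>?ch. \<exists>e\<in>A'. A' - {e} \<notin> ?ch \<and> A \<subseteq> A' - {e}"
  proof (rule unchosen_below_candidate)
   show "\<And>A. A \<in> ?ch ==> finite A" using csS scenarios_finite by blast
   show "cs 0 \<in> ?ch" by blast
   show "A \<subseteq> cs 0" using that U by (simp add: scenarios_def ground_def)
  qed (rule that(2))
  then obtain j e where "j \<le> kk" "e \<in> cs j" "cs j - {e} \<notin> ?ch" "A \<subseteq> cs j - {e}" by blast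
  then show ?thesis by blast
 qed
 have CS: "?C \<subseteq> ?S" using csS by (fastforce simp: scenarios_def)
 have ext: "top_seq ?S g (Suc (Suc kk)) (cs(Suc kk := A))"
  if A: "A \<in> ?S" "\<not> ?S \<subseteq> ?ch ==> A \<notin> ?ch \<and> (\<forall>A'\<in>?S. A' \<notin> ?ch --> g A' \<le> g A)" for A
  unfolding top_seq_def
 proof (intro allI impI)
  fix k assume k: "k < Suc (Suc kk)"
  have im: "(cs(Suc kk := A)) ` {..<k} = cs ` {..<k}" using k by (intro image_cong) auto
  show "(cs(Suc kk := A)) k \<in> ?S \<and> (\<not> ?S \<subseteq> (cs(Suc kk := A)) ` {..<k} -->
    (cs(Suc kk := A)) k \<notin> (cs(Suc kk := A)) ` {..<k} \<and>
    (\<forall>A'\<in>?S. A' \<notin> (cs(Suc kk := A)) ` {..<k} --> g A' \<le> g ((cs(Suc kk := A)) k)))"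
  proof (cases "k = Suc kk")
   case True
   then show ?thesis unfolding im using A by (simp add: lessThan_Suc_atMost)
  next
   case False
   then show ?thesis unfolding im using top k by (simp add: top_seq_def)
  qed
 qed
 show ?thesis
 proof (cases "?C = {}")
  case True
  then have "bc = 0" using best unfolding best_of_def by blast
  moreover have "?S \<subseteq> ?ch" using below True by blast
  ultimately show ?thesis using ext[of "{}"] by (intro bexI[of _ "{}"]) (auto simp: scenarios_def)
 next
  case False
  then obtain A where A: "A \<in> ?C" "bc = of_nat (set_encode A)" "\<forall>A'\<in>?C. g A' \<le> g A"
   using best by (auto simp: best_of_def)
  have AS: "A \<in> ?S" using A(1) CS by blast
  have "g A' \<le> g A" if A': "A' \<in> ?S" "A' \<notin> ?ch" for A'
  proof -
   obtain A'' where A'': "A'' \<in> ?C" "A' \<subseteq> A''" using below[OF A'] by blast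
   then have "g A' \<le> g A''" using CS A' by (intro mono) blast+
   also have "\<dots> \<le> g A" using A A'' by blast
   finally show ?thesis .
  qed
  then have "top_seq ?S g (Suc (Suc kk)) (cs(Suc kk := A))" using A(1) by (intro ext[OF AS]) blast
  then show ?thesis using A AS by blast
 qed
qed

context drso_machine
begin

lemma cor_top:
 assumes bd: "bd B L" and par: "params L" and N: "L 24 0 = of_nat N" and K: "L 25 0 = of_nat K" "1 \<le> K" "K \<le> Z" "K \<le> 2 ^ B"
  and full: "L 15 0 = of_nat (2 ^ usize I - 1)"
  and x: "get_vec 39 (mdim I) L = x" and rbg: "\<And>A. A \<in> scenarios I ==> rb B (value_orc I x A)"
  and g0: "\<And>A. A \<in> scenarios I ==> 0 \<le> value_orc I x A"
  and mono: "\<And>A A'. A \<in> scenarios I ==> A' \<in> scenarios I ==> A \<subseteq> A' ==> value_orc I x A \<le> value_orc I x A'"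
  and Q: "\<And>L' cs. bd B L' ==>
   (\<And>b. b < 60 ==> b \<notin> {10, 11, 12, 14, 27, 45, 46, 47, 48, 49, 50, 51, 52, 53, 54} ==> L' b = L b) ==>
   top_seq (scenarios I) (value_orc I x) K cs ==> (\<And>k. k < K ==> L' 27 (N + k) = of_nat (set_encode (cs k))) ==>
   (\<And>j. j < N ==> L' 27 j = L 27 j) ==> Q L'"
 shows "cor top_prog L Q"
proof -
 let ?S = "scenarios I" and ?g = "value_orc I x"
 let ?Inv = "\<lambda>kk L1. \<exists>cs. top_seq ?S ?g (Suc kk) cs \<and> cs 0 = {..<usize I} \<and>
   (\<forall>k\<le>kk. L1 27 (N + k) = of_nat (set_encode (cs k))) \<and> (\<forall>j<N. L1 27 j = L 27 j)"
 let ?ini = "asg 47 (mi (Kn 0) (Kn 1))"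
 let ?fin = "put 27 (pl (pl (Vr 24) (Vr 45)) (Kn 1)) (Vr 46)"
 let ?body = "Seq (asg 46 (Kn 0)) (Seq ?ini (Seq next_prog ?fin))"
 have rbF: "rb B (of_nat (2 ^ usize I - 1))"
 proof (rule rb_nat)
  have "(2::nat) ^ usize I - 1 \<le> 2 ^ usize I" by (rule diff_le_self)
  then show "(2::nat) ^ usize I - 1 \<le> 2 ^ B" using pow_u(1)[of "usize I"] by linarith
 qed
 have body: "cor ?body L1 (\<lambda>L2. ?Inv (Suc kk) (set_cell 45 0 (of_nat (Suc kk)) L2))"
  if kk: "Suc kk < K" and bd1: "bd B L1" and inv: "?Inv kk L1" and k1: "L1 45 0 = of_nat kk"
   and par1: "params L1" and N1: "L1 24 0 = of_nat N" and x1: "get_vec 39 (mdim I) L1 = x" for kk L1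
 proof -
  obtain cs where cs: "top_seq ?S ?g (Suc kk) cs" "cs 0 = {..<usize I}"
   "\<forall>k\<le>kk. L1 27 (N + k) = of_nat (set_encode (cs k))" "\<forall>j<N. L1 27 j = L 27 j" using inv by blast
  have csS: "cs i \<in> ?S" if "i \<le> kk" for i using cs(1) that by (simp add: top_seq_def)
  let ?L2 = "set_cell 46 0 (ev (Kn 0) L1) L1"
  let ?L3 = "set_cell 47 0 (ev (mi (Kn 0) (Kn 1)) ?L2) ?L2"
  have nxt: "cor next_prog ?L3 (\<lambda>L4. \<exists>A\<in>?S. L4 46 0 = of_nat (set_encode A) \<and> top_seq ?S ?g (Suc (Suc kk)) (cs(Suc kk := A)))"
   if bd3: "bd B ?L3"
  proof (rule cor_next[OF bd3, where kk = kk and N = N and cs = cs and x = x])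
   show "params ?L3" using par1 by simp
   show "get_vec 39 (mdim I) ?L3 = x" using x1 by (simp add: get_vec_def)
   fix L4 assume "best_of ({cs j - {e} |j e. j \<le> kk \<and> e \<in> cs j} - cs ` {..kk}) ?g (L4 46 0) (L4 47 0)"
   from top_seq_extend[OF cs(1,2) mono this]
   show "\<exists>A\<in>?S. L4 46 0 = of_nat (set_encode A) \<and> top_seq ?S ?g (Suc (Suc kk)) (cs(Suc kk := A))" by blast
  qed (use k1 kk K N1 cs(3) csS rbg g0 in \<open>simp_all\<close>)
  show ?thesis
  proof (rule cor_seq_asg[OF bd1 _ _ _ cor_seq_asg])
   assume bd2: "bd B ?L2" and bd3: "bd B ?L3"
   show "cor (Seq next_prog ?fin) ?L3 (\<lambda>L2. ?Inv (Suc kk) (set_cell 45 0 (of_nat (Suc kk)) L2))"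
   proof (rule cor_seq[OF nxt[OF bd3]])
    fix L4 assume bd4: "bd B L4" and fr4: "\<And>b. b < 60 ==> b \<notin> wr next_prog ==> L4 b = ?L3 b"
     and "\<exists>A\<in>?S. L4 46 0 = of_nat (set_encode A) \<and> top_seq ?S ?g (Suc (Suc kk)) (cs(Suc kk := A))"
    then obtain A where A: "A \<in> ?S" "L4 46 0 = of_nat (set_encode A)" "top_seq ?S ?g (Suc (Suc kk)) (cs(Suc kk := A))"
     by blast
    have v: "L4 24 0 = of_nat N" "L4 45 0 = of_nat kk" "L4 27 = L1 27"
     using fr4[of 24] fr4[of 45] fr4[of 27] N1 k1 by simp_all
    have ix: "index_of (ev (pl (pl (Vr 24) (Vr 45)) (Kn 1)) L4) = Suc (N + kk)" using v by simp
    show "cor ?fin L4 (\<lambda>L2. ?Inv (Suc kk) (set_cell 45 0 (of_nat (Suc kk)) L2))"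
    proof (rule cor_put[OF bd4])
     show "?Inv (Suc kk) (set_cell 45 0 (of_nat (Suc kk)) (set_cell 27 (index_of (ev (pl (pl (Vr 24) (Vr 45)) (Kn 1)) L4)) (ev (Vr 46) L4) L4))"
      unfolding ix
     proof (intro exI[of _ "cs(Suc kk := A)"] conjI allI impI)
      fix k assume "k \<le> Suc kk"
      then show "set_cell 45 0 (of_nat (Suc kk)) (set_cell 27 (Suc (N + kk)) (ev (Vr 46) L4) L4) 27 (N + k) =
       of_nat (set_encode ((cs(Suc kk := A)) k))"
       using cs(3) v A(2) by (cases "k = Suc kk") (simp_all add: set_cell_apply)
     next
      fix j assume "j < N"
      then show "set_cell 45 0 (of_nat (Suc kk)) (set_cell 27 (Suc (N + kk)) (ev (Vr 46) L4) L4) 27 j = L 27 j"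
       using cs(4) v by (simp add: set_cell_apply)
     qed (use A cs(2) in simp_all)
    qed (use A rb_nat[OF code_le[OF A(1)]] in \<open>simp_all add: eok_def\<close>)
   qed
  qed (simp_all add: eok_def rb_minus)
 qed
 show ?thesis unfolding top_prog_def
 proof (rule cor_seq_put[OF bd])
  let ?L = "set_cell 27 (index_of (ev (Vr 24) L)) (ev (Vr 15) L) L"
  assume bd0: "bd B ?L"
  show "cor (floop 45 (mi (Vr 25) (Kn 1)) ?body) ?L Q"
  proof (rule cor_floop[where N = "K - 1" and Inv = ?Inv, OF bd0])
   have "top_seq ?S ?g (Suc 0) (\<lambda>_. {..<usize I})"
    using mono full_scenario[of I] by (auto simp: top_seq_def scenarios_def ground_def)
   then show "?Inv 0 (set_cell 45 0 0 ?L)"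
    using N full by (intro exI[of _ "\<lambda>_. {..<usize I}"]) (simp add: set_encode_lessThan)
  next
   fix kk L1 assume "kk < K - 1" and bd1: "bd B L1" and fr: "\<And>b. b < 60 ==> b \<noteq> 45 ==> b \<notin> wr ?body ==> L1 b = ?L b"
    and k1: "L1 45 0 = of_nat kk" and inv: "?Inv kk L1"
   moreover have "params L1" using fr[of 0] fr[of "Suc 0"] by (intro params_cong[OF par]) simp_all
   moreover have "L1 24 0 = of_nat N" using fr[of 24] N by simp
   moreover have "get_vec 39 (mdim I) L1 = x" using fr[of 39] x by (simp add: get_vec_def)
   ultimately show "cor ?body L1 (\<lambda>L2. ?Inv (Suc kk) (set_cell 45 0 (of_nat (Suc kk)) L2))"
    by (intro body) auto
  next
   fix L1 assume bd1: "bd B L1" and fr: "\<And>b. b < 60 ==> b \<noteq> 45 ==> b \<notin> wr ?body ==> L1 b = ?L b"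
    and "?Inv (K - 1) L1"
   then obtain cs where cs: "top_seq ?S ?g (Suc (K - 1)) cs"
    "\<forall>k\<le>K - 1. L1 27 (N + k) = of_nat (set_encode (cs k))" "\<forall>j<N. L1 27 j = L 27 j" by blast
   show "Q L1"
   proof (rule Q[OF bd1, where cs = cs])
    show "top_seq ?S ?g K cs" using cs(1) K by simp
   qed (use cs fr in simp_all)
  qed (use K in \<open>simp_all add: of_nat_diff\<close>)
 qed (use full rbF in \<open>simp_all add: eok_def\<close>)
qed

lemma cor_weight:
 assumes bd: "bd B L" and par: "params L" and N: "L 24 0 = of_nat N" and j: "L 57 0 = of_nat j" and rem: "L 55 0 = rem"
  and rbs: "rb B (1 / of_nat N)" "rb B (rem - min (radius I) rem)"
  and Q: "\<And>L'. bd B L' ==> (\<And>b. b < 60 ==> b \<notin> {46, 55} ==> L' b = L b) ==>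
   L' 46 0 = (if j < N then 1 / of_nat N else min (radius I) rem) ==>
   L' 55 0 = (if j < N then rem else rem - min (radius I) rem) ==> Q L'"
 shows "cor weight_prog L Q"
 unfolding weight_prog_def
proof (rule cor_ifp[OF bd])
 assume "ev (mi (Vr 24) (Vr 57)) L > 0"
 then have jN: "j < N" using N j by simp
 show "cor (asg 46 (di (Kn 1) (Vr 24))) L Q"
 proof (rule cor_asg[OF bd])
  show "Q (set_cell 46 0 (ev (di (Kn 1) (Vr 24)) L) L)"
   by (rule Q) (use N rem jN rbs in \<open>simp_all add: bd_set_cell[OF bd]\<close>)
 qed (use N rbs in \<open>simp_all add: eok_def\<close>)
next
 assume "\<not> ev (mi (Vr 24) (Vr 57)) L > 0"
 then have jN: "\<not> j < N" using N j by simp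
 have r: "L (Suc 0) 3 = radius I" using paramsD[OF par] by simp
 have rbr: "rb B (radius I)" "rb B rem" using bdD[OF bd, of "Suc 0" 3] bdD[OF bd, of 55 0] r rem by simp_all
 show "cor (Seq (ifp (mi eR (Vr 55)) (asg 46 (Vr 55)) (asg 46 eR)) (asg 55 (mi (Vr 55) (Vr 46)))) L Q"
 proof (rule cor_seq)
  show "cor (ifp (mi eR (Vr 55)) (asg 46 (Vr 55)) (asg 46 eR)) L (\<lambda>L'. L' 46 0 = min (radius I) rem)"
   by (rule cor_ifp[OF bd _ cor_asg[OF bd] cor_asg[OF bd]]) (use r rem rbr in \<open>simp_all add: eok_def min_def\<close>)
  fix L1 assume bd1: "bd B L1" and fr: "\<And>b. b < 60 ==> b \<notin> wr (ifp (mi eR (Vr 55)) (asg 46 (Vr 55)) (asg 46 eR)) ==> L1 b = L b"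
   and 46: "L1 46 0 = min (radius I) rem"
  have 55: "L1 55 0 = rem" using fr[of 55] rem by simp
  show "cor (asg 55 (mi (Vr 55) (Vr 46))) L1 Q"
  proof (rule cor_asg[OF bd1])
   show "Q (set_cell 55 0 (ev (mi (Vr 55) (Vr 46)) L1) L1)"
    by (rule Q) (use 46 55 jN rbs fr in \<open>simp_all add: bd_set_cell[OF bd1]\<close>)
  qed (use 46 55 rbs in \<open>simp_all add: eok_def\<close>)
 qed
qed (simp add: eok_def)

lemma cor_record:
 assumes bd: "bd B L" and par: "params L"
  and Q: "\<And>L'. bd B L' ==> (\<And>b. b < 60 ==> b \<notin> {2, 34, 36} ==> L' b = L b) ==>
   (if L 56 0 < L 34 0 then L' 34 0 = L 56 0 \<and> (\<forall>k<mdim I. L' 2 k = L 39 k) else L' 34 0 = L 34 0 \<and> L' 2 = L 2) ==> Q L'"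
 shows "cor record_prog L Q"
 unfolding record_prog_def
proof (rule cor_ifp[OF bd])
 assume "ev (mi (Vr 34) (Vr 56)) L > 0"
 then have lt: "L 56 0 < L 34 0" by simp
 show "cor (Seq (asg 34 (Vr 56)) (floop 36 eM (put 2 (Vr 36) (Ix 39 (Vr 36))))) L Q"
 proof (rule cor_seq_asg[OF bd])
  let ?L = "set_cell 34 0 (ev (Vr 56) L) L" and ?b = "put 2 (Vr 36) (Ix 39 (Vr 36))"
  assume bd0: "bd B ?L"
  show "cor (floop 36 eM ?b) ?L Q"
  proof (rule cor_floop[where N = "mdim I" and Inv = "\<lambda>j L1. \<forall>k<j. L1 2 k = L 39 k", OF bd0])
   fix j L1 assume j: "j < mdim I" and bd1: "bd B L1"
    and fr: "\<And>b. b < 60 ==> b \<noteq> 36 ==> b \<notin> wr ?b ==> L1 b = ?L b"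
    and j1: "L1 36 0 = of_nat j" and inv: "\<forall>k<j. L1 2 k = L 39 k"
   have 39: "L1 39 = L 39" using fr[of 39] by simp
   show "cor ?b L1 (\<lambda>L2. \<forall>k<Suc j. set_cell 36 0 (of_nat (Suc j)) L2 2 k = L 39 k)"
    by (rule cor_put[OF bd1]) (use 39 j1 inv bdD[OF bd1, of 39 j] in \<open>simp_all add: eok_def less_Suc_eq\<close>)
  next
   fix L1 assume bd1: "bd B L1" and fr: "\<And>b. b < 60 ==> b \<noteq> 36 ==> b \<notin> wr ?b ==> L1 b = ?L b"
    and inv: "\<forall>k<mdim I. L1 2 k = L 39 k"
   show "Q L1" by (rule Q[OF bd1]) (use fr inv lt in simp_all)
  qed (use paramsD[OF par] mB mZ in simp_all)
 qed (use bdD[OF bd, of 56 0] in \<open>simp_all add: eok_def\<close>)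
next
 assume "\<not> ev (mi (Vr 34) (Vr 56)) L > 0"
 then show "cor skip L Q" by (intro cor_skip[OF bd], intro Q[OF bd]) simp_all
qed (simp add: eok_def)

lemma cor_objective:
 assumes bd: "bd B L" and par: "params L" and N: "L 24 0 = of_nat N" and K: "L 25 0 = of_nat K"
  and NK: "N + K \<le> Z" "N + K \<le> 2 ^ B" and mh: "L 28 0 = mh" "0 \<le> mh" and r0: "0 \<le> radius I" and K1: "1 \<le> K"
  and As: "\<And>j. j < N + K ==> As j \<in> scenarios I" "\<And>j. j < N + K ==> L 27 j = of_nat (set_encode (As j))"
  and x: "get_vec 39 (mdim I) L = x"
  and dim: "\<And>A. A \<in> scenarios I ==> dim_vec (subgrad_orc I x A) = mdim I"
  and wt: "\<And>j. wt j = (if j < N then 1 / of_nat N else fill (radius I) mh (j - N))"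
  and rb1: "\<And>A. A \<in> scenarios I ==> rb B (value_orc I x A)"
  and rb2: "\<And>A k. A \<in> scenarios I ==> k < mdim I ==> rb B (subgrad_orc I x A $ k)"
  and rb3: "rb B (1 / of_nat N)" "\<And>j. j \<le> K ==> rb B (max 0 (mh - of_nat j * radius I))"
  and rb4: "\<And>j. j \<le> mdim I ==> rb B (\<Sum>k<j. cost1 I $ k * x $ k)"
  and rb5: "\<And>j. j \<le> N + K ==> rb B ((\<Sum>k<mdim I. cost1 I $ k * x $ k) + (\<Sum>i<j. wt i * value_orc I x (As i)))"
  and rb6: "\<And>j k. j \<le> N + K ==> k < mdim I ==> rb B (cost1 I $ k + (\<Sum>i<j. wt i * subgrad_orc I x (As i) $ k))"
  and Q: "\<And>L'. bd B L' ==>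
   (\<And>b. b < 60 ==> b \<notin> {10, 11, 12, 36, 41, 46, 54, 55, 56, 57, 58, 59} ==> L' b = L b) ==>
   L' 56 0 = (\<Sum>k<mdim I. cost1 I $ k * x $ k) + (\<Sum>i<N + K. wt i * value_orc I x (As i)) ==>
   (\<And>k. k < mdim I ==> L' 41 k = cost1 I $ k + (\<Sum>i<N + K. wt i * subgrad_orc I x (As i) $ k)) ==> Q L'"
 shows "cor objective_prog L Q"
proof -
 let ?m = "mdim I"
 let ?base = "\<Sum>k<?m. cost1 I $ k * x $ k"
 let ?val = "\<lambda>j. ?base + (\<Sum>i<j. wt i * value_orc I x (As i))"
 let ?sg = "\<lambda>j k. cost1 I $ k + (\<Sum>i<j. wt i * subgrad_orc I x (As i) $ k)"
 \<comment> \<open>The mass still to be distributed before step \<open>j\<close>; it is untouched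
   during the first \<open>N\<close> steps, which belong to the samples.\<close>
 let ?rem = "\<lambda>j. if j \<le> N then mh else max 0 (mh - of_nat (j - N) * radius I)"
 have xk: "x $ k = L 39 k" if "k < ?m" for k using that unfolding x[symmetric] by (simp add: get_vec_def)
 let ?c1 = "asg 56 (pl (Vr 56) (ti (Ix 0 (Vr 36)) (Ix 39 (Vr 36))))"
 let ?c2 = "put 41 (Vr 36) (Ix 0 (Vr 36))"
 let ?init = "floop 36 eM (Seq ?c1 ?c2)"
 let ?b3 = "put 41 (Vr 36) (pl (Ix 41 (Vr 36)) (ti (Vr 46) (Ix 59 (Vr 36))))"
 let ?add = "floop 36 eM ?b3"
 let ?t3 = "Seq (asg 56 (pl (Vr 56) (ti (Vr 46) (Vr 54)))) ?add"
 let ?t2 = "Seq (Subgrad 59 39 10) (Seq weight_prog ?t3)"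
 let ?t1 = "Seq (decode_prog 58) (Seq (Value 54 39 10) ?t2)"
 let ?body = "Seq (asg 58 (Ix 27 (Vr 57))) ?t1"
 let ?loop = "floop 57 (pl (Vr 24) (Vr 25)) ?body"
 let ?Inv = "\<lambda>j L1. L1 55 0 = ?rem j \<and> L1 56 0 = ?val j \<and> (\<forall>k<?m. L1 41 k = ?sg j k)"
 let ?fr = "\<lambda>L'. \<forall>b<60. b \<notin> {10, 11, 12, 36, 41, 46, 54, 55, 56, 57, 58, 59} --> L' b = L b"
 have facts: "params L'" "L' 24 0 = of_nat N" "L' 25 0 = of_nat K" "L' 27 = L 27" "get_vec 39 ?m L' = x" "L' 39 = L 39"
  if "?fr L'" for L'
  using that N K x params_cong[OF par, of L'] by (simp_all add: get_vec_def)
 have init: "cor ?init L1 (\<lambda>L2. L2 56 0 = ?base \<and> (\<forall>k<?m. L2 41 k = cost1 I $ k))"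
  if bd1: "bd B L1" and fr1: "?fr L1" and z: "L1 56 0 = 0" for L1
 proof (rule cor_floop[where N = ?m and Inv = "\<lambda>j L2. L2 56 0 = (\<Sum>k<j. cost1 I $ k * x $ k) \<and> (\<forall>k<j. L2 41 k = cost1 I $ k)", OF bd1])
  fix j L2 assume j: "j < ?m" and bd2: "bd B L2"
   and fr: "\<And>b. b < 60 ==> b \<noteq> 36 ==> b \<notin> wr (Seq ?c1 ?c2) ==> L2 b = L1 b"
   and j2: "L2 36 0 = of_nat j" and inv: "L2 56 0 = (\<Sum>k<j. cost1 I $ k * x $ k) \<and> (\<forall>k<j. L2 41 k = cost1 I $ k)"
  have v: "L2 0 j = cost1 I $ j" "L2 39 j = x $ j"
   using fr[of 0] fr[of 39] facts[OF fr1] paramsD(9)[OF facts(1)[OF fr1] j] xk[OF j] by simp_all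
  show "cor (Seq ?c1 ?c2) L2 (\<lambda>L3. set_cell 36 0 (of_nat (Suc j)) L3 56 0 = (\<Sum>k<Suc j. cost1 I $ k * x $ k) \<and>
    (\<forall>k<Suc j. set_cell 36 0 (of_nat (Suc j)) L3 41 k = cost1 I $ k))"
   by (rule cor_seq_asg[OF bd2 _ _ _ cor_put])
     (use j2 v inv rb4[of "Suc j"] j bdD[OF bd2, of 0 j] in \<open>simp_all add: eok_def less_Suc_eq\<close>)
 qed (use z mB mZ paramsD[OF facts(1)[OF fr1]] in simp_all)
 have add: "cor ?add L1 (\<lambda>L2. \<forall>k<?m. L2 41 k = ?sg (Suc j) k)"
  if bd1: "bd B L1" and par1: "params L1" and j: "j < N + K" and w: "L1 46 0 = wt j"
   and s: "\<forall>k<?m. L1 59 k = subgrad_orc I x (As j) $ k" and inv: "\<forall>k<?m. L1 41 k = ?sg j k" for L1 j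
 proof (rule cor_floop[where N = ?m and Inv = "\<lambda>i L2. \<forall>k<?m. L2 41 k = (if k < i then ?sg (Suc j) k else ?sg j k)", OF bd1])
  fix i L2 assume i: "i < ?m" and bd2: "bd B L2"
   and fr: "\<And>b. b < 60 ==> b \<noteq> 36 ==> b \<notin> wr ?b3 ==> L2 b = L1 b"
   and i2: "L2 36 0 = of_nat i" and inv2: "\<forall>k<?m. L2 41 k = (if k < i then ?sg (Suc j) k else ?sg j k)"
  have e: "ev (pl (Ix 41 (Vr 36)) (ti (Vr 46) (Ix 59 (Vr 36)))) L2 = ?sg (Suc j) i"
   using i2 inv2 i w s fr[of 46] fr[of 59] by simp
  show "cor ?b3 L2 (\<lambda>L3. \<forall>k<?m. set_cell 36 0 (of_nat (Suc i)) L3 41 k = (if k < Suc i then ?sg (Suc j) k else ?sg j k))"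
  proof (rule cor_put[OF bd2])
   show "\<forall>k<?m. set_cell 36 0 (of_nat (Suc i)) (set_cell 41 (index_of (ev (Vr 36) L2))
     (ev (pl (Ix 41 (Vr 36)) (ti (Vr 46) (Ix 59 (Vr 36)))) L2) L2) 41 k = (if k < Suc i then ?sg (Suc j) k else ?sg j k)"
    unfolding e using inv2 i2 by (simp add: less_Suc_eq)
  qed (use rb6[of "Suc j" i] i j in \<open>simp_all only: e\<close>, simp_all add: eok_def)
 qed (use inv mB mZ paramsD[OF par1] in simp_all)
 have rem_step: "?rem (Suc j) = (if j < N then ?rem j else ?rem j - min (radius I) (?rem j))" for j
 proof (cases "j < N")
  case False
  then have "Suc j - N = Suc (j - N)" "\<not> Suc j \<le> N" by auto
  moreover have "?rem j = max 0 (mh - of_nat (j - N) * radius I)" using False mh(2) by (cases "j = N") auto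
  ultimately show ?thesis using False r0 by (simp add: algebra_simps min_def max_def)
 qed auto
 have wt_eq: "wt j = (if j < N then 1 / of_nat N else min (radius I) (?rem j))" for j
 proof (cases "j < N")
  case False
  then have "?rem j = max 0 (mh - of_nat (j - N) * radius I)" using mh(2) by (cases "j = N") auto
  then show ?thesis using False r0 unfolding wt fill_def by (auto simp: min_def max_def)
 qed (simp add: wt)
 have rb_rem: "rb B (?rem j)" if "j \<le> N + K" for j
  using that rb3(2)[of "j - N"] rb3(2)[of 0] mh(2) by auto
 have body: "cor ?body L1 (\<lambda>L2. ?Inv (Suc j) (set_cell 57 0 (of_nat (Suc j)) L2))"
  if j: "j < N + K" and bd1: "bd B L1" and fr1: "?fr L1" and j1: "L1 57 0 = of_nat j" and inv: "?Inv j L1" for j L1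
 proof (rule cor_seq_asg[OF bd1])
  note f1 = facts[OF fr1]
  have A: "As j \<in> scenarios I" and cj: "L 27 j = of_nat (set_encode (As j))" using As[OF j] by auto
  have e58: "ev (Ix 27 (Vr 57)) L1 = of_nat (set_encode (As j))" using f1 j1 cj by simp
  show "rb B (ev (Ix 27 (Vr 57)) L1)" unfolding e58 by (rule rb_nat[OF code_le[OF A]])
  let ?L1 = "set_cell 58 0 (ev (Ix 27 (Vr 57)) L1) L1"
  assume bd1': "bd B ?L1"
  show "cor ?t1 ?L1 (\<lambda>L2. ?Inv (Suc j) (set_cell 57 0 (of_nat (Suc j)) L2))"
  proof (rule cor_seq[where ?Q1.0 = "\<lambda>L2. get_scenario 10 (usize I) L2 = As j"])
   show "cor (decode_prog 58) ?L1 (\<lambda>L2. get_scenario 10 (usize I) L2 = As j)"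
    by (rule cor_decode[OF bd1', where n = "set_encode (As j)"]) (use f1 e58 decode_scenario[OF A] in \<open>simp_all del: ev.simps\<close>)
   fix L2 assume bd2: "bd B L2" and fr2: "\<And>b. b < 60 ==> b \<notin> wr (decode_prog 58) ==> L2 b = ?L1 b"
    and sc: "get_scenario 10 (usize I) L2 = As j"
   have frL2: "?fr L2" using fr1 fr2 by simp
   note f2 = facts[OF frL2]
   have inv2: "?Inv j L2" "L2 57 0 = of_nat j" using fr2[of 55] fr2[of 56] fr2[of 41] fr2[of 57] inv j1 by simp_all
   let ?L3 = "set_cell 54 0 (value_orc I x (As j)) L2"
   show "cor (Seq (Value 54 39 10) ?t2) L2 (\<lambda>L2. ?Inv (Suc j) (set_cell 57 0 (of_nat (Suc j)) L2))"
   proof (rule cor_seq[OF cor_Value[OF bd2, where Q = "\<lambda>L'. L' = ?L3"]])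
    fix L3 assume bd3: "bd B L3" and L3: "L3 = ?L3"
    have x3: "get_vec 39 ?m L3 = x" "get_scenario 10 (usize I) L3 = As j"
     using f2(5) sc L3 by (simp_all add: get_vec_def get_scenario_def)
    let ?L4 = "set_vec 59 (subgrad_orc I x (As j)) L3"
    show "cor ?t2 L3 (\<lambda>L2. ?Inv (Suc j) (set_cell 57 0 (of_nat (Suc j)) L2))"
    proof (rule cor_seq[OF cor_Subgrad[OF bd3, where Q = "\<lambda>L'. L' = ?L4"]])
     fix L4 assume bd4: "bd B L4" and L4: "L4 = ?L4"
     have v4: "L4 b = L2 b" if "b \<noteq> 54" "b \<noteq> 59" for b using that L3 L4 by (simp add: set_vec_def)
     have s4: "\<forall>k<?m. L4 59 k = subgrad_orc I x (As j) $ k" "L4 54 0 = value_orc I x (As j)"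
      using L3 L4 dim[OF A] by (simp_all add: set_vec_def)
     have par4: "params L4" using v4 by (intro params_cong[OF f2(1)]) simp_all
     show "cor (Seq weight_prog ?t3) L4 (\<lambda>L2. ?Inv (Suc j) (set_cell 57 0 (of_nat (Suc j)) L2))"
     proof (rule cor_seq[where ?Q1.0 = "\<lambda>L5. L5 46 0 = wt j \<and> L5 55 0 = ?rem (Suc j)"])
      show "cor weight_prog L4 (\<lambda>L5. L5 46 0 = wt j \<and> L5 55 0 = ?rem (Suc j))"
      proof (rule cor_weight[OF bd4 par4, where N = N and j = j and rem = "?rem j"])
       show "rb B (?rem j - min (radius I) (?rem j))"
       proof (cases "j < N")
        case True
        have "rb B (mh - min (radius I) mh)"
        proof (cases "radius I \<le> mh")
         case True
         then show ?thesis using rb3(2)[of 1] K1 by simp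
        qed simp
        then show ?thesis using True by simp
       next
        case False
        then show ?thesis using rem_step[of j] rb_rem[of "Suc j"] j by simp
       qed
       fix L5 assume "L5 46 0 = (if j < N then 1 / of_nat N else min (radius I) (?rem j))"
        "L5 55 0 = (if j < N then ?rem j else ?rem j - min (radius I) (?rem j))"
       then show "L5 46 0 = wt j \<and> L5 55 0 = ?rem (Suc j)" using rem_step[of j] wt_eq[of j] by simp
      qed (use v4 f2 inv2 rb3 in simp_all)
      fix L5 assume bd5: "bd B L5" and fr5: "\<And>b. b < 60 ==> b \<notin> wr weight_prog ==> L5 b = L4 b"
       and w5: "L5 46 0 = wt j \<and> L5 55 0 = ?rem (Suc j)"
      have v5: "L5 56 0 = ?val j" "\<forall>k<?m. L5 41 k = ?sg j k" "L5 54 0 = value_orc I x (As j)"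
       "\<forall>k<?m. L5 59 k = subgrad_orc I x (As j) $ k"
       using fr5[of 56] fr5[of 41] fr5[of 54] fr5[of 59] v4[of 56] v4[of 41] inv2(1) s4 by simp_all
      have e56: "ev (pl (Vr 56) (ti (Vr 46) (Vr 54))) L5 = ?val (Suc j)" using v5 w5 by simp
      have par5: "params L5" using fr5 by (intro params_cong[OF par4]) simp_all
      show "cor ?t3 L5 (\<lambda>L2. ?Inv (Suc j) (set_cell 57 0 (of_nat (Suc j)) L2))"
      proof (rule cor_seq_asg[OF bd5])
       show "rb B (ev (pl (Vr 56) (ti (Vr 46) (Vr 54))) L5)" unfolding e56 using rb5[of "Suc j"] j by simp
       let ?L6 = "set_cell 56 0 (ev (pl (Vr 56) (ti (Vr 46) (Vr 54))) L5) L5"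
       assume bd6: "bd B ?L6"
       show "cor ?add ?L6 (\<lambda>L2. ?Inv (Suc j) (set_cell 57 0 (of_nat (Suc j)) L2))"
       proof (rule cor_conseq[OF add[OF bd6 _ j]])
        fix L7 assume fr7: "\<And>b. b < 60 ==> b \<notin> wr ?add ==> L7 b = ?L6 b" and 41: "\<forall>k<?m. L7 41 k = ?sg (Suc j) k"
        have "L7 55 0 = ?rem (Suc j)" using fr7[of 55] w5 by simp
        moreover have "L7 56 0 = ?val (Suc j)" using fr7[of 56] e56 by (simp del: ev.simps)
        ultimately show "?Inv (Suc j) (set_cell 57 0 (of_nat (Suc j)) L7)" using 41 by simp
       qed (use par5 w5 v5 in simp_all)
      qed (simp_all add: eok_def)
     qed
    qed (use x3 rb2[OF A] dim[OF A] in simp_all)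
   qed (use f2(5) sc rb1[OF A] in simp_all)
  qed
 qed (simp_all add: eok_def)
 show ?thesis unfolding objective_prog_def
 proof (rule cor_seq_asg[OF bd _ _ _ cor_seq_asg])
  let ?L1 = "set_cell 55 0 (ev (Vr 28) L) L"
  let ?L2 = "set_cell 56 0 (ev (Kn 0) ?L1) ?L1"
  assume bd1: "bd B ?L1" and bd2: "bd B ?L2"
  have fr2: "?fr ?L2" by simp
  show "cor (Seq ?init ?loop) ?L2 Q"
  proof (rule cor_seq[OF init[OF bd2 fr2]])
   fix L3 assume bd3: "bd B L3" and fr3: "\<And>b. b < 60 ==> b \<notin> wr ?init ==> L3 b = ?L2 b"
    and i3: "L3 56 0 = ?base \<and> (\<forall>k<?m. L3 41 k = cost1 I $ k)"
   have frL3: "?fr L3" using fr3 by simp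
   have 55: "L3 55 0 = mh" using fr3[of 55] mh by simp
   show "cor ?loop L3 Q"
   proof (rule cor_floop[where N = "N + K" and Inv = ?Inv, OF bd3])
    fix j L4 assume j: "j < N + K" and bd4: "bd B L4"
     and fr4: "\<And>b. b < 60 ==> b \<noteq> 57 ==> b \<notin> wr ?body ==> L4 b = L3 b" and j4: "L4 57 0 = of_nat j" and inv: "?Inv j L4"
    have "?fr L4" using frL3 fr4 by simp
    then show "cor ?body L4 (\<lambda>L2. ?Inv (Suc j) (set_cell 57 0 (of_nat (Suc j)) L2))" by (rule body[OF j bd4 _ j4 inv])
   next
    fix L4 assume bd4: "bd B L4" and fr4: "\<And>b. b < 60 ==> b \<noteq> 57 ==> b \<notin> wr ?body ==> L4 b = L3 b" and inv: "?Inv (N + K) L4"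
    show "Q L4" by (rule Q[OF bd4]) (use frL3 fr4 inv in simp_all)
   qed (use facts[OF frL3] NK i3 55 in simp_all)
  qed simp
 qed (use mh rb_rem[of 0] in \<open>simp_all add: eok_def\<close>)
qed

end

section \<open>One cutting step\<close>

text \<open>The heights \<alpha> over a plane through the centroid add up to 0, which normalises
  \<beta> to sum 1 outside \<open>p\<close>, and taking the lowest vertex as \<open>p\<close> gives
  \<open>\<beta> \<ge> -1\<close>: the hypotheses of \<open>contraction_factor\<close>.\<close>

lemma cut_progress:
 fixes v v' :: "nat => nat => real"
 assumes m: "m > 0" and cen: "\<And>k. k < m ==> x k = (\<Sum>i\<le>m. v i k) / (real m + 1)"
  and \<alpha>: "\<And>i. i \<le> m ==> \<alpha> i = (\<Sum>k<m. a k * (v i k - x k))"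
  and p: "p \<le> m" "\<And>i. i \<le> m ==> \<alpha> p \<le> \<alpha> i"
  and s: "\<And>i. i \<le> m ==> s i = (of_int \<lfloor>32 * real m ^ 3 / (1 + \<alpha> i / (- \<alpha> p) / (8 * real m ^ 2))\<rfloor> + 1) / (32 * real m ^ 3)"
  and v': "\<And>i k. i \<le> m ==> k < m ==> v' i k = v p k + s i * (v i k - v p k)"
  and Y: "Y \<noteq> {}" "\<And>y. y \<in> Y ==> in_simplex m v y"
   "\<And>y. y \<in> Y ==> (\<Sum>k<m. a k * y k) < (\<Sum>k<m. a k * x k)"
 shows "\<And>y. y \<in> Y ==> in_simplex m v' y"
  and "simplex_vol m v' \<le> exp (- 1 / (32 * real m ^ 2)) * simplex_vol m v"
proof -
 have M: "real m \<ge> 1" using m by simp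
 let ?\<kappa> = "1 / (8 * real m ^ 2)" and ?D = "32 * real m ^ 3"
 have \<kappa>: "0 < ?\<kappa>" "?\<kappa> \<le> 1/8" using M by (auto simp: field_simps)
 have D: "?D > 0" using M by simp
 have sum0: "(\<Sum>i\<le>m. \<alpha> i) = 0"
 proof -
  have "(\<Sum>i\<le>m. \<alpha> i) = (\<Sum>i\<le>m. \<Sum>k<m. a k * (v i k - x k))" using \<alpha> by simp
  also have "\<dots> = (\<Sum>k<m. \<Sum>i\<le>m. a k * (v i k - x k))" by (rule sum.swap)
  also have "\<dots> = (\<Sum>k<m. a k * ((\<Sum>i\<le>m. v i k) - (real m + 1) * x k))"
   by (simp add: sum_distrib_left[symmetric] sum_subtractf add.commute)
  also have "\<dots> = 0" using cen by (intro sum.neutral) simp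
  finally show ?thesis .
 qed
 \<comment> \<open>If no vertex were below the hyperplane, no point of the simplex would be,
   contrary to the points of \<open>Y\<close>.\<close>
 have neg: "\<alpha> p < 0"
 proof (rule ccontr)
  assume "\<not> \<alpha> p < 0"
  then have nn: "\<alpha> i \<ge> 0" if "i \<le> m" for i using p(2)[OF that] by linarith
  obtain y where y: "y \<in> Y" using Y(1) by blast
  obtain l where l: "\<And>i. i \<le> m ==> 0 \<le> l i" "(\<Sum>i\<le>m. l i) = 1" "\<And>k. k < m ==> y k = (\<Sum>i\<le>m. l i * v i k)"
   using Y(2)[OF y] by (auto simp: in_simplex_def)
  have "(\<Sum>i\<le>m. l i * \<alpha> i) = (\<Sum>i\<le>m. \<Sum>k<m. a k * (l i * v i k) - l i * (a k * x k))"
   using \<alpha> by (intro sum.cong refl) (simp add: sum_distrib_left algebra_simps)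
  also have "\<dots> = (\<Sum>k<m. \<Sum>i\<le>m. a k * (l i * v i k) - l i * (a k * x k))" by (rule sum.swap)
  also have "\<dots> = (\<Sum>k<m. a k * y k - a k * x k)"
   using l(2,3) by (intro sum.cong refl) (simp add: sum_subtractf sum_distrib_left[symmetric] sum_distrib_right[symmetric])
  also have "\<dots> < 0" using Y(3)[OF y] by (simp add: sum_subtractf)
  finally have "(\<Sum>i\<le>m. l i * \<alpha> i) < 0" .
  moreover have "0 \<le> (\<Sum>i\<le>m. l i * \<alpha> i)" using l(1) nn by (intro sum_nonneg) auto
  ultimately show False by linarith
 qed
 define \<beta> where "\<beta> i = \<alpha> i / (- \<alpha> p)" for i
 have \<beta>: "-1 \<le> \<beta> i" if "i \<le> m" for i
 proof -
  have "- (- \<alpha> p) \<le> \<alpha> i" using p(2)[OF that] by simp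
  then have "-1 * (- \<alpha> p) \<le> \<alpha> i" by simp
  then show ?thesis unfolding \<beta>_def using neg by (subst pos_le_divide_eq) auto
 qed
 have "(\<Sum>i\<in>{..m} - {p}. \<beta> i) = (\<Sum>i\<in>{..m} - {p}. \<alpha> i) / (- \<alpha> p)" unfolding \<beta>_def by (rule sum_divide_distrib[symmetric])
 also have "(\<Sum>i\<in>{..m} - {p}. \<alpha> i) = - \<alpha> p"
  using sum.remove[of "{..m}" p \<alpha>] p(1) sum0 by simp
 finally have \<beta>1: "(\<Sum>i\<in>{..m} - {p}. \<beta> i) = 1" using neg by simp
 have sb: "0 < s i" "1 / s i \<le> 1 + \<beta> i / (8 * real m ^ 2)"
  "s i \<le> 1 / (1 + \<beta> i / (8 * real m ^ 2)) + 1 / ?D" if i: "i \<le> m" for i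
 proof -
  define w where "w = 1 + \<beta> i / (8 * real m ^ 2)"
  have "?\<kappa> * \<beta> i \<ge> ?\<kappa> * (-1)" using \<beta>[OF i] \<kappa> by (intro mult_left_mono) auto
  moreover have "w = 1 + ?\<kappa> * \<beta> i" by (simp add: w_def)
  ultimately have w: "w \<ge> 7/8" using \<kappa>(2) by linarith
  have si: "s i = (of_int \<lfloor>?D / w\<rfloor> + 1) / ?D" using s[OF i] by (simp add: w_def \<beta>_def)
  have fl: "?D / w < of_int \<lfloor>?D / w\<rfloor> + 1" "of_int \<lfloor>?D / w\<rfloor> \<le> ?D / w" by linarith+
  have "1 / w < s i" unfolding si using fl(1) D w by (simp add: field_simps)
  moreover have "0 < 1 / w" using w by simp
  ultimately have s0: "0 < s i" by linarith
  then show "0 < s i" .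
  have "1 / s i \<le> 1 / (1 / w)" using \<open>1 / w < s i\<close> \<open>0 < 1 / w\<close> s0 by (intro divide_left_mono mult_pos_pos) auto
  then show "1 / s i \<le> 1 + \<beta> i / (8 * real m ^ 2)" by (simp add: w_def)
  have "s i \<le> (?D / w + 1) / ?D" unfolding si using fl(2) D by (intro divide_right_mono) auto
  also have "\<dots> = 1 / w + 1 / ?D" using D by (simp add: add_divide_distrib)
  finally show "s i \<le> 1 / (1 + \<beta> i / (8 * real m ^ 2)) + 1 / ?D" by (simp add: w_def)
 qed
 have gen: "1 / X * b = b / X" for X b :: real by simp
 have sc: "0 < s i \<and> 1 / s i \<le> 1 + ?\<kappa> * (\<alpha> i / (- \<alpha> p))" if "i \<le> m" for i
  unfolding gen \<beta>_def[symmetric] using sb(1,2)[OF that] by (rule conjI)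
 have \<kappa>1: "?\<kappa> \<le> 1" using \<kappa>(2) by linarith
 show "in_simplex m v' y" if "y \<in> Y" for y
  by (rule simplex_cut[where v = v and v' = v' and s = s and \<alpha> = \<alpha> and x = x and a = a, OF p(1) v' Y(2)[OF that] Y(3)[OF that] \<alpha> neg \<kappa>(1) \<kappa>1 sc])
 have eq: "simplex_vol m v' = (\<Prod>i\<in>{..m} - {p}. \<bar>s i\<bar>) * simplex_vol m v"
  by (rule simplex_vol_contract[OF p(1)]) (rule v')
 have "(\<Prod>i\<in>{..m} - {p}. \<bar>s i\<bar>) \<le> exp (- 1 / (32 * real m ^ 2))"
  by (rule contraction_factor[OF m p(1), where \<beta> = \<beta>]) (use \<beta> \<beta>1 sb in auto)
 then show "simplex_vol m v' \<le> exp (- 1 / (32 * real m ^ 2)) * simplex_vol m v"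
  unfolding eq by (intro mult_right_mono) (auto simp: simplex_vol_def)
qed

text \<open>After \<open>t\<close> cuts a coordinate is a multiple of \<open>1 / D ^ t\<close> of
  size at most \<open>3 ^ t * R\<close>. The scaling factors can exceed 1, so vertices may leave the
  initial simplex; hence a growing bound.\<close>

definition on_grid :: "nat => nat => nat => rat => bool" where
 "on_grid D t R q \<longleftrightarrow> (\<exists>z::int. q = of_int z / of_nat D ^ t \<and> \<bar>z\<bar> \<le> 3 ^ t * int R * int D ^ t)"

text \<open>The crude \<open>D \<le> 2 ^ D\<close> is affordable because \<open>D\<close> will be a
  polynomial in the dimension.\<close>

lemma grid_power_le: "t \<le> T ==> (3::int) ^ t * int D ^ t \<le> 2 ^ (T * D + 2 * T)"
proof -
 assume t: "t \<le> T"
 have "(3::nat) ^ t \<le> 4 ^ T" using t by (intro order_trans[OF power_mono[of 3 4 t] power_increasing]) auto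
 then have 1: "(3::nat) ^ t \<le> 2 ^ (2 * T)" by (simp add: power_mult)
 have "D \<le> 2 ^ D" using less_exp[of D] by simp
 then have "D ^ t \<le> (2 ^ D) ^ t" by (intro power_mono) auto
 also have "\<dots> \<le> (2 ^ D) ^ T" using t by (intro power_increasing) auto
 finally have 2: "D ^ t \<le> 2 ^ (T * D)" by (simp add: power_mult[symmetric] mult.commute)
 have "3 ^ t * D ^ t \<le> 2 ^ (2 * T) * 2 ^ (T * D)" using 1 2 by (rule mult_mono) auto
 then have "3 ^ t * D ^ t \<le> 2 ^ (T * D + 2 * T)" by (simp add: power_add mult.commute)
 then have "int (3 ^ t * D ^ t) \<le> int (2 ^ (T * D + 2 * T))" by (simp only: of_nat_le_iff)
 then show ?thesis by simp
qed

lemma rb_grid_sum: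
 assumes D: "D > 0" and t: "t \<le> T" and R: "R \<le> 2 ^ b" and g: "\<And>i. i < j ==> on_grid D t R (f i)"
 shows "\<exists>z::int. (\<Sum>i<j. f i) = of_int z / of_nat D ^ t \<and> \<bar>z\<bar> \<le> int j * (3 ^ t * int R * int D ^ t)"
  and "rb (T * D + 2 * T + b + j) (\<Sum>i<j. f i)"
proof -
 from g obtain z where z: "\<And>i. i < j ==> f i = of_int (z i) / of_nat D ^ t \<and> \<bar>z i\<bar> \<le> 3 ^ t * int R * int D ^ t"
  unfolding on_grid_def by metis
 have sum: "(\<Sum>i<j. f i) = of_int (\<Sum>i<j. z i) / of_nat D ^ t"
  using z by (simp add: sum_divide_distrib)
 have "\<bar>\<Sum>i<j. z i\<bar> \<le> (\<Sum>i<j. \<bar>z i\<bar>)" by (rule sum_abs)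
 also have "\<dots> \<le> of_nat (card {..<j}) * (3 ^ t * int R * int D ^ t)" using z by (intro sum_bounded_above) auto
 finally have le: "\<bar>\<Sum>i<j. z i\<bar> \<le> int j * (3 ^ t * int R * int D ^ t)" by simp
 show "\<exists>z::int. (\<Sum>i<j. f i) = of_int z / of_nat D ^ t \<and> \<bar>z\<bar> \<le> int j * (3 ^ t * int R * int D ^ t)"
  using sum le by blast
 have j: "int j \<le> 2 ^ j" using less_exp[of j] by (metis less_imp_le of_nat_le_iff of_nat_numeral of_nat_power)
 have R': "int R \<le> 2 ^ b" using R by (metis of_nat_le_iff of_nat_numeral of_nat_power)
 have P: "(3::int) ^ t * int D ^ t \<le> 2 ^ (T * D + 2 * T)" by (rule grid_power_le[OF t])
 have "int j * (int R * (3 ^ t * int D ^ t)) \<le> 2 ^ j * (2 ^ b * 2 ^ (T * D + 2 * T))"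
  using j R' P by (intro mult_mono) auto
 then have n: "\<bar>\<Sum>i<j. z i\<bar> \<le> 2 ^ (T * D + 2 * T + b + j)" using le by (simp add: power_add mult_ac)
 have "1 * int D ^ t \<le> (3::int) ^ t * int D ^ t" by (intro mult_right_mono) auto
 also have "\<dots> \<le> 2 ^ (T * D + 2 * T)" by (rule P)
 also have "\<dots> \<le> 2 ^ (T * D + 2 * T + b + j)" by (intro power_increasing) auto
 finally have d: "int D ^ t \<le> 2 ^ (T * D + 2 * T + b + j)" by simp
 show "rb (T * D + 2 * T + b + j) (\<Sum>i<j. f i)"
  by (rule rbI[of "int D ^ t" "\<Sum>i<j. z i"]) (use D n d sum in simp_all)
qed

lemma rb_grid:
 assumes "D > 0" "t \<le> T" "R \<le> 2 ^ b" "on_grid D t R q"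
 shows "rb (T * D + 2 * T + b + 1) q"
 using rb_grid_sum(2)[OF assms(1-3), of 1 "\<lambda>_. q"] assms(4) by simp

text \<open>For a factor \<open>s\<close> between 0 and 2, the coefficients of
  \<open>(1 - s) * u + s * v\<close> have total absolute value at most 3; this is the base of the
  power in \<open>on_grid\<close>.\<close>

lemma on_grid_shrink:
 assumes D: "D > 0" and u: "on_grid D t R u" and v: "on_grid D t R v" and s: "s = of_int n / of_nat D" "0 \<le> n" "n \<le> 2 * int D"
 shows "on_grid D (Suc t) R (u + s * (v - u))"
proof -
 obtain zu zv where z: "u = of_int zu / of_nat D ^ t" "\<bar>zu\<bar> \<le> 3 ^ t * int R * int D ^ t"
  "v = of_int zv / of_nat D ^ t" "\<bar>zv\<bar> \<le> 3 ^ t * int R * int D ^ t"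
  using u v unfolding on_grid_def by blast
 let ?b = "3 ^ t * int R * int D ^ t"
 have "u + s * (v - u) = of_int (int D * zu + n * (zv - zu)) / of_nat D ^ Suc t"
  using D by (simp add: z s field_simps)
 moreover have "\<bar>int D * zu + n * (zv - zu)\<bar> \<le> 3 ^ Suc t * int R * int D ^ Suc t"
 proof -
  have "int D * zu + n * (zv - zu) = (int D - n) * zu + n * zv" by (simp add: algebra_simps)
  then have "\<bar>int D * zu + n * (zv - zu)\<bar> \<le> \<bar>int D - n\<bar> * \<bar>zu\<bar> + \<bar>n\<bar> * \<bar>zv\<bar>"
   by (metis abs_mult abs_triangle_ineq)
  also have "\<dots> \<le> int D * ?b + (2 * int D) * ?b"
   using z s by (intro add_mono mult_mono) auto
  also have "\<dots> = 3 ^ Suc t * int R * int D ^ Suc t" by (simp add: algebra_simps)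
  finally show ?thesis .
 qed
 ultimately show ?thesis unfolding on_grid_def by blast
qed

section \<open>Parameters of the algorithm\<close>

text \<open>The cost \<open>g(0, U)\<close> dominates all second-stage costs and is the scale
  against which accuracy is measured.\<close>

definition top_value :: "drso => rat" where
 "top_value I = value_orc I (0\<^sub>v (mdim I)) {..<usize I}"

text \<open>The polytope lies in the nonnegative orthant with coordinates at most
  \<open>outer_rad\<close>, so the corner simplex of this size contains it.\<close>

definition simplex_size :: "drso => nat" where
 "simplex_size I = mdim I * (nat \<lfloor>outer_rad I\<rfloor> + 1)"

text \<open>The reciprocal of the ratio \<theta> by which a copy of the inner ball is shrunk towards
  a nearly optimal point. \<open>outer_rad * \<Sum> c + 2 * g(0, U)\<close> bounds the objective on
  the polytope from above, \<open>r * g(0, U) / \<lambda>\<close> the optimum from below.\<close>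

definition inv_theta :: "drso => nat => rat" where
 "inv_theta I E = (of_nat E * lam I) * (outer_rad I * (\<Sum>k<mdim I. cost1 I $ k) + 2 * top_value I) / (radius I * top_value I)"

text \<open>Compares, per dimension, the initial simplex with a corner of edge
  \<open>\<theta> * inner_rad\<close> that must not be lost; the factor \<open>m + 1\<close> absorbs
  the factorial of \<open>simplex_vol_ge\<close>.\<close>

definition vol_ratio :: "drso => nat => rat" where
 "vol_ratio I E = ((of_nat (mdim I) + 1) * of_nat (simplex_size I)) * inv_theta I E / inner_rad I"

definition log_ratio :: "drso => nat => nat" where
 "log_ratio I E = (LEAST l. vol_ratio I E \<le> 2 ^ l)"

text \<open>Its reciprocal is the rounding error of the scaling factors that
  \<open>contraction_factor\<close> tolerates.\<close>

definition precision :: "drso => nat" where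
 "precision I = 32 * (mdim I * (mdim I * mdim I))"

text \<open>A cut gains \<open>1 / (32 m^2)\<close> in the logarithm of the volume, and
  \<open>m * log_ratio\<close> must be gained. This takes \<open>precision * log_ratio\<close> cuts;
  one more makes the inequality strict.\<close>

definition n_cuts :: "drso => nat => nat" where
 "n_cuts I E = precision I * log_ratio I E + 1"

text \<open>Bounds the logarithm of the number of possible query points. It uses
  \<open>log_ratio\<close> instead of the input size, which is not among the data that the machine
  can read.\<close>

definition grid_bits :: "drso => nat => nat" where
 "grid_bits I E = mdim I * (n_cuts I E * (2 + precision I) + log_ratio I E + (mdim I + 5))"

text \<open>The tolerance \<open>r^2 / (4 E)\<close> enters Hoeffding's exponent squared, which
  gives \<open>16 E^2 / r^4\<close>; the second factor is the logarithm of the number of functions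
  in the union bound plus \<Delta>.\<close>

definition n_samples :: "drso => nat => nat => nat" where
 "n_samples I E \<Delta> = nat \<lfloor>(16 * (of_nat E * of_nat E)) / ((radius I * radius I) * (radius I * radius I)) *
   ((of_nat (usize I) + of_nat (grid_bits I E)) + (2 + of_nat \<Delta>))\<rfloor> + 1"

text \<open>The light mass never exceeds 1, so at most this many portions of size \<open>r\<close>
  are handed out.\<close>

definition n_top :: "drso => nat" where
 "n_top I = nat \<lfloor>1 / radius I\<rfloor> + 1"

lemma log_ratio: "vol_ratio I E \<le> 2 ^ log_ratio I E" "l < log_ratio I E ==> 2 ^ l < vol_ratio I E"
proof -
 obtain n where n: "vol_ratio I E \<le> of_nat n" using reals_Archimedean2[of "vol_ratio I E"] less_imp_le by blast
 then have "vol_ratio I E \<le> 2 ^ n" using of_nat_less_two_power[of n, where ?'a = rat] by linarith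
 then show "vol_ratio I E \<le> 2 ^ log_ratio I E" unfolding log_ratio_def by (rule LeastI)
 assume "l < log_ratio I E"
 then show "2 ^ l < vol_ratio I E" unfolding log_ratio_def using not_less_Least[of l "\<lambda>l. vol_ratio I E \<le> 2 ^ l"] by auto
qed

context drso_machine
begin

lemma cor_setup:
 assumes bd: "bd B L" and par: "params L" and z: "\<And>k. L 2 k = 0"
  and pos: "0 \<le> outer_rad I" "0 < radius I"
  and rbs: "rb B (top_value I)" "\<And>j. j \<le> mdim I ==> rb B (\<Sum>k<j. cost1 I $ k)" "rb B (inv_theta I E)" "rb B (vol_ratio I E)"
  and nats: "simplex_size I \<le> 2 ^ B" "log_ratio I E \<le> Z" "log_ratio I E + 1 \<le> B" "precision I \<le> 2 ^ B" "n_cuts I E \<le> 2 ^ B"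
   "grid_bits I E \<le> 2 ^ B" "n_samples I E \<Delta> \<le> 2 ^ B" "n_top I \<le> 2 ^ B"
  and Q: "\<And>L'. bd B L' ==> (\<And>b. b < 60 ==> b \<notin> {10, 11, 12, 14, 15, 16, 17, 18, 19, 20, 21, 22, 23, 24, 25} ==> L' b = L b) ==>
   L' 15 0 = of_nat (2 ^ usize I - 1) ==> L' 16 0 = top_value I ==> L' 18 0 = of_nat (simplex_size I) ==>
   L' 21 0 = of_nat (precision I) ==> L' 22 0 = of_nat (n_cuts I E) ==>
   L' 24 0 = of_nat (n_samples I E \<Delta>) ==> L' 25 0 = of_nat (n_top I) ==> Q L'"
 shows "cor setup_prog L Q"
proof (rule cor_fwd[OF bd])
 fix M assume bdM: "bd B M" and lM: "low M = L"
 have parM: "params M" using par lM params_low by metis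
 have zM: "M 2 k = 0" for k using z lM by (metis low_apply numeral_less_iff semiring_norm(76) semiring_norm(78))
 have lowpar: "params M'" if "M' 0 = M 0" "M' (Suc 0) = M (Suc 0)" for M' using params_cong[OF parM that] .
 obtain M1 where M1: "fwd (asg 14 (Kn 1)) M M1" "bd B M1" "M1 14 0 = 1" "\<And>b. b < 60 ==> b \<noteq> 14 ==> M1 b = M b"
  by (rule fwd_asg[OF bdM, of 14 "Kn 1" 1]) (simp_all add: eok_def)
 have p1: "params M1" using M1(4) by (intro lowpar) simp_all
 have "cor (floop 12 eU (dbl 14)) (low M1) (\<lambda>L'. L' 14 0 = of_nat (2 ^ usize I))"
 proof (rule cor_floop[where N = "usize I" and Inv = "\<lambda>j L'. L' 14 0 = of_nat (2 ^ j)"])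
  fix j L' assume j: "j < usize I" and bd': "bd B L'" and inv: "L' 14 0 = of_nat (2 ^ j)"
  have "rb B (2 ^ j + 2 ^ j)" using rb_nat[OF pow_u(2), of j] j by simp
  then show "cor (dbl 14) L' (\<lambda>L''. set_cell 12 0 (of_nat (Suc j)) L'' 14 0 = of_nat (2 ^ Suc j))"
   by (intro cor_asg[OF bd']) (use inv in \<open>simp_all add: eok_def\<close>)
 qed (use M1 paramsD[OF p1] u_le uZ in simp_all)
 then obtain M2 where M2: "fwd (floop 12 eU (dbl 14)) M1 M2" "bd B M2" "low M2 14 0 = of_nat (2 ^ usize I)" by (rule fwd_cor)
 have f2: "M2 b = M b" if "b < 60" "b \<notin> {12, 14}" for b using fwd_frame[OF M2(1), of b] M1(4)[of b] that by simp
 have "(of_nat (2 ^ usize I) :: rat) - 1 = of_nat (2 ^ usize I - 1)" by (simp add: of_nat_diff)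
 then have e3: "ev (mi (Vr 14) (Kn 1)) M2 = of_nat (2 ^ usize I - 1)" using M2(3) by simp
 have rbF: "rb B (of_nat (2 ^ usize I - 1))"
 proof (rule rb_nat)
  have "(2::nat) ^ usize I - 1 \<le> 2 ^ usize I" by (rule diff_le_self)
  then show "(2::nat) ^ usize I - 1 \<le> 2 ^ B" using pow_u(1)[of "usize I"] by linarith
 qed
 obtain M3 where M3: "fwd (asg 15 (mi (Vr 14) (Kn 1))) M2 M3" "bd B M3" "M3 15 0 = of_nat (2 ^ usize I - 1)"
  "\<And>b. b < 60 ==> b \<noteq> 15 ==> M3 b = M2 b"
  by (rule fwd_asg[where a = 15, OF M2(2) _ _ e3 rbF]) (simp_all add: eok_def)
 have f3: "M3 b = M b" if "b < 60" "b \<notin> {12, 14, 15}" for b using M3(4)[of b] f2[of b] that by simp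
 have "cor (decode_prog 15) (low M3) (\<lambda>L'. get_scenario 10 (usize I) L' = {..<usize I})"
 proof (rule cor_decode[where n = "set_encode {..<usize I}"])
  show "params (low M3)" unfolding params_low using f3 by (intro lowpar) simp_all
  fix L' assume "get_scenario 10 (usize I) L' = set_decode (set_encode {..<usize I}) \<inter> {..<usize I}"
  then show "get_scenario 10 (usize I) L' = {..<usize I}" by simp
 qed (use M3 in \<open>simp_all add: set_encode_lessThan\<close>)
 then obtain M4 where M4: "fwd (decode_prog 15) M3 M4" "bd B M4" "get_scenario 10 (usize I) (low M4) = {..<usize I}" by (rule fwd_cor)
 have f4: "M4 b = M b" if "b < 60" "b \<notin> {10, 11, 12, 14, 15}" for b using fwd_frame[OF M4(1), of b] f3[of b] that by simp
 \<comment> \<open>Array 2 is still blank and serves as the point 0 in the query for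
   \<open>top_value\<close>.\<close>
 have x4: "get_vec 2 (mdim I) (low M4) = 0\<^sub>v (mdim I)" using f4[of 2] zM by (intro eq_vecI) (simp_all add: get_vec_def)
 have "cor (Value 16 2 10) (low M4) (\<lambda>L'. L' 16 0 = top_value I)"
  by (rule cor_Value) (use M4 x4 rbs in \<open>simp_all add: top_value_def\<close>)
 then obtain M5 where M5: "fwd (Value 16 2 10) M4 M5" "bd B M5" "low M5 16 0 = top_value I" by (rule fwd_cor)
 have f5: "M5 b = M b" if "b < 60" "b \<notin> {10, 11, 12, 14, 15, 16}" for b using fwd_frame[OF M5(1), of b] f4[of b] that by simp
 have k5: "M5 15 0 = of_nat (2 ^ usize I - 1)" using fwd_frame[OF M5(1), of 15] fwd_frame[OF M4(1), of 15] M3(3) by simp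
 obtain M6 where M6: "fwd (asg 17 (Kn 0)) M5 M6" "bd B M6" "M6 17 0 = 0" "\<And>b. b < 60 ==> b \<noteq> 17 ==> M6 b = M5 b"
  by (rule fwd_asg[OF M5(2), of 17 "Kn 0" 0]) (simp_all add: eok_def)
 have p6: "params M6" using M6(4) f5 by (intro lowpar) simp_all
 let ?b7 = "asg 17 (pl (Vr 17) (Ix 0 (Vr 12)))"
 have "cor (floop 12 eM ?b7) (low M6) (\<lambda>L'. L' 17 0 = (\<Sum>k<mdim I. cost1 I $ k))"
 proof (rule cor_floop[where N = "mdim I" and Inv = "\<lambda>j L'. L' 17 0 = (\<Sum>k<j. cost1 I $ k)"])
  fix j L' assume j: "j < mdim I" and bd': "bd B L'" and fr: "\<And>b. b < 60 ==> b \<noteq> 12 ==> b \<notin> wr ?b7 ==> L' b = low M6 b"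
   and j': "L' 12 0 = of_nat j" and inv: "L' 17 0 = (\<Sum>k<j. cost1 I $ k)"
  have "L' 0 j = cost1 I $ j" using fr[of 0] paramsD(9)[OF p6 j] by simp
  then show "cor ?b7 L' (\<lambda>L''. set_cell 12 0 (of_nat (Suc j)) L'' 17 0 = (\<Sum>k<Suc j. cost1 I $ k))"
   by (intro cor_asg[OF bd']) (use inv j' rbs(2)[of "Suc j"] j in \<open>simp_all add: eok_def\<close>)
 qed (use M6 paramsD[OF p6] mB mZ in simp_all)
 then obtain M7 where M7: "fwd (floop 12 eM ?b7) M6 M7" "bd B M7" "low M7 17 0 = (\<Sum>k<mdim I. cost1 I $ k)" by (rule fwd_cor)
 have f7: "M7 b = M b" if "b < 60" "b \<notin> {10, 11, 12, 14, 15, 16, 17}" for b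
  using fwd_frame[OF M7(1), of b] M6(4)[of b] f5[of b] that by simp
 have k7: "M7 15 0 = of_nat (2 ^ usize I - 1)" "M7 16 0 = top_value I" "M7 17 0 = (\<Sum>k<mdim I. cost1 I $ k)"
  using fwd_frame[OF M7(1), of 15] fwd_frame[OF M7(1), of 16] M6(4)[of 15] M6(4)[of 16] k5 M5(3) M7(3) by simp_all
 have p7: "params M7" using f7 by (intro lowpar) simp_all
 have "of_nat (nat \<lfloor>outer_rad I\<rfloor>) = (of_int \<lfloor>outer_rad I\<rfloor> :: rat)" using pos by simp
 then have e8: "ev (ti eM (pl (Fl eOut) (Kn 1))) M7 = of_nat (simplex_size I)"
  using paramsD[OF p7] by (simp add: simplex_size_def algebra_simps)
 obtain M8 where M8: "fwd (asg 18 (ti eM (pl (Fl eOut) (Kn 1)))) M7 M8" "bd B M8" "M8 18 0 = of_nat (simplex_size I)"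
  "\<And>b. b < 60 ==> b \<noteq> 18 ==> M8 b = M7 b"
  by (rule fwd_asg[where a = 18, OF M7(2) _ _ e8]) (use rb_nat[OF nats(1)] in \<open>simp_all add: eok_def\<close>)
 have p8: "params M8" using M8(4) f7 by (intro lowpar) simp_all
 let ?e9 = "di (ti (ti eE eLam) (pl (ti eOut (Vr 17)) (ti (Kn 2) (Vr 16)))) (ti eR (Vr 16))"
 have e9: "ev ?e9 M8 = inv_theta I E" using paramsD[OF p8] M8(4)[of 17] M8(4)[of 16] k7 by (simp add: inv_theta_def)
 obtain M9 where M9: "fwd (asg 19 ?e9) M8 M9" "bd B M9" "M9 19 0 = inv_theta I E" "\<And>b. b < 60 ==> b \<noteq> 19 ==> M9 b = M8 b"
  by (rule fwd_asg[where a = 19, OF M8(2) _ _ e9 rbs(3)]) (simp_all add: eok_def)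
 have p9: "params M9" using M9(4) M8(4) f7 by (intro lowpar) simp_all
 let ?e10 = "di (ti (ti (pl eM (Kn 1)) (Vr 18)) (Vr 19)) eIn"
 have e10: "ev ?e10 M9 = vol_ratio I E" using paramsD[OF p9] M9(3) M9(4)[of 18] M8(3) by (simp add: vol_ratio_def)
 obtain M10 where M10: "fwd (asg 19 ?e10) M9 M10" "bd B M10" "M10 19 0 = vol_ratio I E" "\<And>b. b < 60 ==> b \<noteq> 19 ==> M10 b = M9 b"
  by (rule fwd_asg[where a = 19, OF M9(2) _ _ e10 rbs(4)]) (simp_all add: eok_def)
 obtain M11 where M11: "fwd (asg 20 (Kn 0)) M10 M11" "bd B M11" "M11 20 0 = 0" "\<And>b. b < 60 ==> b \<noteq> 20 ==> M11 b = M10 b"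
  by (rule fwd_asg[OF M10(2), of 20 "Kn 0" 0]) (simp_all add: eok_def)
 obtain M12 where M12: "fwd (asg 14 (Kn 1)) M11 M12" "bd B M12" "M12 14 0 = 1" "\<And>b. b < 60 ==> b \<noteq> 14 ==> M12 b = M11 b"
  by (rule fwd_asg[OF M11(2), of 14 "Kn 1" 1]) (simp_all add: eok_def)
 let ?b13 = "Seq (dbl 14) (asg 20 (pl (Vr 20) (Kn 1)))"
 have v12: "M12 19 0 = vol_ratio I E" "M12 20 0 = 0" using M12(4)[of 19] M12(4)[of 20] M11(3) M11(4)[of 19] M10(3) by simp_all
 have lrB: "log_ratio I E \<le> 2 ^ B" using nats(3) less_exp[of B] by linarith
 have "cor (whl (mi (Vr 19) (Vr 14)) ?b13) (low M12) (\<lambda>L'. L' 20 0 = of_nat (log_ratio I E))"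
 proof (rule cor_whl[where N = "log_ratio I E" and Inv = "\<lambda>j L'. L' 14 0 = of_nat (2 ^ j) \<and> L' 20 0 = of_nat j"])
  fix j L' assume j: "j < log_ratio I E" and bd': "bd B L'" and fr: "\<And>b. b < 60 ==> b \<notin> wr ?b13 ==> L' b = low M12 b"
   and inv: "L' 14 0 = of_nat (2 ^ j) \<and> L' 20 0 = of_nat j"
  have "(2::nat) ^ Suc j \<le> 2 ^ B" using nats(3) j by (intro power_increasing) auto
  then have "rb B (2 ^ j + 2 ^ j)" using rb_nat[of "2 ^ Suc j" B] by simp
  moreover have "rb B (of_nat j + 1)" using rb_nat[of "Suc j" B] j lrB by (simp add: add.commute)
  ultimately have "cor ?b13 L' (\<lambda>L''. L'' 14 0 = of_nat (2 ^ Suc j) \<and> L'' 20 0 = of_nat (Suc j))"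
   by (intro cor_seq_asg[OF bd' _ _ _ cor_asg]) (use inv in \<open>simp_all add: eok_def\<close>)
  moreover have "0 < ev (mi (Vr 19) (Vr 14)) L'" using fr[of 19] inv v12 log_ratio(2)[OF j] by simp
  ultimately show "0 < ev (mi (Vr 19) (Vr 14)) L' \<and> cor ?b13 L' (\<lambda>L''. L'' 14 0 = of_nat (2 ^ Suc j) \<and> L'' 20 0 = of_nat (Suc j))"
   by blast
 next
  fix L' assume "bd B L'" and fr: "\<And>b. b < 60 ==> b \<notin> wr ?b13 ==> L' b = low M12 b"
   and inv: "L' 14 0 = of_nat (2 ^ log_ratio I E) \<and> L' 20 0 = of_nat (log_ratio I E)"
  show "\<not> 0 < ev (mi (Vr 19) (Vr 14)) L' \<and> L' 20 0 = of_nat (log_ratio I E)"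
   using fr[of 19] inv v12 log_ratio(1)[of I E] by simp
 qed (use M12 v12 nats in \<open>simp_all add: eok_def\<close>)
 then obtain M13 where M13: "fwd (whl (mi (Vr 19) (Vr 14)) ?b13) M12 M13" "bd B M13" "low M13 20 0 = of_nat (log_ratio I E)" by (rule fwd_cor)
 have g13: "M13 b = M8 b" if "b < 60" "b \<notin> {14, 19, 20}" for b
  using fwd_frame[OF M13(1), of b] M12(4)[of b] M11(4)[of b] M10(4)[of b] M9(4)[of b] that by simp
 have f13: "M13 b = M b" if "b < 60" "b \<notin> {10, 11, 12, 14, 15, 16, 17, 18, 19, 20}" for b
  using g13[of b] M8(4)[of b] f7[of b] that by simp
 have k13: "M13 15 0 = of_nat (2 ^ usize I - 1)" "M13 16 0 = top_value I" "M13 18 0 = of_nat (simplex_size I)" "M13 20 0 = of_nat (log_ratio I E)"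
  using g13[of 15] g13[of 16] g13[of 18] M8(3) M8(4)[of 15] M8(4)[of 16] k7 M13(3) by simp_all
 have p13: "params M13" using f13 by (intro lowpar) simp_all
 have e14: "ev (ti (Kn 32) (ti eM (ti eM eM))) M13 = of_nat (precision I)" using paramsD[OF p13] by (simp add: precision_def)
 obtain M14 where M14: "fwd (asg 21 (ti (Kn 32) (ti eM (ti eM eM)))) M13 M14" "bd B M14" "M14 21 0 = of_nat (precision I)"
  "\<And>b. b < 60 ==> b \<noteq> 21 ==> M14 b = M13 b"
  by (rule fwd_asg[where a = 21, OF M13(2) _ _ e14 rb_nat[OF nats(4)]]) (simp_all add: eok_def)
 have e15: "ev (pl (ti (Vr 21) (Vr 20)) (Kn 1)) M14 = of_nat (n_cuts I E)" using M14 k13 by (simp add: n_cuts_def)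
 obtain M15 where M15: "fwd (asg 22 (pl (ti (Vr 21) (Vr 20)) (Kn 1))) M14 M15" "bd B M15" "M15 22 0 = of_nat (n_cuts I E)"
  "\<And>b. b < 60 ==> b \<noteq> 22 ==> M15 b = M14 b"
  by (rule fwd_asg[where a = 22, OF M14(2) _ _ e15 rb_nat[OF nats(5)]]) (simp_all add: eok_def)
 have p15: "params M15" using f13 M15(4) M14(4) by (intro lowpar) simp_all
 let ?e16 = "ti eM (pl (pl (ti (Vr 22) (pl (Kn 2) (Vr 21))) (Vr 20)) (pl eM (Kn 5)))"
 have e16: "ev ?e16 M15 = of_nat (grid_bits I E)"
  using paramsD[OF p15] M15(3) M15(4)[of 21] M15(4)[of 20] M14(3) M14(4)[of 20] k13 by (simp add: grid_bits_def algebra_simps)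
 obtain M16 where M16: "fwd (asg 23 ?e16) M15 M16" "bd B M16" "M16 23 0 = of_nat (grid_bits I E)"
  "\<And>b. b < 60 ==> b \<noteq> 23 ==> M16 b = M15 b"
  by (rule fwd_asg[where a = 23, OF M15(2) _ _ e16 rb_nat[OF nats(6)]]) (simp_all add: eok_def)
 have p16: "params M16" using f13 M16(4) M15(4) M14(4) by (intro lowpar) simp_all
 let ?e17 = "pl (Fl (ti (di (ti (Kn 16) (ti eE eE)) (ti (ti eR eR) (ti eR eR))) (pl (pl eU (Vr 23)) (pl (Kn 2) eDel)))) (Kn 1)"
 have nn17: "0 \<le> (16 * (of_nat E * of_nat E)) / ((radius I * radius I) * (radius I * radius I)) *
   ((of_nat (usize I) + of_nat (grid_bits I E)) + (2 + of_nat \<Delta> :: rat))"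
  using pos by (intro mult_nonneg_nonneg divide_nonneg_nonneg) auto
 have e17: "ev ?e17 M16 = of_nat (n_samples I E \<Delta>)"
  using paramsD[OF p16] M16(3) nn17 by (simp add: n_samples_def)
 obtain M17 where M17: "fwd (asg 24 ?e17) M16 M17" "bd B M17" "M17 24 0 = of_nat (n_samples I E \<Delta>)"
  "\<And>b. b < 60 ==> b \<noteq> 24 ==> M17 b = M16 b"
  by (rule fwd_asg[where a = 24, OF M16(2) _ _ e17 rb_nat[OF nats(7)]]) (simp_all add: eok_def)
 have p17: "params M17" using f13 M17(4) M16(4) M15(4) M14(4) by (intro lowpar) simp_all
 have e18: "ev (pl (Fl (di (Kn 1) eR)) (Kn 1)) M17 = of_nat (n_top I)" using paramsD[OF p17] pos by (simp add: n_top_def)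
 obtain M18 where M18: "fwd (asg 25 (pl (Fl (di (Kn 1) eR)) (Kn 1))) M17 M18" "bd B M18" "M18 25 0 = of_nat (n_top I)"
  "\<And>b. b < 60 ==> b \<noteq> 25 ==> M18 b = M17 b"
  by (rule fwd_asg[where a = 25, OF M17(2) _ _ e18 rb_nat[OF nats(8)]]) (simp_all add: eok_def)
 have g18: "M18 b = M13 b" if "b < 60" "b \<notin> {21, 22, 23, 24, 25}" for b
  using M18(4)[of b] M17(4)[of b] M16(4)[of b] M15(4)[of b] M14(4)[of b] that by simp
 have "fwd setup_prog M M18" unfolding setup_prog_def
  by (intro fwd_Seq[OF M1(1)] fwd_Seq[OF M2(1)] fwd_Seq[OF M3(1)] fwd_Seq[OF M4(1)] fwd_Seq[OF M5(1)] fwd_Seq[OF M6(1)]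
    fwd_Seq[OF M7(1)] fwd_Seq[OF M8(1)] fwd_Seq[OF M9(1)] fwd_Seq[OF M10(1)] fwd_Seq[OF M11(1)] fwd_Seq[OF M12(1)]
    fwd_Seq[OF M13(1)] fwd_Seq[OF M14(1)] fwd_Seq[OF M15(1)] fwd_Seq[OF M16(1)] fwd_Seq[OF M17(1)] M18(1))
 moreover have "Q (low M18)"
 proof (rule Q)
  fix b :: nat assume b: "b < 60" "b \<notin> {10, 11, 12, 14, 15, 16, 17, 18, 19, 20, 21, 22, 23, 24, 25}"
  then have "M18 b = M b" using g18[of b] f13[of b] by simp
  then show "low M18 b = L b" using b lM by (metis low_apply)
 qed (use M18 k13 g18[of 15] g18[of 16] g18[of 18] M18(4) M17 M16(4) M15 M14 in simp_all)
 ultimately show "\<exists>M'. fwd setup_prog M M' \<and> bd B M' \<and> Q (low M')" using M18(2) by blast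
qed

end

section \<open>Lengths of the numbers that occur in a run\<close>

definition ratio_bits :: "drso => nat => nat => nat" where
 "ratio_bits I E OT = (mdim I + 1) + (2 * isize I + 1) +
   ((E + isize I) + (isize I + mdim I * (isize I + 1) + OT + 3) + (isize I + OT)) + isize I"

text \<open>Oracle answers enter only through the number of cuts, which is fixed before the main
  loop. Otherwise the lengths of answers would feed back into the lengths of the next
  queries.\<close>

definition point_bits :: "drso => nat => nat" where
 "point_bits I E = n_cuts I E * precision I + 2 * n_cuts I E + (2 * isize I + 1) + (mdim I + 1)"

definition weight_bits :: "drso => nat => nat => nat" where
 "weight_bits I E \<Delta> = n_samples I E \<Delta> * (isize I + n_samples I E \<Delta> + 1) + n_top I + isize I + 1"

definition term_bits :: "drso => nat => nat => nat => nat" where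
 "term_bits I E \<Delta> OT = (n_samples I E \<Delta> + n_top I) * (weight_bits I E \<Delta> + OT + 1)"

definition normal_bits :: "drso => nat => nat => nat => nat" where
 "normal_bits I E \<Delta> OT = isize I + term_bits I E \<Delta> OT + 1 + OT"

text \<open>A sum instead of a maximum: it dominates each summand, and the required comparisons
  become linear arithmetic.\<close>

definition cell_bits :: "drso => nat => nat => nat => nat" where
 "cell_bits I E \<Delta> OT = ratio_bits I E OT + point_bits I E + weight_bits I E \<Delta> +
   (mdim I * (isize I + point_bits I E + 1) + term_bits I E \<Delta> OT + 1) + normal_bits I E \<Delta> OT +
   mdim I * (normal_bits I E \<Delta> OT + (point_bits I E + point_bits I E + 1) + 1) +
   2 * precision I + n_cuts I E + grid_bits I E + n_samples I E \<Delta> + n_top I + \<Delta> + 10"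

definition loop_bound :: "drso => nat => nat => nat => nat" where
 "loop_bound I E \<Delta> OT = ratio_bits I E OT + n_cuts I E + n_samples I E \<Delta> + n_top I + mdim I + usize I + 1"

lemma sum_lessThan_add: "(\<Sum>i<n + k. f i) = (\<Sum>i<n. f i) + (\<Sum>i<k. f (n + i :: nat) :: 'a :: comm_monoid_add)"
 by (induction k) (simp_all add: add.assoc)

lemma nat_le_pow2: "n \<le> b ==> n \<le> (2::nat) ^ b"
 using less_exp[of b] by linarith

text \<open>\<open>OT\<close> bounds the oracle time on all inputs up to the length of a query, and
  thereby the length of the answers. It bounds a whole range of inputs because
  \<open>orc_time\<close> is not assumed monotone.\<close>

locale drso_run = drso_machine +
 fixes \<pi> :: "real poly" and OT :: nat
 assumes std: "standing_assumptions \<pi> I" and mon: "monotone_recourse I" and E1: "1 \<le> E"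
  and OT: "\<And>b. b \<le> mdim I * (2 * point_bits I E + 3) + usize I ==> orc_time I b \<le> OT"
  and B: "cell_bits I E \<Delta> OT \<le> B" and Z: "loop_bound I E \<Delta> OT \<le> Z"
begin

abbreviation "m \<equiv> mdim I"
abbreviation "S \<equiv> scenarios I"
abbreviation "N \<equiv> n_samples I E \<Delta>"
abbreviation "K \<equiv> n_top I"
abbreviation "D \<equiv> precision I"
abbreviation "T \<equiv> n_cuts I E"
abbreviation "R \<equiv> simplex_size I"
abbreviation "r \<equiv> real_of_rat (radius I)"
abbreviation "c \<equiv> real_vec (cost1 I)"

lemma facts:
 shows cost_dim: "cost1 I \<in> carrier_vec m"
  and radius: "0 < radius I" "radius I \<le> 1"
  and feas_carrier: "x \<in> feas I ==> x \<in> carrier_vec m"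
  and feas_nonneg: "x \<in> feas I ==> k < m ==> 0 \<le> x $ k"
  and center: "set_pmf (center I) \<subseteq> S"
  and sizes: "m + usize I + vec_size (cost1 I) + rat_size (lam I) + rat_size (radius I)
    + rat_size (outer_rad I) + rat_size (inner_rad I) \<le> isize I"
  and zero_feas: "0\<^sub>v m \<in> feas I"
  and cost_nonneg: "k < m ==> 0 \<le> cost1 I $ k"
  and lam: "1 \<le> lam I"
  and rads: "0 < outer_rad I" "0 < inner_rad I" "inner_rad I \<le> 1"
proof -
 have b: "basic_data I" and n: "nonneg_costs \<pi> I" and bi: "bounded_inflation I" and w: "well_rounded \<pi> I"
  using std by (auto simp: standing_assumptions_def)
 show "cost1 I \<in> carrier_vec m" "0 < radius I" "radius I \<le> 1" "set_pmf (center I) \<subseteq> S"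
  "m + usize I + vec_size (cost1 I) + rat_size (lam I) + rat_size (radius I)
    + rat_size (outer_rad I) + rat_size (inner_rad I) \<le> isize I"
  using b by (auto simp: basic_data_def)
 show fc: "x \<in> carrier_vec m" if "x \<in> feas I" for x
  using b that by (auto simp: basic_data_def polytope_vec_def)
 show "0 \<le> x $ k" if "x \<in> feas I" "k < m"
 proof -
  have "0\<^sub>v m \<le> x" using b that by (auto simp: basic_data_def)
  then show ?thesis using that fc[OF that(1)] by (auto simp: less_eq_vec_def)
 qed
 show "0\<^sub>v m \<in> feas I" using n by (auto simp: nonneg_costs_def int_feas_def)
 show "0 \<le> cost1 I $ k" if "k < m"
  using n that b by (auto simp: nonneg_costs_def less_eq_vec_def basic_data_def)
 show "1 \<le> lam I" using bi by (simp add: bounded_inflation_def)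
 show "0 < outer_rad I" "0 < inner_rad I" "inner_rad I \<le> 1" using w by (auto simp: well_rounded_def)
qed

lemma r_pos: "0 < r" "r \<le> 1"
 using radius by (simp_all add: zero_less_of_rat_iff)

lemma recourse_bounds:
 assumes "x \<in> feas I" "A \<in> S"
 shows "0 \<le> recourse I x A" "recourse I x A \<le> recourse I x {..<usize I}"
proof -
 show "0 \<le> recourse I x A" using std assms by (auto simp: standing_assumptions_def nonneg_costs_def)
 show "recourse I x A \<le> recourse I x {..<usize I}"
  using mon assms full_scenario[of I] unfolding monotone_recourse_def by (auto simp: scenarios_def ground_def)
qed

lemma rb_param:
 "rb (isize I) (lam I)" "rb (isize I) (radius I)" "rb (isize I) (outer_rad I)" "rb (isize I) (inner_rad I)"
 "k < m ==> rb (isize I) (cost1 I $ k)"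
proof -
 show "rb (isize I) (lam I)" by (rule rb_mono[OF rb_rat_size]) (use sizes in linarith)
 show "rb (isize I) (radius I)" by (rule rb_mono[OF rb_rat_size]) (use sizes in linarith)
 show "rb (isize I) (outer_rad I)" by (rule rb_mono[OF rb_rat_size]) (use sizes in linarith)
 show "rb (isize I) (inner_rad I)" by (rule rb_mono[OF rb_rat_size]) (use sizes in linarith)
 assume "k < m"
 then have "rat_size (cost1 I $ k) \<le> vec_size (cost1 I)"
  unfolding vec_size_def using cost_dim by (intro member_le_sum) auto
 then show "rb (isize I) (cost1 I $ k)" using sizes by (intro rb_mono[OF rb_rat_size]) linarith
qed

lemma mu_isize: "m \<le> isize I" "usize I \<le> isize I" using sizes by linarith+

lemma vec_size_bound:
 assumes "x \<in> carrier_vec m" "\<And>k. k < m ==> rb (point_bits I E) (x $ k)"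
 shows "vec_size x \<le> m * (2 * point_bits I E + 3)"
proof -
 have "(\<Sum>i<m. rat_size (x $ i)) \<le> of_nat (card {..<m}) * (2 * point_bits I E + 3)"
  by (intro sum_bounded_above rat_size_rb assms(2)) simp
 then show ?thesis using assms(1) by (simp add: vec_size_def)
qed

lemma value_oracle:
 assumes x: "x \<in> carrier_vec m" "real_vec x \<in> feas I" "\<And>k. k < m ==> rb (point_bits I E) (x $ k)" and A: "A \<in> S"
 shows "real_of_rat (value_orc I x A) = recourse I (real_vec x) A" "rb OT (value_orc I x A)"
  "good_subgradient I (real_vec x) A (real_vec (subgrad_orc I x A))"
  "dim_vec (subgrad_orc I x A) = m" "k < m ==> rb OT (subgrad_orc I x A $ k)"
proof -
 have o: "orc_time I (vec_size x + usize I) \<le> OT" using vec_size_bound[OF x(1,3)] by (intro OT) simp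
 have v: "real_of_rat (value_orc I x A) = recourse I (real_vec x) A \<and>
    rat_size (value_orc I x A) \<le> orc_time I (vec_size x + usize I)"
  using std x A by (auto simp: standing_assumptions_def efficient_convex_recourse_def)
 then show "real_of_rat (value_orc I x A) = recourse I (real_vec x) A" by simp
 show "rb OT (value_orc I x A)" using v o by (intro rb_mono[OF rb_rat_size]) linarith
 have s: "good_subgradient I (real_vec x) A (real_vec (subgrad_orc I x A)) \<and>
    vec_size (subgrad_orc I x A) \<le> orc_time I (vec_size x + usize I)"
  using std x A by (auto simp: standing_assumptions_def efficient_subgradients_def)
 then show "good_subgradient I (real_vec x) A (real_vec (subgrad_orc I x A))" by simp
 have d: "dim_vec (subgrad_orc I x A) = m" using s by (auto simp: good_subgradient_def)
 then show "dim_vec (subgrad_orc I x A) = m" .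
 assume "k < m"
 then have "rat_size (subgrad_orc I x A $ k) \<le> vec_size (subgrad_orc I x A)"
  unfolding vec_size_def using d by (intro member_le_sum) auto
 then show "rb OT (subgrad_orc I x A $ k)" using s o by (intro rb_mono[OF rb_rat_size]) linarith
qed

lemma zero_oracle: "real_vec (0\<^sub>v m) = 0\<^sub>v m" "rb OT (top_value I)" "real_of_rat (top_value I) = recourse I (0\<^sub>v m) {..<usize I}"
proof -
 show z: "real_vec (0\<^sub>v m) = 0\<^sub>v m" by (intro eq_vecI) auto
 show "rb OT (top_value I)" "real_of_rat (top_value I) = recourse I (0\<^sub>v m) {..<usize I}"
  unfolding top_value_def using value_oracle(1,2)[of "0\<^sub>v m" "{..<usize I}"] z zero_feas full_scenario[of I] by auto
qed

lemma separation_oracle: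
 assumes x: "x \<in> carrier_vec m" "\<And>k. k < m ==> rb (point_bits I E) (x $ k)"
 shows "sep_orc I x = None ==> real_vec x \<in> feas I"
  and "sep_orc I x = Some a ==> dim_vec a = m \<and> (\<forall>k<m. rb OT (a $ k)) \<and> (\<forall>y\<in>feas I. real_vec a \<bullet> y < real_vec a \<bullet> real_vec x)"
proof -
 have e: "case sep_orc I x of None => real_vec x \<in> feas I
     | Some a => a \<in> carrier_vec m \<and> (\<forall>y\<in>feas I. real_vec a \<bullet> y < real_vec a \<bullet> real_vec x) \<and>
       vec_size a \<le> orc_time I (vec_size x)"
  using std x(1) by (auto simp: standing_assumptions_def efficient_feas_def)
 show "sep_orc I x = None ==> real_vec x \<in> feas I" using e by simp
 assume "sep_orc I x = Some a"
 then have a: "a \<in> carrier_vec m" "\<forall>y\<in>feas I. real_vec a \<bullet> y < real_vec a \<bullet> real_vec x" "vec_size a \<le> orc_time I (vec_size x)"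
  using e by auto
 have "orc_time I (vec_size x) \<le> OT" using vec_size_bound[OF x] by (intro OT) simp
 moreover have "rat_size (a $ k) \<le> vec_size a" if "k < m" for k
  unfolding vec_size_def using a(1) that by (intro member_le_sum) auto
 ultimately have "rb OT (a $ k)" if "k < m" for k using that a(3) by (intro rb_mono[OF rb_rat_size]) force
 then show "dim_vec a = m \<and> (\<forall>k<m. rb OT (a $ k)) \<and> (\<forall>y\<in>feas I. real_vec a \<bullet> y < real_vec a \<bullet> real_vec x)"
  using a by auto
qed

lemma N_pos: "1 \<le> N" and K_pos: "1 \<le> K" and T_pos: "1 \<le> T"
 by (simp_all add: n_samples_def n_top_def n_cuts_def)

lemma K_large: "1 \<le> r * real K"
proof -
 have "1 / radius I < of_int \<lfloor>1 / radius I\<rfloor> + 1" by linarith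
 also have "\<dots> = of_nat K" using radius by (simp add: n_top_def)
 finally have "1 < radius I * of_nat K" using radius by (simp add: field_simps)
 then have "real_of_rat 1 < real_of_rat (radius I * of_nat K)" by (simp only: of_rat_less)
 then show ?thesis by (simp add: of_rat_mult)
qed

section \<open>The empirical objective\<close>

definition phat :: "(nat => nat set) => nat set => real" where
 "phat As A = real (card {j. j < N \<and> As j = A}) / real N"

definition mhat :: "(nat => nat set) => rat" where
 "mhat As = (\<Sum>i<N. min (1 / of_nat N) (radius I / of_nat (card {j. j < N \<and> As j = As i})))"

text \<open>The gain is a supremum over shifts that do not depend on the point, so
  \<open>fhat\<close> inherits convexity from the recourse function, and an optimal shift provides a
  subgradient.\<close>

definition fhat :: "(nat => nat set) => real Matrix.vec => real" where
 "fhat As y = c \<bullet> y + (\<Sum>i<N. recourse I y (As i)) / real N + shift_gain S r (light_mass S r (phat As)) (recourse I y)"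

lemma dot_eq: "y \<in> carrier_vec m ==> c \<bullet> y = (\<Sum>k<m. real_of_rat (cost1 I $ k) * y $ k)"
 using cost_dim by (simp add: scalar_prod_def atLeast0LessThan)

lemma dot_nonneg: "y \<in> feas I ==> 0 \<le> c \<bullet> y"
 by (subst dot_eq) (auto intro!: sum_nonneg mult_nonneg_nonneg simp: feas_carrier feas_nonneg cost_nonneg zero_le_of_rat_iff)

lemma gain_ge: "y \<in> feas I ==> s \<in> shifts S r M ==> (\<Sum>A\<in>S. s A * recourse I y A) \<le> shift_gain S r M (recourse I y)"
 by (rule shift_gain_ge[where g = "recourse I y" and U = "{..<usize I}"])
   (auto simp: finite_scenarios r_pos full_scenario recourse_bounds simp del: zero_less_of_rat_iff)

lemma gain_le: "y \<in> feas I ==> 0 \<le> M ==> shift_gain S r M (recourse I y) \<le> M * recourse I y {..<usize I}"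
 by (rule shift_gain_le[where g = "recourse I y" and U = "{..<usize I}"])
   (auto simp: finite_scenarios r_pos full_scenario recourse_bounds simp del: zero_less_of_rat_iff)

lemma gain_least: "y \<in> feas I ==> 0 \<le> M ==> (\<And>s. s \<in> shifts S r M ==> (\<Sum>A\<in>S. s A * recourse I y A) \<le> b) ==>
  shift_gain S r M (recourse I y) \<le> b"
 by (rule shift_gain_least[where g = "recourse I y" and U = "{..<usize I}"])
   (auto simp: finite_scenarios r_pos full_scenario recourse_bounds simp del: zero_less_of_rat_iff)

lemma gain_top: "y \<in> feas I ==> r \<le> M ==> r * recourse I y {..<usize I} \<le> shift_gain S r M (recourse I y)"
 by (rule shift_gain_top[where g = "recourse I y" and U = "{..<usize I}"])
   (auto simp: finite_scenarios r_pos full_scenario recourse_bounds simp del: zero_less_of_rat_iff)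

lemma gain_scale: "y \<in> feas I ==> 0 \<le> M' ==> M' \<le> q * M ==> 1 \<le> q ==>
  shift_gain S r M' (recourse I y) \<le> q * shift_gain S r M (recourse I y)"
 by (rule shift_gain_scale[where g = "recourse I y" and U = "{..<usize I}"])
   (auto simp: finite_scenarios r_pos full_scenario recourse_bounds simp del: zero_less_of_rat_iff)

context
 fixes As :: "nat => nat set" assumes As: "\<And>j. j < N ==> As j \<in> S"
begin

lemma sum_by_value: "(\<Sum>i<N. h (As i)) = (\<Sum>A\<in>S. real (card {j. j < N \<and> As j = A}) * (h A :: real))"
proof -
 have "(\<Sum>i<N. h (As i)) = (\<Sum>A\<in>S. \<Sum>i\<in>{i\<in>{..<N}. As i = A}. h (As i))"
  using As finite_scenarios by (intro sum.group[symmetric]) auto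
 also have "\<dots> = (\<Sum>A\<in>S. real (card {j. j < N \<and> As j = A}) * h A)"
  by (intro sum.cong refl) simp
 finally show ?thesis .
qed

lemma phat_sum: "(\<Sum>A\<in>S. phat As A) = 1" and phat_nonneg: "0 \<le> phat As A"
 and phat_expect: "(\<Sum>i<N. h (As i)) / real N = (\<Sum>A\<in>S. phat As A * (h A :: real))"
proof -
 show e: "(\<Sum>i<N. h (As i)) / real N = (\<Sum>A\<in>S. phat As A * (h A :: real))" for h
  unfolding sum_by_value phat_def by (simp add: sum_divide_distrib)
 show "(\<Sum>A\<in>S. phat As A) = 1" using e[of "\<lambda>_. 1"] N_pos by simp
 show "0 \<le> phat As A" by (simp add: phat_def)
qed

lemma mhat_real: "real_of_rat (mhat As) = light_mass S r (phat As)"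
proof -
 have min: "real_of_rat (min a b) = min (real_of_rat a) (real_of_rat b)" for a b by (simp add: min_def of_rat_less_eq)
 have gen: "n * min (1 / q) (b / n) = min (n / q) b" if "n > 0" for n q b :: real
  using that by (simp add: min_mult_distrib_left)
 have "real_of_rat (mhat As) = (\<Sum>i<N. min (1 / real N) (r / real (card {j. j < N \<and> As j = As i})))"
  unfolding mhat_def by (simp add: of_rat_sum min of_rat_divide)
 also have "\<dots> = (\<Sum>A\<in>S. real (card {j. j < N \<and> As j = A}) * min (1 / real N) (r / real (card {j. j < N \<and> As j = A})))"
  by (rule sum_by_value)
 also have "\<dots> = light_mass S r (phat As)" unfolding light_mass_def
 proof (intro sum.cong refl)
  fix A
  let ?n = "real (card {j. j < N \<and> As j = A})"
  show "?n * min (1 / real N) (r / ?n) = min (phat As A) r"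
  proof (cases "?n = 0")
   case False
   then have "?n > 0" using of_nat_0_le_iff[of "card {j. j < N \<and> As j = A}", where ?'a = real] by linarith
   then show ?thesis unfolding phat_def by (rule gen)
  next
   case True
   show ?thesis unfolding phat_def True using min_absorb1[OF less_imp_le[OF r_pos(1)]] by simp
  qed
 qed
 finally show ?thesis .
qed

lemma mhat_bounds:
 "r \<le> real_of_rat (mhat As)" "real_of_rat (mhat As) \<le> r * real (card S)" "real_of_rat (mhat As) \<le> r * real K"
 "real_of_rat (mhat As) \<le> 1"
proof -
 show "r \<le> real_of_rat (mhat As)" unfolding mhat_real
  using light_mass_ge[OF finite_scenarios phat_nonneg phat_sum] r_pos by simp
 show "real_of_rat (mhat As) \<le> r * real (card S)" unfolding mhat_real by (rule light_mass_le_card)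
 show 1: "real_of_rat (mhat As) \<le> 1" unfolding mhat_real using phat_sum by (rule light_mass_le_1)
 show "real_of_rat (mhat As) \<le> r * real K" using 1 K_large by linarith
qed

lemma fhat_nonneg_le:
 assumes y: "y \<in> feas I"
 shows "fhat As y \<le> c \<bullet> y + 2 * recourse I y {..<usize I}"
proof -
 have U: "recourse I y {..<usize I} \<ge> 0" using recourse_bounds(1)[OF y full_scenario] .
 have "(\<Sum>i<N. recourse I y (As i)) \<le> of_nat (card {..<N}) * recourse I y {..<usize I}"
  using As recourse_bounds(2)[OF y] by (intro sum_bounded_above) auto
 then have "(\<Sum>i<N. recourse I y (As i)) / real N \<le> recourse I y {..<usize I}"
  using N_pos by (simp add: field_simps)
 moreover have "shift_gain S r (real_of_rat (mhat As)) (recourse I y) \<le> real_of_rat (mhat As) * recourse I y {..<usize I}"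
  using mhat_bounds(1) r_pos(1) by (intro gain_le[OF y]) linarith
 moreover have "real_of_rat (mhat As) * recourse I y {..<usize I} \<le> 1 * recourse I y {..<usize I}"
  using mhat_bounds(4) U by (rule mult_right_mono)
 ultimately show ?thesis unfolding fhat_def mhat_real[symmetric] by linarith
qed

text \<open>At \<open>x\<close> the greedy weights attain the supremum in the gain; elsewhere they
  are still an admissible shift. So the weighted sum of the scenario subgradients is a subgradient
  of the whole objective at \<open>x\<close>.\<close>

lemma fhat_eval:
 assumes x: "x \<in> carrier_vec m" "real_vec x \<in> feas I" "\<And>k. k < m ==> rb (point_bits I E) (x $ k)"
  and cs: "top_seq S (value_orc I x) K cs"
  and wt: "\<And>j. wt j = (if j < N then 1 / of_nat N else fill (radius I) (mhat As) (j - N))"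
  and Bs: "\<And>j. Bs j = (if j < N then As j else cs (j - N))"
 shows "real_of_rat ((\<Sum>k<m. cost1 I $ k * x $ k) + (\<Sum>i<N + K. wt i * value_orc I x (Bs i))) = fhat As (real_vec x)"
  and "y \<in> feas I ==> fhat As y \<ge> fhat As (real_vec x) +
   (\<Sum>k<m. real_of_rat (cost1 I $ k + (\<Sum>i<N + K. wt i * subgrad_orc I x (Bs i) $ k)) * (y $ k - real_of_rat (x $ k)))"
proof -
 let ?M = "real_of_rat (mhat As)"
 have M0: "0 < ?M" using mhat_bounds(1) r_pos by linarith
 have max: "real_of_rat (max a b) = max (real_of_rat a) (real_of_rat b)" for a b by (simp add: max_def of_rat_less_eq)
 have min: "real_of_rat (min a b) = min (real_of_rat a) (real_of_rat b)" for a b by (simp add: min_def of_rat_less_eq)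
 have fill: "real_of_rat (fill (radius I) (mhat As) k) = fill r ?M k" for k
  by (simp add: fill_def max min of_rat_diff of_rat_mult)
 have fill0: "0 \<le> fill r ?M k" for k by (simp add: fill_def)
 have csS: "cs k \<in> S" if "k < K" for k using cs that by (simp add: top_seq_def)
 have vo: "real_of_rat (value_orc I x A) = recourse I (real_vec x) A" if "A \<in> S" for A using value_oracle(1)[OF x that] .
 have split: "(\<Sum>i<N + K. real_of_rat (wt i) * h (Bs i)) = (\<Sum>i<N. h (As i)) / real N + (\<Sum>k<K. fill r ?M k * h (cs k))" for h
 proof -
  have "(\<Sum>i<N + K. real_of_rat (wt i) * h (Bs i)) = (\<Sum>i<N. real_of_rat (wt i) * h (Bs i)) + (\<Sum>k<K. real_of_rat (wt (N + k)) * h (Bs (N + k)))"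
   by (rule sum_lessThan_add)
  also have "(\<Sum>i<N. real_of_rat (wt i) * h (Bs i)) = (\<Sum>i<N. h (As i)) / real N"
   unfolding sum_divide_distrib by (intro sum.cong refl) (simp add: wt Bs of_rat_divide)
  also have "(\<Sum>k<K. real_of_rat (wt (N + k)) * h (Bs (N + k))) = (\<Sum>k<K. fill r ?M k * h (cs k))"
   by (intro sum.cong refl) (simp add: wt Bs fill)
  finally show ?thesis .
 qed
 have top: "top_seq S (recourse I (real_vec x)) K cs"
  unfolding top_seq_def
 proof (intro allI impI)
  fix k assume k: "k < K"
  have "recourse I (real_vec x) A \<le> recourse I (real_vec x) (cs k)" if "A \<in> S" "value_orc I x A \<le> value_orc I x (cs k)" for A
   using that vo[OF that(1)] vo[OF csS[OF k]] by (metis of_rat_less_eq)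
  then show "cs k \<in> S \<and> (\<not> S \<subseteq> cs ` {..<k} --> cs k \<notin> cs ` {..<k} \<and>
    (\<forall>A\<in>S. A \<notin> cs ` {..<k} --> recourse I (real_vec x) A \<le> recourse I (real_vec x) (cs k)))"
   using cs k by (simp add: top_seq_def)
 qed
 note greedy = finite_scenarios[of I] r_pos(1) M0 mhat_bounds(2,3)
 obtain s where s: "s \<in> shifts S r ?M" "\<And>g'. (\<Sum>A\<in>S. s A * g' A) = (\<Sum>k<K. fill r ?M k * g' (cs k))"
  using greedy_in_shifts[OF greedy top] by blast
 have ge: "(\<Sum>k<K. fill r ?M k * recourse I y (cs k)) \<le> shift_gain S r ?M (recourse I y)" if "y \<in> feas I" for y
  using gain_ge[OF that s(1)] s(2) by simp
 have le: "shift_gain S r ?M (recourse I (real_vec x)) \<le> (\<Sum>k<K. fill r ?M k * recourse I (real_vec x) (cs k))"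
  using M0 greedy_optimal[OF greedy top] recourse_bounds(1)[OF x(2)] by (intro gain_least[OF x(2)]) auto
 have eqG: "shift_gain S r ?M (recourse I (real_vec x)) = (\<Sum>k<K. fill r ?M k * recourse I (real_vec x) (cs k))"
  using ge[OF x(2)] le by (rule antisym[rotated])
 have val: "(\<Sum>i<N + K. real_of_rat (wt i) * real_of_rat (value_orc I x (Bs i))) =
  (\<Sum>i<N + K. real_of_rat (wt i) * recourse I (real_vec x) (Bs i))"
  using As csS vo by (intro sum.cong refl) (simp add: Bs)
 show main: "real_of_rat ((\<Sum>k<m. cost1 I $ k * x $ k) + (\<Sum>i<N + K. wt i * value_orc I x (Bs i))) = fhat As (real_vec x)"
  unfolding of_rat_add of_rat_sum of_rat_mult val split fhat_def mhat_real[symmetric] eqG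
  using x(1) by (simp add: dot_eq)
 assume y: "y \<in> feas I"
 let ?d = "\<lambda>A k. real_of_rat (subgrad_orc I x A $ k)"
 let ?dy = "\<lambda>k. y $ k - real_of_rat (x $ k)"
 have sub: "recourse I y A \<ge> recourse I (real_vec x) A + (\<Sum>k<m. ?d A k * ?dy k)" if A: "A \<in> S" for A
 proof -
  have "recourse I y A \<ge> recourse I (real_vec x) A + real_vec (subgrad_orc I x A) \<bullet> (y - real_vec x)"
   using value_oracle(3)[OF x A] y by (simp add: good_subgradient_def subgradient_on_def)
  moreover have "real_vec (subgrad_orc I x A) \<bullet> (y - real_vec x) = (\<Sum>k<m. ?d A k * ?dy k)"
   using value_oracle(4)[OF x A] x(1) feas_carrier[OF y] by (simp add: scalar_prod_def atLeast0LessThan)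
  ultimately show ?thesis by simp
 qed
 have "(\<Sum>i<N + K. real_of_rat (wt i) * (recourse I (real_vec x) (Bs i) + (\<Sum>k<m. ?d (Bs i) k * ?dy k)))
  \<le> (\<Sum>i<N + K. real_of_rat (wt i) * recourse I y (Bs i))"
 proof (intro sum_mono mult_left_mono)
  fix i assume i: "i \<in> {..<N + K}"
  then have "Bs i \<in> S" using As csS by (simp add: Bs)
  then show "recourse I (real_vec x) (Bs i) + (\<Sum>k<m. ?d (Bs i) k * ?dy k) \<le> recourse I y (Bs i)" by (rule sub)
  show "0 \<le> real_of_rat (wt i)" by (simp add: wt fill_def)
 qed
 also have "\<dots> \<le> (\<Sum>i<N. recourse I y (As i)) / real N + shift_gain S r ?M (recourse I y)"
  unfolding split using ge[OF y] by simp
 also have "\<dots> = fhat As y - c \<bullet> y" by (simp add: fhat_def mhat_real)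
 finally have 1: "(\<Sum>i<N + K. real_of_rat (wt i) * (recourse I (real_vec x) (Bs i) + (\<Sum>k<m. ?d (Bs i) k * ?dy k))) \<le> fhat As y - c \<bullet> y" .
 have 2: "(\<Sum>i<N + K. real_of_rat (wt i) * (recourse I (real_vec x) (Bs i) + (\<Sum>k<m. ?d (Bs i) k * ?dy k))) =
  (\<Sum>i<N + K. real_of_rat (wt i) * recourse I (real_vec x) (Bs i)) + (\<Sum>i<N + K. real_of_rat (wt i) * (\<Sum>k<m. ?d (Bs i) k * ?dy k))"
  by (simp add: distrib_left sum.distrib)
 have 3: "(\<Sum>i<N + K. real_of_rat (wt i) * recourse I (real_vec x) (Bs i)) = fhat As (real_vec x) - c \<bullet> real_vec x"
  unfolding split fhat_def mhat_real[symmetric] eqG by simp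
 have 4: "(\<Sum>i<N + K. real_of_rat (wt i) * (\<Sum>k<m. ?d (Bs i) k * ?dy k)) = (\<Sum>k<m. (\<Sum>i<N + K. real_of_rat (wt i) * ?d (Bs i) k) * ?dy k)"
  unfolding sum_distrib_left sum_distrib_right by (subst sum.swap) (simp add: mult.assoc)
 have 5: "(\<Sum>k<m. real_of_rat (cost1 I $ k + (\<Sum>i<N + K. wt i * subgrad_orc I x (Bs i) $ k)) * ?dy k) =
  (c \<bullet> y - c \<bullet> real_vec x) + (\<Sum>k<m. (\<Sum>i<N + K. real_of_rat (wt i) * ?d (Bs i) k) * ?dy k)"
  using x(1) feas_carrier[OF y]
  by (simp add: dot_eq of_rat_add of_rat_sum of_rat_mult distrib_right sum.distrib right_diff_distrib sum_subtractf)
 show "fhat As y \<ge> fhat As (real_vec x) +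
   (\<Sum>k<m. real_of_rat (cost1 I $ k + (\<Sum>i<N + K. wt i * subgrad_orc I x (Bs i) $ k)) * ?dy k)"
  using 1 unfolding 2 3 4 5 by linarith
qed

end

end

section \<open>The main loop\<close>

context drso_run
begin

text \<open>A superset of the queries of every run, fixed before sampling: a union bound over it
  covers queries that are chosen adaptively from the same samples. The denominator is that of the
  last round times \<open>m + 1\<close> from the centroid.\<close>

definition points :: "rat Matrix.vec set" where
 "points = {v \<in> carrier_vec m. \<forall>k<m. \<exists>z::int. v $ k = of_int z / (of_nat D ^ T * (of_nat m + 1)) \<and>
   \<bar>z\<bar> \<le> int (m + 1) * (3 ^ T * int R * int D ^ T)}"

lemma bits:
 "ratio_bits I E OT \<le> B" "point_bits I E \<le> B" "weight_bits I E \<Delta> \<le> B"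
 "m * (isize I + point_bits I E + 1) + term_bits I E \<Delta> OT + 1 \<le> B" "normal_bits I E \<Delta> OT \<le> B"
 "m * (normal_bits I E \<Delta> OT + (point_bits I E + point_bits I E + 1) + 1) \<le> B"
 "2 * D + 1 \<le> B" "T \<le> B" "grid_bits I E \<le> B" "N + K \<le> B" "D \<le> B"
 using B unfolding cell_bits_def by linarith+

lemma loops: "ratio_bits I E OT \<le> Z" "T \<le> Z" "N + K \<le> Z"
 using Z unfolding loop_bound_def by linarith+

lemma R_le: "R \<le> 2 ^ (2 * isize I + 1)"
proof -
 have fl: "\<lfloor>outer_rad I\<rfloor> \<ge> 0" using rads by simp
 have "rb (isize I) (of_nat (nat \<lfloor>outer_rad I\<rfloor>))" using rb_floor[OF rb_param(3)] fl by simp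
 then have "nat \<lfloor>outer_rad I\<rfloor> \<le> 2 ^ isize I" by (rule rb_of_nat_le)
 moreover have "m \<le> 2 ^ isize I" using mu_isize(1) by (rule nat_le_pow2)
 ultimately have "R \<le> 2 ^ isize I * (2 ^ isize I + 1)" unfolding simplex_size_def by (intro mult_mono) auto
 also have "\<dots> \<le> 2 ^ isize I * (2 ^ isize I * 2)" by (intro mult_left_mono) auto
 also have "\<dots> = 2 ^ (2 * isize I + 1)" by (simp add: power_add mult_2)
 finally show ?thesis .
qed

lemma D_pos: "k < m ==> 0 < D" by (simp add: precision_def)

lemma point_bits_eq: "T * D + 2 * T + (2 * isize I + 1) + Suc m = point_bits I E"
 by (simp add: point_bits_def)

text \<open>Fractions from an earlier round are expanded by \<open>D ^ (T - t)\<close> to the common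
  denominator.\<close>

lemma centroid_point:
 assumes t: "t \<le> T" and g: "\<And>i k. i \<le> m ==> k < m ==> on_grid D t R (v i k)"
  and x: "x \<in> carrier_vec m" "\<And>k. k < m ==> x $ k = (\<Sum>i\<le>m. v i k) / (of_nat m + 1)"
 shows "x \<in> points"
 unfolding points_def
proof (intro CollectI conjI allI impI x(1))
 fix k assume k: "k < m"
 have D0: "D > 0" by (rule D_pos[OF k])
 obtain z :: int where z: "(\<Sum>i<Suc m. v i k) = of_int z / of_nat D ^ t" "\<bar>z\<bar> \<le> int (Suc m) * (3 ^ t * int R * int D ^ t)"
  using rb_grid_sum(1)[OF D0 t R_le, of "Suc m" "\<lambda>i. v i k"] g k by force
 let ?z = "z * int D ^ (T - t)"
 have gen: "z / b / c = z * a / (b * a * c)" if "a \<noteq> 0" for z a b c :: rat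
  using that by (cases "b = 0 \<or> c = 0") (auto simp: field_simps)
 have pw: "of_nat D ^ T = of_nat D ^ t * (of_nat D ^ (T - t) :: rat)" using t by (simp flip: power_add)
 have "x $ k = of_int z / of_nat D ^ t / (of_nat m + 1)" using x(2)[OF k] z(1) by (simp only: lessThan_Suc_atMost)
 also have "\<dots> = of_int ?z / (of_nat D ^ T * (of_nat m + 1))" unfolding pw of_int_mult of_int_power of_int_of_nat_eq
  by (rule gen) (use D0 in simp)
 finally have eq: "x $ k = of_int ?z / (of_nat D ^ T * (of_nat m + 1))" .
 have "\<bar>?z\<bar> \<le> int (Suc m) * (3 ^ t * int R * int D ^ t) * int D ^ (T - t)"
  using z(2) by (simp add: abs_mult power_abs mult_right_mono)
 also have "\<dots> = int (Suc m) * (3 ^ t * (int R * int D ^ T))" using t by (simp add: mult_ac flip: power_add)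
 also have "\<dots> \<le> int (Suc m) * (3 ^ T * (int R * int D ^ T))"
  using t by (intro mult_left_mono mult_right_mono power_increasing) auto
 finally show "\<exists>z::int. x $ k = of_int z / (of_nat D ^ T * (of_nat m + 1)) \<and> \<bar>z\<bar> \<le> int (m + 1) * (3 ^ T * int R * int D ^ T)"
  using eq by (intro exI[of _ ?z]) (simp add: mult_ac)
qed

lemma point_rb:
 assumes x: "x \<in> points" and k: "k < m" shows "rb (point_bits I E) (x $ k)"
proof -
 have D0: "D > 0" by (rule D_pos[OF k])
 obtain z :: int where z: "x $ k = of_int z / (of_nat D ^ T * (of_nat m + 1))" "\<bar>z\<bar> \<le> int (m + 1) * (3 ^ T * int R * int D ^ T)"
  using x k by (auto simp: points_def)
 have P: "(3::int) ^ T * int D ^ T \<le> 2 ^ (T * D + 2 * T)" by (rule grid_power_le) simp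
 have m1: "int (m + 1) \<le> 2 ^ Suc m" using nat_le_pow2[of "m + 1" "Suc m"] by (metis of_nat_le_iff of_nat_numeral of_nat_power Suc_eq_plus1 order_refl)
 have R': "int R \<le> 2 ^ (2 * isize I + 1)" using R_le by (metis of_nat_le_iff of_nat_numeral of_nat_power)
 have "int (m + 1) * (int R * (3 ^ T * int D ^ T)) \<le> 2 ^ Suc m * (2 ^ (2 * isize I + 1) * 2 ^ (T * D + 2 * T))"
  using m1 R' P by (intro mult_mono) auto
 also have "\<dots> = 2 ^ point_bits I E" unfolding point_bits_eq[symmetric] by (simp add: power_add mult_ac)
 finally have n: "\<bar>z\<bar> \<le> 2 ^ point_bits I E" using z(2) by (simp add: mult_ac)
 have "1 * int D ^ T \<le> (3::int) ^ T * int D ^ T" by (intro mult_right_mono) auto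
 then have "int D ^ T * int (m + 1) \<le> 2 ^ (T * D + 2 * T) * 2 ^ Suc m" using P m1 by (intro mult_mono) auto
 also have "\<dots> = 2 ^ (T * D + 2 * T + Suc m)" by (simp add: power_add)
 also have "\<dots> \<le> 2 ^ point_bits I E" unfolding point_bits_def by (intro power_increasing) auto
 finally have d: "int D ^ T * int (m + 1) \<le> 2 ^ point_bits I E" .
 show ?thesis by (rule rbI[of "int D ^ T * int (m + 1)" z]) (use D0 n d z(1) in \<open>simp_all add: add.commute\<close>)
qed

lemma zero_point: "0\<^sub>v m \<in> points"
 unfolding points_def by (auto intro!: exI[of _ "0::int"])

lemma shrink_factor:
 fixes al :: "nat => rat"
 assumes al: "al p \<le> al i" "al p \<le> 0" and m: "0 < m"
  and s: "s = (of_int \<lfloor>of_nat D / (1 + al i / (0 - al p) / (8 * (of_nat m * of_nat m)))\<rfloor> + 1) / of_nat D"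
 shows "\<exists>n::int. s = of_int n / of_nat D \<and> 0 \<le> n \<and> n \<le> 2 * int D"
proof -
 let ?x = "al i / (0 - al p) / (8 * (of_nat m * of_nat m)) :: rat"
 have D32: "32 \<le> D" using m by (cases m) (auto simp: precision_def)
 have mm: "(1::rat) \<le> of_nat m * of_nat m" using m by (cases m) (auto simp: algebra_simps)
 have b: "-1 \<le> al i / (0 - al p)"
 proof (cases "al p = 0")
  case False
  then have "0 < - al p" using al by simp
  then show ?thesis using al by (simp add: field_simps)
 qed simp
 have "-1 / 8 \<le> ?x"
 proof -
  have "(-1) / (8 * (of_nat m * of_nat m)) \<le> ?x" using b mm by (intro divide_right_mono) auto
  moreover have "-1 / 8 \<le> (-1) / (8 * (of_nat m * of_nat m) :: rat)" using mm by (simp add: field_simps)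
  ultimately show ?thesis by linarith
 qed
 then have x: "7 / 8 \<le> 1 + ?x" by linarith
 define q where "q = of_nat D / (1 + ?x)"
 have q0: "0 \<le> q" unfolding q_def using x by (intro divide_nonneg_nonneg) auto
 have "q \<le> of_nat D / (7 / 8)" unfolding q_def using x by (intro divide_left_mono mult_pos_pos) auto
 then have "7 * q \<le> 8 * of_nat D" by simp
 moreover have "of_int \<lfloor>q\<rfloor> \<le> q" by linarith
 moreover have "(32::rat) \<le> of_nat D" using D32 by (metis of_nat_le_iff of_nat_numeral)
 ultimately have "of_int \<lfloor>q\<rfloor> + 1 \<le> (2 * of_nat D :: rat)" by linarith
 then have "of_int (\<lfloor>q\<rfloor> + 1) \<le> (of_int (2 * int D) :: rat)" by simp
 then have "\<lfloor>q\<rfloor> + 1 \<le> 2 * int D" by (simp only: of_int_le_iff)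
 moreover have "0 \<le> \<lfloor>q\<rfloor> + 1" using q0 by (simp add: zero_le_floor add_increasing2)
 ultimately show ?thesis unfolding s q_def[symmetric] by (intro exI[of _ "\<lfloor>q\<rfloor> + 1"]) simp
qed

section \<open>Invariants of the main loop relative to a set of target points\<close>

definition regs :: "(nat => nat set) => memory => bool" where
 "regs As L \<longleftrightarrow> params L \<and> L 15 0 = of_nat (2 ^ usize I - 1) \<and> L 21 0 = of_nat D \<and> L 24 0 = of_nat N \<and> L 25 0 = of_nat K \<and>
   L 28 0 = mhat As \<and> (\<forall>j<N. L 27 j = of_nat (set_encode (As j)))"

definition answer_ok :: "(nat => nat set) => memory => bool" where
 "answer_ok As L \<longleftrightarrow> get_vec 2 m L \<in> points \<and> real_vec (get_vec 2 m L) \<in> feas I \<and>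
   fhat As (real_vec (get_vec 2 m L)) \<le> real_of_rat (L 34 0)"

text \<open>Once the recorded value is at most \<tau>, nothing is claimed about the simplex any
  more, since later cuts may remove target points. Before that, every cut keeps all of
  \<open>Y\<close>. Dimension 0 is exempt.\<close>

definition simplex_ok :: "real => real Matrix.vec set => nat => memory => bool" where
 "simplex_ok \<tau> Y t L \<longleftrightarrow> (0 < m --> real_of_rat (L 34 0) \<le> \<tau> \<or>
   ((\<forall>y\<in>Y. in_simplex m (\<lambda>i k. real_of_rat (L 33 (i * m + k))) (\<lambda>k. y $ k)) \<and>
   simplex_vol m (\<lambda>i k. real_of_rat (L 33 (i * m + k))) \<le> exp (- real t / (32 * real m ^ 2)) * real R ^ m))"

definition track :: "(nat => nat set) => real => real Matrix.vec set => nat => memory => bool" where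
 "track As \<tau> Y t L \<longleftrightarrow> regs As L \<and> (\<forall>i\<le>m. \<forall>k<m. on_grid D t R (L 33 (i * m + k))) \<and> answer_ok As L \<and> simplex_ok \<tau> Y t L \<and>
   L 34 0 \<le> 2 * top_value I"

definition normal_ok :: "real => real Matrix.vec set => rat Matrix.vec => memory => bool" where
 "normal_ok \<tau> Y x L \<longleftrightarrow> (\<forall>k<m. rb (normal_bits I E \<Delta> OT) (L 41 k)) \<and> (real_of_rat (L 34 0) \<le> \<tau> \<or>
   (\<forall>y\<in>Y. (\<Sum>k<m. real_of_rat (L 41 k) * y $ k) < (\<Sum>k<m. real_of_rat (L 41 k) * real_of_rat (x $ k))))"

context
 fixes As :: "nat => nat set" and \<tau> :: real and Y :: "real Matrix.vec set"
 assumes As: "\<And>j. j < N ==> As j \<in> S"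
  and Y: "Y \<noteq> {}" "\<And>y. y \<in> Y ==> y \<in> feas I" "\<And>y. y \<in> Y ==> fhat As y \<le> \<tau>"
begin

lemma rb_mhat: "rb (n_samples I E \<Delta> * (isize I + n_samples I E \<Delta> + 1)) (mhat As)"
 "j \<le> N ==> rb B (\<Sum>i<j. min (1 / of_nat N) (radius I / of_nat (card {j. j < N \<and> As j = As i})))"
proof -
 have one: "rb (isize I + N) (min (1 / of_nat N) (radius I / of_nat (card {j. j < N \<and> As j = As i})))" for i
 proof -
  have "rb N (of_nat N)" by (rule rb_nat[OF nat_le_pow2]) simp
  then have 1: "rb (isize I + N) (1 / of_nat N)" using rb_mono[OF rb_div[OF rb_1[of 0]]] by simp
  have "card {j. j < N \<and> As j = As i} \<le> card {..<N}" by (rule card_mono) auto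
  then have "rb N (of_nat (card {j. j < N \<and> As j = As i}))" by (intro rb_nat[OF nat_le_pow2]) simp
  then have 2: "rb (isize I + N) (radius I / of_nat (card {j. j < N \<and> As j = As i}))" by (rule rb_div[OF rb_param(2)])
  show ?thesis using 1 2 by (simp add: min_def)
 qed
 have s: "rb (j * (isize I + N + 1)) (\<Sum>i<j. min (1 / of_nat N) (radius I / of_nat (card {j. j < N \<and> As j = As i})))" for j
  by (rule rb_sum[OF one])
 show "rb (n_samples I E \<Delta> * (isize I + n_samples I E \<Delta> + 1)) (mhat As)" unfolding mhat_def by (rule s)
 assume j: "j \<le> N"
 have "j * (isize I + N + 1) \<le> N * (isize I + N + 1)" using j by (rule mult_right_mono) simp
 also have "\<dots> \<le> B" using bits(3) unfolding weight_bits_def by linarith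
 finally show "rb B (\<Sum>i<j. min (1 / of_nat N) (radius I / of_nat (card {j. j < N \<and> As j = As i})))" using s rb_mono by blast
qed

lemma rb_rem: "j \<le> K ==> rb (weight_bits I E \<Delta>) (max 0 (mhat As - of_nat j * radius I))"
 and rb_fill: "j \<le> K ==> rb (weight_bits I E \<Delta>) (fill (radius I) (mhat As) j)"
 and rb_invN: "rb (weight_bits I E \<Delta>) (1 / of_nat N)"
proof -
 have a: "rb (weight_bits I E \<Delta>) (mhat As - of_nat j * radius I)" if "j \<le> K" for j
 proof -
  have "rb K (of_nat j)" using that by (intro rb_nat[OF nat_le_pow2])
  from rb_diff[OF rb_mhat(1) rb_mult[OF this rb_param(2)]] show ?thesis
   by (rule rb_mono) (simp add: weight_bits_def)
 qed
 have b: "rb (weight_bits I E \<Delta>) (radius I)" by (rule rb_mono[OF rb_param(2)]) (simp add: weight_bits_def)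
 show "rb (weight_bits I E \<Delta>) (max 0 (mhat As - of_nat j * radius I))" if "j \<le> K" using a[OF that] by (simp add: max_def)
 show "rb (weight_bits I E \<Delta>) (fill (radius I) (mhat As) j)" if "j \<le> K" using a[OF that] b by (simp add: fill_def max_def min_def)
 have "rb N (of_nat N)" by (rule rb_nat[OF nat_le_pow2]) simp
 then have "rb N (1 / of_nat N)" using rb_mono[OF rb_div[OF rb_1[of 0]]] by simp
 then show "rb (weight_bits I E \<Delta>) (1 / of_nat N)"
 proof (rule rb_mono)
  have "N * 1 \<le> N * (isize I + N + 1)" by (intro mult_left_mono) auto
  then show "N \<le> weight_bits I E \<Delta>" unfolding weight_bits_def by linarith
 qed
qed

text \<open>If the subgradient cut at \<open>x\<close> does not strictly keep a target point, the
  subgradient inequality makes the value at \<open>x\<close> no larger than at that point; the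
  record is then at most \<tau>.\<close>

lemma cor_evaluate:
 assumes bd: "bd B L" and regs: "regs As L" and ans: "answer_ok As L"
  and x: "get_vec 39 m L = x" "x \<in> points" "real_vec x \<in> feas I"
  and Q: "\<And>L'. bd B L' ==>
   (\<And>b. b < 60 ==> b \<notin> {2, 10, 11, 12, 14, 27, 34, 36, 41, 45, 46, 47, 48, 49, 50, 51, 52, 53, 54, 55, 56, 57, 58, 59} ==> L' b = L b) ==>
   regs As L' ==> answer_ok As L' ==> L' 34 0 \<le> L 34 0 ==> normal_ok \<tau> Y x L' ==> Q L'"
 shows "cor (Seq top_prog (Seq objective_prog record_prog)) L Q"
proof -
 have r: "params L" "L 15 0 = of_nat (2 ^ usize I - 1)" "L 21 0 = of_nat D" "L 24 0 = of_nat N" "L 25 0 = of_nat K" "L 28 0 = mhat As"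
  "\<And>j. j < N ==> L 27 j = of_nat (set_encode (As j))" using regs by (auto simp: regs_def)
 have xc: "x \<in> carrier_vec m" using x(2) by (simp add: points_def)
 have xrb: "\<And>k. k < m ==> rb (point_bits I E) (x $ k)" using point_rb[OF x(2)] .
 have vo: "real_of_rat (value_orc I x A) = recourse I (real_vec x) A" "rb OT (value_orc I x A)"
  "good_subgradient I (real_vec x) A (real_vec (subgrad_orc I x A))"
  "dim_vec (subgrad_orc I x A) = m" if "A \<in> S" for A
  using value_oracle[of x A] xc x(3) xrb that by blast+
 have vo5: "rb OT (subgrad_orc I x A $ k)" if "A \<in> S" "k < m" for A k
  using value_oracle(5)[of x A k] xc x(3) xrb that by blast
 have OTB: "OT \<le> B" using bits(5) unfolding normal_bits_def by linarith
 have wB: "weight_bits I E \<Delta> \<le> B" by (rule bits(3))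
 have g0: "0 \<le> value_orc I x A" if "A \<in> S" for A
  using vo(1)[OF that] recourse_bounds(1)[OF x(3) that] by (metis zero_le_of_rat_iff)
 have gm: "value_orc I x A \<le> value_orc I x A'" if "A \<in> S" "A' \<in> S" "A \<subseteq> A'" for A A'
 proof -
  have "recourse I (real_vec x) A \<le> recourse I (real_vec x) A'" using mon x(3) that unfolding monotone_recourse_def by blast
  then show ?thesis using vo(1)[OF that(1)] vo(1)[OF that(2)] by (metis of_rat_less_eq)
 qed
 have n2: "K \<le> 2 ^ B" "N + K \<le> 2 ^ B" using bits(10) by (auto intro!: nat_le_pow2)
 show ?thesis
 proof (rule cor_seq[where ?Q1.0 = "\<lambda>L1. \<exists>cs. top_seq S (value_orc I x) K cs \<and>
   (\<forall>k<K. L1 27 (N + k) = of_nat (set_encode (cs k))) \<and> (\<forall>j<N. L1 27 j = L 27 j)"])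
  show "cor top_prog L (\<lambda>L1. \<exists>cs. top_seq S (value_orc I x) K cs \<and>
   (\<forall>k<K. L1 27 (N + k) = of_nat (set_encode (cs k))) \<and> (\<forall>j<N. L1 27 j = L 27 j))"
  proof (rule cor_top[OF bd r(1) r(4) r(5) K_pos _ n2(1) r(2) x(1)])
   show "K \<le> Z" using loops(3) by linarith
   fix L' cs assume "top_seq S (value_orc I x) K cs" "\<And>k. k < K ==> L' 27 (N + k) = of_nat (set_encode (cs k))"
    "\<And>j. j < N ==> L' 27 j = L 27 j"
   then show "\<exists>cs. top_seq S (value_orc I x) K cs \<and>
    (\<forall>k<K. L' 27 (N + k) = of_nat (set_encode (cs k))) \<and> (\<forall>j<N. L' 27 j = L 27 j)" by blast
  qed (use g0 gm rb_mono[OF vo(2) OTB] in blast)+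
  fix L1 assume bd1: "bd B L1" and fr1: "\<And>b. b < 60 ==> b \<notin> wr top_prog ==> L1 b = L b"
   and "\<exists>cs. top_seq S (value_orc I x) K cs \<and> (\<forall>k<K. L1 27 (N + k) = of_nat (set_encode (cs k))) \<and> (\<forall>j<N. L1 27 j = L 27 j)"
  then obtain cs where cs: "top_seq S (value_orc I x) K cs" "\<forall>k<K. L1 27 (N + k) = of_nat (set_encode (cs k))"
   "\<forall>j<N. L1 27 j = L 27 j" by blast
  have csS: "cs k \<in> S" if "k < K" for k using cs(1) that by (simp add: top_seq_def)
  define Bs where "Bs j = (if j < N then As j else cs (j - N))" for j
  define wt where "wt j = (if j < N then 1 / of_nat N else fill (radius I) (mhat As) (j - N))" for j
  have BsS: "Bs j \<in> S" if "j < N + K" for j using that As csS by (auto simp: Bs_def)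
  have BsC: "L1 27 j = of_nat (set_encode (Bs j))" if "j < N + K" for j
  proof (cases "j < N")
   case False
   then have jN: "j - N < K" "N + (j - N) = j" using that by auto
   show ?thesis using cs(2)[rule_format, OF jN(1)] False unfolding jN(2) by (simp add: Bs_def)
  qed (use cs(3) r(7) in \<open>simp add: Bs_def\<close>)
  have wtrb: "rb (weight_bits I E \<Delta>) (wt j)" if "j < N + K" for j
   using rb_invN rb_fill[of "j - N"] that by (simp add: wt_def)
  let ?base = "\<Sum>k<m. cost1 I $ k * x $ k"
  let ?val = "?base + (\<Sum>i<N + K. wt i * value_orc I x (Bs i))"
  let ?sg = "\<lambda>k. cost1 I $ k + (\<Sum>i<N + K. wt i * subgrad_orc I x (Bs i) $ k)"
  have rb_base: "rb (j * (isize I + point_bits I E + 1)) (\<Sum>k<j. cost1 I $ k * x $ k)" if "j \<le> m" for j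
   using that by (intro rb_sum rb_mult rb_param(5) xrb) auto
  have term_le: "j * (weight_bits I E \<Delta> + OT + 1) \<le> term_bits I E \<Delta> OT" if "j \<le> N + K" for j
   unfolding term_bits_def using that by (intro mult_right_mono) auto
  have rb_sg: "rb (normal_bits I E \<Delta> OT) (cost1 I $ k + (\<Sum>i<j. wt i * subgrad_orc I x (Bs i) $ k))" if "j \<le> N + K" "k < m" for j k
  proof -
   have "rb (j * (weight_bits I E \<Delta> + OT + 1)) (\<Sum>i<j. wt i * subgrad_orc I x (Bs i) $ k)"
    using that by (intro rb_sum rb_mult wtrb vo5 BsS) auto
   from rb_add[OF rb_param(5)[OF that(2)] this] show ?thesis
    by (rule rb_mono) (use term_le[OF that(1)] in \<open>simp add: normal_bits_def\<close>)
  qed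
  have frL1: "L1 b = L b" if "b < 60" "b \<notin> {10, 11, 12, 14, 27, 45, 46, 47, 48, 49, 50, 51, 52, 53, 54}" for b
   using fr1[of b] that by simp
  have par1: "params L1" using frL1 by (intro params_cong[OF r(1)]) simp_all
  show "cor (Seq objective_prog record_prog) L1 Q"
  proof (rule cor_seq[where ?Q1.0 = "\<lambda>L2. L2 56 0 = ?val \<and> (\<forall>k<m. L2 41 k = ?sg k)"])
   show "cor objective_prog L1 (\<lambda>L2. L2 56 0 = ?val \<and> (\<forall>k<m. L2 41 k = ?sg k))"
   proof (rule cor_objective[OF bd1 par1, where N = N and K = K and mh = "mhat As" and As = Bs and x = x and wt = wt])
    show "get_vec 39 m L1 = x" using x(1) frL1[of 39] by (simp add: get_vec_def)
    have "0 \<le> real_of_rat (mhat As)" using mhat_bounds(1)[OF As] r_pos(1) by (meson less_imp_le order_trans)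
    then show "0 \<le> mhat As" by (simp add: zero_le_of_rat_iff)
    show "0 \<le> radius I" using radius by simp
    show "rb B (\<Sum>k<j. cost1 I $ k * x $ k)" if "j \<le> m" for j
    proof (rule rb_mono[OF rb_base[OF that]])
     have "j * (isize I + point_bits I E + 1) \<le> m * (isize I + point_bits I E + 1)" using that by (rule mult_right_mono) simp
     then show "j * (isize I + point_bits I E + 1) \<le> B" using bits(4) by linarith
    qed
    show "rb B (?base + (\<Sum>i<j. wt i * value_orc I x (Bs i)))" if "j \<le> N + K" for j
    proof -
     have "rb (j * (weight_bits I E \<Delta> + OT + 1)) (\<Sum>i<j. wt i * value_orc I x (Bs i))"
      using that by (intro rb_sum rb_mult wtrb vo(2) BsS) auto
     from rb_add[OF rb_base[OF order_refl] this] show ?thesis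
      by (rule rb_mono) (use term_le[OF that] bits(4) in linarith)
    qed
    show "rb B (cost1 I $ k + (\<Sum>i<j. wt i * subgrad_orc I x (Bs i) $ k))" if "j \<le> N + K" "k < m" for j k
     using rb_mono[OF rb_sg[OF that] bits(5)] .
    show "rb B (subgrad_orc I x A $ k)" if "A \<in> S" "k < m" for A k using rb_mono[OF vo5[OF that] OTB] .
    show "rb B (value_orc I x A)" if "A \<in> S" for A using rb_mono[OF vo(2)[OF that] OTB] .
    show "rb B (1 / of_nat N)" using rb_mono[OF rb_invN wB] .
    show "rb B (max 0 (mhat As - of_nat j * radius I))" if "j \<le> K" for j using rb_mono[OF rb_rem[OF that] wB] .
   qed (use frL1 r K_pos loops(3) n2(2) BsS BsC vo(4) in \<open>simp_all add: wt_def\<close>)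
   fix L2 assume bd2: "bd B L2" and fr2: "\<And>b. b < 60 ==> b \<notin> wr objective_prog ==> L2 b = L1 b"
    and v2: "L2 56 0 = ?val \<and> (\<forall>k<m. L2 41 k = ?sg k)"
   have par2: "params L2" using fr2 by (intro params_cong[OF par1]) simp_all
   have wt': "\<And>j. wt j = (if j < N then 1 / of_nat N else fill (radius I) (mhat As) (j - N))" by (simp add: wt_def)
   have Bs': "\<And>j. Bs j = (if j < N then As j else cs (j - N))" by (simp add: Bs_def)
   have val: "real_of_rat (L2 56 0) = fhat As (real_vec x)"
    using fhat_eval(1)[OF As xc x(3) xrb cs(1) wt' Bs'] v2 by simp
   have sub: "fhat As y \<ge> fhat As (real_vec x) + (\<Sum>k<m. real_of_rat (L2 41 k) * (y $ k - real_of_rat (x $ k)))" if "y \<in> feas I" for y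
    using fhat_eval(2)[OF As xc x(3) xrb cs(1) wt' Bs' that] v2 by simp
   show "cor record_prog L2 Q"
   proof (rule cor_record[OF bd2 par2])
    fix L3 assume bd3: "bd B L3" and fr3: "\<And>b. b < 60 ==> b \<notin> {2, 34, 36} ==> L3 b = L2 b"
     and rec: "if L2 56 0 < L2 34 0 then L3 34 0 = L2 56 0 \<and> (\<forall>k<m. L3 2 k = L2 39 k) else L3 34 0 = L2 34 0 \<and> L3 2 = L2 2"
    have fr: "L3 b = L b" if "b < 60" "b \<notin> {2, 10, 11, 12, 14, 27, 34, 36, 41, 45, 46, 47, 48, 49, 50, 51, 52, 53, 54, 55, 56, 57, 58, 59}" for b
     using fr3[of b] fr2[of b] frL1[of b] that by simp
    have L234: "L2 34 = L 34" "L2 2 = L 2" "L2 39 = L 39" "L3 27 = L1 27" "L3 41 = L2 41"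
     using fr2[of 34] fr2[of 2] fr2[of 39] frL1[of 34] frL1[of 2] frL1[of 39] fr3[of 27] fr2[of 27] fr3[of 41] by simp_all
    have le: "L3 34 0 \<le> L 34 0" "L3 34 0 \<le> L2 56 0" using rec L234 by (auto split: if_splits)
    show "Q L3"
    proof (rule Q[OF bd3 fr])
     show "regs As L3" unfolding regs_def
      using fr[of 15] fr[of 21] fr[of 24] fr[of 25] fr[of 28] r L234(4) cs(3) params_cong[OF r(1) fr[of 0] fr[of "Suc 0"]] by simp
     show "answer_ok As L3"
     proof (cases "L2 56 0 < L2 34 0")
      case True
      then have "get_vec 2 m L3 = x" using rec L234(3) unfolding x(1)[symmetric] by (auto simp: get_vec_def)
      then show ?thesis unfolding answer_ok_def using x(2,3) val rec True by simp
     next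
      case False
      then have "get_vec 2 m L3 = get_vec 2 m L" "L3 34 0 = L 34 0" using rec L234 by (simp_all add: get_vec_def)
      then show ?thesis using ans unfolding answer_ok_def by simp
     qed
     show "L3 34 0 \<le> L 34 0" by (rule le(1))
     show "normal_ok \<tau> Y x L3" unfolding normal_ok_def
     proof (intro conjI allI impI)
      fix k assume k: "k < m"
      show "rb (normal_bits I E \<Delta> OT) (L3 41 k)" using rb_sg[OF order_refl k] v2 k L234(5) by simp
     next
      show "real_of_rat (L3 34 0) \<le> \<tau> \<or> (\<forall>y\<in>Y. (\<Sum>k<m. real_of_rat (L3 41 k) * y $ k) < (\<Sum>k<m. real_of_rat (L3 41 k) * real_of_rat (x $ k)))"
      proof (rule disjCI, rule ccontr)
       assume nex: "\<not> (\<forall>y\<in>Y. (\<Sum>k<m. real_of_rat (L3 41 k) * y $ k) < (\<Sum>k<m. real_of_rat (L3 41 k) * real_of_rat (x $ k)))"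
        and gt: "\<not> real_of_rat (L3 34 0) \<le> \<tau>"
       then obtain y where y: "y \<in> Y" "\<not> (\<Sum>k<m. real_of_rat (L3 41 k) * y $ k) < (\<Sum>k<m. real_of_rat (L3 41 k) * real_of_rat (x $ k))" by blast
       have "fhat As (real_vec x) + (\<Sum>k<m. real_of_rat (L2 41 k) * (y $ k - real_of_rat (x $ k))) \<le> \<tau>"
        using sub[OF Y(2)[OF y(1)]] Y(3)[OF y(1)] by linarith
       moreover have "real_of_rat (L3 34 0) \<le> fhat As (real_vec x)" using le(2) val by (metis of_rat_less_eq)
       moreover have "0 \<le> (\<Sum>k<m. real_of_rat (L2 41 k) * (y $ k - real_of_rat (x $ k)))"
        using y(2) L234(5) by (simp add: right_diff_distrib sum_subtractf)
       ultimately show False using gt by linarith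
      qed
     qed
    qed
   qed
  qed
 qed
qed

lemma track_counter [simp]: "track As \<tau> Y t (set_cell 35 i q L) = track As \<tau> Y t L"
 by (simp add: track_def regs_def answer_ok_def simplex_ok_def get_vec_def)

lemma floor_real_of_rat: "\<lfloor>real_of_rat q\<rfloor> = \<lfloor>q\<rfloor>"
proof (rule floor_unique)
 have "real_of_rat (of_int \<lfloor>q\<rfloor>) \<le> real_of_rat q" by (simp only: of_rat_less_eq of_int_floor_le)
 then show "of_int \<lfloor>q\<rfloor> \<le> real_of_rat q" by simp
 have "real_of_rat q < real_of_rat (of_int \<lfloor>q\<rfloor> + 1)" unfolding of_rat_less by linarith
 then show "real_of_rat q < of_int \<lfloor>q\<rfloor> + 1" by (simp add: of_rat_add)
qed

text \<open>Grid membership and lengths are preserved unconditionally. The claim about the simplex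
  uses \<open>cut_progress\<close>, which applies while the record exceeds \<tau> and the cut is
  known to keep \<open>Y\<close>.\<close>

lemma cor_cut:
 assumes bd: "bd B L" and tr: "track As \<tau> Y t L" and t: "t < T"
  and Q: "\<And>L'. bd B L' ==> track As \<tau> Y (Suc t) L' ==> Q L'"
 shows "cor cut_prog L Q"
proof (rule cor_fwd[OF bd])
 fix M assume bdM: "bd B M" and lM: "low M = L"
 have regs: "regs As L" and gridL: "\<And>i k. i \<le> m ==> k < m ==> on_grid D t R (L 33 (i * m + k))"
  and ans: "answer_ok As L" and simp_ok: "simplex_ok \<tau> Y t L" using tr by (auto simp: track_def)
 have par: "params L" using regs by (simp add: regs_def)
 let ?v = "\<lambda>i k. L 33 (i * m + k)"
 have tT: "t \<le> T" using t by simp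
 have pbB: "point_bits I E \<le> B" by (rule bits(2))
 have rbsum: "rb B (\<Sum>i<j. ?v i k)" if "j \<le> Suc m" "k < m" for j k
  by (rule rb_mono[OF rb_grid_sum(2)[OF D_pos[OF that(2)] tT R_le]])
    (use gridL that pbB point_bits_eq in \<open>auto simp del: point_bits_eq\<close>)
 have rbv: "rb (point_bits I E) (?v i k)" if "i \<le> m" "k < m" for i k
  by (rule rb_mono[OF rb_grid[OF D_pos[OF that(2)] tT R_le gridL[OF that]]]) (use point_bits_eq in linarith)
 define x where "x = Matrix.vec m (\<lambda>k. (\<Sum>i\<le>m. ?v i k) / (of_nat m + 1))"
 have xk: "x $ k = (\<Sum>i\<le>m. ?v i k) / (of_nat m + 1)" if "k < m" for k using that by (simp add: x_def)
 have xP: "x \<in> points" by (rule centroid_point[OF tT gridL _ xk]) (simp_all add: x_def)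
 have xrb: "rb (point_bits I E) (x $ k)" if "k < m" for k using point_rb[OF xP that] .
 have "cor centroid_prog (low M) (\<lambda>L1. get_vec 39 m L1 = x)"
  unfolding lM
 proof (rule cor_centroid[OF bd par])
  show "rb B ((\<Sum>i\<le>m. ?v i k) / (of_nat m + 1))" if "k < m" for k using rb_mono[OF xrb[OF that] pbB] xk[OF that] by simp
  show "get_vec 39 m L1 = x" if "\<And>k. k < m ==> L1 39 k = (\<Sum>i\<le>m. ?v i k) / (of_nat m + 1)" for L1
   using that by (intro eq_vecI) (simp_all add: get_vec_def x_def)
 qed (rule rbsum)
 then obtain M1 where M1: "fwd centroid_prog M M1" "bd B M1" "get_vec 39 m (low M1) = x" by (rule fwd_cor)
 have f1: "low M1 b = L b" if "b < 60" "b \<notin> {36, 37, 38, 39}" for b using fwd_frame[OF M1(1), of b] that lM by auto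
 have OTB: "OT \<le> B" using bits(5) unfolding normal_bits_def by linarith
 have xc: "x \<in> carrier_vec m" by (simp add: x_def)
 let ?L1 = "low M1"
 have "cor (Separate 40 41 39) ?L1 (\<lambda>L2. (sep_orc I x = None \<and> L2 = set_cell 40 0 0 ?L1) \<or>
   (\<exists>d. sep_orc I x = Some d \<and> L2 = set_cell 40 0 1 (set_vec 41 d ?L1)))"
 proof (rule cor_Separate)
  fix d assume "sep_orc I (get_vec 39 m ?L1) = Some d"
  then have d: "sep_orc I x = Some d" using M1(3) by simp
  have "dim_vec d = m \<and> (\<forall>k<m. rb OT (d $ k))" using separation_oracle(2)[OF xc _ d] xrb by blast
  then have "\<forall>i<dim_vec d. rb B (d $ i)" using rb_mono[OF _ OTB] by simp
  then show "(\<forall>i<dim_vec d. rb B (d $ i)) \<and> ((sep_orc I x = None \<and> set_cell 40 0 1 (set_vec 41 d ?L1) = set_cell 40 0 0 ?L1) \<or>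
   (\<exists>d'. sep_orc I x = Some d' \<and> set_cell 40 0 1 (set_vec 41 d ?L1) = set_cell 40 0 1 (set_vec 41 d' ?L1)))"
   using d by blast
 qed (use M1 in simp_all)
 then obtain M2 where M2: "fwd (Separate 40 41 39) M1 M2" "bd B M2"
  "(sep_orc I x = None \<and> low M2 = set_cell 40 0 0 ?L1) \<or> (\<exists>d. sep_orc I x = Some d \<and> low M2 = set_cell 40 0 1 (set_vec 41 d ?L1))"
  by (rule fwd_cor)
 have f2: "low M2 b = L b" if "b < 60" "b \<notin> {36, 37, 38, 39, 40, 41}" for b
  using fwd_frame[OF M2(1), of b] f1[of b] that by simp
 have x2: "get_vec 39 m (low M2) = x" using fwd_frame[OF M2(1), of 39] M1(3) by (simp add: get_vec_def)
 have regs2: "regs As (low M2)"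
  using regs f2[of 15] f2[of 21] f2[of 24] f2[of 25] f2[of 28] f2[of 27] params_cong[OF par f2[of 0] f2[of "Suc 0"]]
  unfolding regs_def by simp
 have ans2: "answer_ok As (low M2)" using ans f2[of 2] f2[of 34] unfolding answer_ok_def get_vec_def by simp
 let ?cond = "ifp (Vr 40) skip (Seq top_prog (Seq objective_prog record_prog))"
 have "cor ?cond (low M2) (\<lambda>L3. regs As L3 \<and> answer_ok As L3 \<and> L3 34 0 \<le> L 34 0 \<and> normal_ok \<tau> Y x L3)"
 proof (rule cor_ifp)
  assume "0 < ev (Vr 40) (low M2)"
  then obtain d where d: "sep_orc I x = Some d" "low M2 = set_cell 40 0 1 (set_vec 41 d ?L1)" using M2(3) by (auto simp del: low_apply)
  have dd: "dim_vec d = m" "\<And>k. k < m ==> rb OT (d $ k)" "\<And>y. y \<in> feas I ==> real_vec d \<bullet> y < real_vec d \<bullet> real_vec x"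
   using separation_oracle(2)[OF xc _ d(1)] xrb by blast+
  have 41: "low M2 41 k = d $ k" if "k < m" for k using d(2) dd(1) that by (simp add: set_vec_def)
  have "normal_ok \<tau> Y x (low M2)" unfolding normal_ok_def
  proof (intro conjI allI impI disjI2 ballI)
   fix k assume "k < m"
   then show "rb (normal_bits I E \<Delta> OT) (low M2 41 k)"
    unfolding 41[OF \<open>k < m\<close>] by (intro rb_mono[OF dd(2)]) (simp_all add: normal_bits_def)
  next
   fix y assume y: "y \<in> Y"
   have "real_vec d \<bullet> y = (\<Sum>k<m. real_of_rat (d $ k) * y $ k)" "real_vec d \<bullet> real_vec x = (\<Sum>k<m. real_of_rat (d $ k) * real_of_rat (x $ k))"
    using feas_carrier[OF Y(2)[OF y]] xc dd(1) by (simp_all add: scalar_prod_def atLeast0LessThan)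
   then show "(\<Sum>k<m. real_of_rat (low M2 41 k) * y $ k) < (\<Sum>k<m. real_of_rat (low M2 41 k) * real_of_rat (x $ k))"
    using dd(3)[OF Y(2)[OF y]] 41 by simp
  qed
  then show "cor skip (low M2) (\<lambda>L3. regs As L3 \<and> answer_ok As L3 \<and> L3 34 0 \<le> L 34 0 \<and> normal_ok \<tau> Y x L3)"
   using M2(2) regs2 ans2 f2[of 34] by (intro cor_skip) simp_all
 next
  assume "\<not> 0 < ev (Vr 40) (low M2)"
  then have none: "sep_orc I x = None" using M2(3) by (auto simp del: low_apply)
  then have xf: "real_vec x \<in> feas I" using separation_oracle(1)[OF xc] xrb by blast
  show "cor (Seq top_prog (Seq objective_prog record_prog)) (low M2) (\<lambda>L3. regs As L3 \<and> answer_ok As L3 \<and> L3 34 0 \<le> L 34 0 \<and> normal_ok \<tau> Y x L3)"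
   by (rule cor_evaluate[OF _ regs2 ans2 x2 xP xf]) (use M2(2) f2[of 34] in simp_all)
 qed (use M2(2) in \<open>simp_all add: eok_def\<close>)
 then obtain M3 where M3: "fwd ?cond M2 M3" "bd B M3"
  "regs As (low M3) \<and> answer_ok As (low M3) \<and> low M3 34 0 \<le> L 34 0 \<and> normal_ok \<tau> Y x (low M3)" by (rule fwd_cor)
 have f3: "M3 33 = L 33" using fwd_frame[OF M3(1), of 33] f2[of 33] by simp
 have x3: "M3 39 k = x $ k" if "k < m" for k
 proof -
  have "M3 39 = M2 39" using fwd_frame[OF M3(1), of 39] by simp
  moreover have "M2 39 k = x $ k" using arg_cong[OF x2, of "\<lambda>v. v $ k"] that by (simp add: get_vec_def)
  ultimately show ?thesis by simp
 qed
 have par3: "params (low M3)" using M3(3) by (simp add: regs_def)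
 define a where "a k = M3 41 k" for k
 define al where "al i = (\<Sum>k<m. a k * (?v i k - x $ k))" for i
 have rba: "rb (normal_bits I E \<Delta> OT) (a k)" if "k < m" for k using M3(3) that by (simp add: normal_ok_def a_def)
 have "cor heights_prog (low M3) (\<lambda>L4. \<forall>i\<le>m. L4 42 i = al i)"
 proof (rule cor_heights[OF _ par3])
  fix i j assume ij: "i \<le> m" "j \<le> m"
  have "rb (j * (normal_bits I E \<Delta> OT + (point_bits I E + point_bits I E + 1) + 1)) (\<Sum>k<j. a k * (?v i k - x $ k))"
   using ij by (intro rb_sum rb_mult rb_diff rba rbv xrb) auto
  moreover have "j * (normal_bits I E \<Delta> OT + (point_bits I E + point_bits I E + 1) + 1) \<le> B"
   using mult_right_mono[OF ij(2), of "normal_bits I E \<Delta> OT + (point_bits I E + point_bits I E + 1) + 1"] bits(6) by linarith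
  ultimately have "rb B (\<Sum>k<j. a k * (?v i k - x $ k))" by (rule rb_mono)
  moreover have "(\<Sum>k<j. low M3 41 k * (low M3 33 (i * m + k) - low M3 39 k)) = (\<Sum>k<j. a k * (?v i k - x $ k))"
   using ij x3 by (intro sum.cong) (simp_all add: a_def f3)
  ultimately show "rb B (\<Sum>k<j. low M3 41 k * (low M3 33 (i * m + k) - low M3 39 k))" by simp
 next
  fix L4 assume h: "\<And>i. i \<le> m ==> L4 42 i = (\<Sum>k<m. low M3 41 k * (low M3 33 (i * m + k) - low M3 39 k))"
  show "\<forall>i\<le>m. L4 42 i = al i"
  proof (intro allI impI)
   fix i assume "i \<le> m"
   show "L4 42 i = al i" unfolding h[OF \<open>i \<le> m\<close>] al_def using x3 by (intro sum.cong) (simp_all add: a_def f3)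
  qed
 qed (use M3(2) in simp)
 then obtain M4 where M4: "fwd heights_prog M3 M4" "bd B M4" "\<forall>i\<le>m. low M4 42 i = al i" by (rule fwd_cor)
 have f4: "M4 b = M3 b" if "b < 60" "b \<notin> {36, 37, 38, 42}" for b using fwd_frame[OF M4(1), of b] that by simp
 have par4: "params (low M4)" using f4 params_low params_cong[of "M3" "M4"] par3 by simp
 have "cor argmin_prog (low M4) (\<lambda>L5. \<exists>p\<le>m. L5 43 0 = of_nat p \<and> (\<forall>i\<le>m. al p \<le> al i))"
 proof (rule cor_argmin[OF _ par4])
  fix L5 p assume p: "p \<le> m" "L5 43 0 = of_nat p" and le: "\<And>i. i \<le> m ==> low M4 42 p \<le> low M4 42 i"
  have "al p \<le> al i" if "i \<le> m" for i using le[OF that] M4(3) p(1) that by simp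
  then show "\<exists>p\<le>m. L5 43 0 = of_nat p \<and> (\<forall>i\<le>m. al p \<le> al i)" using p by blast
 qed (use M4(2) in simp)
 then obtain M5 where M5: "fwd argmin_prog M4 M5" "bd B M5" "\<exists>p\<le>m. low M5 43 0 = of_nat p \<and> (\<forall>i\<le>m. al p \<le> al i)" by (rule fwd_cor)
 obtain p where p: "p \<le> m" "M5 43 0 = of_nat p" "\<And>i. i \<le> m ==> al p \<le> al i" using M5(3) by auto
 have f5: "M5 b = M3 b" if "b < 60" "b \<notin> {36, 37, 38, 42, 43}" for b using fwd_frame[OF M5(1), of b] f4[of b] that by simp
 have par5: "params (low M5)" using f5 params_low params_cong[of "M3" "M5"] par3 by simp
 have al5: "M5 42 i = al i" if "i \<le> m" for i using fwd_frame[OF M5(1), of 42] M4(3) that by simp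
 have D5: "M5 21 0 = of_nat D" using f5[of 21] M3(3) by (simp add: regs_def)
 have v5: "M5 33 = L 33" using f5[of 33] f3 by simp
 define s where "s i = (of_int \<lfloor>of_nat D / (1 + al i / (0 - al p) / (8 * (of_nat m * of_nat m)))\<rfloor> + 1) / (of_nat D :: rat)" for i
 define v' where "v' i k = ?v p k + s i * (?v i k - ?v p k)" for i k
 \<comment> \<open>The centroid balances the heights, so the lowest one is not positive; this holds
   even when the cut separates nothing.\<close>
 have al_sum: "(\<Sum>i\<le>m. al i) = 0"
 proof -
  have "(\<Sum>i\<le>m. al i) = (\<Sum>k<m. \<Sum>i\<le>m. a k * (?v i k - x $ k))" unfolding al_def by (rule sum.swap)
  also have "\<dots> = (\<Sum>k<m. a k * ((\<Sum>i\<le>m. ?v i k) - (of_nat m + 1) * x $ k))"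
   by (simp add: sum_distrib_left[symmetric] sum_subtractf add.commute)
  also have "\<dots> = 0"
  proof (intro sum.neutral ballI)
   fix k assume "k \<in> {..<m}"
   moreover have "(of_nat m + 1 :: rat) \<noteq> 0" by (metis Suc_eq_plus1 of_nat_Suc of_nat_neq_0 add.commute)
   ultimately show "a k * ((\<Sum>i\<le>m. ?v i k) - (of_nat m + 1) * x $ k) = 0" using xk[of k] by simp
  qed
  finally show ?thesis .
 qed
 have alp: "al p \<le> 0"
 proof (rule ccontr)
  assume "\<not> al p \<le> 0"
  then have "0 < al i" if "i \<le> m" for i using p(3)[OF that] by linarith
  then have "0 < (\<Sum>i\<le>m. al i)" by (intro sum_pos) auto
  then show False using al_sum by simp
 qed
 have sD: "\<exists>n::int. s i = of_int n / of_nat D \<and> 0 \<le> n \<and> n \<le> 2 * int D" if "i \<le> m" "0 < m" for i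
  by (rule shrink_factor[OF p(3)[OF that(1)] alp that(2)]) (simp add: s_def)
 have rbs: "rb B (s i)" if im: "i \<le> m" for i
 proof (cases "0 < m")
  case True
  obtain n :: int where n: "s i = of_int n / of_nat D" "0 \<le> n" "n \<le> 2 * int D" using sD[OF im True] by blast
  have D0: "0 < D" by (rule D_pos[OF True])
  have "2 * D \<le> 2 ^ (2 * D + 1)" "D \<le> 2 ^ (2 * D + 1)" by (rule nat_le_pow2, simp)+
  then have "int (2 * D) \<le> int (2 ^ (2 * D + 1))" "int D \<le> int (2 ^ (2 * D + 1))" by (simp_all only: of_nat_le_iff)
  then have le: "2 * int D \<le> 2 ^ (2 * D + 1)" "int D \<le> 2 ^ (2 * D + 1)" by simp_all
  have "\<bar>n\<bar> \<le> 2 ^ (2 * D + 1)" using n le by linarith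
  then have "rb (2 * D + 1) (s i)" by (intro rbI[of "int D" n]) (use n D0 le(2) in simp_all)
  then show ?thesis using bits(7) by (rule rb_mono)
 qed (simp add: s_def precision_def)
 have grid': "on_grid D (Suc t) R (v' i k)" if ik: "i \<le> m" "k < m" for i k
 proof -
  have m0: "0 < m" using ik by simp
  obtain n :: int where n: "s i = of_int n / of_nat D" "0 \<le> n" "n \<le> 2 * int D" using sD[OF ik(1) m0] by blast
  show ?thesis unfolding v'_def by (rule on_grid_shrink[OF D_pos[OF ik(2)] gridL[OF p(1) ik(2)] gridL[OF ik] n])
 qed
 have rbv': "rb B (v' i k)" if ik: "i \<le> m" "k < m" for i k
  by (rule rb_mono[OF rb_grid[OF D_pos[OF ik(2)] Suc_leI[OF t] R_le grid'[OF ik]]]) (use point_bits_eq bits(2) in linarith)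
 have "cor shrink_prog (low M5) (\<lambda>L6. \<forall>i\<le>m. \<forall>k<m. L6 33 (i * m + k) = v' i k)"
  by (rule cor_shrink[OF _ par5, where p = p and D = "of_nat D" and s = s and v' = v'])
    (use M5(2) p D5 al5 v5 rbs rbv' in \<open>simp_all add: s_def v'_def\<close>)
 then obtain M6 where M6: "fwd shrink_prog M5 M6" "bd B M6" "\<forall>i\<le>m. \<forall>k<m. low M6 33 (i * m + k) = v' i k" by (rule fwd_cor)
 have f6: "M6 b = M3 b" if "b < 60" "b \<notin> {33, 36, 37, 38, 42, 43, 44}" for b using fwd_frame[OF M6(1), of b] f5[of b] that by simp
 have v6: "M6 33 (i * m + k) = v' i k" if "i \<le> m" "k < m" for i k using M6(3) that by simp
 have "track As \<tau> Y (Suc t) (low M6)" unfolding track_def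
 proof (intro conjI allI impI)
  have "params M6" using params_cong[of M3 M6] f6 par3 params_low by simp
  then show "regs As (low M6)" using M3(3) f6[of 15] f6[of 21] f6[of 24] f6[of 25] f6[of 28] f6[of 27]
   unfolding regs_def params_low by simp
  show "answer_ok As (low M6)" using M3(3) f6[of 2] f6[of 34] unfolding answer_ok_def get_vec_def by simp
  show "on_grid D (Suc t) R (low M6 33 (i * m + k))" if "i \<le> m" "k < m" for i k using grid'[OF that] v6[OF that] by simp
  have "low M6 34 0 = low M3 34 0" using f6[of 34] by simp
  moreover have "low M3 34 0 \<le> L 34 0" using M3(3) by blast
  moreover have "L 34 0 \<le> 2 * top_value I" using tr unfolding track_def by blast
  ultimately show "low M6 34 0 \<le> 2 * top_value I" by linarith
  show "simplex_ok \<tau> Y (Suc t) (low M6)" unfolding simplex_ok_def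
  proof (intro impI disjCI)
   assume m0: "0 < m" and nalt: "\<not> ((\<forall>y\<in>Y. in_simplex m (\<lambda>i k. real_of_rat (low M6 33 (i * m + k))) (\<lambda>k. y $ k)) \<and>
    simplex_vol m (\<lambda>i k. real_of_rat (low M6 33 (i * m + k))) \<le> exp (- real (Suc t) / (32 * real m ^ 2)) * real R ^ m)"
   show "real_of_rat (low M6 34 0) \<le> \<tau>"
   proof (rule ccontr)
    assume gt: "\<not> real_of_rat (low M6 34 0) \<le> \<tau>"
    have 34: "low M6 34 0 = low M3 34 0" using f6[of 34] by simp
    have "real_of_rat (low M3 34 0) \<le> real_of_rat (L 34 0)" using M3(3) by (simp only: of_rat_less_eq)
    then have gtL: "\<not> real_of_rat (L 34 0) \<le> \<tau>" using gt 34 by simp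
    let ?vr = "\<lambda>i k. real_of_rat (?v i k)" and ?v'r = "\<lambda>i k. real_of_rat (low M6 33 (i * m + k))"
    have ins: "\<And>y. y \<in> Y ==> in_simplex m ?vr (\<lambda>k. y $ k)" and vol: "simplex_vol m ?vr \<le> exp (- real t / (32 * real m ^ 2)) * real R ^ m"
     using simp_ok gtL m0 by (auto simp: simplex_ok_def)
    have cut: "\<And>y. y \<in> Y ==> (\<Sum>k<m. real_of_rat (a k) * y $ k) < (\<Sum>k<m. real_of_rat (a k) * real_of_rat (x $ k))"
     using M3(3) gt 34 by (auto simp: normal_ok_def a_def)
    note cp = cut_progress[OF m0, where x = "\<lambda>k. real_of_rat (x $ k)" and v = ?vr and \<alpha> = "\<lambda>i. real_of_rat (al i)"
     and a = "\<lambda>k. real_of_rat (a k)" and p = p and s = "\<lambda>i. real_of_rat (s i)" and v' = ?v'r and Y = "(\<lambda>y k. y $ k) ` Y"]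
    have h1: "real_of_rat (x $ k) = (\<Sum>i\<le>m. ?vr i k) / (real m + 1)" if "k < m" for k
     using xk[OF that] by (simp add: of_rat_divide of_rat_sum of_rat_add)
    have h2: "real_of_rat (al i) = (\<Sum>k<m. real_of_rat (a k) * (?vr i k - real_of_rat (x $ k)))" if "i \<le> m" for i
     by (simp add: al_def of_rat_sum of_rat_mult of_rat_diff)
    have h3: "real_of_rat (al p) \<le> real_of_rat (al i)" if "i \<le> m" for i using p(3)[OF that] by (simp only: of_rat_less_eq)
    \<comment> \<open>The program divides by \<open>0 - al p\<close> and writes powers as products;
      the two arguments of the floor are nevertheless the same number, once as a rational and once
      as a real.\<close>
    have h4: "real_of_rat (s i) = (of_int \<lfloor>32 * real m ^ 3 / (1 + real_of_rat (al i) / (- real_of_rat (al p)) / (8 * real m ^ 2))\<rfloor> + 1) / (32 * real m ^ 3)"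
     if "i \<le> m" for i
    proof -
     have "real_of_rat (of_nat D / (1 + al i / (0 - al p) / (8 * (of_nat m * of_nat m)))) =
      32 * real m ^ 3 / (1 + real_of_rat (al i) / (- real_of_rat (al p)) / (8 * real m ^ 2))"
      by (simp add: of_rat_divide of_rat_add of_rat_diff of_rat_mult precision_def power2_eq_square power3_eq_cube mult_ac)
     then have "\<lfloor>of_nat D / (1 + al i / (0 - al p) / (8 * (of_nat m * of_nat m)))\<rfloor> =
      \<lfloor>32 * real m ^ 3 / (1 + real_of_rat (al i) / (- real_of_rat (al p)) / (8 * real m ^ 2))\<rfloor>"
      using floor_real_of_rat by metis
     moreover have "real D = 32 * real m ^ 3" by (simp add: precision_def power3_eq_cube)
     ultimately show ?thesis unfolding s_def of_rat_divide of_rat_add by (simp only: of_rat_of_int_eq of_rat_1 of_rat_of_nat_eq)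
    qed
    have h5: "?v'r i k = ?vr p k + real_of_rat (s i) * (?vr i k - ?vr p k)" if "i \<le> m" "k < m" for i k
     using v6[OF that] by (simp add: v'_def of_rat_add of_rat_mult of_rat_diff)
    have h6: "(\<lambda>y k. y $ k) ` Y \<noteq> {}" using Y(1) by simp
    have in': "in_simplex m ?v'r y" if "y \<in> (\<lambda>y k. y $ k) ` Y" for y
     by (rule cp(1)[OF h1 h2 p(1) h3 h4 h5 h6 _ _ that]) (use ins cut in auto)
    have vol': "simplex_vol m ?v'r \<le> exp (- 1 / (32 * real m ^ 2)) * simplex_vol m ?vr"
     by (rule cp(2)[OF h1 h2 p(1) h3 h4 h5 h6]) (use ins cut in auto)
    also have "\<dots> \<le> exp (- 1 / (32 * real m ^ 2)) * (exp (- real t / (32 * real m ^ 2)) * real R ^ m)"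
     using vol by (intro mult_left_mono) auto
    also have "\<dots> = exp (- real (Suc t) / (32 * real m ^ 2)) * real R ^ m"
     unfolding mult.assoc[symmetric] exp_add[symmetric] by (simp add: add_divide_distrib diff_divide_distrib)
    finally show False using nalt in' by blast
   qed
  qed
 qed
 then have "Q (low M6)" using M6(2) by (intro Q) simp_all
 moreover have "fwd cut_prog M M6" unfolding cut_prog_def
  by (intro fwd_Seq[OF M1(1)] fwd_Seq[OF M2(1)] fwd_Seq[OF M3(1)] fwd_Seq[OF M4(1)] fwd_Seq[OF M5(1)] M6(1))
 ultimately show "\<exists>M'. fwd cut_prog M M' \<and> bd B M' \<and> Q (low M')" using M6(2) by blast
qed

end

end

section \<open>Random execution\<close>

text \<open>All randomness is factored out: \<open>P\<close> is the distribution of the samples and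
  \<open>F\<close> the deterministic outcome for given samples. One amount of fuel serves all
  outcomes, which is why the composition rules ask for finite support.\<close>

definition rexec :: "drso => com => memory => 'w pmf => ('w => memory \<times> nat) => bool" where
 "rexec I c M P F \<longleftrightarrow> (\<exists>k0. \<forall>k\<ge>k0. \<forall>t0. exec I k c (M, t0) =
   map_spmf (\<lambda>w. (fst (F w), t0 + snd (F w))) (spmf_of_pmf P))"

lemma rexec_Sample:
 "rexec I (Sample a) M (center I) (\<lambda>A. (set_vec a (Matrix.vec (usize I) (\<lambda>i. if i \<in> A then 1 else 0)) M, 1 + usize I))"
 unfolding rexec_def
proof (intro exI[of _ 1] allI impI)
 fix k t0 :: nat assume "1 \<le> k"
 then obtain k' where "k = Suc k'" by (cases k) auto
 then show "exec I k (Sample a) (M, t0) = map_spmf (\<lambda>w. (fst (set_vec a (Matrix.vec (usize I) (\<lambda>i. if i \<in> w then 1 else 0)) M, 1 + usize I),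
    t0 + snd (set_vec a (Matrix.vec (usize I) (\<lambda>i. if i \<in> w then 1 else 0)) M, 1 + usize I))) (spmf_of_pmf (center I))"
  by (simp add: add.assoc)
qed

lemma rexec_Seq_det:
 assumes "runs I c1 M M1 t1" "rexec I c2 M1 P F"
 shows "rexec I (Seq c1 c2) M P (\<lambda>w. (fst (F w), t1 + snd (F w)))"
proof -
 from assms obtain k1 k2 where
  k1: "\<And>k t0. k1 \<le> k ==> exec I k c1 (M, t0) = return_spmf (M1, t0 + t1)" and
  k2: "\<And>k t0. k2 \<le> k ==> exec I k c2 (M1, t0) = map_spmf (\<lambda>w. (fst (F w), t0 + snd (F w))) (spmf_of_pmf P)"
  unfolding runs_def rexec_def by blast
 show ?thesis unfolding rexec_def
 proof (intro exI[of _ "Suc (max k1 k2)"] allI impI)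
  fix k t0 assume "Suc (max k1 k2) \<le> k"
  then obtain k' where "k = Suc k'" "k1 \<le> k'" "k2 \<le> k'" by (cases k) auto
  then show "exec I k (Seq c1 c2) (M, t0) = map_spmf (\<lambda>w. (fst (fst (F w), t1 + snd (F w)), t0 + snd (fst (F w), t1 + snd (F w)))) (spmf_of_pmf P)"
   by (simp add: k1 k2 add.assoc)
 qed
qed

lemma uniform_fuel:
 assumes "finite X" "\<And>w. w \<in> X ==> \<exists>k0. \<forall>k\<ge>k0. R w k"
 shows "\<exists>k0::nat. \<forall>w\<in>X. \<forall>k\<ge>k0. R w k"
proof -
 from assms(2) obtain K where K: "\<And>w k. w \<in> X ==> K w \<le> k ==> R w k" by metis
 have "K w \<le> Max (insert 0 (K ` X))" if "w \<in> X" for w using assms(1) that by (intro Max_ge) auto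
 then show ?thesis using K by (intro exI[of _ "Max (insert 0 (K ` X))"]) (meson order_trans)
qed

lemma rexec_Seq_rand:
 assumes "rexec I c1 M P F" "finite (set_pmf P)" "\<And>w. w \<in> set_pmf P ==> runs I c2 (fst (F w)) (G w) (t w)"
 shows "rexec I (Seq c1 c2) M P (\<lambda>w. (G w, snd (F w) + t w))"
proof -
 from assms(1) obtain k1 where
  k1: "\<And>k t0. k1 \<le> k ==> exec I k c1 (M, t0) = map_spmf (\<lambda>w. (fst (F w), t0 + snd (F w))) (spmf_of_pmf P)"
  unfolding rexec_def by blast
 have "\<exists>k0. \<forall>w\<in>set_pmf P. \<forall>k\<ge>k0. \<forall>t0. exec I k c2 (fst (F w), t0) = return_spmf (G w, t0 + t w)"
  using assms(3) by (intro uniform_fuel[OF assms(2)]) (simp add: runs_def)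
 then obtain k2 where k2: "\<And>w k t0. w \<in> set_pmf P ==> k2 \<le> k ==> exec I k c2 (fst (F w), t0) = return_spmf (G w, t0 + t w)" by blast
 show ?thesis unfolding rexec_def
 proof (intro exI[of _ "Suc (max k1 k2)"] allI impI)
  fix k t0 assume "Suc (max k1 k2) \<le> k"
  then obtain k' where k': "k = Suc k'" "k1 \<le> k'" "k2 \<le> k'" by (cases k) auto
  have "exec I k (Seq c1 c2) (M, t0) = bind_spmf (spmf_of_pmf P) (\<lambda>w. exec I k' c2 (fst (F w), t0 + snd (F w)))"
   unfolding k'(1) exec.simps k1[OF k'(2)] bind_map_spmf by (simp only: o_def)
  also have "\<dots> = bind_spmf (spmf_of_pmf P) (\<lambda>w. return_spmf (G w, t0 + snd (F w) + t w))"
   using k' k2 by (intro bind_spmf_cong) auto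
  finally show "exec I k (Seq c1 c2) (M, t0) = map_spmf (\<lambda>w. (fst (G w, snd (F w) + t w), t0 + snd (G w, snd (F w) + t w))) (spmf_of_pmf P)"
   by (simp add: map_spmf_conv_bind_spmf add.assoc)
 qed
qed

text \<open>Unrolls one round: the head of the list is the sample drawn now, the tail feeds the
  remaining rounds, whose start memory depends on the head.\<close>

lemma rexec_While_replicate:
 assumes pos: "M a 0 > 0" and c: "rexec I c M P F" "finite (set_pmf P)"
  and loop: "\<And>w. w \<in> set_pmf P ==> rexec I (While a c) (fst (F w)) (replicate_pmf n P) (F' w)"
 shows "rexec I (While a c) M (replicate_pmf (Suc n) P)
  (\<lambda>ws. (fst (F' (hd ws) (tl ws)), 1 + rat_size (M a 0) + snd (F (hd ws)) + snd (F' (hd ws) (tl ws))))"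
proof -
 from c(1) obtain k1 where
  k1: "\<And>k t0. k1 \<le> k ==> exec I k c (M, t0) = map_spmf (\<lambda>w. (fst (F w), t0 + snd (F w))) (spmf_of_pmf P)"
  unfolding rexec_def by blast
 have "\<exists>k0. \<forall>w\<in>set_pmf P. \<forall>k\<ge>k0. \<forall>t0. exec I k (While a c) (fst (F w), t0) =
   map_spmf (\<lambda>ws. (fst (F' w ws), t0 + snd (F' w ws))) (spmf_of_pmf (replicate_pmf n P))"
  using loop by (intro uniform_fuel[OF c(2)]) (simp add: rexec_def)
 then obtain k2 where k2: "\<And>w k t0. w \<in> set_pmf P ==> k2 \<le> k ==> exec I k (While a c) (fst (F w), t0) =
   map_spmf (\<lambda>ws. (fst (F' w ws), t0 + snd (F' w ws))) (spmf_of_pmf (replicate_pmf n P))" by blast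
 let ?G = "\<lambda>ws. (fst (F' (hd ws) (tl ws)), 1 + rat_size (M a 0) + snd (F (hd ws)) + snd (F' (hd ws) (tl ws)))"
 show ?thesis unfolding rexec_def
 proof (intro exI[of _ "Suc (max k1 k2)"] allI impI)
  fix k t0 assume "Suc (max k1 k2) \<le> k"
  then obtain k' where k': "k = Suc k'" "k1 \<le> k'" "k2 \<le> k'" by (cases k) auto
  let ?t = "t0 + 1 + rat_size (M a 0)"
  have rep: "spmf_of_pmf (replicate_pmf (Suc n) P) = bind_spmf (spmf_of_pmf P) (\<lambda>w. map_spmf ((#) w) (spmf_of_pmf (replicate_pmf n P)))"
   by (simp add: map_spmf_conv_bind_spmf bind_spmf_of_pmf spmf_of_pmf_bind)
  have "exec I k (While a c) (M, t0) = bind_spmf (exec I k' c (M, ?t)) (exec I k' (While a c))" using k' pos by (simp add: Let_def)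
  also have "\<dots> = bind_spmf (spmf_of_pmf P) (\<lambda>w. exec I k' (While a c) (fst (F w), ?t + snd (F w)))"
   unfolding k1[OF k'(2)] bind_map_spmf by (simp only: o_def)
  also have "\<dots> = bind_spmf (spmf_of_pmf P) (\<lambda>w. map_spmf (\<lambda>ws. (fst (F' w ws), ?t + snd (F w) + snd (F' w ws))) (spmf_of_pmf (replicate_pmf n P)))"
   using k' k2 by (intro bind_spmf_cong) auto
  also have "\<dots> = map_spmf (\<lambda>ws. (fst (?G ws), t0 + snd (?G ws))) (spmf_of_pmf (replicate_pmf (Suc n) P))"
   unfolding rep map_spmf_bind_spmf by (simp only: o_def spmf.map_comp list.sel fst_conv snd_conv add.assoc)
  finally show "exec I k (While a c) (M, t0) = map_spmf (\<lambda>ws. (fst (?G ws), t0 + snd (?G ws))) (spmf_of_pmf (replicate_pmf (Suc n) P))" .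
 qed
qed

context drso_run
begin

text \<open>Induction on the number of samples still to be drawn. The loop is written the way
  \<open>floop\<close> unfolds, because \<open>cor_floop\<close> covers deterministic bodies
  only.\<close>

lemma sampling_loop:
 fixes n :: nat
 defines "e \<equiv> mi (Vr 24) (Vr 26)"
 defines "body \<equiv> Seq (Seq (Seq (Sample 10) (Seq encode_prog (put 27 (Vr 26) (Vr 13)))) (asg 26 (pl (Vr 26) (Kn 1)))) (ecomp e 60)"
 assumes "bd B M" "params M" "M 24 0 = of_nat N" "M 26 0 = of_nat j" "j + n = N" "M 60 0 = ev e M"
 shows "\<exists>F. rexec I (While 60 body) M (replicate_pmf n (center I)) F \<and>
  (\<forall>ws\<in>set_pmf (replicate_pmf n (center I)). bd B (fst (F ws)) \<and>
    (\<forall>b<60. b \<notin> {10, 12, 13, 14, 26, 27} --> fst (F ws) b = M b) \<and>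
    (\<forall>i<j. fst (F ws) 27 i = M 27 i) \<and> (\<forall>i<n. fst (F ws) 27 (j + i) = of_nat (set_encode (ws ! i))) \<and>
    snd (F ws) \<le> n * ((1 + ticks Z body) * W) + W)"
 using assms(3-)
proof (induction n arbitrary: M j)
 case 0
 have eokE: "eok e" by (simp add: e_def eok_def)
 have "ev e M = 0" using 0 by (simp add: e_def)
 then have r: "runs I (While 60 body) M M (1 + rat_size (ev e M))" using runs_While_False[of M 60 I body] 0 by simp
 have "rexec I (While 60 body) M (replicate_pmf 0 (center I)) (\<lambda>_. (M, 1 + rat_size (ev e M)))"
  using r unfolding rexec_def runs_def by simp
 moreover have "1 + rat_size (ev e M) \<le> W" using size_ev[of M e] 0 eokE W_SB by (auto simp: eok_def)
 ultimately show ?case using 0 by (intro exI[of _ "\<lambda>_. (M, 1 + rat_size (ev e M))"]) simp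
next
 case (Suc n)
 have eokE: "eok e" by (simp add: e_def eok_def)
 have evM: "ev e M = of_nat (Suc n)" using Suc.prems by (simp add: e_def flip: \<open>j + Suc n = N\<close>)
 have finc: "finite (set_pmf (center I))" using center finite_scenarios by (rule finite_subset)
 let ?S = "\<lambda>A. set_vec 10 (Matrix.vec (usize I) (\<lambda>i. if i \<in> A then 1 else 0)) M"
 let ?rest = "Seq encode_prog (put 27 (Vr 26) (Vr 13))" and ?inc = "asg 26 (pl (Vr 26) (Kn 1))"
 have jN: "j < N" using Suc.prems by simp
 have step: "\<exists>M' t1 t2 t3. \<exists>M1 M2. runs I ?rest (?S A) M1 t1 \<and> runs I ?inc M1 M2 t2 \<and> runs I (ecomp e 60) M2 M' t3 \<and>
   t1 \<le> ticks Z ?rest * W \<and> t2 \<le> ticks Z ?inc * W \<and> t3 \<le> ticks Z (ecomp e 60) * W \<and> bd B M' \<and>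
   (\<forall>b<60. b \<notin> {10, 12, 13, 14, 26, 27} --> M' b = M b) \<and> M' 26 0 = of_nat (Suc j) \<and> M' 60 0 = ev e M' \<and>
   (\<forall>i. M' 27 i = (if i = j then of_nat (set_encode A) else M 27 i))" if A: "A \<in> S" for A
 proof -
  let ?M0 = "?S A"
  have bd0: "bd B ?M0" using Suc.prems(1) by (simp add: bd_def set_vec_def)
  have M0: "?M0 b = M b" if "b \<noteq> 10" for b using that by (simp add: set_vec_def)
  have "cor encode_prog (low ?M0) (\<lambda>L. L 13 0 = of_nat (set_encode A))"
  proof (rule cor_encode[where A = A])
   show "params (low ?M0)" using Suc.prems(2) M0 params_low params_cong[of M ?M0] by simp
   show "low ?M0 10 i = (if i \<in> A then 1 else 0)" if "i < usize I" for i using that by (simp add: set_vec_def)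
   have "A \<inter> {..<usize I} = A" using A by (auto simp: scenarios_def ground_def)
   then show "L' 13 0 = of_nat (set_encode A)" if "L' 13 0 = of_nat (set_encode (A \<inter> {..<usize I}))" for L' :: memory using that by simp
  qed (use bd0 in simp)
  then obtain M1 where M1: "fwd encode_prog ?M0 M1" "bd B M1" "low M1 13 0 = of_nat (set_encode A)" by (rule fwd_cor)
  have f1: "M1 b = M b" if "b < 60" "b \<notin> {10, 12, 13, 14}" for b using fwd_frame[OF M1(1), of b] M0[of b] that by simp
  let ?L2 = "set_cell 27 j (of_nat (set_encode A)) (low M1)"
  have "cor (put 27 (Vr 26) (Vr 13)) (low M1) (\<lambda>L. L = ?L2)"
   by (rule cor_put) (use M1 f1[of 26] Suc.prems rb_nat[OF code_le[OF A]] in \<open>simp_all add: eok_def\<close>)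
  then obtain M2 where M2: "fwd (put 27 (Vr 26) (Vr 13)) M1 M2" "bd B M2" "low M2 = ?L2" by (rule fwd_cor)
  have M2v: "M2 27 i = (if i = j then of_nat (set_encode A) else M 27 i)" for i
  proof -
   have "M2 27 i = low M2 27 i" by simp
   also have "\<dots> = (if i = j then of_nat (set_encode A) else M 27 i)" unfolding M2(3) using f1[of 27] by (simp add: set_cell_apply)
   finally show ?thesis .
  qed
  have f2: "M2 b = M b" if "b < 60" "b \<notin> {10, 12, 13, 14, 27}" for b using fwd_frame[OF M2(1), of b] f1[of b] that by simp
  have "Suc j \<le> 2 ^ B" using jN bits(10) by (intro nat_le_pow2) linarith
  then have rbj: "rb B (of_nat (Suc j))" by (rule rb_nat)
  obtain M3 where M3: "fwd ?inc M2 M3" "bd B M3" "M3 26 0 = of_nat (Suc j)" "\<And>b. b < 60 ==> b \<noteq> 26 ==> M3 b = M2 b"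
   by (rule fwd_asg[where a = 26 and e = "pl (Vr 26) (Kn 1)", OF M2(2) _ _ _ rbj]) (use f2[of 26] Suc.prems in \<open>simp_all add: eok_def add.commute\<close>)
  obtain M4 t3 where M4: "runs I (ecomp e 60) M3 M4 t3" "\<forall>a<60. M4 a = M3 a" "M4 60 0 = ev e M3" "t3 \<le> ticks Z (ecomp e 60) * W"
   using runs_ecomp[OF M3(2), of e 60] eokE by (auto simp: eok_def)
  have ev4: "ev e M4 = ev e M3" using M4(2) by (intro ev_cong) (auto simp: e_def)
  obtain t1 where t1: "runs I ?rest ?M0 M2 t1" "t1 \<le> ticks Z ?rest * W" using fwd_Seq[OF M1(1) M2(1)] unfolding fwd_def by blast
  obtain t2 where t2: "runs I ?inc M2 M3 t2" "t2 \<le> ticks Z ?inc * W" using M3(1) unfolding fwd_def by blast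
  have "bd B M4" using M3(2) M4(2) by (simp add: bd_def)
  moreover have "\<forall>b<60. b \<notin> {10, 12, 13, 14, 26, 27} --> M4 b = M b" using M4(2) M3(4) f2 by simp
  moreover have "\<forall>i. M4 27 i = (if i = j then of_nat (set_encode A) else M 27 i)" using M4(2) M3(4) M2v by simp
  ultimately show ?thesis using t1 t2 M4 M3(3) ev4 by (intro exI[of _ M4] exI[of _ t1] exI[of _ t2] exI[of _ t3] exI[of _ M2] exI[of _ M3]) simp
 qed
 \<comment> \<open>Naming the conjunction allows end memories and running times to be chosen in one
   go as functions of the drawn scenario.\<close>
 define st_ok where "st_ok A M' t1 t2 t3 M1 M2 \<longleftrightarrow> runs I ?rest (?S A) M1 t1 \<and> runs I ?inc M1 M2 t2 \<and> runs I (ecomp e 60) M2 M' t3 \<and>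
   t1 \<le> ticks Z ?rest * W \<and> t2 \<le> ticks Z ?inc * W \<and> t3 \<le> ticks Z (ecomp e 60) * W \<and> bd B M' \<and>
   (\<forall>b<60. b \<notin> {10, 12, 13, 14, 26, 27} --> M' b = M b) \<and> M' 26 0 = of_nat (Suc j) \<and> M' 60 0 = ev e M' \<and>
   (\<forall>i. M' 27 i = (if i = j then of_nat (set_encode A) else M 27 i))" for A M' t1 t2 t3 M1 M2
 have "\<exists>M' t1 t2 t3 M1 M2. st_ok A M' t1 t2 t3 M1 M2" if "A \<in> S" for A unfolding st_ok_def using step[OF that] .
 then obtain M' t1 t2 t3 M1 M2 where "\<And>A. A \<in> S ==> st_ok A (M' A) (t1 A) (t2 A) (t3 A) (M1 A) (M2 A)" by metis
 note st = this[unfolded st_ok_def]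
 have inS: "A \<in> S" if "A \<in> set_pmf (center I)" for A using center that by blast
 have r: "runs I ?rest (?S A) (M1 A) (t1 A)" "runs I ?inc (M1 A) (M2 A) (t2 A)" "runs I (ecomp e 60) (M2 A) (M' A) (t3 A)"
  if "A \<in> set_pmf (center I)" for A using st[OF inS[OF that]] by blast+
 have "rexec I (Seq (Sample 10) ?rest) M (center I) (\<lambda>A. (M1 A, snd (?S A, 1 + usize I) + t1 A))"
  by (rule rexec_Seq_rand[OF rexec_Sample finc]) (unfold fst_conv, rule r(1))
 then have r1: "rexec I (Seq (Sample 10) ?rest) M (center I) (\<lambda>A. (M1 A, 1 + usize I + t1 A))" unfolding snd_conv .
 have "rexec I (Seq (Seq (Sample 10) ?rest) ?inc) M (center I) (\<lambda>A. (M2 A, snd (M1 A, 1 + usize I + t1 A) + t2 A))"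
  by (rule rexec_Seq_rand[OF r1 finc]) (unfold fst_conv, rule r(2))
 then have r2: "rexec I (Seq (Seq (Sample 10) ?rest) ?inc) M (center I) (\<lambda>A. (M2 A, 1 + usize I + t1 A + t2 A))" unfolding snd_conv .
 have "rexec I body M (center I) (\<lambda>A. (M' A, snd (M2 A, 1 + usize I + t1 A + t2 A) + t3 A))"
  unfolding body_def by (rule rexec_Seq_rand[OF r2 finc]) (unfold fst_conv, rule r(3))
 then have r3: "rexec I body M (center I) (\<lambda>A. (M' A, (1 + usize I) + t1 A + t2 A + t3 A))" unfolding snd_conv .
 have tb: "(1 + usize I) + t1 A + t2 A + t3 A \<le> ticks Z body * W" if "A \<in> S" for A
  using st[OF that] W_sample unfolding body_def by (simp add: distrib_right)
 define F_ok where "F_ok A F \<longleftrightarrow> rexec I (While 60 body) (M' A) (replicate_pmf n (center I)) F \<and>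
  (\<forall>ws\<in>set_pmf (replicate_pmf n (center I)). bd B (fst (F ws)) \<and>
    (\<forall>b<60. b \<notin> {10, 12, 13, 14, 26, 27} --> fst (F ws) b = M' A b) \<and>
    (\<forall>i<Suc j. fst (F ws) 27 i = M' A 27 i) \<and> (\<forall>i<n. fst (F ws) 27 (Suc j + i) = of_nat (set_encode (ws ! i))) \<and>
    snd (F ws) \<le> n * ((1 + ticks Z body) * W) + W)" for A F
 have "\<exists>F. F_ok A F" if A: "A \<in> S" for A
  unfolding F_ok_def
 proof (rule Suc.IH)
  show "params (M' A)" using st[OF A] by (intro params_cong[OF Suc.prems(2)]) simp_all
 qed (use st[OF A] Suc.prems in simp_all)
 then obtain F' where "\<And>A. A \<in> S ==> F_ok A (F' A)" by metis
 note F' = this[unfolded F_ok_def]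
 have pos: "M 60 0 > 0" using Suc.prems(6) evM by simp
 let ?F = "\<lambda>ws. (fst (F' (hd ws) (tl ws)), 1 + rat_size (M 60 0) + ((1 + usize I) + t1 (hd ws) + t2 (hd ws) + t3 (hd ws)) + snd (F' (hd ws) (tl ws)))"
 have "rexec I (While 60 body) M (replicate_pmf (Suc n) (center I)) ?F"
  using rexec_While_replicate[OF pos r3 finc, of n F'] F' inS by simp
 moreover have "bd B (fst (?F ws)) \<and> (\<forall>b<60. b \<notin> {10, 12, 13, 14, 26, 27} --> fst (?F ws) b = M b) \<and>
    (\<forall>i<j. fst (?F ws) 27 i = M 27 i) \<and> (\<forall>i<Suc n. fst (?F ws) 27 (j + i) = of_nat (set_encode (ws ! i))) \<and>
    snd (?F ws) \<le> Suc n * ((1 + ticks Z body) * W) + W" if ws: "ws \<in> set_pmf (replicate_pmf (Suc n) (center I))" for ws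
 proof -
  obtain A ws' where w: "ws = A # ws'" "A \<in> set_pmf (center I)" "ws' \<in> set_pmf (replicate_pmf n (center I))"
   using ws by auto
  have A: "A \<in> S" using inS[OF w(2)] .
  have f: "bd B (fst (F' A ws'))" "\<forall>b<60. b \<notin> {10, 12, 13, 14, 26, 27} --> fst (F' A ws') b = M' A b"
    "\<forall>i<Suc j. fst (F' A ws') 27 i = M' A 27 i" "\<forall>i<n. fst (F' A ws') 27 (Suc j + i) = of_nat (set_encode (ws' ! i))"
    "snd (F' A ws') \<le> n * ((1 + ticks Z body) * W) + W" using F'[OF A] w(3) by blast+
  have s: "\<forall>b<60. b \<notin> {10, 12, 13, 14, 26, 27} --> M' A b = M b" "\<forall>i. M' A 27 i = (if i = j then of_nat (set_encode A) else M 27 i)"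
   using st[OF A] by blast+
  have "fst (F' A ws') 27 (j + i) = of_nat (set_encode ((A # ws') ! i))" if "i < Suc n" for i
   using f(3,4) s(2) that by (cases i) simp_all
  moreover have "1 + rat_size (M 60 0) \<le> W" using size_ev[of M e] Suc.prems(1,6) eokE W_SB by (auto simp: eok_def)
  then have "1 + rat_size (M 60 0) + ((1 + usize I) + t1 A + t2 A + t3 A) + snd (F' A ws') \<le> Suc n * ((1 + ticks Z body) * W) + W"
   using tb[OF A] f(5) by (simp add: distrib_right)
  ultimately show ?thesis using f(1-3) s w(1) by simp
 qed
 ultimately show ?case by blast
qed

end

lemma rb_le: "rb b q ==> q \<le> 2 ^ b"
proof -
 assume "rb b q"
 then obtain n d :: int where nd: "0 < d" "\<bar>n\<bar> \<le> 2 ^ b" "q = of_int n / of_int d" unfolding rb_def by blast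
 have "n \<le> 2 ^ b * 1" using nd by simp
 also have "\<dots> \<le> 2 ^ b * d" using nd by (intro mult_left_mono) auto
 finally have "of_int n \<le> (of_int (2 ^ b * d) :: rat)" by (simp only: of_int_le_iff)
 then show ?thesis unfolding nd(3) using nd(1) by (simp add: divide_le_eq mult.commute)
qed

lemma component_le_norm2:
 assumes "x \<in> carrier_vec n" "k < n" shows "x $ k \<le> norm2 x"
proof -
 have "x $ k * x $ k \<le> (\<Sum>i = 0..<n. x $ i * x $ i)" using assms by (intro member_le_sum) auto
 then have "(x $ k)\<^sup>2 \<le> x \<bullet> x" using assms by (simp add: scalar_prod_def power2_eq_square)
 then show ?thesis unfolding norm2_def by (rule real_le_rsqrt)
qed

section \<open>Size estimates and assembly of the complete run\<close>

context drso_run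
begin

lemma feas_norm: "x \<in> feas I ==> norm2 x \<le> real_of_rat (outer_rad I)"
 using std unfolding standing_assumptions_def well_rounded_def by blast

lemma feas_le_outer: "x \<in> feas I ==> k < m ==> x $ k \<le> real_of_rat (outer_rad I)"
 using component_le_norm2[OF feas_carrier] feas_norm by fastforce

lemma feas_sum_le: "x \<in> feas I ==> (\<Sum>k<m. x $ k) \<le> real R"
proof -
 assume x: "x \<in> feas I"
 have "real_of_rat (outer_rad I) < of_int \<lfloor>real_of_rat (outer_rad I)\<rfloor> + 1" by linarith
 also have "\<dots> = real (nat \<lfloor>outer_rad I\<rfloor> + 1)" unfolding floor_real_of_rat using rads(1) by simp
 finally have "x $ k \<le> real (nat \<lfloor>outer_rad I\<rfloor> + 1)" if "k < m" for k using feas_le_outer[OF x that] by linarith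
 then have "(\<Sum>k<m. x $ k) \<le> of_nat (card {..<m}) * real (nat \<lfloor>outer_rad I\<rfloor> + 1)" by (intro sum_bounded_above) auto
 then show ?thesis by (simp add: simplex_size_def distrib_left add.commute)
qed

text \<open>The length \<open>b\<close> of \<open>top_value\<close> is a parameter because two
  bounds are needed: \<open>OT\<close> during the run, and the answer to the single query at 0 in
  the time analysis, where \<open>OT\<close> itself is still to be estimated.\<close>

lemma ratio_sizes:
 assumes b: "rb b (top_value I)"
 shows "j \<le> m ==> rb (ratio_bits I E b) (\<Sum>k<j. cost1 I $ k)" "rb (ratio_bits I E b) (inv_theta I E)"
  "rb (ratio_bits I E b) (vol_ratio I E)" "log_ratio I E \<le> ratio_bits I E b"
proof -
 have cs: "rb (m * (isize I + 1)) (\<Sum>k<j. cost1 I $ k)" if j: "j \<le> m" for j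
 proof (rule rb_mono[OF rb_sum])
  show "rb (isize I) (cost1 I $ k)" if "k < j" for k using that j by (intro rb_param(5)) simp
  show "j * (isize I + 1) \<le> m * (isize I + 1)" using j by (rule mult_right_mono) simp
 qed
 have "m * (isize I + 1) \<le> ratio_bits I E b" unfolding ratio_bits_def by linarith
 then show "rb (ratio_bits I E b) (\<Sum>k<j. cost1 I $ k)" if "j \<le> m" by (rule rb_mono[OF cs[OF that]])
 have rE: "rb E (of_nat E)" by (rule rb_nat[OF nat_le_pow2]) simp
 have r2: "rb 1 2" using rb_nat[of 2 1] by simp
 have "rb ((E + isize I) + (isize I + m * (isize I + 1) + (1 + b) + 1) + (isize I + b)) (inv_theta I E)"
  unfolding inv_theta_def by (intro rb_div rb_mult rb_add rE rb_param cs r2 b) simp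
 then have th: "rb ((E + isize I) + (isize I + m * (isize I + 1) + b + 3) + (isize I + b)) (inv_theta I E)"
  by (rule rb_mono) simp
 have "(E + isize I) + (isize I + m * (isize I + 1) + b + 3) + (isize I + b) \<le> ratio_bits I E b" unfolding ratio_bits_def by linarith
 then show "rb (ratio_bits I E b) (inv_theta I E)" by (rule rb_mono[OF th])
 have "rb (m + 1) (of_nat (m + 1))" by (rule rb_nat[OF nat_le_pow2]) simp
 then have m1: "rb (m + 1) (of_nat m + 1)" by (simp add: add.commute)
 show vr: "rb (ratio_bits I E b) (vol_ratio I E)"
  unfolding vol_ratio_def ratio_bits_def by (intro rb_div rb_mult m1 th rb_param rb_nat[OF R_le])
 show "log_ratio I E \<le> ratio_bits I E b"
 proof (rule ccontr)
  assume "\<not> log_ratio I E \<le> ratio_bits I E b"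
  then have "2 ^ ratio_bits I E b < vol_ratio I E" by (intro log_ratio(2)) simp
  then show False using rb_le[OF vr] by simp
 qed
qed

lemma setup_sizes:
 "rb B (top_value I)" "j \<le> m ==> rb B (\<Sum>k<j. cost1 I $ k)" "rb B (inv_theta I E)"
 "rb (ratio_bits I E OT) (vol_ratio I E)" "log_ratio I E \<le> ratio_bits I E OT" "log_ratio I E + 1 \<le> B"
proof -
 note rs = ratio_sizes[OF zero_oracle(2)]
 have "OT \<le> ratio_bits I E OT" unfolding ratio_bits_def by linarith
 then show "rb B (top_value I)" using rb_mono[OF zero_oracle(2)] bits(1) by simp
 show "rb B (\<Sum>k<j. cost1 I $ k)" if "j \<le> m" by (rule rb_mono[OF rs(1)[OF that] bits(1)])
 show "rb B (inv_theta I E)" by (rule rb_mono[OF rs(2) bits(1)])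
 show "rb (ratio_bits I E OT) (vol_ratio I E)" by (rule rs(3))
 show lr: "log_ratio I E \<le> ratio_bits I E OT" by (rule rs(4))
 have "ratio_bits I E OT + 1 \<le> cell_bits I E \<Delta> OT" unfolding cell_bits_def by linarith
 then show "log_ratio I E + 1 \<le> B" using lr B by linarith
qed

lemma cor_optimize:
 assumes As: "\<And>j. j < N ==> As j \<in> S"
  and Y: "Y \<noteq> {}" "\<And>y. y \<in> Y ==> y \<in> feas I" "\<And>y. y \<in> Y ==> fhat As y \<le> \<tau>"
  and bd: "bd B L" and par: "params L" and L: "L 15 0 = of_nat (2 ^ usize I - 1)" "L 16 0 = top_value I"
   "L 18 0 = of_nat R" "L 21 0 = of_nat D" "L 22 0 = of_nat T" "L 24 0 = of_nat N" "L 25 0 = of_nat K"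
   "\<And>j. j < N ==> L 27 j = of_nat (set_encode (As j))" "\<And>k. L 2 k = 0" "\<And>n. L 33 n = 0"
 shows "cor optimize_prog L (track As \<tau> Y T)"
 unfolding optimize_prog_def
proof (rule cor_seq[where ?Q1.0 = "\<lambda>L1. (\<forall>b<60. b \<notin> {28, 29, 30, 31} --> L1 b = L b) \<and> L1 28 0 = mhat As"])
 have NB: "N \<le> Z" "N \<le> 2 ^ B" using loops(3) bits(10) by (auto intro!: nat_le_pow2)
 have fin: "finite (As i)" if "i < N" for i using As[OF that] by (auto simp: scenarios_def ground_def intro: finite_subset)
 have cnt: "{j. j < N \<and> set_encode (As j) = set_encode (As i)} = {j. j < N \<and> As j = As i}" if "i < N" for i
  using fin[OF that] fin by (auto simp: set_encode_eq)
 have sums: "(\<Sum>i<j. min (1 / of_nat N) (radius I / of_nat (card {j. j < N \<and> set_encode (As j) = set_encode (As i)}))) =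
  (\<Sum>i<j. min (1 / of_nat N) (radius I / of_nat (card {j. j < N \<and> As j = As i})))" if "j \<le> N" for j
  using that cnt by (intro sum.cong refl) simp
 show "cor mass_prog L (\<lambda>L1. (\<forall>b<60. b \<notin> {28, 29, 30, 31} --> L1 b = L b) \<and> L1 28 0 = mhat As)"
 proof (rule cor_mass[OF bd par L(6) NB L(8)])
  show "rb B (\<Sum>i<j. min (1 / of_nat N) (radius I / of_nat (card {k. k < N \<and> set_encode (As k) = set_encode (As i)})))" if "j \<le> N" for j
   unfolding sums[OF that] by (rule rb_mhat(2)[OF As Y that])
  show "(\<forall>b<60. b \<notin> {28, 29, 30, 31} --> L' b = L b) \<and> L' 28 0 = mhat As"
   if "\<And>b. b < 60 ==> b \<notin> {28, 29, 30, 31} ==> L' b = L b"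
    "L' 28 0 = (\<Sum>i<N. min (1 / of_nat N) (radius I / of_nat (card {k. k < N \<and> set_encode (As k) = set_encode (As i)})))" for L'
   using that sums[of N] unfolding mhat_def by simp
 qed simp_all
next
 fix L1 assume bd1: "bd B L1" and "(\<forall>b<60. b \<notin> {28, 29, 30, 31} --> L1 b = L b) \<and> L1 28 0 = mhat As"
 then have f1: "\<And>b. b < 60 ==> b \<notin> {28, 29, 30, 31} ==> L1 b = L b" and m1: "L1 28 0 = mhat As" by blast+
 have par1: "params L1" using f1 by (intro params_cong[OF par]) simp_all
 let ?Q = "\<lambda>L2. (\<forall>b<60. b \<notin> {12, 33, 34} --> L2 b = L1 b) \<and> L2 34 0 = 2 * top_value I \<and> (\<forall>k<m. L2 33 k = 0) \<and>
   (\<forall>i<m. \<forall>k<m. L2 33 (Suc i * m + k) = (if i = k then of_nat R else 0))"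
 show "cor (Seq init_prog (floop 35 (Vr 22) cut_prog)) L1 (track As \<tau> Y T)"
 proof (rule cor_seq[where ?Q1.0 = ?Q])
  have "rb 1 2" using rb_nat[of 2 1] by simp
  from rb_mult[OF this zero_oracle(2)] have t2: "rb B (2 * top_value I)"
   by (rule rb_mono) (use bits(5) in \<open>simp add: normal_bits_def\<close>)
  show "cor init_prog L1 ?Q"
  proof (rule cor_init[OF bd1 par1 _ _ _ t2])
   show "?Q L'" if "\<And>b. b < 60 ==> b \<notin> {12, 33, 34} ==> L' b = L1 b" "L' 34 0 = 2 * top_value I"
    "\<And>k. k < m ==> L' 33 k = 0" "\<And>i k. i < m ==> k < m ==> L' 33 (Suc i * m + k) = (if i = k then of_nat R else 0)" for L'
    using that by blast
  qed (use f1[of 33] f1[of 18] f1[of 16] L in simp_all)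
 next
  fix L2 assume bd2: "bd B L2" and Q: "?Q L2"
  have f2: "L2 b = L b" if "b < 60" "b \<notin> {12, 28, 29, 30, 31, 33, 34}" for b using Q f1[of b] that by simp
  have v0: "L2 33 k = 0" if "k < m" for k using Q that by blast
  have v: "L2 33 (Suc i * m + k) = (if i = k then of_nat R else 0)" if "i < m" "k < m" for i k using Q that by blast
  have l34: "L2 34 0 = 2 * top_value I" using Q by blast
  have par2: "params L2" using f2 by (intro params_cong[OF par]) simp_all
  have tr0: "track As \<tau> Y 0 L2" unfolding track_def
  proof (intro conjI allI impI)
   have "L2 28 0 = mhat As" using Q m1 by simp
   then show "regs As L2" unfolding regs_def using par2 f2[of 15] f2[of 21] f2[of 24] f2[of 25] f2[of 27] L by simp
   show "on_grid D 0 R (L2 33 (i * m + k))" if "i \<le> m" "k < m" for i k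
   proof (cases i)
    case 0
    then show ?thesis using v0[OF that(2)] by (simp add: on_grid_def)
   next
    case (Suc j)
    then have "L2 33 (i * m + k) = (if j = k then of_nat R else 0)" using v[of j k] that by simp
    then show ?thesis by (auto simp: on_grid_def intro!: exI[of _ "int R"])
   qed
   have g: "get_vec 2 m L2 = 0\<^sub>v m" using f2[of 2] L(9) by (auto simp: get_vec_def)
   have "c \<bullet> 0\<^sub>v m = 0" using cost_dim by simp
   then have "fhat As (0\<^sub>v m) \<le> 2 * recourse I (0\<^sub>v m) {..<usize I}" using fhat_nonneg_le[OF As zero_feas] by simp
   then show "answer_ok As L2" unfolding answer_ok_def g zero_oracle(1) l34 of_rat_mult zero_oracle(3)[symmetric]
    using zero_point zero_feas by simp
   show "simplex_ok \<tau> Y 0 L2" unfolding simplex_ok_def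
   proof (intro impI disjI2 conjI ballI)
    assume m0: "0 < m"
    let ?v = "\<lambda>i k. real_of_rat (L2 33 (i * m + k))"
    have w0: "?v 0 k = 0" if "k < m" for k using v0[OF that] by simp
    have w: "?v (Suc i) k = (if i = k then real R else 0)" if "i < m" "k < m" for i k using v[OF that] by simp
    have "R > 0" using m0 by (simp add: simplex_size_def)
    then have R0: "real R > 0" by (simp only: of_nat_0_less_iff)
    show "in_simplex m ?v (\<lambda>k. y $ k)" if "y \<in> Y" for y
     by (rule in_simplex_corner[OF w0 w R0]) (use feas_nonneg feas_sum_le Y(2)[OF that] in auto)
    show "simplex_vol m ?v \<le> exp (- real 0 / (32 * real m ^ 2)) * real R ^ m"
     using simplex_vol_corner[OF w0 w] by simp
   qed
  qed (simp add: l34)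
  show "cor (floop 35 (Vr 22) cut_prog) L2 (track As \<tau> Y T)"
  proof (rule cor_floop[where N = T and Inv = "track As \<tau> Y", OF bd2])
   show "T \<le> 2 ^ B" using bits(8) by (rule nat_le_pow2)
   show "track As \<tau> Y 0 (set_cell 35 0 0 L2)" using tr0 track_counter[OF As Y] by simp
   show "cor cut_prog L' (\<lambda>L''. track As \<tau> Y (Suc j) (set_cell 35 0 (of_nat (Suc j)) L''))"
    if "j < T" "bd B L'" "track As \<tau> Y j L'" for j L'
    by (rule cor_cut[OF As Y that(2,3,1)]) (simp_all add: track_counter[OF As Y])
  qed (use f2[of 22] L loops(2) in \<open>simp_all\<close>)
 qed
qed

text \<open>The threshold \<tau> may depend on the samples while the target set \<open>Y\<close> may
  not. The program knows neither; they only parametrise the guarantee.\<close>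

lemma main_run:
 fixes \<tau> :: "nat set list => real"
 assumes M0: "bd B M0" "params M0" "\<And>k. M0 2 k = 0" "\<And>n. M0 33 n = 0" and Y: "Y \<noteq> {}" "\<And>y. y \<in> Y ==> y \<in> feas I"
  and \<tau>: "\<And>ws y. ws \<in> set_pmf (replicate_pmf N (center I)) ==> y \<in> Y ==> fhat ((!) ws) y \<le> \<tau> ws"
 shows "\<exists>F. rexec I main_prog M0 (replicate_pmf N (center I)) F \<and>
  (\<forall>ws\<in>set_pmf (replicate_pmf N (center I)). snd (F ws) \<le> ticks Z main_prog * W \<and>
    track ((!) ws) (\<tau> ws) Y T (low (fst (F ws))))"
proof -
 let ?P = "replicate_pmf N (center I)"
 let ?post = "\<lambda>L. (\<forall>b<60. b \<notin> {10, 11, 12, 14, 15, 16, 17, 18, 19, 20, 21, 22, 23, 24, 25} --> L b = low M0 b) \<and>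
   L 15 0 = of_nat (2 ^ usize I - 1) \<and> L 16 0 = top_value I \<and> L 18 0 = of_nat R \<and> L 21 0 = of_nat D \<and> L 22 0 = of_nat T \<and>
   L 24 0 = of_nat N \<and> L 25 0 = of_nat K"
 have "2 * isize I + 1 \<le> ratio_bits I E OT" unfolding ratio_bits_def by linarith
 then have "2 * isize I + 1 \<le> B" using bits(1) by linarith
 then have "(2::nat) ^ (2 * isize I + 1) \<le> 2 ^ B" by (rule power_increasing) simp
 then have RB: "R \<le> 2 ^ B" using R_le by linarith
 have lZ: "log_ratio I E \<le> Z" using setup_sizes(5) loops(1) by linarith
 have "cor setup_prog (low M0) ?post"
  by (rule cor_setup[OF _ _ _ _ _ setup_sizes(1,2,3) rb_mono[OF setup_sizes(4) bits(1)] RB lZ setup_sizes(6)])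
    (use M0 rads radius bits nat_le_pow2[of _ B] in \<open>simp_all add: params_low less_imp_le\<close>)
 then obtain M1 where M1: "fwd setup_prog M0 M1" "bd B M1" "?post (low M1)" by (rule fwd_cor)
 have f1: "M1 b = M0 b" if "b < 60" "b \<notin> {10, 11, 12, 14, 15, 16, 17, 18, 19, 20, 21, 22, 23, 24, 25}" for b
  using M1(3) that by simp
 obtain M2 where M2: "fwd (asg 26 (Kn 0)) M1 M2" "bd B M2" "M2 26 0 = 0" "\<And>b. b < 60 ==> b \<noteq> 26 ==> M2 b = M1 b"
  by (rule fwd_asg[OF M1(2), of 26 "Kn 0" 0]) (simp_all add: eok_def)
 let ?e = "mi (Vr 24) (Vr 26)"
 let ?body = "Seq (Seq (Seq (Sample 10) (Seq encode_prog (put 27 (Vr 26) (Vr 13)))) (asg 26 (pl (Vr 26) (Kn 1)))) (ecomp ?e 60)"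
 obtain M3 t3 where M3: "runs I (ecomp ?e 60) M2 M3 t3" "\<forall>a<60. M3 a = M2 a" "M3 60 0 = ev ?e M2" "t3 \<le> ticks Z (ecomp ?e 60) * W"
  using runs_ecomp[OF M2(2), of ?e 60] by auto
 have f3: "M3 b = M1 b" if "b < 60" "b \<noteq> 26" for b using M3(2) M2(4) that by simp
 have bd3: "bd B M3" using M2(2) M3(2) by (simp add: bd_def)
 have ev3: "ev ?e M3 = ev ?e M2" using M3(2) by (intro ev_cong) auto
 have par3: "params M3" using f3 f1 by (intro params_cong[OF M0(2)]) simp_all
 have "M3 24 0 = of_nat N" "M3 26 0 = of_nat 0" using M3(2) M2(3) f3[of 24] M1(3) by simp_all
 from sampling_loop[OF bd3 par3 this _ M3(3)[folded ev3], of N]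
 obtain F where F: "rexec I (While 60 ?body) M3 ?P F" and
  Fp: "\<And>ws. ws \<in> set_pmf ?P ==> bd B (fst (F ws)) \<and> (\<forall>b<60. b \<notin> {10, 12, 13, 14, 26, 27} --> fst (F ws) b = M3 b) \<and>
    (\<forall>i<N. fst (F ws) 27 i = of_nat (set_encode (ws ! i))) \<and> snd (F ws) \<le> N * ((1 + ticks Z ?body) * W) + W" by auto
 obtain t2 where t2: "runs I (asg 26 (Kn 0)) M1 M2 t2" "t2 \<le> ticks Z (asg 26 (Kn 0)) * W" using M2(1) unfolding fwd_def by blast
 obtain t1 where t1: "runs I setup_prog M0 M1 t1" "t1 \<le> ticks Z setup_prog * W" using M1(1) unfolding fwd_def by blast
 have sp: "sample_prog = Seq (asg 26 (Kn 0)) (Seq (ecomp ?e 60) (While 60 ?body))"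
  by (simp add: sample_prog_def floop_def whl_def)
 have "rexec I sample_prog M1 ?P (\<lambda>w. (fst (fst (F w), t3 + snd (F w)), t2 + snd (fst (F w), t3 + snd (F w))))"
  unfolding sp by (rule rexec_Seq_det[OF t2(1) rexec_Seq_det[OF M3(1) F]])
 then have rs: "rexec I sample_prog M1 ?P (\<lambda>w. (fst (F w), t2 + (t3 + snd (F w))))" unfolding fst_conv snd_conv .
 have "finite (set_pmf (center I))" using center finite_scenarios by (rule finite_subset)
 then have finP: "finite (set_pmf ?P)" by (simp add: set_replicate_pmf finite_lists_length_eq lists_eq_set)
 have wsS: "ws ! j \<in> S" if "ws \<in> set_pmf ?P" "j < N" for ws j
 proof -
  have "set ws \<subseteq> set_pmf (center I)" "length ws = N" using that(1) by (auto simp: set_replicate_pmf)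
  moreover from this have "ws ! j \<in> set ws" using that(2) by simp
  ultimately show ?thesis using center by blast
 qed
 have opt: "\<exists>M' t. runs I optimize_prog (fst (F ws)) M' t \<and> t \<le> ticks Z optimize_prog * W \<and> track ((!) ws) (\<tau> ws) Y T (low M')"
  if ws: "ws \<in> set_pmf ?P" for ws
 proof -
  have f4: "fst (F ws) b = M1 b" if "b < 60" "b \<notin> {10, 12, 13, 14, 26, 27}" for b using Fp[OF ws] f3[of b] that by simp
  have "cor optimize_prog (low (fst (F ws))) (track ((!) ws) (\<tau> ws) Y T)"
  proof (rule cor_optimize[OF wsS[OF ws] Y \<tau>[OF ws]])
   show "params (low (fst (F ws)))" unfolding params_low using f4 f1 by (intro params_cong[OF M0(2)]) simp_all
  qed (use Fp[OF ws] f4[of 15] f4[of 16] f4[of 18] f4[of 21] f4[of 22] f4[of 24] f4[of 25] f4[of 2] f4[of 33]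
     f1[of 2] f1[of 33] M1(3) M0(3,4) in \<open>simp_all del: ticks.simps\<close>)
  then show ?thesis unfolding cor_def by blast
 qed
 then obtain G t4 where G: "\<And>ws. ws \<in> set_pmf ?P ==> runs I optimize_prog (fst (F ws)) (G ws) (t4 ws) \<and>
   t4 ws \<le> ticks Z optimize_prog * W \<and> track ((!) ws) (\<tau> ws) Y T (low (G ws))" by metis
 have "rexec I (Seq sample_prog optimize_prog) M1 ?P (\<lambda>w. (G w, snd (fst (F w), t2 + (t3 + snd (F w))) + t4 w))"
  by (rule rexec_Seq_rand[OF rs finP]) (use G in simp)
 then have "rexec I main_prog M0 ?P (\<lambda>w. (fst (G w, snd (fst (F w), t2 + (t3 + snd (F w))) + t4 w),
   t1 + snd (G w, snd (fst (F w), t2 + (t3 + snd (F w))) + t4 w)))"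
  unfolding main_prog_def by (rule rexec_Seq_det[OF t1(1)])
 then have r: "rexec I main_prog M0 ?P (\<lambda>w. (G w, t1 + (t2 + (t3 + snd (F w)) + t4 w)))" unfolding fst_conv snd_conv .
 have "t1 + (t2 + (t3 + snd (F ws)) + t4 ws) \<le> ticks Z main_prog * W" if ws: "ws \<in> set_pmf ?P" for ws
 proof -
  have gen: "s \<le> (z * k + 1) * w" if "s \<le> n * (k * w) + w" "n \<le> z" for s n k w z :: nat
  proof -
   have "n * (k * w) \<le> z * (k * w)" using that(2) by (rule mult_right_mono) simp
   then have "s \<le> z * (k * w) + w" using that(1) by linarith
   then show ?thesis by (simp add: distrib_right mult.assoc)
  qed
  have "snd (F ws) \<le> ticks Z (While 60 ?body) * W" unfolding ticks.simps(12)
   by (rule gen[where n = N], use Fp[OF ws] in blast) (use loops(3) in linarith)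
  then have "t1 + (t2 + (t3 + snd (F ws)) + t4 ws) \<le> ticks Z setup_prog * W + (ticks Z (asg 26 (Kn 0)) * W + (ticks Z (ecomp ?e 60) * W +
   ticks Z (While 60 ?body) * W) + ticks Z optimize_prog * W)" using t1(2) t2(2) M3(4) G[OF ws] by (intro add_mono) auto
  also have "\<dots> = ticks Z main_prog * W" unfolding main_prog_def sp ticks.simps(10) by (simp only: distrib_right add.assoc)
  finally show ?thesis .
 qed
 then show ?thesis using r G by (intro exI[of _ "\<lambda>w. (G w, t1 + (t2 + (t3 + snd (F w)) + t4 w))"]) simp
qed

end

section \<open>Approximation guarantee\<close>

lemma polytope_convex:
 assumes P: "polytope_vec n P" and xy: "x \<in> P" "y \<in> P" and t: "0 \<le> t" "t \<le> 1"
 shows "(1 - t) \<cdot>\<^sub>v x + t \<cdot>\<^sub>v y \<in> P"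
proof -
 obtain F where F: "F \<subseteq> carrier_vec n \<times> UNIV" "P = {x \<in> carrier_vec n. \<forall>(a, b) \<in> F. a \<bullet> x \<le> b}"
  using P unfolding polytope_vec_def by blast
 have "a \<bullet> ((1 - t) \<cdot>\<^sub>v x + t \<cdot>\<^sub>v y) \<le> b" if ab: "(a, b) \<in> F" for a b
 proof -
  have c: "a \<in> carrier_vec n" "x \<in> carrier_vec n" "y \<in> carrier_vec n" using F ab xy by auto
  have "a \<bullet> ((1 - t) \<cdot>\<^sub>v x + t \<cdot>\<^sub>v y) = (1 - t) * (a \<bullet> x) + t * (a \<bullet> y)"
   using c by (subst scalar_prod_add_distrib[of _ n]) (auto simp: scalar_prod_smult_distrib[of _ n])
  also have "\<dots> \<le> (1 - t) * b + t * b" using F ab xy t by (intro add_mono mult_left_mono) auto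
  finally show ?thesis by (simp add: algebra_simps)
 qed
 then show ?thesis using F xy by auto
qed

text \<open>Lets the factorial enter the volume estimate as an \<open>n\<close>-th power.\<close>

lemma fact_Suc_le_power: "fact (Suc n) \<le> real (Suc n) ^ n"
proof (induction n)
 case (Suc n)
 have "fact (Suc (Suc n)) = real (Suc (Suc n)) * fact (Suc n)" by (rule fact_Suc)
 also have "\<dots> \<le> real (Suc (Suc n)) * real (Suc (Suc n)) ^ n"
  using Suc power_mono[of "real (Suc n)" "real (Suc (Suc n))" n] by (intro mult_left_mono) auto
 finally show ?case by simp
qed simp

context drso_run
begin

abbreviation "U \<equiv> {..<usize I}"
abbreviation "h \<equiv> robust_cost I"
abbreviation "mass \<equiv> light_mass S r (pmf (center I))"
abbreviation "mean y \<equiv> measure_pmf.expectation (center I) (recourse I y)"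

lemma ambiguity_iff: "q \<in> ambiguity I \<longleftrightarrow> set_pmf q \<subseteq> S \<and> (\<forall>A\<in>S. \<bar>pmf (center I) A - pmf q A\<bar> \<le> r)"
proof -
 have "linf_dist I (center I) q \<le> r \<longleftrightarrow> (\<forall>A\<in>S. \<bar>pmf (center I) A - pmf q A\<bar> \<le> r)"
  using Max_le_iff[of "(\<lambda>A. \<bar>pmf (center I) A - pmf q A\<bar>) ` S" r] finite_scenarios[of I] full_scenario[of I]
  unfolding linf_dist_def by blast
 then show ?thesis by (simp add: ambiguity_def)
qed

lemma expectation_bounds:
 assumes y: "y \<in> feas I" and q: "set_pmf q \<subseteq> S"
 shows "0 \<le> measure_pmf.expectation q (recourse I y)" "measure_pmf.expectation q (recourse I y) \<le> recourse I y U"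
proof -
 have e: "measure_pmf.expectation q (recourse I y) = (\<Sum>A\<in>S. pmf q A * recourse I y A)"
  using q by (subst integral_measure_pmf_real[OF finite_scenarios]) (auto simp: mult.commute)
 show "0 \<le> measure_pmf.expectation q (recourse I y)" unfolding e
  by (intro sum_nonneg mult_nonneg_nonneg) (auto simp: recourse_bounds[OF y])
 have "(\<Sum>A\<in>S. pmf q A * recourse I y A) \<le> (\<Sum>A\<in>S. pmf q A * recourse I y U)"
  by (intro sum_mono mult_left_mono) (auto simp: recourse_bounds[OF y])
 also have "\<dots> = recourse I y U" using sum_pmf_eq_1[OF finite_scenarios q] by (simp flip: sum_distrib_right)
 finally show "measure_pmf.expectation q (recourse I y) \<le> recourse I y U" unfolding e .
qed

lemma mass_bounds: "r \<le> mass"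
 using light_mass_ge[OF finite_scenarios _ sum_pmf_eq_1[OF finite_scenarios center]] r_pos by simp

lemma robust_ge:
 assumes "y \<in> feas I" "q \<in> ambiguity I"
 shows "c \<bullet> y + measure_pmf.expectation q (recourse I y) \<le> h y"
proof -
 have "bdd_above ((\<lambda>q. measure_pmf.expectation q (recourse I y)) ` ambiguity I)"
  using expectation_bounds(2)[OF assms(1)] by (intro bdd_aboveI[of _ "recourse I y U"]) (auto simp: ambiguity_iff)
 from cSUP_upper[OF assms(2) this] show ?thesis unfolding robust_cost_def by simp
qed

lemma center_ambiguity: "center I \<in> ambiguity I"
 using center r_pos by (simp add: ambiguity_iff less_imp_le)

text \<open>The centre lies in the ball and every shift is dominated by a distribution in it, so
  \<open>h\<close> is at least each of mean and gain. The last bound combines bounded inflation with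
  \<open>r * g(y, U)\<close> being at most the gain; it keeps \<open>h\<close> away from 0 relative
  to \<open>g(0, U)\<close>.\<close>

lemma robust_bounds:
 assumes y: "y \<in> feas I"
 shows "c \<bullet> y + mean y \<le> h y" "c \<bullet> y + shift_gain S r mass (recourse I y) \<le> h y"
  "h y \<le> c \<bullet> y + mean y + shift_gain S r mass (recourse I y)" "h y \<le> c \<bullet> y + recourse I y U" "0 \<le> h y"
  "r * real_of_rat (top_value I) \<le> real_of_rat (lam I) * h y"
proof -
 show 1: "c \<bullet> y + mean y \<le> h y" by (rule robust_ge[OF y center_ambiguity])
 show 2: "c \<bullet> y + shift_gain S r mass (recourse I y) \<le> h y"
 proof -
  have "shift_gain S r mass (recourse I y) \<le> h y - c \<bullet> y"
  proof (rule gain_least[OF y])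
   show "0 \<le> mass" using mass_bounds r_pos by linarith
   fix s assume "s \<in> shifts S r mass"
   from redistribute_lower[where g = "recourse I y" and U = U, OF finite_scenarios r_pos(1) full_scenario _ _ center this r_pos(2)]
   obtain q where "q \<in> ambiguity I" "(\<Sum>A\<in>S. s A * recourse I y A) \<le> measure_pmf.expectation q (recourse I y)"
    using recourse_bounds[OF y] unfolding ambiguity_iff by blast
   then show "(\<Sum>A\<in>S. s A * recourse I y A) \<le> h y - c \<bullet> y" using robust_ge[OF y] by fastforce
  qed
  then show ?thesis by simp
 qed
 have "(SUP q\<in>ambiguity I. measure_pmf.expectation q (recourse I y)) \<le> mean y + shift_gain S r mass (recourse I y)"
 proof (rule cSUP_least)
  fix q assume "q \<in> ambiguity I"
  then show "measure_pmf.expectation q (recourse I y) \<le> mean y + shift_gain S r mass (recourse I y)"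
   by (intro redistribute_upper[where U = U, OF finite_scenarios r_pos(1) full_scenario]) (auto simp: ambiguity_iff center recourse_bounds[OF y])
 qed (use center_ambiguity in blast)
 then show "h y \<le> c \<bullet> y + mean y + shift_gain S r mass (recourse I y)" unfolding robust_cost_def by simp
 have "(SUP q\<in>ambiguity I. measure_pmf.expectation q (recourse I y)) \<le> recourse I y U"
  by (intro cSUP_least) (use center_ambiguity ambiguity_iff expectation_bounds(2)[OF y] in blast)+
 then show "h y \<le> c \<bullet> y + recourse I y U" unfolding robust_cost_def by simp
 show h0: "0 \<le> h y" using 1 expectation_bounds(1)[OF y center] dot_nonneg[OF y] by linarith
 have l: "1 \<le> real_of_rat (lam I)" using lam by simp
 have inf: "recourse I (0\<^sub>v m) U \<le> recourse I y U + real_of_rat (lam I) * (c \<bullet> y)"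
  using std y full_scenario[of I] unfolding standing_assumptions_def bounded_inflation_def by blast
 have "r * real_of_rat (top_value I) \<le> r * recourse I y U + r * (real_of_rat (lam I) * (c \<bullet> y))"
  unfolding zero_oracle(3) distrib_left[symmetric] using inf r_pos by (intro mult_left_mono) auto
 also have "r * recourse I y U \<le> shift_gain S r mass (recourse I y)" by (rule gain_top[OF y mass_bounds])
 also have "\<dots> \<le> h y - c \<bullet> y" using 2 by linarith
 also have "\<dots> \<le> real_of_rat (lam I) * (h y - c \<bullet> y)"
  using l mult_right_mono[of 1 "real_of_rat (lam I)" "h y - c \<bullet> y"] 1 expectation_bounds(1)[OF y center] by simp
 also have "r * (real_of_rat (lam I) * (c \<bullet> y)) \<le> 1 * (real_of_rat (lam I) * (c \<bullet> y))"
  using r_pos l dot_nonneg[OF y] by (intro mult_right_mono) auto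
 finally show "r * real_of_rat (top_value I) \<le> real_of_rat (lam I) * h y" by (simp add: algebra_simps)
qed

lemma phat_mass: "(\<And>j. j < N ==> As j \<in> S) ==> r \<le> light_mass S r (phat As)"
 using mhat_bounds(1)[where As = As] mhat_real[where As = As] by simp

text \<open>The tolerance for the mean is a multiple of \<open>g(y, U)\<close>, the scale of the
  costs at \<open>y\<close>; since the gain is at least \<open>r * g(y, U)\<close>, it becomes a
  relative error.\<close>

definition representative :: "(nat => nat set) => real Matrix.vec => bool" where
 "representative As y \<longleftrightarrow> (\<forall>A\<in>S. \<bar>phat As A - pmf (center I) A\<bar> \<le> r\<^sup>2 / (4 * real E)) \<and>
   \<bar>(\<Sum>i<N. recourse I y (As i)) / real N - mean y\<bar> \<le> r\<^sup>2 / (4 * real E) * recourse I y U"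

lemma fhat_nonneg:
 assumes As: "\<And>j. j < N ==> As j \<in> S" and y: "y \<in> feas I"
 shows "c \<bullet> y \<le> fhat As y" "0 \<le> fhat As y"
proof -
 have "0 \<le> r * recourse I y U" using r_pos recourse_bounds(1)[OF y full_scenario] by simp
 also have "\<dots> \<le> shift_gain S r (light_mass S r (phat As)) (recourse I y)"
  by (rule gain_top[OF y phat_mass[OF As]])
 finally have "0 \<le> shift_gain S r (light_mass S r (phat As)) (recourse I y)" .
 moreover have "0 \<le> (\<Sum>i<N. recourse I y (As i)) / real N" using As recourse_bounds(1)[OF y] by (intro divide_nonneg_nonneg sum_nonneg) auto
 ultimately show "c \<bullet> y \<le> fhat As y" unfolding fhat_def by linarith
 then show "0 \<le> fhat As y" using dot_nonneg[OF y] by linarith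
qed

text \<open>Two errors of relative size at most \<open>1 / (2 E)\<close> each: the light mass,
  itself at least \<open>r\<close>, is off by at most
  \<open>2 * (r^2 / (4 E)) / r = r / (2 E)\<close>, and the error of the mean is absorbed by the
  gain.\<close>

lemma representative_bounds:
 assumes As: "\<And>j. j < N ==> As j \<in> S" and y: "y \<in> feas I" and rep: "representative As y"
 shows "h y \<le> (1 + 1 / real E) * fhat As y" "fhat As y \<le> (2 + 1 / real E) * h y"
proof -
 let ?m = "light_mass S r (phat As)" and ?e = "1 / (2 * real E)"
 let ?G = "shift_gain S r ?m (recourse I y)" and ?H = "shift_gain S r mass (recourse I y)"
 let ?a = "(\<Sum>i<N. recourse I y (As i)) / real N"
 have E0: "real E > 0" using E1 by simp
 have g0: "0 \<le> recourse I y U" by (rule recourse_bounds(1)[OF y full_scenario])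
 have mm: "r \<le> ?m" by (rule phat_mass[OF As])
 have "\<bar>?m - mass\<bar> \<le> 2 * (r\<^sup>2 / (4 * real E)) / r"
  using rep unfolding representative_def
  by (intro light_mass_diff finite_scenarios r_pos phat_nonneg[OF As] phat_sum[OF As] sum_pmf_eq_1[OF finite_scenarios center]) auto
 also have "\<dots> = ?e * r" using r_pos(1) E0 by (simp add: power2_eq_square field_simps)
 finally have d: "\<bar>?m - mass\<bar> \<le> ?e * r" .
 have "?e * r \<le> ?e * ?m" "?e * r \<le> ?e * mass" using mm mass_bounds E0 by (intro mult_left_mono; simp)+
 then have le: "mass \<le> (1 + ?e) * ?m" "?m \<le> (1 + ?e) * mass" using d unfolding distrib_right by linarith+
 have e1: "1 \<le> 1 + ?e" using E0 by simp
 have GH: "?H \<le> (1 + ?e) * ?G" "?G \<le> (1 + ?e) * ?H"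
  using gain_scale[OF y _ le(1) e1] gain_scale[OF y _ le(2) e1] mm mass_bounds r_pos by simp_all
 have tG: "r * recourse I y U \<le> ?G" "r * recourse I y U \<le> ?H" using gain_top[OF y] mm mass_bounds by auto
 have "r\<^sup>2 / (4 * real E) * recourse I y U = (r * (r * recourse I y U)) / (4 * real E)" by (simp add: power2_eq_square)
 also have "\<dots> \<le> (1 * (r * recourse I y U)) / (4 * real E)"
  using r_pos g0 E0 by (intro divide_right_mono mult_right_mono) auto
 also have "\<dots> \<le> (2 * (r * recourse I y U)) / (4 * real E)" using r_pos g0 E0 by (intro divide_right_mono) auto
 also have "\<dots> = ?e * (r * recourse I y U)" by simp
 finally have "\<bar>?a - mean y\<bar> \<le> ?e * (r * recourse I y U)" using rep unfolding representative_def by linarith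
 moreover have "?e * (r * recourse I y U) \<le> ?e * ?G" "?e * (r * recourse I y U) \<le> ?e * ?H"
  using tG E0 by (intro mult_left_mono; simp)+
 ultimately have a: "mean y \<le> ?a + ?e * ?G" "?a \<le> mean y + ?e * ?H" by linarith+
 have ee: "1 + 1 / real E = 1 + ?e + ?e" using E0 by (simp add: field_simps)
 have G0: "0 \<le> ?G" "0 \<le> ?H" using tG r_pos g0 mult_nonneg_nonneg[of r "recourse I y U"] by linarith+
 have "h y \<le> c \<bullet> y + ?a + (1 + 1 / real E) * ?G"
  using robust_bounds(3)[OF y] a(1) GH(1) unfolding ee distrib_right by linarith
 also have "\<dots> \<le> (1 + 1 / real E) * fhat As y"
 proof -
  have "0 \<le> ?a" using As recourse_bounds(1)[OF y] by (intro divide_nonneg_nonneg sum_nonneg) auto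
  then have "1 * (c \<bullet> y + ?a) \<le> (1 + 1 / real E) * (c \<bullet> y + ?a)"
   using dot_nonneg[OF y] E0 by (intro mult_right_mono) auto
  then show ?thesis unfolding fhat_def by (simp only: distrib_left)
 qed
 finally show "h y \<le> (1 + 1 / real E) * fhat As y" .
 have "fhat As y \<le> (c \<bullet> y + mean y) + (1 + 1 / real E) * ?H"
  unfolding fhat_def ee distrib_right using a(2) GH(2) unfolding distrib_right by linarith
 also have "\<dots> \<le> h y + (1 + 1 / real E) * h y"
  using robust_bounds(1,2)[OF y] dot_nonneg[OF y] E0 by (intro add_mono mult_left_mono) auto
 finally show "fhat As y \<le> (2 + 1 / real E) * h y" by (simp add: algebra_simps)
qed

text \<open>The light mass does not depend on the point, so the gain is a supremum of nonnegative
  combinations of convex functions.\<close>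

lemma fhat_convex:
 assumes As: "\<And>j. j < N ==> As j \<in> S" and xy: "x \<in> feas I" "y \<in> feas I" and t: "0 \<le> t" "t \<le> 1"
 shows "fhat As ((1 - t) \<cdot>\<^sub>v x + t \<cdot>\<^sub>v y) \<le> (1 - t) * fhat As x + t * fhat As y"
proof -
 let ?z = "(1 - t) \<cdot>\<^sub>v x + t \<cdot>\<^sub>v y" and ?m = "light_mass S r (phat As)"
 have z: "?z \<in> feas I" using std by (intro polytope_convex[OF _ xy t]) (auto simp: standing_assumptions_def basic_data_def)
 have cv: "recourse I ?z A \<le> (1 - t) * recourse I x A + t * recourse I y A" if "A \<in> S" for A
  using std that xy t unfolding standing_assumptions_def efficient_convex_recourse_def convex_fun_on_def by blast
 have cl: "c \<bullet> ?z = (1 - t) * (c \<bullet> x) + t * (c \<bullet> y)"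
  using feas_carrier[OF xy(1)] feas_carrier[OF xy(2)] cost_dim
  by (subst scalar_prod_add_distrib[of _ m]) (auto simp: scalar_prod_smult_distrib[of _ m])
 have "(\<Sum>i<N. recourse I ?z (As i)) \<le> (\<Sum>i<N. (1 - t) * recourse I x (As i) + t * recourse I y (As i))"
  using As cv by (intro sum_mono) auto
 then have "(\<Sum>i<N. recourse I ?z (As i)) / real N \<le> ((1 - t) * (\<Sum>i<N. recourse I x (As i)) + t * (\<Sum>i<N. recourse I y (As i))) / real N"
  by (intro divide_right_mono) (auto simp: sum.distrib sum_distrib_left)
 moreover have "shift_gain S r ?m (recourse I ?z) \<le> (1 - t) * shift_gain S r ?m (recourse I x) + t * shift_gain S r ?m (recourse I y)"
 proof (rule gain_least[OF z])
  have "r \<le> ?m" by (rule phat_mass[OF As])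
  then show "0 \<le> ?m" using r_pos(1) by linarith
  fix s assume s: "s \<in> shifts S r ?m"
  have "(\<Sum>A\<in>S. s A * recourse I ?z A) \<le> (\<Sum>A\<in>S. s A * ((1 - t) * recourse I x A + t * recourse I y A))"
   using s cv by (intro sum_mono mult_left_mono) (auto simp: shifts_def)
  also have "\<dots> = (1 - t) * (\<Sum>A\<in>S. s A * recourse I x A) + t * (\<Sum>A\<in>S. s A * recourse I y A)"
   by (simp add: sum_distrib_left sum.distrib distrib_left mult_ac)
  also have "\<dots> \<le> (1 - t) * shift_gain S r ?m (recourse I x) + t * shift_gain S r ?m (recourse I y)"
   using gain_ge[OF xy(1) s] gain_ge[OF xy(2) s] t by (intro add_mono mult_left_mono) auto
  finally show "(\<Sum>A\<in>S. s A * recourse I ?z A) \<le> (1 - t) * shift_gain S r ?m (recourse I x) + t * shift_gain S r ?m (recourse I y)" .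
 qed
 moreover have "((1 - t) * (\<Sum>i<N. recourse I x (As i)) + t * (\<Sum>i<N. recourse I y (As i))) / real N =
  (1 - t) * ((\<Sum>i<N. recourse I x (As i)) / real N) + t * ((\<Sum>i<N. recourse I y (As i)) / real N)" by (simp add: add_divide_distrib)
 ultimately show ?thesis unfolding fhat_def cl distrib_left by linarith
qed

abbreviation "width \<equiv> real_of_rat (outer_rad I) * (\<Sum>k<m. real_of_rat (cost1 I $ k)) + 2 * real_of_rat (top_value I)"

lemma fhat_le_width:
 assumes As: "\<And>j. j < N ==> As j \<in> S" and y: "y \<in> feas I"
 shows "fhat As y \<le> width"
proof -
 have "c \<bullet> y \<le> (\<Sum>k<m. real_of_rat (cost1 I $ k) * real_of_rat (outer_rad I))"
  unfolding dot_eq[OF feas_carrier[OF y]]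
  by (intro sum_mono mult_left_mono) (auto simp: feas_le_outer[OF y] cost_nonneg)
 moreover have "recourse I y U \<le> real_of_rat (top_value I)" unfolding zero_oracle(3)
  using std y full_scenario[of I] unfolding standing_assumptions_def nonneg_costs_def by blast
 moreover have "fhat As y \<le> c \<bullet> y + 2 * recourse I y U" by (rule fhat_nonneg_le[OF As y])
 ultimately show ?thesis unfolding sum_distrib_right[symmetric] by (simp add: mult.commute)
qed

abbreviation "\<theta> \<equiv> 1 / real_of_rat (inv_theta I E)"

text \<open>Moving by the fraction \<theta> towards a feasible point raises the objective by at most
  \<open>\<theta> * width\<close>; \<theta> is small enough for this to be a share
  \<open>1 / E\<close> of \<open>h y\<close>, whatever the feasible \<open>y\<close>.\<close>

lemma theta:
 assumes top: "0 < top_value I"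
 shows "0 < \<theta>" "\<theta> \<le> 1" "1 \<le> real_of_rat (inv_theta I E)" "y \<in> feas I ==> \<theta> * width \<le> h y / real E"
proof -
 let ?t = "real_of_rat (top_value I)" and ?l = "real_of_rat (lam I)"
 have t0: "0 < ?t" using top by simp
 have l: "1 \<le> ?l" using lam by simp
 have e: "1 \<le> real E" using E1 by simp
 have "0 \<le> (\<Sum>k<m. real_of_rat (cost1 I $ k))" by (intro sum_nonneg) (auto simp: cost_nonneg)
 then have w: "2 * ?t \<le> width" using rads by simp
 have eq: "real_of_rat (inv_theta I E) = (real E * ?l) * width / (r * ?t)"
  by (simp add: inv_theta_def of_rat_divide of_rat_mult of_rat_add of_rat_sum)
 have rt: "0 < r * ?t" using r_pos(1) t0 by (rule mult_pos_pos)
 have "1 * (2 * ?t) \<le> (real E * ?l) * width" using e l w t0 mult_mono[of 1 "real E" 1 ?l] by (intro mult_mono) auto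
 moreover have "r * ?t \<le> 1 * ?t" using r_pos t0 by (intro mult_right_mono) auto
 ultimately have "r * ?t \<le> (real E * ?l) * width" using t0 by linarith
 then show i1: "1 \<le> real_of_rat (inv_theta I E)" unfolding eq using rt by (simp add: le_divide_eq)
 then show "0 < \<theta>" "\<theta> \<le> 1" by (simp_all add: divide_le_eq)
 assume y: "y \<in> feas I"
 have w0: "width > 0" using w t0 by linarith
 have gen: "1 / (a * l * w / b) * w = (b / l) / a" if "w > 0" "a > 0" "l > 0" for a l w b :: real using that by (simp add: field_simps)
 have "\<theta> * width = (r * ?t / ?l) / real E" unfolding eq by (rule gen[OF w0]) (use e l in linarith)+
 also have "r * ?t / ?l \<le> h y" using robust_bounds(6)[OF y] l by (simp add: divide_le_eq mult.commute)
 finally show "\<theta> * width \<le> h y / real E" using e by (simp add: divide_right_mono)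
qed

end

section \<open>Uniform accuracy on the grid and the end of the cutting argument\<close>

context drso_run
begin

text \<open>The other factors of \<open>vol_ratio\<close> are at least 1. This bounds the simplex by
  a quantity that the machine can compute for \<open>grid_bits\<close>.\<close>

lemma simplex_size_le: "0 < top_value I ==> R \<le> 2 ^ log_ratio I E"
proof -
 assume top: "0 < top_value I"
 have "real_of_rat (vol_ratio I E) \<le> real_of_rat (2 ^ log_ratio I E)" using log_ratio(1) by (simp only: of_rat_less_eq)
 then have "real_of_rat (vol_ratio I E) \<le> 2 ^ log_ratio I E" by (simp add: of_rat_power)
 moreover have "real R \<le> real_of_rat (vol_ratio I E)"
 proof -
  have V: "0 < real_of_rat (inner_rad I)" "real_of_rat (inner_rad I) \<le> 1" using rads by simp_all
  have "real R * 1 \<le> ((real m + 1) * real R) * real_of_rat (inv_theta I E)"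
   using theta(3)[OF top] mult_right_mono[of 1 "real m + 1" "real R"] by (intro mult_mono) auto
  also have "\<dots> \<le> ((real m + 1) * real R) * real_of_rat (inv_theta I E) / real_of_rat (inner_rad I)"
   using V theta(3)[OF top] by (simp add: le_divide_eq mult_left_le)
  finally show ?thesis by (simp add: vol_ratio_def of_rat_divide of_rat_mult of_rat_add)
 qed
 ultimately have "real R \<le> 2 ^ log_ratio I E" by linarith
 then have "real R \<le> real (2 ^ log_ratio I E)" by (simp only: of_nat_power of_nat_numeral)
 then show ?thesis by (simp only: of_nat_le_iff)
qed

lemma points_card:
 assumes top: "0 < top_value I"
 shows "finite points" "card points \<le> 2 ^ grid_bits I E"
proof -
 let ?b = "int (m + 1) * (3 ^ T * int R * int D ^ T)"
 let ?v = "\<lambda>f :: nat => int. Matrix.vec m (\<lambda>k. of_int (f k) / (of_nat D ^ T * (of_nat m + 1)) :: rat)"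
 let ?F = "PiE {..<m} (\<lambda>_. {- ?b..?b})"
 have sub: "points \<subseteq> ?v ` ?F"
 proof
  fix x assume x: "x \<in> points"
  then have "\<forall>k<m. \<exists>z::int. x $ k = of_int z / (of_nat D ^ T * (of_nat m + 1)) \<and> \<bar>z\<bar> \<le> ?b" by (simp add: points_def)
  then obtain f :: "nat => int" where f: "\<And>k. k < m ==> x $ k = of_int (f k) / (of_nat D ^ T * (of_nat m + 1)) \<and> \<bar>f k\<bar> \<le> ?b" by metis
  have "x = ?v (restrict f {..<m})" using x f by (intro eq_vecI) (auto simp: points_def)
  moreover have "f k \<in> {- ?b..?b}" if "k \<in> {..<m}" for k using f[of k] that unfolding atLeastAtMost_iff lessThan_iff by linarith
  then have "restrict f {..<m} \<in> ?F" unfolding restrict_PiE_iff by blast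
  ultimately show "x \<in> ?v ` ?F" by blast
 qed
 have finF: "finite ?F" by (intro finite_PiE) auto
 show "finite points" by (rule finite_subset[OF sub finite_imageI[OF finF]])
 let ?k = "T * D + 2 * T + log_ratio I E + (m + 1)"
 have bk: "?b \<le> 2 ^ ?k"
 proof -
  have P: "(3::int) ^ T * int D ^ T \<le> 2 ^ (T * D + 2 * T)" by (rule grid_power_le) simp
  have "int R \<le> int (2 ^ log_ratio I E)" using simplex_size_le[OF top] by (simp only: of_nat_le_iff)
  then have R': "int R \<le> 2 ^ log_ratio I E" by simp
  have "int (m + 1) \<le> int (2 ^ (m + 1))" using nat_le_pow2[of "m + 1" "m + 1"] by (simp only: of_nat_le_iff)
  then have m1: "int (m + 1) \<le> 2 ^ (m + 1)" by simp
  have "?b = (3 ^ T * int D ^ T) * int R * int (m + 1)" by (simp add: mult_ac)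
  also have "\<dots> \<le> 2 ^ (T * D + 2 * T) * 2 ^ log_ratio I E * 2 ^ (m + 1)" using P R' m1 by (intro mult_mono) auto
  also have "\<dots> = 2 ^ ?k" by (simp only: power_add)
  finally show ?thesis .
 qed
 have "card points \<le> card ?F" using card_mono[OF finite_imageI[OF finF] sub] card_image_le[OF finF, of ?v] by linarith
 also have "\<dots> = nat (2 * ?b + 1) ^ m"
 proof -
  have "card {- b..b} = nat (2 * b + 1)" for b :: int by simp
  then show ?thesis by (simp only: card_PiE finite_lessThan prod_constant card_lessThan)
 qed
 also have "\<dots> \<le> (2 ^ (?k + 2)) ^ m"
 proof (rule power_mono)
  have "2 * ?b + 1 \<le> 2 * 2 ^ ?k + 2 ^ ?k" using bk one_le_power[of "2::int" ?k] by linarith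
  also have "\<dots> \<le> 2 ^ (?k + 2)" by (simp add: power_add)
  finally have "2 * ?b + 1 \<le> int (2 ^ (?k + 2))" by simp
  then show "nat (2 * ?b + 1) \<le> 2 ^ (?k + 2)" by linarith
 qed simp
 also have "\<dots> = 2 ^ ((?k + 2) * m)" by (simp only: power_mult)
 also have "\<dots> \<le> 2 ^ grid_bits I E"
 proof (rule power_increasing)
  have "(?k + 2) * m \<le> (T * (2 + D) + log_ratio I E + (m + 5)) * m" by (rule mult_right_mono) (auto simp: algebra_simps)
  then show "(?k + 2) * m \<le> grid_bits I E" by (simp only: grid_bits_def mult.commute)
 qed simp
 finally show "card points \<le> 2 ^ grid_bits I E" .
qed

lemma samples_ws: "ws \<in> set_pmf (replicate_pmf N (center I)) ==> length ws = N"
 "ws \<in> set_pmf (replicate_pmf N (center I)) ==> j < N ==> ws ! j \<in> S"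
proof -
 assume ws: "ws \<in> set_pmf (replicate_pmf N (center I))"
 then have *: "set ws \<subseteq> set_pmf (center I)" "length ws = N" by (auto simp: set_replicate_pmf)
 then show "length ws = N" by simp
 assume "j < N"
 then have "ws ! j \<in> set ws" using * by simp
 then show "ws ! j \<in> S" using * center by blast
qed

text \<open>The union bound ranges over the indicators of all scenarios and the normalised costs at
  all grid points and at the comparison point \<open>x\<close>, which need not lie on the grid.
  Their number is at most \<open>2 ^ (usize I + grid_bits I E + 2)\<close>.\<close>

lemma representative_prob:
 assumes top: "0 < top_value I" and x: "x \<in> feas I"
 shows "measure_pmf.prob (replicate_pmf N (center I))
  {ws. \<exists>y\<in>insert x (real_vec ` points \<inter> feas I). \<not> representative ((!) ws) y} \<le> (1 / 2) ^ \<Delta>"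
proof -
 let ?P = "replicate_pmf N (center I)" and ?\<eta> = "r\<^sup>2 / (4 * real E)"
 let ?X = "insert x (real_vec ` points \<inter> feas I)"
 let ?\<phi> = "\<lambda>y A. recourse I y A / recourse I y U"
 let ?F = "(\<lambda>A. indicator {A} :: nat set => real) ` S \<union> ?\<phi> ` ?X"
 have E0: "0 < real E" using E1 by simp
 have \<eta>: "0 < ?\<eta>" using r_pos(1) E0 by simp
 have N0: "0 < real N" using N_pos by simp
 have finX: "finite ?X" using points_card(1)[OF top] by simp
 have finF: "finite ?F" using finX finite_scenarios[of I] by simp
 have X: "y \<in> feas I" if "y \<in> ?X" for y using that x by blast
 have rng: "0 \<le> \<phi> A \<and> \<phi> A \<le> 1" if "\<phi> \<in> ?F" "A \<in> set_pmf (center I)" for \<phi> A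
 proof -
  have A: "A \<in> S" using that center by blast
  from that(1) show ?thesis
  proof
   assume "\<phi> \<in> ?\<phi> ` ?X"
   then obtain y where y: "y \<in> feas I" "\<phi> = ?\<phi> y" using X by blast
   show ?thesis unfolding y(2) using recourse_bounds[OF y(1) A] by (auto simp: divide_le_eq_1)
  qed (auto simp: indicator_def)
 qed
 let ?bad = "{xs. \<exists>\<phi>\<in>?F. \<bar>(\<Sum>x\<leftarrow>xs. \<phi> x) - real N * measure_pmf.expectation (center I) \<phi>\<bar> \<ge> real N * ?\<eta>}"
 have dev: "\<bar>(\<Sum>i<N. \<phi> (ws ! i)) / real N - measure_pmf.expectation (center I) \<phi>\<bar> < ?\<eta>"
  if ws: "ws \<in> set_pmf ?P" "ws \<notin> ?bad" "\<phi> \<in> ?F" for ws \<phi>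
 proof -
  have sl: "(\<Sum>x\<leftarrow>ws. \<phi> x) = (\<Sum>i<N. \<phi> (ws ! i))" using samples_ws(1)[OF ws(1)] by (simp add: sum_list_sum_nth atLeast0LessThan)
  have "\<not> real N * ?\<eta> \<le> \<bar>(\<Sum>x\<leftarrow>ws. \<phi> x) - real N * measure_pmf.expectation (center I) \<phi>\<bar>" using ws(2,3) by blast
  then have "\<bar>(\<Sum>i<N. \<phi> (ws ! i)) - real N * measure_pmf.expectation (center I) \<phi>\<bar> < real N * ?\<eta>" unfolding sl not_le .
  moreover have "\<bar>(\<Sum>i<N. \<phi> (ws ! i)) - real N * measure_pmf.expectation (center I) \<phi>\<bar> =
    real N * \<bar>(\<Sum>i<N. \<phi> (ws ! i)) / real N - measure_pmf.expectation (center I) \<phi>\<bar>"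
   using N0 by (simp add: abs_if field_simps)
  ultimately show ?thesis using N0 by (simp only: mult_less_cancel_left_pos)
 qed
 have good: "representative ((!) ws) y" if ws: "ws \<in> set_pmf ?P" "ws \<notin> ?bad" and y: "y \<in> ?X" for ws y
  unfolding representative_def
 proof (intro conjI ballI)
  fix A assume A: "A \<in> S"
  have "(\<Sum>i<N. indicator {A} (ws ! i)) = real (card {j. j < N \<and> ws ! j = A})"
  proof -
   have "(\<Sum>i<N. indicator {A} (ws ! i)) = (\<Sum>i<N. if ws ! i = A then 1 else 0 :: real)" by (intro sum.cong refl) simp
   also have "\<dots> = real (card ({..<N} \<inter> {j. ws ! j = A}))" by (subst sum.If_cases) simp_all
   also have "{..<N} \<inter> {j. ws ! j = A} = {j. j < N \<and> ws ! j = A}" by auto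
   finally show ?thesis .
  qed
  moreover have "measure_pmf.expectation (center I) (indicator {A}) = pmf (center I) A" by (simp add: pmf.rep_eq)
  ultimately show "\<bar>phat ((!) ws) A - pmf (center I) A\<bar> \<le> ?\<eta>"
   using dev[OF ws, of "indicator {A}"] A unfolding phat_def by auto
 next
  have yf: "y \<in> feas I" by (rule X[OF y])
  have g0: "0 \<le> recourse I y U" by (rule recourse_bounds(1)[OF yf full_scenario])
  let ?a = "(\<Sum>i<N. recourse I y (ws ! i)) / real N"
  show "\<bar>?a - mean y\<bar> \<le> ?\<eta> * recourse I y U"
  \<comment> \<open>Normalisation divides by \<open>g(y, U)\<close>; if this is 0, all costs at
    \<open>y\<close> vanish and so do both means.\<close>
  proof (cases "recourse I y U = 0")
   case True
   have "recourse I y A = 0" if "A \<in> S" for A using recourse_bounds[OF yf that] True by simp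
   then have "?a = 0" using samples_ws(2)[OF ws(1)] by simp
   moreover have "mean y = 0" using expectation_bounds[OF yf center] True by linarith
   ultimately show ?thesis unfolding True by (simp only: mult_zero_right diff_self abs_zero order_refl)
  next
   case False
   have d: "\<bar>(\<Sum>i<N. ?\<phi> y (ws ! i)) / real N - measure_pmf.expectation (center I) (?\<phi> y)\<bar> < ?\<eta>"
    using y by (intro dev[OF ws]) blast
   have e1: "(\<Sum>i<N. ?\<phi> y (ws ! i)) / real N = ?a / recourse I y U" by (simp add: sum_divide_distrib mult.commute)
   have e2: "measure_pmf.expectation (center I) (?\<phi> y) = mean y / recourse I y U" by simp
   have e3: "\<bar>?a / recourse I y U - mean y / recourse I y U\<bar> = \<bar>?a - mean y\<bar> / recourse I y U"
    unfolding diff_divide_distrib[symmetric] abs_divide using g0 by (simp only: abs_of_nonneg)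
   have "\<bar>?a - mean y\<bar> / recourse I y U < ?\<eta>" using d unfolding e1 e2 e3 .
   then show ?thesis using False g0 by (simp add: divide_less_eq split: if_splits)
  qed
 qed
 have "AE ws in measure_pmf ?P. ws \<in> {ws. \<exists>y\<in>?X. \<not> representative ((!) ws) y} --> ws \<in> ?bad"
  unfolding AE_measure_pmf_iff
 proof (intro ballI impI)
  fix ws assume ws: "ws \<in> set_pmf ?P" "ws \<in> {ws. \<exists>y\<in>?X. \<not> representative ((!) ws) y}"
  from ws(2) obtain y where y: "y \<in> ?X" "\<not> representative ((!) ws) y" by blast
  show "ws \<in> ?bad"
  proof (rule ccontr)
   assume "ws \<notin> ?bad"
   from y(2) good[OF ws(1) this y(1)] show False by (rule notE)
  qed
 qed
 then have "measure_pmf.prob ?P {ws. \<exists>y\<in>?X. \<not> representative ((!) ws) y} \<le> measure_pmf.prob ?P ?bad"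
  by (rule measure_pmf.finite_measure_mono_AE) simp
 also have "\<dots> \<le> real (card ?F) * (2 * exp (- 2 * real N * ?\<eta>\<^sup>2))"
  by (rule replicate_pmf_uniform_deviation[OF finF _ \<eta>]) (rule rng)
 also have "\<dots> \<le> (1 / 2) ^ \<Delta>"
 proof -
  let ?k = "usize I + grid_bits I E + 2 + \<Delta>"
  have c1: "card ?F \<le> card ((\<lambda>A. indicator {A} :: nat set => real) ` S) + card (?\<phi> ` ?X)" by (rule card_Un_le)
  have c2: "card ((\<lambda>A. indicator {A} :: nat set => real) ` S) \<le> card S" by (rule card_image_le[OF finite_scenarios])
  have c3: "card (?\<phi> ` ?X) \<le> card ?X" by (rule card_image_le[OF finX])
  have c4: "card S = 2 ^ usize I" by (simp add: scenarios_def ground_def card_Pow)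
  have "card (real_vec ` points \<inter> feas I) \<le> card (real_vec ` points)" using points_card(1)[OF top] by (intro card_mono) auto
  also have "\<dots> \<le> card points" by (rule card_image_le[OF points_card(1)[OF top]])
  finally have "card (real_vec ` points \<inter> feas I) \<le> 2 ^ grid_bits I E" using points_card(2)[OF top] by linarith
  then have c5: "card ?X \<le> Suc (2 ^ grid_bits I E)"
   using points_card(1)[OF top] by (cases "x \<in> real_vec ` points \<inter> feas I") (simp_all add: insert_absorb card_insert_disjoint)
  have gen: "a + Suc b \<le> a * b * 4" if "1 \<le> a" "1 \<le> b" for a b :: nat
  proof -
   have "a * 1 \<le> a * b" "1 * b \<le> a * b" using that by (intro mult_mono; simp)+
   moreover have "1 \<le> a * b" using that by simp
   ultimately show ?thesis by linarith
  qed
  have "(2::nat) ^ usize I + Suc (2 ^ grid_bits I E) \<le> 2 ^ usize I * 2 ^ grid_bits I E * 4" by (rule gen) simp_all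
  also have "\<dots> = 2 ^ (usize I + grid_bits I E + 2)" by (simp add: power_add)
  finally have "card ?F \<le> 2 ^ (usize I + grid_bits I E + 2)" using c1 c2 c3 c4 c5 by linarith
  then have "real (card ?F) \<le> real (2 ^ (usize I + grid_bits I E + 2))" by (simp only: of_nat_le_iff)
  then have cF: "real (card ?F) \<le> 2 ^ (usize I + grid_bits I E + 2)" by (simp only: of_nat_power of_nat_numeral)
  have Nk: "16 * (real E)\<^sup>2 / r ^ 4 * real ?k \<le> real N"
  proof -
   let ?q = "(16 * (of_nat E * of_nat E)) / ((radius I * radius I) * (radius I * radius I)) *
     ((of_nat (usize I) + of_nat (grid_bits I E)) + (2 + of_nat \<Delta>)) :: rat"
   have "0 \<le> ?q" using radius by simp
   then have "?q \<le> of_nat N" unfolding n_samples_def by linarith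
   then have "real_of_rat ?q \<le> real_of_rat (of_nat N)" by (simp only: of_rat_less_eq)
   then show ?thesis by (simp add: of_rat_divide of_rat_mult of_rat_add power2_eq_square power4_eq_xxxx mult_ac add_ac)
  qed
  have "2 * real ?k = 2 * (16 * (real E)\<^sup>2 / r ^ 4 * real ?k) * ?\<eta>\<^sup>2"
   using E0 r_pos(1) by (simp add: power_divide power_mult_distrib flip: power_mult)
  also have "\<dots> \<le> 2 * real N * ?\<eta>\<^sup>2" using Nk by (intro mult_right_mono mult_left_mono) auto
  finally have "exp (- 2 * real N * ?\<eta>\<^sup>2) \<le> exp (- (2 * real ?k))" by simp
  also have "\<dots> = exp (- 2) ^ ?k"
  proof -
   have "exp (- (2 * real n)) = exp (- 2) ^ n" for n by (simp add: mult.commute flip: exp_of_nat_mult)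
   then show ?thesis .
  qed
  \<comment> \<open>Of each factor \<open>1 / 4\<close>, one half cancels the number of functions
    and the other is left for the confidence.\<close>
  also have "\<dots> \<le> (1 / 4) ^ ?k"
  proof (rule power_mono)
   have "(2::real) \<le> exp 1" using exp_ge_add_one_self[of 1] by simp
   then have "(2::real) * 2 \<le> exp 1 * exp 1" by (intro mult_mono) auto
   then have "4 \<le> exp (2::real)" by (simp flip: exp_add)
   then show "exp (- 2) \<le> 1 / (4::real)" by (simp add: exp_minus field_simps)
  qed simp
  finally have "real (card ?F) * (2 * exp (- 2 * real N * ?\<eta>\<^sup>2)) \<le> 2 ^ (usize I + grid_bits I E + 2) * (2 * (1 / 4) ^ ?k)"
   using cF by (intro mult_mono) auto
  also have "\<dots> = 2 * (1 / 2) ^ (usize I + grid_bits I E + 2) * (1 / 4) ^ \<Delta>"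
  proof -
   have q: "(2::real) ^ n * (1 / 4) ^ n = (1 / 2) ^ n" for n using power_mult_distrib[of "2::real" "1 / 4" n] by simp
   have "(2::real) ^ n * (2 * (1 / 4) ^ (n + d)) = 2 * (1 / 2) ^ n * (1 / 4) ^ d" for n d
    unfolding power_add q[symmetric] by (simp only: mult_ac)
   then show ?thesis by blast
  qed
  also have "\<dots> \<le> 1 * (1 / 2) ^ \<Delta>"
  proof (rule mult_mono)
   have "2 * (1 / 2 :: real) ^ (j + 2) = (1 / 2) ^ j / 2" for j by (simp add: power_add power2_eq_square)
   moreover have "(1 / 2 :: real) ^ j \<le> 1" for j by (rule power_le_one) auto
   ultimately have "2 * (1 / 2 :: real) ^ (j + 2) \<le> 1 / 2" for j by (simp only: divide_right_mono zero_le_numeral)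
   then have "2 * (1 / 2 :: real) ^ (j + 2) \<le> 1" for j by (rule order_trans) simp
   then show "2 * (1 / 2) ^ (usize I + grid_bits I E + 2) \<le> (1::real)" .
   show "(1 / 4) ^ \<Delta> \<le> (1 / 2 :: real) ^ \<Delta>" by (rule power_mono) auto
  qed auto
  finally show ?thesis by simp
 qed
 finally show ?thesis .
qed

text \<open>Shrinking a corner of the inner ball towards \<open>x\<close> by the factor \<theta>
  yields \<open>m + 1\<close> points that are feasible and, by convexity, nearly as good as
  \<open>x\<close>. They span a corner of edge \<open>\<theta> * inner_rad\<close>, too large to fit
  into the final simplex.\<close>

lemma probes:
 assumes top: "0 < top_value I" and x: "x \<in> feas I"
 obtains Y y0 where "\<And>y. y \<in> Y ==> y \<in> feas I" "y0 \<in> Y"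
  "\<And>As y. (\<And>j. j < N ==> As j \<in> S) ==> y \<in> Y ==> fhat As y \<le> fhat As x + h x / real E"
  "\<And>j. j < m ==> \<exists>y\<in>Y. \<forall>k<m. y $ k = y0 $ k + (if k = j then \<theta> * real_of_rat (inner_rad I) else 0)"
proof -
 let ?V = "real_of_rat (inner_rad I)"
 have V: "0 < ?V" using rads by simp
 obtain z where z: "z \<in> carrier_vec m" and ball: "\<And>y. y \<in> carrier_vec m ==> norm2 (y - z) \<le> ?V ==> y \<in> feas I"
  using std unfolding standing_assumptions_def well_rounded_def by blast
 \<comment> \<open>The index \<open>m\<close> matches no coordinate, so \<open>w m\<close> is the
   centre \<open>z\<close> and needs no separate treatment.\<close>
 define w where "w j = Matrix.vec m (\<lambda>k. z $ k + (if k = j then ?V else 0))" for j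
 have wf: "w j \<in> feas I" for j
 proof (rule ball)
  have "w j - z = Matrix.vec m (\<lambda>k. if k = j then ?V else 0)" using z by (auto simp: w_def)
  then have "(w j - z) \<bullet> (w j - z) = (\<Sum>k = 0..<m. (if k = j then ?V else 0) * (if k = j then ?V else 0))"
   by (simp add: scalar_prod_def)
  also have "\<dots> = (\<Sum>k = 0..<m. if k = j then ?V * ?V else 0)" by (rule sum.cong) auto
  also have "\<dots> \<le> ?V\<^sup>2" by (simp add: power2_eq_square)
  finally show "norm2 (w j - z) \<le> ?V" unfolding norm2_def using V by (intro real_le_lsqrt) auto
 qed (simp add: w_def)
 have w0: "w m = z" using z by (auto simp: w_def)
 define q where "q j = (1 - \<theta>) \<cdot>\<^sub>v x + \<theta> \<cdot>\<^sub>v w j" for j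
 have t: "0 \<le> \<theta>" "\<theta> \<le> 1" using theta(1,2)[OF top] by linarith+
 show ?thesis
 proof (rule that[of "q ` {..m}" "q m"])
  show "y \<in> feas I" if "y \<in> q ` {..m}" for y
   using that std polytope_convex[OF _ x wf t] unfolding q_def by (auto simp: standing_assumptions_def basic_data_def)
  show "q m \<in> q ` {..m}" by simp
  fix As y assume As: "\<And>j. j < N ==> As j \<in> S" and "y \<in> q ` {..m}"
  then obtain j where y: "y = (1 - \<theta>) \<cdot>\<^sub>v x + \<theta> \<cdot>\<^sub>v w j" unfolding q_def by blast
  have "fhat As y \<le> (1 - \<theta>) * fhat As x + \<theta> * fhat As (w j)" unfolding y by (rule fhat_convex[OF As x wf t])
  also have "\<dots> \<le> 1 * fhat As x + \<theta> * width"
   using t fhat_nonneg(2)[OF As x] fhat_le_width[OF As wf] by (intro add_mono mult_left_mono mult_right_mono) auto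
  also have "\<dots> \<le> fhat As x + h x / real E" using theta(4)[OF top x] by simp
  finally show "fhat As y \<le> fhat As x + h x / real E" .
 next
  fix j assume j: "j < m"
  have "q j $ k = q m $ k + (if k = j then \<theta> * ?V else 0)" if "k < m" for k
   unfolding q_def w0 using that feas_carrier[OF x] z by (simp add: w_def distrib_left)
  then show "\<exists>y\<in>q ` {..m}. \<forall>k<m. y $ k = q m $ k + (if k = j then \<theta> * ?V else 0)"
   using j by (intro bexI[of _ "q j"]) (blast, simp)
 qed
qed

text \<open>If the record never reached \<tau>, the corner spanned by the probes would still be
  inside, yet after \<open>T\<close> cuts the simplex is too small for it.\<close>

lemma simplex_exhausted:
 assumes top: "0 < top_value I" and m0: "0 < m" and ok: "simplex_ok \<tau> Y T L" and y0: "y0 \<in> Y"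
  and Y: "\<And>j. j < m ==> \<exists>y\<in>Y. \<forall>k<m. y $ k = y0 $ k + (if k = j then \<theta> * real_of_rat (inner_rad I) else 0)"
 shows "real_of_rat (L 34 0) \<le> \<tau>"
proof (rule ccontr)
 assume "\<not> real_of_rat (L 34 0) \<le> \<tau>"
 then have in_s: "\<And>y. y \<in> Y ==> in_simplex m (\<lambda>i k. real_of_rat (L 33 (i * m + k))) (\<lambda>k. y $ k)"
  and vol: "simplex_vol m (\<lambda>i k. real_of_rat (L 33 (i * m + k))) \<le> exp (- real T / (32 * real m ^ 2)) * real R ^ m"
  using ok m0 unfolding simplex_ok_def by auto
 let ?v = "\<lambda>i k. real_of_rat (L 33 (i * m + k))" and ?l = "log_ratio I E" and ?V = "real_of_rat (inner_rad I)"
 let ?\<rho> = "\<theta> * ?V"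
 have V: "0 < ?V" using rads by simp
 have \<rho>: "0 < ?\<rho>" using theta(1)[OF top] V by (rule mult_pos_pos)
 have "R > 0" using m0 by (simp add: simplex_size_def)
 then have R0: "real R > 0" by (simp only: of_nat_0_less_iff)
 have "?\<rho> ^ m \<le> fact (Suc m) * simplex_vol m ?v"
 proof (rule simplex_vol_ge[OF in_s[OF y0] _ less_imp_le[OF \<rho>]])
  fix j assume "j < m"
  then obtain y where y: "y \<in> Y" "\<And>k. k < m ==> y $ k = y0 $ k + (if k = j then ?\<rho> else 0)" using Y by blast
  show "in_simplex m ?v (\<lambda>k. y0 $ k + (if k = j then ?\<rho> else 0))" using in_s[OF y(1)] y(2) unfolding in_simplex_def by simp
 qed
 also have "\<dots> \<le> real (Suc m) ^ m * (exp (- real T / (32 * real m ^ 2)) * real R ^ m)"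
  by (intro mult_mono fact_Suc_le_power vol) (auto simp: simplex_vol_def)
 also have "\<dots> < real (Suc m) ^ m * (((1 / 2) ^ ?l) ^ m * real R ^ m)"
 proof (intro mult_strict_left_mono mult_strict_right_mono)
  have "real m * real ?l < real T / (32 * real m ^ 2)"
   using m0 by (simp add: n_cuts_def precision_def field_simps power2_eq_square)
  then have "exp (- real T / (32 * real m ^ 2)) < exp (- (real m * real ?l))" by simp
  also have "\<dots> = exp (- 1) ^ (?l * m)" by (simp add: mult.commute flip: exp_of_nat_mult)
  also have "\<dots> \<le> (1 / 2) ^ (?l * m)"
  proof (rule power_mono)
   have "(2::real) \<le> exp 1" using exp_ge_add_one_self[of 1] by simp
   then show "exp (- 1) \<le> 1 / (2::real)" by (simp add: exp_minus field_simps)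
  qed simp
  finally show "exp (- real T / (32 * real m ^ 2)) < ((1 / 2) ^ ?l) ^ m" by (simp add: power_mult)
 qed (use R0 in auto)
 also have "\<dots> = (real (Suc m) * ((1 / 2) ^ ?l * real R)) ^ m" by (simp only: power_mult_distrib)
 also have "\<dots> \<le> ?\<rho> ^ m"
 proof (rule power_mono)
  have i1: "1 \<le> real_of_rat (inv_theta I E)" by (rule theta(3)[OF top])
  have "real_of_rat (vol_ratio I E) \<le> real_of_rat (2 ^ ?l)" using log_ratio(1) by (simp only: of_rat_less_eq)
  then have "(real (Suc m) * real R) * real_of_rat (inv_theta I E) / ?V \<le> 2 ^ ?l"
   by (simp add: vol_ratio_def of_rat_divide of_rat_mult of_rat_add of_rat_power add.commute)
  moreover have "a * (1 / p * b) \<le> 1 / i * v" if "a * b * i / v \<le> p" "0 < p" "0 < i" "0 < v" for a b i v p :: real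
   using that by (simp add: field_simps)
  ultimately show "real (Suc m) * ((1 / 2) ^ ?l * real R) \<le> ?\<rho>" unfolding power_one_over using i1 V by simp
 qed simp
 finally show False by simp
qed

lemma opt_nonneg: "0 \<le> (INF x\<in>feas I. h x)"
 using zero_feas robust_bounds(5) by (intro cINF_greatest) auto

text \<open>The losses combine to \<open>2 * (1 + 1 / E)^3\<close>: \<open>2 + 1 / E\<close> for the
  estimate at \<open>x\<close> plus \<open>1 / E\<close> for the probes, then one factor
  \<open>1 + 1 / E\<close> for returning from \<open>fhat\<close> to \<open>h\<close> and one for
  \<open>x\<close> being only nearly optimal.\<close>

lemma run_guarantee:
 assumes M0: "bd B M0" "params M0" "\<And>k. M0 2 k = 0" "\<And>n. M0 33 n = 0"
 shows "\<exists>F. rexec I main_prog M0 (replicate_pmf N (center I)) F \<and>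
  (\<forall>ws\<in>set_pmf (replicate_pmf N (center I)). snd (F ws) \<le> ticks Z main_prog * W \<and>
    real_vec (get_vec 2 m (fst (F ws))) \<in> feas I) \<and>
  measure_pmf.prob (replicate_pmf N (center I))
   {ws. h (real_vec (get_vec 2 m (fst (F ws)))) \<le> 2 * (1 + 1 / real E) ^ 3 * (INF x\<in>feas I. h x)} \<ge> 1 - (1 / 2) ^ \<Delta>"
proof -
 let ?P = "replicate_pmf N (center I)" and ?e = "1 / real E"
 define opt where "opt = (INF x\<in>feas I. h x)"
 have E0: "0 < real E" using E1 by simp
 have bdd: "bdd_below (h ` feas I)" using robust_bounds(5) by (intro bdd_belowI[of _ 0]) auto
 have ne: "feas I \<noteq> {}" using zero_feas by blast
 have opt0: "0 \<le> opt" unfolding opt_def by (rule opt_nonneg)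
 have "1 \<le> (1 + ?e) ^ 3" using E0 by (intro one_le_power) simp
 then have k1: "1 \<le> 2 * (1 + ?e) ^ 3" by linarith
 have lowv: "get_vec 2 m (low M) = get_vec 2 m M" for M by (simp add: get_vec_def)
 show ?thesis unfolding opt_def[symmetric]
 \<comment> \<open>With \<open>g(0, U) = 0\<close> the accuracy has no scale to refer to, and in
   dimension 0 there is no simplex. In both cases the answer turns out to be exactly optimal: the
   objective at the answer is 0, or there is only one feasible point.\<close>
 proof (cases "0 < top_value I \<and> 0 < m")
  case True
  then have top: "0 < top_value I" and m0: "0 < m" by auto
  have "0 < r * real_of_rat (top_value I) / real_of_rat (lam I)" using top r_pos(1) lam by (intro divide_pos_pos mult_pos_pos) auto
  also have "\<dots> \<le> opt" unfolding opt_def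
  proof (rule cINF_greatest[OF ne])
   fix x assume "x \<in> feas I"
   from robust_bounds(6)[OF this] show "r * real_of_rat (top_value I) / real_of_rat (lam I) \<le> h x"
    using lam by (simp add: divide_le_eq mult.commute)
  qed
  \<comment> \<open>The comparison point is taken slightly above the infimum, so attainment need not
    be proved; this uses \<open>opt > 0\<close>.\<close>
  finally have "opt < (1 + ?e) * opt" using E0 by (simp add: distrib_right)
  then obtain x where x: "x \<in> feas I" "h x < (1 + ?e) * opt"
   using cInf_lessD[of "h ` feas I" "(1 + ?e) * opt"] ne unfolding opt_def by blast
  obtain Y y0 where Y: "\<And>y. y \<in> Y ==> y \<in> feas I" "y0 \<in> Y"
   "\<And>As y. (\<And>j. j < N ==> As j \<in> S) ==> y \<in> Y ==> fhat As y \<le> fhat As x + h x / real E"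
   "\<And>j. j < m ==> \<exists>y\<in>Y. \<forall>k<m. y $ k = y0 $ k + (if k = j then \<theta> * real_of_rat (inner_rad I) else 0)"
   using probes[OF top x(1)] by blast
  have Yne: "Y \<noteq> {}" using Y(2) by blast
  obtain F where F: "rexec I main_prog M0 ?P F" and tr: "\<And>ws. ws \<in> set_pmf ?P ==> snd (F ws) \<le> ticks Z main_prog * W \<and>
    track ((!) ws) (fhat ((!) ws) x + h x / real E) Y T (low (fst (F ws)))"
   using main_run[OF M0 Yne Y(1) Y(3)[OF samples_ws(2)]] by blast
  let ?ans = "\<lambda>ws. real_vec (get_vec 2 m (fst (F ws)))"
  have ans: "get_vec 2 m (fst (F ws)) \<in> points" "?ans ws \<in> feas I" "fhat ((!) ws) (?ans ws) \<le> fhat ((!) ws) x + h x / real E"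
   if ws: "ws \<in> set_pmf ?P" for ws
  proof -
   have a: "answer_ok ((!) ws) (low (fst (F ws)))" "simplex_ok (fhat ((!) ws) x + h x / real E) Y T (low (fst (F ws)))"
    using tr[OF ws] unfolding track_def by blast+
   then show "get_vec 2 m (fst (F ws)) \<in> points" "?ans ws \<in> feas I" unfolding answer_ok_def lowv by blast+
   show "fhat ((!) ws) (?ans ws) \<le> fhat ((!) ws) x + h x / real E"
    using a(1) simplex_exhausted[OF top m0 a(2) Y(2,4)] unfolding answer_ok_def lowv by linarith
  qed
  let ?bad = "{ws. \<exists>y\<in>insert x (real_vec ` points \<inter> feas I). \<not> representative ((!) ws) y}"
  let ?good = "{ws. h (?ans ws) \<le> 2 * (1 + ?e) ^ 3 * opt}"
  have good: "ws \<in> ?good" if ws: "ws \<in> set_pmf ?P" "ws \<notin> ?bad" for ws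
  proof -
   note S = samples_ws(2)[OF ws(1)]
   have rx: "representative ((!) ws) x" using ws(2) by blast
   have ra: "representative ((!) ws) (?ans ws)" using ws(2) ans(1,2)[OF ws(1)] by blast
   have hx0: "0 \<le> h x" by (rule robust_bounds(5)[OF x(1)])
   have "fhat ((!) ws) x \<le> (2 + ?e) * h x" by (rule representative_bounds(2)[OF S x(1) rx])
   then have f: "fhat ((!) ws) (?ans ws) \<le> (2 + 2 * ?e) * h x" using ans(3)[OF ws(1)] by (simp add: distrib_right)
   have "h (?ans ws) \<le> (1 + ?e) * fhat ((!) ws) (?ans ws)" by (rule representative_bounds(1)[OF S ans(2)[OF ws(1)] ra])
   also have "\<dots> \<le> (1 + ?e) * ((2 + 2 * ?e) * ((1 + ?e) * opt))"
    using f x(2) E0 mult_left_mono[of "h x" "(1 + ?e) * opt" "2 + 2 * ?e"] by (intro mult_left_mono) auto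
   also have "\<dots> = 2 * (1 + ?e) ^ 3 * opt"
   proof -
    have "(1 + e) * ((2 + 2 * e) * ((1 + e) * b)) = 2 * (1 + e) ^ 3 * b" for e b :: real by (simp add: power3_eq_cube algebra_simps)
    then show ?thesis .
   qed
   finally show ?thesis by simp
  qed
  have "1 - (1 / 2) ^ \<Delta> \<le> 1 - measure_pmf.prob ?P ?bad" using representative_prob[OF top x(1)] by simp
  also have "\<dots> = measure_pmf.prob ?P (UNIV - ?bad)" using measure_pmf.prob_compl[of ?bad ?P] by simp
  also have "\<dots> \<le> measure_pmf.prob ?P ?good"
   using good by (intro measure_pmf.finite_measure_mono_AE) (auto simp: AE_measure_pmf_iff)
  finally show "\<exists>F. rexec I main_prog M0 ?P F \<and> (\<forall>ws\<in>set_pmf ?P. snd (F ws) \<le> ticks Z main_prog * W \<and>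
    real_vec (get_vec 2 m (fst (F ws))) \<in> feas I) \<and>
   measure_pmf.prob ?P {ws. h (real_vec (get_vec 2 m (fst (F ws)))) \<le> 2 * (1 + ?e) ^ 3 * opt} \<ge> 1 - (1 / 2) ^ \<Delta>"
   using F tr ans(2) by (intro exI[of _ F]) blast
 next
  case False
  obtain F where F: "rexec I main_prog M0 ?P F" and tr: "\<And>ws. ws \<in> set_pmf ?P ==> snd (F ws) \<le> ticks Z main_prog * W \<and>
    track ((!) ws) (fhat ((!) ws) (0\<^sub>v m)) {0\<^sub>v m} T (low (fst (F ws)))"
   using main_run[OF M0, of "{0\<^sub>v m}" "\<lambda>ws. fhat ((!) ws) (0\<^sub>v m)"] zero_feas by auto
  let ?ans = "\<lambda>ws. real_vec (get_vec 2 m (fst (F ws)))"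
  have ans: "?ans ws \<in> feas I" "fhat ((!) ws) (?ans ws) \<le> 2 * real_of_rat (top_value I)" if ws: "ws \<in> set_pmf ?P" for ws
  proof -
   have a: "answer_ok ((!) ws) (low (fst (F ws)))" and l: "low (fst (F ws)) 34 0 \<le> 2 * top_value I"
    using tr[OF ws] unfolding track_def by blast+
   show "?ans ws \<in> feas I" using a unfolding answer_ok_def lowv by blast
   have "real_of_rat (low (fst (F ws)) 34 0) \<le> real_of_rat (2 * top_value I)" using l by (simp only: of_rat_less_eq)
   then show "fhat ((!) ws) (?ans ws) \<le> 2 * real_of_rat (top_value I)" using a unfolding answer_ok_def lowv by (simp add: of_rat_mult)
  qed
  have "h (?ans ws) \<le> opt" if ws: "ws \<in> set_pmf ?P" for ws
  proof (cases "m = 0")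
   case True
   have "x = ?ans ws" if "x \<in> feas I" for x using feas_carrier[OF that] True by (intro eq_vecI) (auto simp: get_vec_def)
   then show ?thesis unfolding opt_def using ne by (intro cINF_greatest) auto
  next
   case False
   with \<open>\<not> (0 < top_value I \<and> 0 < m)\<close> have "real_of_rat (top_value I) \<le> 0" by simp
   moreover have "recourse I (?ans ws) U \<le> real_of_rat (top_value I)" unfolding zero_oracle(3)
    using std ans(1)[OF ws] full_scenario[of I] unfolding standing_assumptions_def nonneg_costs_def by blast
   moreover have "c \<bullet> ?ans ws \<le> fhat ((!) ws) (?ans ws)" by (rule fhat_nonneg(1)[OF samples_ws(2)[OF ws] ans(1)[OF ws]])
   ultimately show ?thesis using robust_bounds(4)[OF ans(1)[OF ws]] ans(2)[OF ws] opt0 by linarith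
  qed
  moreover have "opt \<le> 2 * (1 + ?e) ^ 3 * opt" using mult_right_mono[OF k1 opt0] by simp
  ultimately have "measure_pmf.prob ?P {ws. h (?ans ws) \<le> 2 * (1 + ?e) ^ 3 * opt} = 1"
   by (subst measure_pmf.prob_eq_1) (auto simp: AE_measure_pmf_iff intro: order_trans)
  then show "\<exists>F. rexec I main_prog M0 ?P F \<and> (\<forall>ws\<in>set_pmf ?P. snd (F ws) \<le> ticks Z main_prog * W \<and>
    real_vec (get_vec 2 m (fst (F ws))) \<in> feas I) \<and>
   measure_pmf.prob ?P {ws. h (real_vec (get_vec 2 m (fst (F ws)))) \<le> 2 * (1 + ?e) ^ 3 * opt} \<ge> 1 - (1 / 2) ^ \<Delta>"
   using F tr ans(1) by (intro exI[of _ F]) simp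
 qed
qed

end

section \<open>Polynomial running time\<close>

text \<open>A maximum over all inputs up to a length, because \<open>orc_time\<close> is not assumed
  monotone.\<close>

definition oracle_max :: "drso => nat => nat" where
 "oracle_max I n = Max (orc_time I ` {..n})"

definition oracle_bits :: "drso => nat => nat" where
 "oracle_bits I E = oracle_max I (mdim I * (2 * point_bits I E + 3) + usize I)"

definition word_bits :: "drso => nat => nat => nat" where
 "word_bits I E \<Delta> = cell_bits I E \<Delta> (oracle_bits I E) + usize I + mdim I + 1"

definition step_time :: "drso => nat => nat => nat" where
 "step_time I E \<Delta> = 2 * (2 * (40 * (word_bits I E \<Delta> + 1)) + 3) + 1 +
   (1 + (mdim I * (2 * word_bits I E \<Delta> + 3) + usize I) + oracle_max I (mdim I * (2 * word_bits I E \<Delta> + 3) + usize I)) + (1 + usize I)"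

lemma oracle_max_ge: "b \<le> n ==> orc_time I b \<le> oracle_max I n"
 unfolding oracle_max_def by (intro Max_ge) auto

lemma oracle_max_attained: "\<exists>b\<le>n. oracle_max I n = orc_time I b"
proof -
 have "oracle_max I n \<in> orc_time I ` {..n}" unfolding oracle_max_def by (intro Max_in) auto
 then show ?thesis by auto
qed

text \<open>The parameters are fixed in an order without cycles: query length, then oracle time,
  then loop count and cell length, then instruction cost.\<close>

lemma canonical_run:
 assumes "standing_assumptions \<pi> I" "monotone_recourse I" "1 \<le> E"
 shows "drso_run I (word_bits I E \<Delta>) (loop_bound I E \<Delta> (oracle_bits I E)) (step_time I E \<Delta>) E \<Delta> \<pi> (oracle_bits I E)"
proof
 let ?B = "word_bits I E \<Delta>"
 show "10 \<le> ?B" unfolding word_bits_def cell_bits_def by linarith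
 show "2 * (2 * (40 * (?B + 1)) + 3) + 1 \<le> step_time I E \<Delta>" "1 + usize I \<le> step_time I E \<Delta>"
  unfolding step_time_def by linarith+
 show "oracle_cost I b \<le> step_time I E \<Delta>" if "b \<le> mdim I * (2 * ?B + 3) + usize I" for b
  using oracle_max_ge[OF that, of I] that unfolding step_time_def oracle_cost_def by linarith
 show "mdim I + 1 \<le> 2 ^ ?B" by (rule nat_le_pow2) (simp add: word_bits_def)
qed (use assms oracle_max_ge in \<open>auto simp: word_bits_def loop_bound_def oracle_bits_def\<close>)

context drso_run
begin

lemma initial_memory:
 assumes E: "of_int \<lceil>1 / \<epsilon>\<rceil> = (of_nat E :: rat)" and \<Delta>: "of_int \<lceil>log 2 (1 / \<delta>)\<rceil> = (of_nat \<Delta> :: rat)"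
 shows "bd B (fst (initial_config I \<epsilon> \<delta>))" "params (fst (initial_config I \<epsilon> \<delta>))"
  "fst (initial_config I \<epsilon> \<delta>) 2 k = 0" "fst (initial_config I \<epsilon> \<delta>) 33 k = 0"
proof -
 let ?M = "fst (initial_config I \<epsilon> \<delta>)"
 let ?p = "[of_nat m, of_nat (usize I), lam I, radius I, outer_rad I, inner_rad I, of_nat E, of_nat \<Delta>]"
 have M0: "?M 0 i = (if i < m then cost1 I $ i else 0)" and M1: "?M (Suc 0) i = (if i < 8 then ?p ! i else 0)"
  and M: "b \<noteq> 0 ==> b \<noteq> Suc 0 ==> ?M b i = 0" for b i
  using cost_dim E \<Delta> by (auto simp: initial_config_def set_vec_def input_params_def vec_of_list_index simp del: vec_of_list_Cons)
 show "?M 2 k = 0" "?M 33 k = 0" by (simp_all add: M)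
 show "params ?M" unfolding params_def One_nat_def M0 M1 by simp
 have iB: "isize I \<le> B" "E \<le> B" "\<Delta> \<le> B" using B unfolding cell_bits_def ratio_bits_def by linarith+
 have n: "rb B (of_nat j)" if "j \<le> B" for j using that by (intro rb_nat nat_le_pow2)
 have "rb B q" if "q \<in> set ?p" for q
  using that rb_mono[OF rb_param(1) iB(1)] rb_mono[OF rb_param(2) iB(1)] rb_mono[OF rb_param(3) iB(1)] rb_mono[OF rb_param(4) iB(1)]
   n[OF iB(2)] n[OF iB(3)] n[of m] n[of "usize I"] mu_isize iB(1) by auto
 moreover have "?p ! i \<in> set ?p" if "i < 8" for i using that by (intro nth_mem) simp
 ultimately have "rb B (?M (Suc 0) i)" for i unfolding M1 by (simp only: rb_0 split: if_split) blast
 moreover have "rb B (?M 0 i)" for i unfolding M0 using rb_mono[OF rb_param(5) iB(1)] by simp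
 ultimately have "rb B (?M b i)" for b i using M[of b i] by (cases "b = 0"; cases "b = Suc 0") simp_all
 then show "bd B ?M" by (simp add: bd_def)
qed

text \<open>\<open>oracle_bits\<close> refers to the length of query points, that length to the
  number of cuts, and this number to \<open>log_ratio\<close>. Bounding \<open>log_ratio\<close> by
  the query at 0 alone breaks the circle.\<close>

lemma log_ratio_le_oracle: "log_ratio I E \<le> ratio_bits I E (oracle_max I (3 * m + usize I))"
proof (rule ratio_sizes(4))
 have "real_vec (0\<^sub>v m) \<in> feas I" unfolding zero_oracle(1) by (rule zero_feas)
 then have "rat_size (top_value I) \<le> orc_time I (vec_size (0\<^sub>v m) + usize I)"
  unfolding top_value_def using std full_scenario[of I] zero_carrier_vec[of m]
  unfolding standing_assumptions_def efficient_convex_recourse_def by blast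
 moreover have "vec_size (0\<^sub>v m) \<le> 3 * m" using sum_bounded_above[of "{..<m}" "\<lambda>i. rat_size (0\<^sub>v m $ i)" 3] rat_size_rb[OF rb_0[of 0]]
  by (simp add: vec_size_def)
 ultimately have "rat_size (top_value I) \<le> oracle_max I (3 * m + usize I)"
  using oracle_max_ge[of "vec_size (0\<^sub>v m) + usize I" "3 * m + usize I" I] by linarith
 then show "rb (oracle_max I (3 * m + usize I)) (top_value I)" by (rule rb_mono[OF rb_rat_size])
qed

lemma n_top_le: "real K \<le> 1 / r + 1"
proof -
 have "of_nat K \<le> 1 / radius I + 1" using radius by (simp add: n_top_def)
 then have "real_of_rat (of_nat K) \<le> real_of_rat (1 / radius I + 1)" by (simp only: of_rat_less_eq)
 then show ?thesis by (simp add: of_rat_add of_rat_divide)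
qed

lemma n_samples_le: "real N \<le> 16 * (real E * real E) * ((1 / r) * (1 / r) * ((1 / r) * (1 / r))) *
  (real (usize I) + real (grid_bits I E) + 2 + real \<Delta>) + 1"
proof -
 let ?q = "(16 * (of_nat E * of_nat E)) / ((radius I * radius I) * (radius I * radius I)) *
     ((of_nat (usize I) + of_nat (grid_bits I E)) + (2 + of_nat \<Delta>)) :: rat"
 have "0 \<le> ?q" using radius by simp
 then have "of_nat N \<le> ?q + 1" unfolding n_samples_def by simp
 then have "real_of_rat (of_nat N) \<le> real_of_rat (?q + 1)" by (simp only: of_rat_less_eq)
 then show ?thesis by (simp add: of_rat_divide of_rat_mult of_rat_add add_ac)
qed

end

text \<open>A general polynomial need not be monotone. The form \<open>c * (1 + X) ^ k\<close> is so
  for nonnegative \<open>c\<close>, and bounds of this form are closed under sums and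
  products.\<close>

definition poly_bounded :: "'a set => ('a => real) => ('a => real) => bool" where
 "poly_bounded A X f \<longleftrightarrow> (\<exists>c k. \<forall>a\<in>A. \<bar>f a\<bar> \<le> c * (1 + X a) ^ k)"

locale scale =
 fixes A :: "'a set" and X :: "'a => real"
 assumes X: "\<And>a. a \<in> A ==> 0 \<le> X a"
begin

lemma pb_le: "poly_bounded A X g ==> (\<And>a. a \<in> A ==> \<bar>f a\<bar> \<le> g a) ==> poly_bounded A X f"
 unfolding poly_bounded_def by (meson abs_ge_self order_trans)

lemma pb_const: "poly_bounded A X (\<lambda>_. b)"
 unfolding poly_bounded_def by (intro exI[of _ "\<bar>b\<bar>"] exI[of _ 0]) simp

lemma pb_self: "poly_bounded A X X"
 unfolding poly_bounded_def using X by (intro exI[of _ 1] exI[of _ 1]) simp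

lemma pb_add:
 assumes "poly_bounded A X f" "poly_bounded A X g"
 shows "poly_bounded A X (\<lambda>a. f a + g a)"
proof -
 from assms obtain c k d l where *: "\<And>a. a \<in> A ==> \<bar>f a\<bar> \<le> c * (1 + X a) ^ k" "\<And>a. a \<in> A ==> \<bar>g a\<bar> \<le> d * (1 + X a) ^ l"
  unfolding poly_bounded_def by blast
 have "\<bar>f a + g a\<bar> \<le> (\<bar>c\<bar> + \<bar>d\<bar>) * (1 + X a) ^ (k + l)" if a: "a \<in> A" for a
 proof -
  have p: "(1 + X a) ^ k \<le> (1 + X a) ^ (k + l)" "(1 + X a) ^ l \<le> (1 + X a) ^ (k + l)" "0 \<le> (1 + X a) ^ k" "0 \<le> (1 + X a) ^ l"
   using X[OF a] by (auto intro!: power_increasing)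
  have "c * (1 + X a) ^ k \<le> \<bar>c\<bar> * (1 + X a) ^ (k + l)" "d * (1 + X a) ^ l \<le> \<bar>d\<bar> * (1 + X a) ^ (k + l)"
   using p by (auto intro!: mult_mono)
  then show ?thesis using *(1)[OF a] *(2)[OF a] by (simp add: distrib_right)
 qed
 then show ?thesis unfolding poly_bounded_def by blast
qed

lemma pb_mult:
 assumes "poly_bounded A X f" "poly_bounded A X g"
 shows "poly_bounded A X (\<lambda>a. f a * g a)"
proof -
 from assms obtain c k d l where *: "\<And>a. a \<in> A ==> \<bar>f a\<bar> \<le> c * (1 + X a) ^ k" "\<And>a. a \<in> A ==> \<bar>g a\<bar> \<le> d * (1 + X a) ^ l"
  unfolding poly_bounded_def by blast
 have "\<bar>f a * g a\<bar> \<le> (c * d) * (1 + X a) ^ (k + l)" if a: "a \<in> A" for a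
 proof -
  have "\<bar>f a\<bar> * \<bar>g a\<bar> \<le> (c * (1 + X a) ^ k) * (d * (1 + X a) ^ l)"
   using *(1)[OF a] *(2)[OF a] by (intro mult_mono) auto
  then show ?thesis by (simp add: abs_mult power_add mult_ac)
 qed
 then show ?thesis unfolding poly_bounded_def by blast
qed

lemma pb_power: "poly_bounded A X f ==> poly_bounded A X (\<lambda>a. f a ^ n)"
 by (induction n) (simp_all add: pb_const pb_mult)

lemma pb_poly: "poly_bounded A X f ==> poly_bounded A X (\<lambda>a. poly p (f a))"
 by (induction p) (simp_all add: pb_const pb_add pb_mult)

end

lemma poly_growth: "\<exists>c k. 0 \<le> c \<and> (\<forall>x\<ge>0. \<bar>poly p x\<bar> \<le> c * (1 + x) ^ k)" for p :: "real poly"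
proof -
 interpret scale "{0..}" "\<lambda>x :: real. x" by standard simp
 from pb_poly[OF pb_self, of p] obtain c k where *: "\<And>x. 0 \<le> x ==> \<bar>poly p x\<bar> \<le> c * (1 + x) ^ k"
  unfolding poly_bounded_def by auto
 have "0 \<le> \<bar>poly p 0\<bar>" by simp
 also have "\<dots> \<le> c" using *[of 0] by simp
 finally show ?thesis using * by blast
qed

context scale
begin

text \<open>The maximum is attained at an input of length at most \<open>n a\<close>; \<pi> is first
  replaced by a monotone bound, since a polynomial may decrease.\<close>

lemma pb_oracle_max:
 assumes n: "poly_bounded A X (\<lambda>a. real (n a))" and i: "poly_bounded A X (\<lambda>a. real (isize (I a)))"
  and t: "\<And>a b. a \<in> A ==> real (orc_time (I a) b) \<le> poly \<pi> (real (isize (I a) + b))"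
 shows "poly_bounded A X (\<lambda>a. real (oracle_max (I a) (n a)))"
proof -
 obtain c k where c: "0 \<le> c" "\<And>x. 0 \<le> x ==> \<bar>poly \<pi> x\<bar> \<le> c * (1 + x) ^ k" using poly_growth[of \<pi>] by blast
 show ?thesis
 proof (rule pb_le[where g = "\<lambda>a. c * (1 + (real (isize (I a)) + real (n a))) ^ k"])
  show "poly_bounded A X (\<lambda>a. c * (1 + (real (isize (I a)) + real (n a))) ^ k)"
   by (intro pb_mult pb_const pb_power pb_add n i)
  fix a assume a: "a \<in> A"
  obtain b where b: "b \<le> n a" "oracle_max (I a) (n a) = orc_time (I a) b" using oracle_max_attained by blast
  have "real (orc_time (I a) b) \<le> c * (1 + real (isize (I a) + b)) ^ k"
   using t[OF a, of b] c(2)[of "real (isize (I a) + b)"] by linarith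
  also have "\<dots> \<le> c * (1 + (real (isize (I a)) + real (n a))) ^ k"
   using b(1) c(1) by (intro mult_left_mono power_mono) auto
  finally show "\<bar>real (oracle_max (I a) (n a))\<bar> \<le> c * (1 + (real (isize (I a)) + real (n a))) ^ k" using b(2) by simp
 qed
qed

lemma pb_ticks:
 assumes "poly_bounded A X (\<lambda>a. real (z a))"
 shows "poly_bounded A X (\<lambda>a. real (ticks (z a) c))"
 by (induction c) (auto intro!: pb_add pb_mult pb_const assms)

lemma pb_nat_le: "poly_bounded A X (\<lambda>a. real (g a)) ==> (\<And>a. a \<in> A ==> f a \<le> g a) ==> poly_bounded A X (\<lambda>a. real (f a))"
 by (erule pb_le) simp

end

section \<open>Running time over all instances and the final guarantee\<close>

definition instances :: "real poly => (drso \<times> real \<times> real) set" where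
 "instances \<pi> = {(I, \<epsilon>, \<delta>). standing_assumptions \<pi> I \<and> monotone_recourse I \<and> 0 < \<epsilon> \<and> \<epsilon> \<le> 1 / 3 \<and> 0 < \<delta> \<and> \<delta> < 1}"

fun magnitude :: "drso \<times> real \<times> real => real" where
 "magnitude (I, \<epsilon>, \<delta>) = real (isize I) + real_of_rat (lam I) / (\<epsilon> * real_of_rat (radius I)) + ln (1 / \<delta>)"

abbreviation "accuracy a \<equiv> nat \<lceil>1 / fst (snd a)\<rceil>"
abbreviation "confidence a \<equiv> nat \<lceil>log 2 (1 / snd (snd a))\<rceil>"

lemma instance_bounds:
 assumes a: "a \<in> instances \<pi>"
 shows "standing_assumptions \<pi> (fst a)" "monotone_recourse (fst a)" "1 \<le> accuracy a"
  "real (isize (fst a)) \<le> magnitude a" "mdim (fst a) \<le> isize (fst a)" "usize (fst a) \<le> isize (fst a)"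
  "real (accuracy a) \<le> magnitude a + 1" "real (confidence a) \<le> magnitude a + magnitude a + 1"
  "0 < real_of_rat (radius (fst a))" "1 / real_of_rat (radius (fst a)) \<le> magnitude a"
  "1 / fst (snd a) \<le> real (accuracy a)" "log 2 (1 / snd (snd a)) \<le> real (confidence a)"
  "of_int \<lceil>1 / fst (snd a)\<rceil> = (of_nat (accuracy a) :: rat)" "of_int \<lceil>log 2 (1 / snd (snd a))\<rceil> = (of_nat (confidence a) :: rat)"
proof -
 obtain I \<epsilon> \<delta> where aI: "a = (I, \<epsilon>, \<delta>)" by (cases a)
 have st: "standing_assumptions \<pi> I" "monotone_recourse I" "0 < \<epsilon>" "\<epsilon> \<le> 1 / 3" "0 < \<delta>" "\<delta> < 1" using a by (auto simp: instances_def aI)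
 then show "standing_assumptions \<pi> (fst a)" "monotone_recourse (fst a)" by (simp_all add: aI)
 have b: "0 < radius I" "radius I \<le> 1" "1 \<le> lam I" and sz: "mdim I \<le> isize I" "usize I \<le> isize I"
  using st(1) by (auto simp: standing_assumptions_def basic_data_def bounded_inflation_def)
 have r: "0 < real_of_rat (radius I)" "real_of_rat (radius I) \<le> 1" "1 \<le> real_of_rat (lam I)" using b by simp_all
 show "0 < real_of_rat (radius (fst a))" "mdim (fst a) \<le> isize (fst a)" "usize (fst a) \<le> isize (fst a)" using r sz by (simp_all add: aI)
 let ?q = "real_of_rat (lam I) / (\<epsilon> * real_of_rat (radius I))"
 have er: "0 < \<epsilon> * real_of_rat (radius I)" using st r by simp
 have q1: "1 / \<epsilon> \<le> ?q" "1 / real_of_rat (radius I) \<le> ?q"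
 proof -
  have "\<epsilon> * real_of_rat (radius I) \<le> \<epsilon> * 1" "\<epsilon> * real_of_rat (radius I) \<le> 1 * real_of_rat (radius I)"
   using st r by (intro mult_left_mono mult_right_mono; simp)+
  then show "1 / \<epsilon> \<le> ?q" "1 / real_of_rat (radius I) \<le> ?q" using st r er by (intro frac_le; simp)+
 qed
 have l0: "0 \<le> ln (1 / \<delta>)" using st by (intro ln_ge_zero) simp
 have q0: "0 \<le> ?q" using q1(2) r zero_le_divide_1_iff[of "real_of_rat (radius I)"] by linarith
 have mg: "magnitude a = real (isize I) + ?q + ln (1 / \<delta>)" by (simp add: aI)
 show "real (isize (fst a)) \<le> magnitude a" "1 / real_of_rat (radius (fst a)) \<le> magnitude a" unfolding mg using l0 q0 q1 by (simp_all add: aI)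
 have e3: "3 \<le> 1 / \<epsilon>" using st by (simp add: field_simps)
 have d0: "0 < log 2 (1 / \<delta>)" using st by (subst zero_less_log_cancel_iff) auto
 have E: "real (accuracy a) = of_int \<lceil>1 / \<epsilon>\<rceil>" and D: "real (confidence a) = of_int \<lceil>log 2 (1 / \<delta>)\<rceil>" using e3 d0 by (simp_all add: aI)
 show "1 / fst (snd a) \<le> real (accuracy a)" "log 2 (1 / snd (snd a)) \<le> real (confidence a)" unfolding E D by (simp_all add: aI)
 show "real (accuracy a) \<le> magnitude a + 1" unfolding E mg using q1(1) l0 ceiling_correct[of "1 / \<epsilon>"] of_nat_0_le_iff[of "isize I", where ?'a = real] by linarith
 have "3 \<le> real (accuracy a)" unfolding E using e3 ceiling_correct[of "1 / \<epsilon>"] by linarith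
 then show "1 \<le> accuracy a" by linarith
 \<comment> \<open>The machine reads a binary logarithm of \<open>1 / \<delta>\<close>, the time
   bound speaks of the natural one; they differ by a factor of at most 2.\<close>
 have "1 / 2 \<le> ln (2::real)"
 proof -
  have "exp (1 / 2 :: real) ^ 2 \<le> 3" using exp_le by (simp flip: exp_of_nat_mult)
  also have "\<dots> \<le> 2 ^ 2" by simp
  finally have "exp (1 / 2) \<le> (2::real)" by (rule power2_le_imp_le) simp
  then show ?thesis by (subst ln_ge_iff) auto
 qed
 then have "ln (1 / \<delta>) / ln 2 \<le> ln (1 / \<delta>) / (1 / 2)" using l0 by (intro divide_left_mono) auto
 then have "log 2 (1 / \<delta>) \<le> 2 * ln (1 / \<delta>)" by (simp add: log_def)
 then have "log 2 (1 / \<delta>) \<le> ln (1 / \<delta>) + ln (1 / \<delta>)" by (simp only: mult_2)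
 moreover have "x \<le> (s + q + l) + (s + q + l) + 1" if "x - 1 < y" "y \<le> l + l" "0 \<le> q" "0 \<le> s" for x y s q l :: real
  using that by argo
 ultimately show "real (confidence a) \<le> magnitude a + magnitude a + 1"
  unfolding D mg using q0 ceiling_correct[THEN conjunct1, of "log 2 (1 / \<delta>)"] of_nat_0_le_iff[of "isize I", where ?'a = real] by blast
 show "of_int \<lceil>1 / fst (snd a)\<rceil> = (of_nat (accuracy a) :: rat)" "of_int \<lceil>log 2 (1 / snd (snd a))\<rceil> = (of_nat (confidence a) :: rat)"
  using e3 d0 by (simp_all add: aI)
qed

lemma polynomial_time:
 "\<exists>Q. \<forall>a\<in>instances \<pi>. real (ticks (loop_bound (fst a) (accuracy a) (confidence a) (oracle_bits (fst a) (accuracy a))) main_prog *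
   step_time (fst a) (accuracy a) (confidence a)) \<le> poly Q (magnitude a)"
proof -
 interpret scale "instances \<pi>" magnitude
 proof
  fix a assume "a \<in> instances \<pi>"
  from instance_bounds(4)[OF this] show "0 \<le> magnitude a" by linarith
 qed
 let ?pb = "\<lambda>f. poly_bounded (instances \<pi>) magnitude (\<lambda>a. real (f a))"
 note cl = pb_add pb_mult pb_const
 note nat = of_nat_add of_nat_mult of_nat_numeral of_nat_1
 have run: "drso_run (fst a) (word_bits (fst a) (accuracy a) (confidence a))
   (loop_bound (fst a) (accuracy a) (confidence a) (oracle_bits (fst a) (accuracy a)))
   (step_time (fst a) (accuracy a) (confidence a)) (accuracy a) (confidence a) \<pi> (oracle_bits (fst a) (accuracy a))"
  if "a \<in> instances \<pi>" for a using instance_bounds(1-3)[OF that] by (rule canonical_run)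
 have orc: "real (orc_time (fst a) b) \<le> poly \<pi> (real (isize (fst a) + b))" if "a \<in> instances \<pi>" for a b
  using instance_bounds(1)[OF that] unfolding standing_assumptions_def efficient_feas_def by blast
 have i: "?pb (\<lambda>a. isize (fst a))" by (rule pb_le[OF pb_self]) (use instance_bounds(4) in simp)
 have m: "?pb (\<lambda>a. mdim (fst a))" by (rule pb_nat_le[OF i]) (rule instance_bounds(5))
 have u: "?pb (\<lambda>a. usize (fst a))" by (rule pb_nat_le[OF i]) (rule instance_bounds(6))
 have E: "?pb accuracy" by (rule pb_le[OF pb_add[OF pb_self pb_const[of 1]]]) (use instance_bounds(7) in simp)
 have d: "?pb confidence" by (rule pb_le[OF pb_add[OF pb_add[OF pb_self pb_self] pb_const[of 1]]]) (use instance_bounds(8) in simp)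
 have r: "poly_bounded (instances \<pi>) magnitude (\<lambda>a. 1 / real_of_rat (radius (fst a)))"
 proof (rule pb_le[OF pb_self])
  fix a assume a: "a \<in> instances \<pi>"
  from instance_bounds(9,10)[OF a] show "\<bar>1 / real_of_rat (radius (fst a))\<bar> \<le> magnitude a" by simp
 qed
 have o: "?pb (\<lambda>a. oracle_max (fst a) (n a))" if "?pb n" for n by (rule pb_oracle_max[OF that i orc])
 have ratio: "?pb (\<lambda>a. ratio_bits (fst a) (accuracy a) (n a))" if "?pb n" for n
  unfolding ratio_bits_def nat by (intro cl i m E that)
 have o0: "?pb (\<lambda>a. oracle_max (fst a) (3 * mdim (fst a) + usize (fst a)))" by (rule o) (unfold nat, intro cl m u)
 have l: "?pb (\<lambda>a. log_ratio (fst a) (accuracy a))"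
  by (rule pb_nat_le[OF ratio[OF o0]]) (rule drso_run.log_ratio_le_oracle[OF run])
 have p: "?pb (\<lambda>a. precision (fst a))" unfolding precision_def nat by (intro cl m)
 have t: "?pb (\<lambda>a. n_cuts (fst a) (accuracy a))" unfolding n_cuts_def nat by (intro cl p l)
 have g: "?pb (\<lambda>a. grid_bits (fst a) (accuracy a))" unfolding grid_bits_def nat by (intro cl p l t m)
 have pt: "?pb (\<lambda>a. point_bits (fst a) (accuracy a))" unfolding point_bits_def nat by (intro cl t p i m)
 have k: "?pb (\<lambda>a. n_top (fst a))"
  by (rule pb_le[OF pb_add[OF r pb_const[of 1]]]) (use drso_run.n_top_le[OF run] in simp)
 have N: "?pb (\<lambda>a. n_samples (fst a) (accuracy a) (confidence a))"
 proof (rule pb_le)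
  show "\<bar>real (n_samples (fst a) (accuracy a) (confidence a))\<bar> \<le> 16 * (real (accuracy a) * real (accuracy a)) *
   ((1 / real_of_rat (radius (fst a))) * (1 / real_of_rat (radius (fst a))) * ((1 / real_of_rat (radius (fst a))) * (1 / real_of_rat (radius (fst a))))) *
   (real (usize (fst a)) + real (grid_bits (fst a) (accuracy a)) + 2 + real (confidence a)) + 1" if "a \<in> instances \<pi>" for a
   using drso_run.n_samples_le[OF run[OF that]] by simp
 qed (intro cl E r u g d)
 have w: "?pb (\<lambda>a. weight_bits (fst a) (accuracy a) (confidence a))" unfolding weight_bits_def nat by (intro cl N i k)
 have ob: "?pb (\<lambda>a. oracle_bits (fst a) (accuracy a))" unfolding oracle_bits_def by (rule o) (unfold nat, intro cl m u pt)
 have tb: "?pb (\<lambda>a. term_bits (fst a) (accuracy a) (confidence a) (oracle_bits (fst a) (accuracy a)))"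
  unfolding term_bits_def nat by (intro cl N k w ob)
 have nb: "?pb (\<lambda>a. normal_bits (fst a) (accuracy a) (confidence a) (oracle_bits (fst a) (accuracy a)))"
  unfolding normal_bits_def nat by (intro cl i tb ob)
 have wb: "?pb (\<lambda>a. word_bits (fst a) (accuracy a) (confidence a))"
  unfolding word_bits_def cell_bits_def nat by (intro cl ratio ob pt w m i tb nb p t g N k d u)
 have z: "?pb (\<lambda>a. loop_bound (fst a) (accuracy a) (confidence a) (oracle_bits (fst a) (accuracy a)))"
  unfolding loop_bound_def nat by (intro cl ratio ob t N k m u)
 have st: "?pb (\<lambda>a. step_time (fst a) (accuracy a) (confidence a))"
  unfolding step_time_def nat
  by (intro cl wb m u o) (unfold nat, intro cl wb m u)
 have "?pb (\<lambda>a. ticks (loop_bound (fst a) (accuracy a) (confidence a) (oracle_bits (fst a) (accuracy a))) main_prog * step_time (fst a) (accuracy a) (confidence a))"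
  unfolding nat by (intro pb_mult pb_ticks z st)
 then obtain c k where "\<And>a. a \<in> instances \<pi> ==> \<bar>real (ticks (loop_bound (fst a) (accuracy a) (confidence a) (oracle_bits (fst a) (accuracy a))) main_prog *
   step_time (fst a) (accuracy a) (confidence a))\<bar> \<le> c * (1 + magnitude a) ^ k" unfolding poly_bounded_def by blast
 then have "\<forall>a\<in>instances \<pi>. real (ticks (loop_bound (fst a) (accuracy a) (confidence a) (oracle_bits (fst a) (accuracy a))) main_prog *
   step_time (fst a) (accuracy a) (confidence a)) \<le> poly (Polynomial.smult c ([:1, 1:] ^ k)) (magnitude a)" by (simp add: poly_power)
 then show ?thesis by blast
qed

theorem theorem4p1:
  shows "\<exists>(C::real) (prog::com). \<forall>\<pi>::real poly. \<exists>Q::real poly.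
    \<forall>(I::drso) (\<epsilon>::real) (\<delta>::real).
      standing_assumptions \<pi> I \<and> monotone_recourse I \<and>
      0 < \<epsilon> \<and> \<epsilon> \<le> 1 / 3 \<and> 0 < \<delta> \<and> \<delta> < 1 \<longrightarrow>
      (\<exists>k. let D = exec I k prog (initial_config I \<epsilon> \<delta>) in
         lossless_spmf D \<and>
         (\<forall>s\<in>set_spmf D.
            answer I s \<in> feas I \<and>
            real (run_time s)
              \<le> poly Q (real (isize I) + real_of_rat (lam I) / (\<epsilon> * real_of_rat (radius I))
                         + ln (1 / \<delta>))) \<and>
         measure (measure_spmf D)
           {s. robust_cost I (answer I s) \<le> (2 + C * \<epsilon>) * (INF x\<in>feas I. robust_cost I x)}
           \<ge> 1 - \<delta>)"
proof (rule exI[of _ 10], rule exI[of _ main_prog], rule allI)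
 fix \<pi> :: "real poly"
 obtain Q where Q: "\<And>a. a \<in> instances \<pi> ==> real (ticks (loop_bound (fst a) (accuracy a) (confidence a) (oracle_bits (fst a) (accuracy a))) main_prog *
   step_time (fst a) (accuracy a) (confidence a)) \<le> poly Q (magnitude a)" using polynomial_time[of \<pi>] by blast
 have main: "\<exists>k. let D = exec I k main_prog (initial_config I \<epsilon> \<delta>) in lossless_spmf D \<and>
   (\<forall>s\<in>set_spmf D. answer I s \<in> feas I \<and> real (run_time s) \<le> poly Q (magnitude (I, \<epsilon>, \<delta>))) \<and>
   measure (measure_spmf D) {s. robust_cost I (answer I s) \<le> (2 + 10 * \<epsilon>) * (INF x\<in>feas I. robust_cost I x)} \<ge> 1 - \<delta>"
  if a: "(I, \<epsilon>, \<delta>) \<in> instances \<pi>" for I \<epsilon> \<delta>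
 proof -
  define E where "E = nat \<lceil>1 / \<epsilon>\<rceil>"
  define \<Delta> where "\<Delta> = nat \<lceil>log 2 (1 / \<delta>)\<rceil>"
  note ib = instance_bounds[OF a, unfolded fst_conv snd_conv, folded E_def \<Delta>_def]
  have eps: "0 < \<epsilon>" "\<epsilon> \<le> 1 / 3" "0 < \<delta>" using a by (auto simp: instances_def)
  interpret drso_run I "word_bits I E \<Delta>" "loop_bound I E \<Delta> (oracle_bits I E)" "step_time I E \<Delta>" E \<Delta> \<pi> "oracle_bits I E"
   by (rule canonical_run[OF ib(1-3)])
  let ?P = "replicate_pmf N (center I)" and ?opt = "INF x\<in>feas I. h x" and ?M = "fst (initial_config I \<epsilon> \<delta>)"
  obtain F where F: "rexec I main_prog ?M ?P F"
   "\<And>ws. ws \<in> set_pmf ?P ==> snd (F ws) \<le> ticks (loop_bound I E \<Delta> (oracle_bits I E)) main_prog * step_time I E \<Delta> \<and>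
     real_vec (get_vec 2 m (fst (F ws))) \<in> feas I"
   "measure_pmf.prob ?P {ws. h (real_vec (get_vec 2 m (fst (F ws)))) \<le> 2 * (1 + 1 / real E) ^ 3 * ?opt} \<ge> 1 - (1 / 2) ^ \<Delta>"
   using run_guarantee[OF initial_memory[OF ib(13,14)]] by blast
  obtain k where "\<And>t0. exec I k main_prog (?M, t0) = map_spmf (\<lambda>w. (fst (F w), t0 + snd (F w))) (spmf_of_pmf ?P)"
   using F(1) unfolding rexec_def by blast
  from this[of 0] have D: "exec I k main_prog (initial_config I \<epsilon> \<delta>) = map_spmf F (spmf_of_pmf ?P)"
   by (simp add: initial_config_def)
  have time: "real (snd (F ws)) \<le> poly Q (magnitude (I, \<epsilon>, \<delta>))" if "ws \<in> set_pmf ?P" for ws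
  proof -
   have "real (snd (F ws)) \<le> real (ticks (loop_bound I E \<Delta> (oracle_bits I E)) main_prog * step_time I E \<Delta>)"
    using F(2)[OF that] by (simp only: of_nat_le_iff)
   then show ?thesis using Q[OF a, unfolded fst_conv snd_conv, folded E_def \<Delta>_def] by linarith
  qed
  have E0: "0 < real E" using ib(3) by simp
  have e: "1 / real E \<le> \<epsilon>" using ib(11) eps E0 by (simp add: field_simps)
  have e0: "0 \<le> 1 / real E" using E0 by simp
  \<comment> \<open>Expanding, \<open>(1 + \<epsilon>)^3 = 1 + \<epsilon> * (3 + 3 * \<epsilon> +
    \<epsilon>^2)\<close>, and the bracket is at most 5 for \<open>\<epsilon> \<le> 1 / 3\<close>:
    this is where the constant 10 comes from.\<close>
  have fac: "2 * (1 + 1 / real E) ^ 3 \<le> 2 + 10 * \<epsilon>"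
  proof -
   have "(1 + 1 / real E) ^ 3 \<le> (1 + \<epsilon>) ^ 3" using e e0 by (intro power_mono) auto
   also have "\<dots> = 1 + \<epsilon> * (3 + 3 * \<epsilon> + \<epsilon> * \<epsilon>)" by (simp add: power3_eq_cube algebra_simps)
   also have "\<dots> \<le> 1 + \<epsilon> * 5"
   proof -
    have "\<epsilon> * \<epsilon> \<le> 1 * \<epsilon>" using eps by (intro mult_right_mono) auto
    then have "3 + 3 * \<epsilon> + \<epsilon> * \<epsilon> \<le> 5" using eps by linarith
    then show ?thesis using eps by (intro add_left_mono mult_left_mono) auto
   qed
   finally show ?thesis by simp
  qed
  have "1 - \<delta> \<le> 1 - (1 / 2) ^ \<Delta>"
  proof -
   have "1 / \<delta> = 2 powr (log 2 (1 / \<delta>))" using eps by simp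
   also have "\<dots> \<le> 2 powr real \<Delta>" using ib(12) by (intro powr_mono) auto
   finally have "1 / \<delta> \<le> 2 ^ \<Delta>" by (simp add: powr_realpow)
   then have "1 \<le> \<delta> * 2 ^ \<Delta>" using eps by (simp add: field_simps)
   then show ?thesis by (simp add: power_one_over divide_le_eq)
  qed
  also have "\<dots> \<le> measure_pmf.prob ?P {ws. h (real_vec (get_vec 2 m (fst (F ws)))) \<le> 2 * (1 + 1 / real E) ^ 3 * ?opt}" by (rule F(3))
  also have "\<dots> \<le> measure_pmf.prob ?P {ws. h (real_vec (get_vec 2 m (fst (F ws)))) \<le> (2 + 10 * \<epsilon>) * ?opt}"
   using mult_right_mono[OF fac opt_nonneg] by (intro measure_pmf.finite_measure_mono) auto
  also have "\<dots> = measure (measure_spmf (map_spmf F (spmf_of_pmf ?P))) {s. h (answer I s) \<le> (2 + 10 * \<epsilon>) * ?opt}"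
   by (simp add: measure_map_spmf measure_spmf_spmf_of_pmf vimage_def answer_def)
  finally show ?thesis unfolding D Let_def using F(2) time
   by (intro exI[of _ k] conjI) (auto simp: D answer_def run_time_def)
 qed
 show "\<exists>Q::real poly.
  \<forall>(I::drso) (\<epsilon>::real) (\<delta>::real).
   standing_assumptions \<pi> I \<and> monotone_recourse I \<and>
   0 < \<epsilon> \<and> \<epsilon> \<le> 1 / 3 \<and> 0 < \<delta> \<and> \<delta> < 1 -->
   (\<exists>k. let D = exec I k main_prog (initial_config I \<epsilon> \<delta>) in
     lossless_spmf D \<and>
     (\<forall>s\<in>set_spmf D.
      answer I s \<in> feas I \<and>
      real (run_time s)
       \<le> poly Q (real (isize I) + real_of_rat (lam I) / (\<epsilon> * real_of_rat (radius I))
             + ln (1 / \<delta>))) \<and>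
     measure (measure_spmf D)
      {s. robust_cost I (answer I s) \<le> (2 + 10 * \<epsilon>) * (INF x\<in>feas I. robust_cost I x)}
      \<ge> 1 - \<delta>)"
 proof (intro exI[of _ Q] allI impI)
  fix I :: drso and \<epsilon> \<delta> :: real
  assume "standing_assumptions \<pi> I \<and> monotone_recourse I \<and> 0 < \<epsilon> \<and> \<epsilon> \<le> 1 / 3 \<and> 0 < \<delta> \<and> \<delta> < 1"
  then have "(I, \<epsilon>, \<delta>) \<in> instances \<pi>" by (simp add: instances_def)
  from main[OF this] show "\<exists>k. let D = exec I k main_prog (initial_config I \<epsilon> \<delta>) in
     lossless_spmf D \<and>
     (\<forall>s\<in>set_spmf D.
      answer I s \<in> feas I \<and>
      real (run_time s)
       \<le> poly Q (real (isize I) + real_of_rat (lam I) / (\<epsilon> * real_of_rat (radius I))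
             + ln (1 / \<delta>))) \<and>
     measure (measure_spmf D)
      {s. robust_cost I (answer I s) \<le> (2 + 10 * \<epsilon>) * (INF x\<in>feas I. robust_cost I x)}
      \<ge> 1 - \<delta>" unfolding magnitude.simps .
 qed
qed

end
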